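(* Let $G$ be a finitely presented group and let $H\le G$ be a subgroup such that the membership problem for $H$ in $G$ is solvable in subexponential time. Let $G_1\le G$ be a subgroup of finite index in $G$ such that $H\le G_1$. Let $\phi:G_1\to\bar G$ be an epimorphism onto a group $\bar G$ and let $K$ be a subgroup with $\phi(H)\le K\le\bar G$. (1) Suppose $\bar G$ is a non-elementary word-hyperbolic group and $K\le\bar G$ is a rational subgroup of infinite index. Then for any finite generating set $A$ of $G$ the membership problem $MP(G,H,A)$ for $H$ in $G$ is solvable with linear-time average-case complexity uniformly relative to the family of all length-invariant discrete probability measures $\mu:(A\cup A^{-1})^*\to[0,1]$. (2) Suppose $\bar G$ is automatic and $K\le\bar G$ is a rational subgroup such that the Schreier coset graph for $\bar G$ over $K$ is non-amenable (and hence $K$ has infinite index in $\bar G$). Then for any finite generating set $A$ of $G$ the membership problem $MP(G,H,A)$ for $H$ in $G$ is solvable with quadratic-time average-case complexity uniformly relative to the family of all length-invariant discrete probability measures $\mu:(A\cup A^{-1})^*\to[0,1]$.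
   Context: Membership problem: a finite generating set of a group $G$ is a finite alphabet $A$ with a map $\pi: A\to G$ whose image generates $G$ (different letters may represent the same element, and letters may represent $1$). Put $X=A\cup A^{-1}$, where $A^{-1}$ is the set of formal inverses, and let $X^*$ be the set of all (not necessarily freely reduced) words in $X$. For $H\le G$, $MP(G,H,A)\subseteq X^*$ is the set of words representing elements of $H$. Its worst-case complexity does not depend on the choice of finite generating set, so one speaks of the membership problem for $H$ in $G$. Rational subgroups: a subgroup $H$ of an automatic group $G$ is rational if for some automatic language $L$ for $G$ (the regular language of an automatic structure) the pre-image of $H$ in $L$ is itself a regular language. In a word-hyperbolic group, rational subgroups are also called quasiconvex. A word-hyperbolic group is non-elementary if it is not virtually cyclic (finite groups count as virtually cyclic). Schreier graphs: for a group $G$ with finite generating set $A$ and $H\le G$, the Schreier coset graph $\Gamma(G,H,A)$ has vertex set $\{Hg: g\in G\}$ and, for each coset $Hg$ and each $a\in A$, an edge labeled $a$ from $Hg$ to $Hga$, together with its formal inverse edge from $Hga$ to $Hg$ labeled $a^{-1}$. It is connected and $2|A|$-regular. A connected regular graph (loops and multiple edges allowed) is non-amenable if there is $\epsilon>0$ such that every finite nonempty set $S$ of vertices has at least $\epsilon|S|$ edges joining $S$ to its complement. For Schreier graphs, whether this holds does not depend on the choice of finite generating set. Complexity: an algorithm is a deterministic multi-tape Turing machine. A non-negative function $f(n)$ is subexponential if $\lim_{n\to\infty} f(n)/r^n=0$ for every $r>1$. Solvable in subexponential time means decidable by an algorithm with running time bounded by a subexponential function of the input length. Measures: for a finite alphabet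 $X$ with $|X|\ge 2$, a discrete probability measure on $X^*$ is a function $\mu:X^*\to[0,1]$ with $\sum_{w\in X^*}\mu(w)=1$; it is length-invariant if $\mu(w)=\mu(w')$ whenever $|w|=|w'|$. Average-case complexity: let $\mathcal{D}\subseteq X^*$ and let $M$ be an algorithm that decides, for every $w\in X^*$, whether $w\in\mathcal{D}$, in time $T(w)<\infty$. Let $f(n)$ be a non-decreasing positive function and let $\mathfrak{R}$ be a family of discrete probability measures on $X^*$. $M$ solves $\mathcal{D}$ with average-case time-complexity bounded by $f(n)$ uniformly relative to $\mathfrak{R}$ if there is $0<C<\infty$ such that for every $\mu\in\mathfrak{R}$, $$\sum_{w\in X^*}\frac{T(w)}{f(|w|)}\mu(w)\le C.$$ $\mathcal{D}$ is solvable with linear-time (respectively quadratic-time) average-case complexity uniformly relative to $\mathfrak{R}$ if this holds for some algorithm $M$ and some linear (respectively quadratic) function $f$. *)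

theory Defs
  imports
    "HOL-Algebra.Elementary_Groups"
    "HOL-Analysis.Infinite_Sum"
    "Graph_Theory.Digraph"
begin

section \<open>Words over a generating alphabet\<close>

datatype 'a letter = Pos 'a | Neg 'a

fun formal_inv :: "'a letter \<Rightarrow> 'a letter" where
  "formal_inv (Pos a) = Neg a"
| "formal_inv (Neg a) = Pos a"

definition letters :: "'a set \<Rightarrow> 'a letter set" where
  "letters A = Pos ` A \<union> Neg ` A"

fun letter_val :: "'g monoid \<Rightarrow> ('a \<Rightarrow> 'g) \<Rightarrow> 'a letter \<Rightarrow> 'g" where
  "letter_val G \<pi> (Pos a) = \<pi> a"
| "letter_val G \<pi> (Neg a) = inv\<^bsub>G\<^esub> (\<pi> a)"

definition word_val :: "'g monoid \<Rightarrow> ('a \<Rightarrow> 'g) \<Rightarrow> 'a letter list \<Rightarrow> 'g" where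
  "word_val G \<pi> w = foldr (\<lambda>x g. letter_val G \<pi> x \<otimes>\<^bsub>G\<^esub> g) w \<one>\<^bsub>G\<^esub>"

definition finite_generating :: "'g monoid \<Rightarrow> 'a set \<Rightarrow> ('a \<Rightarrow> 'g) \<Rightarrow> bool" where
  "finite_generating G A \<pi> \<longleftrightarrow>
     finite A \<and> \<pi> \<in> A \<rightarrow> carrier G \<and> generate G (\<pi> ` A) = carrier G"

definition membership_problem ::
    "'g monoid \<Rightarrow> 'g set \<Rightarrow> 'a set \<Rightarrow> ('a \<Rightarrow> 'g) \<Rightarrow> 'a letter list set" where
  "membership_problem G H A \<pi> = {w \<in> lists (letters A). word_val G \<pi> w \<in> H}"

text \<open>Below, a property of a group asking for some finite generating alphabet quantifies over
  the alphabets \<open>{..<n}\<close> of natural numbers, to which every finite alphabet is in bijection.\<close>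


section \<open>Finite presentations\<close>

definition presentation_step ::
    "'a set \<Rightarrow> 'a letter list set \<Rightarrow> ('a letter list \<times> 'a letter list) set" where
  "presentation_step A R =
     {(u @ r @ v, u @ v) | u r v. u \<in> lists (letters A) \<and> v \<in> lists (letters A) \<and>
        r \<in> R \<union> {[x, formal_inv x] | x. x \<in> letters A}}"

definition presentation_cong ::
    "'a set \<Rightarrow> 'a letter list set \<Rightarrow> ('a letter list \<times> 'a letter list) set" where
  "presentation_cong A R =
     Restr ((presentation_step A R \<union> (presentation_step A R)\<inverse>)\<^sup>*) (lists (letters A))"

text \<open>The group \<open>\<langle>A | R\<rangle>\<close>, as the quotient of the free monoid on the letters and their formal
  inverses by the congruence generated by the relators and by free cancellation.\<close>

definition presented_group :: "'a set \<Rightarrow> 'a letter list set \<Rightarrow> 'a letter list set monoid" where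
  "presented_group A R =
     \<lparr>carrier = lists (letters A) // presentation_cong A R,
      monoid.mult = (\<lambda>c d. \<Union>u\<in>c. \<Union>v\<in>d. presentation_cong A R `` {u @ v}),
      one = presentation_cong A R `` {[]}\<rparr>"

definition finitely_presented :: "'g monoid \<Rightarrow> bool" where
  "finitely_presented G \<longleftrightarrow>
     (\<exists>(n::nat) R. finite R \<and> R \<subseteq> lists (letters {..<n}) \<and> presented_group {..<n} R \<cong> G)"


section \<open>Word-hyperbolic groups\<close>

definition finite_index :: "'g monoid \<Rightarrow> 'g set \<Rightarrow> bool" where
  "finite_index G H \<longleftrightarrow> subgroup H G \<and> finite (rcosets\<^bsub>G\<^esub> H)"

definition virtually_cyclic :: "'g monoid \<Rightarrow> bool" where
  "virtually_cyclic G \<longleftrightarrow>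
     (\<exists>C. finite_index G C \<and> cyclic_group (G\<lparr>carrier := C\<rparr>))"

definition word_dist :: "'g monoid \<Rightarrow> 'a set \<Rightarrow> ('a \<Rightarrow> 'g) \<Rightarrow> 'g \<Rightarrow> 'g \<Rightarrow> nat" where
  "word_dist G A \<pi> g h =
     (LEAST n. \<exists>w \<in> lists (letters A). length w = n \<and> word_val G \<pi> w = inv\<^bsub>G\<^esub> g \<otimes>\<^bsub>G\<^esub> h)"

definition gromov_product :: "'g monoid \<Rightarrow> 'a set \<Rightarrow> ('a \<Rightarrow> 'g) \<Rightarrow> 'g \<Rightarrow> 'g \<Rightarrow> 'g \<Rightarrow> real" where
  "gromov_product G A \<pi> t x y =
     (real (word_dist G A \<pi> t x) + real (word_dist G A \<pi> t y) - real (word_dist G A \<pi> x y)) / 2"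

text \<open>Gromov's definition: the group with a word metric is a \<open>\<delta>\<close>-hyperbolic metric space.\<close>

definition word_hyperbolic :: "'g monoid \<Rightarrow> bool" where
  "word_hyperbolic G \<longleftrightarrow> group G \<and>
     (\<exists>(n::nat) \<pi> \<delta>. finite_generating G {..<n} \<pi> \<and>
        (\<forall>t \<in> carrier G. \<forall>x \<in> carrier G. \<forall>y \<in> carrier G. \<forall>z \<in> carrier G.
           gromov_product G {..<n} \<pi> t x y \<ge>
           min (gromov_product G {..<n} \<pi> t x z) (gromov_product G {..<n} \<pi> t z y) - \<delta>))"


section \<open>Automatic groups and rational subgroups\<close>

definition regular_language :: "'x set \<Rightarrow> 'x list set \<Rightarrow> bool" where
  "regular_language \<Sigma> L \<longleftrightarrow> finite \<Sigma> \<and>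
     (\<exists>(n::nat) \<delta> q\<^sub>0 F. q\<^sub>0 < n \<and> (\<forall>q<n. \<forall>x\<in>\<Sigma>. \<delta> q x < n) \<and> F \<subseteq> {..<n} \<and>
        L = {w \<in> lists \<Sigma>. foldl \<delta> q\<^sub>0 w \<in> F})"

text \<open>A pair of words is read synchronously, the shorter word being padded at its end with
  the padding symbol \<open>None\<close>.\<close>

fun pad_pair :: "'x list \<Rightarrow> 'x list \<Rightarrow> ('x option \<times> 'x option) list" where
  "pad_pair [] [] = []"
| "pad_pair (x # u) [] = (Some x, None) # pad_pair u []"
| "pad_pair [] (y # v) = (None, Some y) # pad_pair [] v"
| "pad_pair (x # u) (y # v) = (Some x, Some y) # pad_pair u v"

definition regular_relation :: "'x set \<Rightarrow> ('x list \<times> 'x list) set \<Rightarrow> bool" where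
  "regular_relation \<Sigma> P \<longleftrightarrow>
     regular_language (insert None (Some ` \<Sigma>) \<times> insert None (Some ` \<Sigma>))
       ((\<lambda>(u, v). pad_pair u v) ` P)"

definition automatic_structure ::
    "'g monoid \<Rightarrow> 'a set \<Rightarrow> ('a \<Rightarrow> 'g) \<Rightarrow> 'a letter list set \<Rightarrow> bool" where
  "automatic_structure G A \<pi> L \<longleftrightarrow>
     finite_generating G A \<pi> \<and>
     regular_language (letters A) L \<and>
     word_val G \<pi> ` L = carrier G \<and>
     regular_relation (letters A) {(u, v). u \<in> L \<and> v \<in> L \<and> word_val G \<pi> u = word_val G \<pi> v} \<and>
     (\<forall>x \<in> letters A. regular_relation (letters A)
        {(u, v). u \<in> L \<and> v \<in> L \<and> word_val G \<pi> (u @ [x]) = word_val G \<pi> v})"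

definition automatic_group :: "'g monoid \<Rightarrow> bool" where
  "automatic_group G \<longleftrightarrow> group G \<and>
     (\<exists>(n::nat) \<pi> L. automatic_structure G {..<n} \<pi> L)"

definition rational_subgroup :: "'g set \<Rightarrow> 'g monoid \<Rightarrow> bool" where
  "rational_subgroup K G \<longleftrightarrow> subgroup K G \<and>
     (\<exists>(n::nat) \<pi> L. automatic_structure G {..<n} \<pi> L \<and>
        regular_language (letters {..<n}) {w \<in> L. word_val G \<pi> w \<in> K})"


section \<open>Schreier graphs and non-amenability\<close>

text \<open>The arc \<open>(v, x)\<close> is the edge labelled \<open>x\<close> issuing from \<open>v\<close>; an arc labelled \<open>Neg a\<close> is
  the formal inverse of an arc labelled \<open>Pos a\<close>.\<close>

definition schreier_graph ::
    "'g monoid \<Rightarrow> 'g set \<Rightarrow> 'a set \<Rightarrow> ('a \<Rightarrow> 'g) \<Rightarrow> ('g set, 'g set \<times> 'a letter) pre_digraph" where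
  "schreier_graph G H A \<pi> =
     \<lparr>verts = rcosets\<^bsub>G\<^esub> H,
      arcs = (rcosets\<^bsub>G\<^esub> H) \<times> letters A,
      tail = fst,
      head = (\<lambda>(v, x). v #>\<^bsub>G\<^esub> letter_val G \<pi> x)\<rparr>"

text \<open>For connected regular graphs whose arcs come in mutually inverse pairs. An edge joining
  \<open>S\<close> to its complement is counted once, by its orientation that leaves \<open>S\<close>.\<close>

definition nonamenable_graph :: "('v, 'e) pre_digraph \<Rightarrow> bool" where
  "nonamenable_graph \<Gamma> \<longleftrightarrow>
     (\<exists>\<epsilon>::real. \<epsilon> > 0 \<and>
        (\<forall>S. S \<subseteq> verts \<Gamma> \<and> finite S \<and> S \<noteq> {} \<longrightarrow>
           real (card {e \<in> arcs \<Gamma>. tail \<Gamma> e \<in> S \<and> head \<Gamma> e \<notin> S}) \<ge> \<epsilon> * real (card S)))"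

definition nonamenable_schreier :: "'g monoid \<Rightarrow> 'g set \<Rightarrow> bool" where
  "nonamenable_schreier G H \<longleftrightarrow>
     (\<exists>(n::nat) \<pi>. finite_generating G {..<n} \<pi> \<and> nonamenable_graph (schreier_graph G H {..<n} \<pi>))"


section \<open>Deterministic multi-tape Turing machines\<close>

datatype 'x tape_symbol = Blank | Input 'x | Aux nat

datatype head_move = Move_Left | Stay | Move_Right

fun shift :: "head_move \<Rightarrow> int" where
  "shift Move_Left = -1"
| "shift Stay = 0"
| "shift Move_Right = 1"

record 'x tm =
  num_tapes :: nat
  tm_states :: "nat set"
  tape_alphabet :: "'x tape_symbol set"
  start_state :: nat
  accept_state :: nat
  reject_state :: nat
  transition :: "nat \<Rightarrow> 'x tape_symbol list \<Rightarrow> nat \<times> ('x tape_symbol \<times> head_move) list"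

definition wf_tm :: "'x set \<Rightarrow> 'x tm \<Rightarrow> bool" where
  "wf_tm X M \<longleftrightarrow>
     num_tapes M \<ge> 1 \<and>
     finite (tm_states M) \<and>
     {start_state M, accept_state M, reject_state M} \<subseteq> tm_states M \<and>
     accept_state M \<noteq> reject_state M \<and>
     finite (tape_alphabet M) \<and>
     insert Blank (Input ` X) \<subseteq> tape_alphabet M \<and>
     (\<forall>q \<in> tm_states M. \<forall>ss \<in> lists (tape_alphabet M). length ss = num_tapes M \<longrightarrow>
        fst (transition M q ss) \<in> tm_states M \<and>
        length (snd (transition M q ss)) = num_tapes M \<and>
        fst ` set (snd (transition M q ss)) \<subseteq> tape_alphabet M)"

text \<open>A configuration is a state with, for each tape, the content of the (two-way infinite)
  tape and the head position. The input is written on the first tape from cell \<open>0\<close> on.\<close>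

type_synonym 'x config = "nat \<times> ((int \<Rightarrow> 'x tape_symbol) \<times> int) list"

definition initial_config :: "'x tm \<Rightarrow> 'x list \<Rightarrow> 'x config" where
  "initial_config M w =
     (start_state M,
      (\<lambda>i. if 0 \<le> i \<and> i < int (length w) then Input (w ! nat i) else Blank, 0)
        # replicate (num_tapes M - 1) (\<lambda>_. Blank, 0))"

definition halted :: "'x tm \<Rightarrow> 'x config \<Rightarrow> bool" where
  "halted M c \<longleftrightarrow> fst c \<in> {accept_state M, reject_state M}"

definition tm_step :: "'x tm \<Rightarrow> 'x config \<Rightarrow> 'x config" where
  "tm_step M c =
     (if halted M c then c
      else (let (q, acts) = transition M (fst c) (map (\<lambda>(t, i). t i) (snd c))
            in (q, map2 (\<lambda>(t, i) (s, m). (t(i := s), i + shift m)) (snd c) acts)))"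

definition tm_run :: "'x tm \<Rightarrow> 'x list \<Rightarrow> nat \<Rightarrow> 'x config" where
  "tm_run M w n = (tm_step M ^^ n) (initial_config M w)"

definition run_time :: "'x tm \<Rightarrow> 'x list \<Rightarrow> nat" where
  "run_time M w = (LEAST n. halted M (tm_run M w n))"

definition decides :: "'x tm \<Rightarrow> 'x set \<Rightarrow> 'x list set \<Rightarrow> bool" where
  "decides M X D \<longleftrightarrow> wf_tm X M \<and> D \<subseteq> lists X \<and>
     (\<forall>w \<in> lists X. (\<exists>n. halted M (tm_run M w n)) \<and>
        (fst (tm_run M w (run_time M w)) = accept_state M \<longleftrightarrow> w \<in> D))"


section \<open>Worst-case and average-case complexity\<close>

definition subexponential :: "(nat \<Rightarrow> real) \<Rightarrow> bool" where
  "subexponential f \<longleftrightarrow> (\<forall>n. f n \<ge> 0) \<and> (\<forall>r>1. (\<lambda>n. f n / r ^ n) \<longlonglongrightarrow> 0)"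

definition subexponential_time_solvable :: "'x set \<Rightarrow> 'x list set \<Rightarrow> bool" where
  "subexponential_time_solvable X D \<longleftrightarrow>
     (\<exists>M f. decides M X D \<and> subexponential f \<and>
        (\<forall>w \<in> lists X. real (run_time M w) \<le> f (length w)))"

definition membership_subexponential :: "'g monoid \<Rightarrow> 'g set \<Rightarrow> bool" where
  "membership_subexponential G H \<longleftrightarrow>
     (\<exists>(n::nat) \<pi>. finite_generating G {..<n} \<pi> \<and>
        subexponential_time_solvable (letters {..<n}) (membership_problem G H {..<n} \<pi>))"

definition discrete_prob :: "'x set \<Rightarrow> ('x list \<Rightarrow> real) \<Rightarrow> bool" where
  "discrete_prob X \<mu> \<longleftrightarrow> (\<forall>w \<in> lists X. 0 \<le> \<mu> w \<and> \<mu> w \<le> 1) \<and> (\<mu> has_sum 1) (lists X)"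

definition length_invariant :: "'x set \<Rightarrow> ('x list \<Rightarrow> real) \<Rightarrow> bool" where
  "length_invariant X \<mu> \<longleftrightarrow>
     (\<forall>w \<in> lists X. \<forall>w' \<in> lists X. length w = length w' \<longrightarrow> \<mu> w = \<mu> w')"

definition solves_on_average ::
    "'x tm \<Rightarrow> 'x set \<Rightarrow> 'x list set \<Rightarrow> (nat \<Rightarrow> real) \<Rightarrow> ('x list \<Rightarrow> real) set \<Rightarrow> bool" where
  "solves_on_average M X D f \<RR> \<longleftrightarrow>
     decides M X D \<and> mono f \<and> (\<forall>n. f n > 0) \<and>
     (\<exists>C>0. \<forall>\<mu> \<in> \<RR>.
        (\<lambda>w. real (run_time M w) / f (length w) * \<mu> w) summable_on lists X \<and>
        (\<Sum>\<^sub>\<infinity>w\<in>lists X. real (run_time M w) / f (length w) * \<mu> w) \<le> C)"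

definition linear_fun :: "(nat \<Rightarrow> real) \<Rightarrow> bool" where
  "linear_fun f \<longleftrightarrow> (\<exists>a b. a > 0 \<and> (\<forall>n. f n = a * real n + b))"

definition quadratic_fun :: "(nat \<Rightarrow> real) \<Rightarrow> bool" where
  "quadratic_fun f \<longleftrightarrow> (\<exists>a b c. a > 0 \<and> (\<forall>n. f n = a * (real n)\<^sup>2 + b * real n + c))"

definition linear_time_on_average ::
    "'x set \<Rightarrow> 'x list set \<Rightarrow> ('x list \<Rightarrow> real) set \<Rightarrow> bool" where
  "linear_time_on_average X D \<RR> \<longleftrightarrow> (\<exists>M f. linear_fun f \<and> solves_on_average M X D f \<RR>)"

definition quadratic_time_on_average ::
    "'x set \<Rightarrow> 'x list set \<Rightarrow> ('x list \<Rightarrow> real) set \<Rightarrow> bool" where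
  "quadratic_time_on_average X D \<RR> \<longleftrightarrow> (\<exists>M f. quadratic_fun f \<and> solves_on_average M X D f \<RR>)"

end

(* Two machines are combined: a fast one decides whether the image of a word lies in phi^{-1}(K),
   and only if it does is the given subexponential one run. If the fraction of words of length n
   lying in phi^{-1}(K) decays exponentially, the expected cost of the second stage is bounded.

   The decay. Let g_0, ..., g_{m-1} be a transversal of G_1. Words act on pairs (i, Kg) through the
   cocycle phi(g_i x g_j^{-1}), and those in phi^{-1}(K) trace closed paths. The isoperimetric
   inequality of the cosets of K passes to this action and, by a Cheeger argument with finite sums,
   bounds the norm of its adjacency operator by some q < |X|. So there are at most q^n closed paths.

   Hyperbolic groups, treated with the four-point condition only. A non-elementary group contains
   four elements y^N, y^{-N}, t y^N t^{-1}, t y^{-N} t^{-1} of length about L which pairwise diverge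
   early. Seen from a far away point, a rational subgroup K of infinite index lies in one direction,
   hence at most one of the four brings that point closer to K. The weight 2^{-d(K, g)/L} and the
   Schur test then show that the coset space is non-amenable. Membership in K is decided by Dehn's
   algorithm: a stack machine rewrites the word to a local geodesic, and the prefixes of a local
   geodesic representing an element of K stay in finitely many cosets of K.

   Automatic groups. The normal form is updated letter by letter with the multiplier automata,
   at linear cost each. *)

theory Submission
  imports Defs "HOL-Library.Countable" "HOL-Analysis.Convex" "HOL-Real_Asymp.Real_Asymp"
begin

section \<open>Words and the word metric\<close>

text \<open>A length-invariant measure is constant on each sphere of words, so it suffices to bound
  the sum of the running times over the words of length n by C f(n) |X|^n. The words that reach the
  slow machine number at most q^n and their translations have length at most cn; subexponential time
  at length cn is O((|X|/q)^n), and the exponentials cancel. The weights with base 2 grow by about 2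
  in at most one of k diverging directions and halve in the others, so the Schur test succeeds when
  2 + (k - 1)/2 < k, that is from k = 4 on: hence four elements. Their divergence must not depend on
  their length L, since the errors enter relative to L. The weights live on hyperbolic generators,
  while rationality refers to an automatic structure over possibly different ones. Automata are
  therefore left early: all they give is that elements of K are joined to 1 by paths of linear
  length near K. Along a path the four-point inequality loses only the logarithm of the number of
  steps, and this turns such paths into quasiconvexity.\<close>

lemma formal_inv_formal_inv [simp]: "formal_inv (formal_inv x) = x"
  by (cases x) auto

lemma formal_inv_letters [simp]: "formal_inv x \<in> letters A \<longleftrightarrow> x \<in> letters A"
  by (cases x) (auto simp: letters_def)

lemma finite_letters [simp]: "finite A \<Longrightarrow> finite (letters A)"
  by (simp add: letters_def)

definition word_inv :: "'a letter list \<Rightarrow> 'a letter list" where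
  "word_inv w = rev (map formal_inv w)"

lemma length_word_inv [simp]: "length (word_inv w) = length w"
  by (simp add: word_inv_def)

lemma word_inv_lists [simp]: "word_inv w \<in> lists (letters A) \<longleftrightarrow> w \<in> lists (letters A)"
  by (auto simp: word_inv_def in_lists_conv_set)

lemma word_val_Nil [simp]: "word_val G \<pi> [] = \<one>\<^bsub>G\<^esub>"
  by (simp add: word_val_def)

lemma word_val_Cons [simp]: "word_val G \<pi> (x # w) = letter_val G \<pi> x \<otimes>\<^bsub>G\<^esub> word_val G \<pi> w"
  by (simp add: word_val_def)

locale word_group = group G for G :: "'g monoid" (structure)
begin

lemma inv_mult_cancel [simp]:
  assumes "x \<in> carrier G" "y \<in> carrier G"
  shows "inv x \<otimes> (x \<otimes> y) = y" "x \<otimes> (inv x \<otimes> y) = y"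
  using assms by (simp_all flip: m_assoc)

lemma letter_val_closed [simp]:
  assumes "\<pi> \<in> A \<rightarrow> carrier G" "x \<in> letters A"
  shows "letter_val G \<pi> x \<in> carrier G"
  using assms by (cases x) (auto simp: letters_def)

lemma word_val_closed [simp]:
  assumes "\<pi> \<in> A \<rightarrow> carrier G" "w \<in> lists (letters A)"
  shows "word_val G \<pi> w \<in> carrier G"
  using assms(2) by (induction w) (auto simp: letter_val_closed[OF assms(1)])

lemma word_val_append:
  assumes "\<pi> \<in> A \<rightarrow> carrier G" "u \<in> lists (letters A)" "v \<in> lists (letters A)"
  shows "word_val G \<pi> (u @ v) = word_val G \<pi> u \<otimes> word_val G \<pi> v"
  using assms(2)
proof (induction u)
  case Nil
  then show ?case using word_val_closed[OF assms(1,3)] by simp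
next
  case (Cons x u)
  then show ?case
    using letter_val_closed[OF assms(1)] word_val_closed[OF assms(1)] assms(3) by (simp add: m_assoc)
qed

lemma letter_val_formal_inv:
  assumes "\<pi> \<in> A \<rightarrow> carrier G" "x \<in> letters A"
  shows "letter_val G \<pi> (formal_inv x) = inv (letter_val G \<pi> x)"
  using assms by (cases x) (auto simp: letters_def dest!: funcset_mem)

lemma word_val_word_inv:
  assumes "\<pi> \<in> A \<rightarrow> carrier G" "w \<in> lists (letters A)"
  shows "word_val G \<pi> (word_inv w) = inv (word_val G \<pi> w)"
  using assms(2)
proof (induction w)
  case Nil
  then show ?case by (simp add: word_inv_def)
next
  case (Cons x w)
  have "word_val G \<pi> (word_inv (x # w)) = word_val G \<pi> (word_inv w @ [formal_inv x])"
    by (simp add: word_inv_def)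
  also have "\<dots> = word_val G \<pi> (word_inv w) \<otimes> word_val G \<pi> [formal_inv x]"
    using Cons by (intro word_val_append[OF assms(1)]) auto
  also have "\<dots> = inv (word_val G \<pi> (x # w))"
    using Cons letter_val_closed[OF assms(1)] word_val_closed[OF assms(1)]
    by (simp add: letter_val_formal_inv[OF assms(1)] inv_mult_group)
  finally show ?case .
qed

lemma generating_word:
  assumes "finite_generating G A \<pi>" "g \<in> carrier G"
  shows "\<exists>w\<in>lists (letters A). word_val G \<pi> w = g"
proof -
  have pi: "\<pi> \<in> A \<rightarrow> carrier G" and "g \<in> generate G (\<pi> ` A)"
    using assms by (auto simp: finite_generating_def)
  from this(2) show ?thesis
  proof induction
    case one
    show ?case by (rule bexI[of _ "[]"]) auto
  next
    case (incl h)
    then obtain a where "a \<in> A" "h = \<pi> a" by auto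
    then show ?case using pi by (intro bexI[of _ "[Pos a]"]) (auto simp: letters_def dest: funcset_mem)
  next
    case (inv h)
    then obtain a where "a \<in> A" "h = \<pi> a" by auto
    then show ?case using pi by (intro bexI[of _ "[Neg a]"]) (auto simp: letters_def dest: funcset_mem)
  next
    case (eng h1 h2)
    then obtain u v where "u \<in> lists (letters A)" "v \<in> lists (letters A)"
      "word_val G \<pi> u = h1" "word_val G \<pi> v = h2" by blast
    then show ?case using word_val_append[OF pi] by (intro bexI[of _ "u @ v"]) auto
  qed
qed

end

section \<open>Word length, word metric and discrete geodesics\<close>

locale word_metric = word_group +
  fixes A :: "'b set" and \<pi> :: "'b \<Rightarrow> 'a"
  assumes generating: "finite_generating G A \<pi>"
begin

abbreviation val :: "'b letter list \<Rightarrow> 'a" where "val \<equiv> word_val G \<pi>"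
abbreviation Words :: "'b letter list set" where "Words \<equiv> lists (letters A)"
abbreviation wdist :: "'a \<Rightarrow> 'a \<Rightarrow> nat" where "wdist \<equiv> word_dist G A \<pi>"

text \<open>Copies the \<open>LEAST\<close> of \<open>word_dist\<close>, so that distance and length
  are related by unfolding alone.\<close>

definition len :: "'a \<Rightarrow> nat" where
  "len g = (LEAST n. \<exists>w \<in> Words. length w = n \<and> val w = g)"

lemma map_closed: "\<pi> \<in> A \<rightarrow> carrier G" and finite_alphabet: "finite A"
  using generating by (auto simp: finite_generating_def)

lemmas val_closed [simp] = word_val_closed[OF map_closed]
lemmas val_append = word_val_append[OF map_closed]
lemmas val_inv = word_val_word_inv[OF map_closed]
lemmas lval_closed [simp] = letter_val_closed[OF map_closed]

lemma len_word:
  assumes "g \<in> carrier G"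
  shows "\<exists>w\<in>Words. length w = len g \<and> val w = g"
proof -
  obtain w where "w \<in> Words" "val w = g" using generating_word[OF generating assms] by blast
  then have "\<exists>n. \<exists>w\<in>Words. length w = n \<and> val w = g" by blast
  from LeastI_ex[OF this] show ?thesis unfolding len_def .
qed

lemma len_val_le: "w \<in> Words \<Longrightarrow> len (val w) \<le> length w"
  unfolding len_def by (rule Least_le) blast

lemma len_one [simp]: "len \<one> = 0"
  using len_val_le[of "[]"] by simp

lemma len_mult: "g \<in> carrier G \<Longrightarrow> h \<in> carrier G \<Longrightarrow> len (g \<otimes> h) \<le> len g + len h"
proof -
  assume "g \<in> carrier G" "h \<in> carrier G"
  then obtain u v where "u \<in> Words" "length u = len g" "val u = g" "v \<in> Words" "length v = len h" "val v = h"
    using len_word by metis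
  then show ?thesis using len_val_le[of "u @ v"] val_append[of u v] by simp
qed

lemma len_inv_le: "g \<in> carrier G \<Longrightarrow> len (inv g) \<le> len g"
proof -
  assume "g \<in> carrier G"
  then obtain u where "u \<in> Words" "length u = len g" "val u = g" using len_word by metis
  then show ?thesis using len_val_le[of "word_inv u"] val_inv[of u] by simp
qed

lemma len_inv [simp]: "g \<in> carrier G \<Longrightarrow> len (inv g) = len g"
  using len_inv_le[of g] len_inv_le[of "inv g"] by simp

lemma wdist_len: "wdist g h = len (inv g \<otimes> h)"
  by (simp add: word_dist_def len_def)

lemma wdist_one [simp]: "g \<in> carrier G \<Longrightarrow> wdist \<one> g = len g"
  by (simp add: wdist_len)

lemma wdist_left [simp]:
  assumes "x \<in> carrier G" "g \<in> carrier G" "h \<in> carrier G"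
  shows "wdist (x \<otimes> g) (x \<otimes> h) = wdist g h"
proof -
  have "inv (x \<otimes> g) \<otimes> (x \<otimes> h) = inv g \<otimes> h"
    using assms by (simp add: inv_mult_group m_assoc)
  then show ?thesis by (simp add: wdist_len)
qed

lemma wdist_mult: "x \<in> carrier G \<Longrightarrow> g \<in> carrier G \<Longrightarrow> wdist x (x \<otimes> g) = len g"
  using wdist_left[of x \<one> g] by simp

lemma wdist_refl [simp]: "g \<in> carrier G \<Longrightarrow> wdist g g = 0"
  by (simp add: wdist_len)

lemma wdist_commute:
  assumes "g \<in> carrier G" "h \<in> carrier G"
  shows "wdist g h = wdist h g"
proof -
  have "inv (inv g \<otimes> h) = inv h \<otimes> g" using assms by (simp add: inv_mult_group)
  then show ?thesis using assms len_inv[of "inv g \<otimes> h"] by (simp add: wdist_len)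
qed

lemma wdist_triangle:
  assumes "x \<in> carrier G" "y \<in> carrier G" "z \<in> carrier G"
  shows "wdist x z \<le> wdist x y + wdist y z"
proof -
  have "inv x \<otimes> z = (inv x \<otimes> y) \<otimes> (inv y \<otimes> z)"
    using assms by (simp add: m_assoc)
  then show ?thesis using len_mult[of "inv x \<otimes> y" "inv y \<otimes> z"] assms by (simp add: wdist_len)
qed

lemma finite_ball: "finite {g \<in> carrier G. len g \<le> n}"
proof (rule finite_subset)
  show "{g \<in> carrier G. len g \<le> n} \<subseteq> val ` {w. set w \<subseteq> letters A \<and> length w \<le> n}"
  proof
    fix g assume "g \<in> {g \<in> carrier G. len g \<le> n}"
    then obtain w where "w \<in> Words" "length w \<le> n" "val w = g" using len_word[of g] by fastforce
    then show "g \<in> val ` {w. set w \<subseteq> letters A \<and> length w \<le> n}"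
      by (intro image_eqI[of _ _ w]) (auto simp: in_lists_conv_set)
  qed
  show "finite (val ` {w. set w \<subseteq> letters A \<and> length w \<le> n})"
    using finite_alphabet by (intro finite_imageI finite_lists_length_le) auto
qed

text \<open>\<open>len\<close> is subadditive and never exceeds the number of letters, so a total
  without loss leaves no loss in any factor.\<close>

lemma geodesic_word_sub:
  assumes "u @ v @ w \<in> Words" "len (val (u @ v @ w)) = length (u @ v @ w)"
  shows "len (val v) = length v"
proof -
  have W: "u \<in> Words" "v \<in> Words" "w \<in> Words" using assms by auto
  have "len (val (u @ v @ w)) \<le> len (val u) + (len (val v) + len (val w))"
    using W len_mult[of "val u" "val v \<otimes> val w"] len_mult[of "val v" "val w"]
    by (simp add: val_append)
  then show ?thesis
    using assms len_val_le[OF W(1)] len_val_le[OF W(2)] len_val_le[OF W(3)] by simp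
qed

text \<open>The path runs through the prefixes of a shortest word for
  \<open>inv g \<otimes> h\<close>. Since \<open>take\<close> saturates, it is defined for all
  indices and rests at \<open>h\<close> after its end.\<close>

lemma geodesic_path:
  assumes "g \<in> carrier G" "h \<in> carrier G"
  shows "\<exists>p. p 0 = g \<and> p (wdist g h) = h \<and> (\<forall>i. p i \<in> carrier G) \<and>
    (\<forall>i j. i \<le> j \<longrightarrow> j \<le> wdist g h \<longrightarrow> wdist (p i) (p j) = j - i)"
proof -
  define n where "n = wdist g h"
  obtain w where w: "w \<in> Words" "length w = n" "val w = inv g \<otimes> h"
    using len_word[of "inv g \<otimes> h"] assms by (auto simp: n_def wdist_len)
  have tk: "take i w \<in> Words" for i using w(1) by (auto dest: in_set_takeD)
  define p where "p i = g \<otimes> val (take i w)" for i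
  have "wdist (p i) (p j) = j - i" if "i \<le> j" "j \<le> n" for i j
  proof -
    have sp: "take j w = take i w @ take (j - i) (drop i w)"
      using take_add[of i "j - i" w] that by simp
    have inW: "take (j - i) (drop i w) \<in> Words" 
      using w(1) by (auto dest!: in_set_takeD in_set_dropD)
    have "w = take i w @ take (j - i) (drop i w) @ drop j w"
      using sp append_take_drop_id[of j w] by (metis append.assoc)
    then have "len (val (take (j - i) (drop i w))) = length (take (j - i) (drop i w))"
      using geodesic_word_sub[of "take i w" "take (j - i) (drop i w)" "drop j w"] w
      by (metis n_def wdist_len)
    moreover have "p j = p i \<otimes> val (take (j - i) (drop i w))"
      unfolding p_def sp by (subst val_append[OF tk inW]) (use assms tk inW in \<open>simp add: m_assoc\<close>)
    ultimately show ?thesis using that w(2) inW tk assms by (simp add: wdist_mult p_def)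
  qed
  moreover have "p n = h" using w assms by (simp add: p_def)
  moreover have "p 0 = g" "\<And>i. p i \<in> carrier G" using assms tk by (simp_all add: p_def)
  ultimately show ?thesis unfolding n_def by blast
qed

lemma geodesic_point:
  assumes "g \<in> carrier G" "h \<in> carrier G" "j \<le> wdist g h"
  shows "\<exists>p\<in>carrier G. wdist g p = j \<and> wdist p h = wdist g h - j"
proof -
  obtain p where p: "p 0 = g" "p (wdist g h) = h" "\<And>i. p i \<in> carrier G"
    "\<And>i j. i \<le> j \<Longrightarrow> j \<le> wdist g h \<Longrightarrow> wdist (p i) (p j) = j - i"
    using geodesic_path[OF assms(1,2)] by blast
  show ?thesis using p(3)[of j] p(4)[of 0 j] p(4)[of j "wdist g h"] p(1,2) assms(3) by auto
qed

end

section \<open>Four-point hyperbolicity\<close>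

text \<open>Distances are abstract and real-valued, so the estimates below are free of group
  notation and apply to \<open>wdist\<close> through \<open>real\<close>. The last axiom is spelled
  out because \<open>gp\<close> only becomes available inside the locale.\<close>

locale four_point =
  fixes S :: "'p set" and d :: "'p \<Rightarrow> 'p \<Rightarrow> real" and \<delta> :: real
  assumes d_refl: "x \<in> S \<Longrightarrow> d x x = 0"
    and d_sym: "x \<in> S \<Longrightarrow> y \<in> S \<Longrightarrow> d x y = d y x"
    and d_tri: "x \<in> S \<Longrightarrow> y \<in> S \<Longrightarrow> z \<in> S \<Longrightarrow> d x z \<le> d x y + d y z"
    and delta_nonneg: "0 \<le> \<delta>"
    and four_pt: "t \<in> S \<Longrightarrow> x \<in> S \<Longrightarrow> y \<in> S \<Longrightarrow> z \<in> S \<Longrightarrow>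
      (d t x + d t y - d x y) / 2 \<ge>
      min ((d t x + d t z - d x z) / 2) ((d t z + d t y - d z y) / 2) - \<delta>"
begin

text \<open>The Gromov product. In a tree it is the length of the common part of the geodesics from
  \<open>t\<close> to \<open>x\<close> and to \<open>y\<close>; a large value is read below as: seen
  from \<open>t\<close>, both points lie in the same direction.\<close>

definition gp :: "'p \<Rightarrow> 'p \<Rightarrow> 'p \<Rightarrow> real" where "gp t x y = (d t x + d t y - d x y) / 2"

lemma gp_sym: "t \<in> S \<Longrightarrow> x \<in> S \<Longrightarrow> y \<in> S \<Longrightarrow> gp t x y = gp t y x"
  by (simp add: gp_def d_sym)

lemma gp_nonneg: "t \<in> S \<Longrightarrow> x \<in> S \<Longrightarrow> y \<in> S \<Longrightarrow> 0 \<le> gp t x y"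
  using d_tri[of x t y] d_sym[of x t] by (simp add: gp_def)

lemma gp_le1: "t \<in> S \<Longrightarrow> x \<in> S \<Longrightarrow> y \<in> S \<Longrightarrow> gp t x y \<le> d t x"
  using d_tri[of t x y] by (simp add: gp_def)

lemma gp_le2: "t \<in> S \<Longrightarrow> x \<in> S \<Longrightarrow> y \<in> S \<Longrightarrow> gp t x y \<le> d t y"
  using d_tri[of t y x] d_sym[of x y] by (simp add: gp_def)

text \<open>In the tripod spanned by the three points, the centre cuts the side from
  \<open>t\<close> to \<open>x\<close> into these two parts.\<close>

lemma gp_flip: "t \<in> S \<Longrightarrow> x \<in> S \<Longrightarrow> y \<in> S \<Longrightarrow> gp t x y + gp x t y = d t x"
  by (simp add: gp_def d_sym field_simps)

lemma gp_ge: "t \<in> S \<Longrightarrow> x \<in> S \<Longrightarrow> y \<in> S \<Longrightarrow> d t x - d x y \<le> gp t x y"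
  using d_tri[of t y x] d_sym[of y x] d_tri[of t x y] by (simp add: gp_def)

lemma gp_base: "s \<in> S \<Longrightarrow> t \<in> S \<Longrightarrow> x \<in> S \<Longrightarrow> y \<in> S \<Longrightarrow> gp s x y \<le> gp t x y + d s t"
  using d_tri[of s t x] d_tri[of s t y] by (simp add: gp_def field_simps)

lemma gp_arg: "t \<in> S \<Longrightarrow> x \<in> S \<Longrightarrow> y \<in> S \<Longrightarrow> z \<in> S \<Longrightarrow> gp t x y \<le> gp t x z + d y z"
  using d_tri[of t z y] d_tri[of x y z] d_sym[of y z] by (simp add: gp_def field_simps)

lemma gp_self [simp]: "t \<in> S \<Longrightarrow> x \<in> S \<Longrightarrow> gp t t x = 0" "t \<in> S \<Longrightarrow> x \<in> S \<Longrightarrow> gp t x t = 0"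
  by (simp_all add: gp_def d_refl d_sym)

lemma dist_gp: "d x y = d t x + d t y - 2 * gp t x y"
  by (simp add: gp_def field_simps)

lemma gp_min: "t \<in> S \<Longrightarrow> x \<in> S \<Longrightarrow> y \<in> S \<Longrightarrow> z \<in> S \<Longrightarrow> min (gp t x z) (gp t z y) - \<delta> \<le> gp t x y"
  using four_pt unfolding gp_def by blast

lemma gp_minI:
  assumes "t \<in> S" "x \<in> S" "y \<in> S" "z \<in> S" "a \<le> gp t x z" "a \<le> gp t z y"
  shows "a - \<delta> \<le> gp t x y"
  using gp_min[of t x y z] assms by linarith

lemma gp_minI3:
  assumes "t \<in> S" "x \<in> S" "y \<in> S" "z \<in> S" "w \<in> S" "a \<le> gp t x z" "a \<le> gp t z w" "a \<le> gp t w y"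
  shows "a - 2 * \<delta> \<le> gp t x y"
  using gp_minI[of t x w z a] gp_minI[of t x y w "a - \<delta>"] assms delta_nonneg by linarith

text \<open>Halving the path uses the four-point condition along a binary tree of depth
  \<open>k\<close>, so the loss is logarithmic in the number of steps. A bound thus survives along
  paths whose length is linear in the distances involved.\<close>

lemma gp_path:
  assumes "t \<in> S" "\<And>i. i \<le> m \<Longrightarrow> p i \<in> S" "1 \<le> m" "m \<le> 2 ^ k"
    and "\<And>i. i < m \<Longrightarrow> a \<le> gp t (p i) (p (Suc i))"
  shows "a - real k * \<delta> \<le> gp t (p 0) (p m)"
  using assms(2-)
proof (induction k arbitrary: m p)
  case 0
  then have "m = 1" by simp
  then show ?case using 0(4)[of 0] by simp
next
  case (Suc k)
  show ?case
  proof (cases "m \<le> 2 ^ k")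
    case True
    then have "a - real k * \<delta> \<le> gp t (p 0) (p m)" using Suc by auto
    then show ?thesis using delta_nonneg by (simp add: algebra_simps)
  next
    case False
    define n where "n = (2::nat) ^ k"
    have n: "n < m" "1 \<le> n" "m - n \<le> 2 ^ k" using False Suc.prems(3) by (auto simp: n_def)
    have "a - real k * \<delta> \<le> gp t (p 0) (p n)"
      using Suc.prems n by (intro Suc.IH) (auto simp: n_def)
    moreover have "a - real k * \<delta> \<le> gp t (p (n + 0)) (p (n + (m - n)))"
      using Suc.prems n by (intro Suc.IH[of "m - n" "\<lambda>i. p (n + i)"]) auto
    ultimately have "(a - real k * \<delta>) - \<delta> \<le> gp t (p 0) (p m)"
      using n Suc.prems(1)[of 0] Suc.prems(1)[of n] Suc.prems(1)[of m] assms(1)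
      by (intro gp_minI[of t _ _ "p n"]) auto
    then show ?thesis by (simp add: algebra_simps)
  qed
qed

text \<open>Both points nearly lie on a geodesic from \<open>b\<close> to \<open>e\<close>, because
  their products with \<open>e\<close> at \<open>b\<close> almost reach their distances from
  \<open>b\<close>. By the four-point condition the same holds for their product with each other,
  and nearly equal distances from \<open>b\<close> then leave little room between them.\<close>

lemma near_points:
  assumes "b \<in> S" "e \<in> S" "p \<in> S" "q \<in> S"
    and "d b p - c1 \<le> gp b p e" "d b q - c2 \<le> gp b q e" "\<bar>d b p - d b q\<bar> \<le> h" "0 \<le> c1" "0 \<le> c2"
  shows "d p q \<le> h + 2 * (c1 + c2 + \<delta>)"
proof -
  define m where "m = min (d b p) (d b q)"
  have "(m - c1 - c2) - \<delta> \<le> gp b p q"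
    using assms gp_sym[of b q e] by (intro gp_minI[of b p q e]) (auto simp: m_def min_def)
  moreover have "d b p + d b q \<le> 2 * m + h" using assms(7) by (auto simp: m_def min_def)
  ultimately show ?thesis using dist_gp[of p q b] by (simp add: algebra_simps)
qed

subsection \<open>Local geodesics and local quasigeodesic chains\<close>

text \<open>Induction in steps of \<open>L\<close>. Seen from \<open>x (n - L)\<close>, the point
  \<open>L\<close> earlier has product 0 with \<open>x n\<close>, since both lie on a geodesic piece
  of length 2L, while by induction it shares at least L - \<delta> with \<open>x 0\<close>. As
  \<open>L\<close> exceeds 2\<delta>, the four-point condition makes \<open>x 0\<close> and
  \<open>x n\<close> nearly opposite.\<close>

lemma local_geodesic_end:
  assumes "\<And>i. i \<le> n \<Longrightarrow> x i \<in> S"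
    and "\<And>i j. i \<le> j \<Longrightarrow> j \<le> n \<Longrightarrow> j - i \<le> 2 * L \<Longrightarrow> d (x i) (x j) = real (j - i)"
    and "2 * \<delta> < real L" "L \<le> n"
  shows "gp (x (n - L)) (x 0) (x n) \<le> \<delta>"
  using assms(1,2,4)
proof (induction n rule: less_induct)
  case (less n)
  have L: "0 < L" using assms(3) delta_nonneg by linarith
  define m where "m = n - L"
  have m: "m < n" "n - m = L" "m + L = n" using L less.prems(3) by (auto simp: m_def)
  have S: "x 0 \<in> S" "x m \<in> S" "x n \<in> S" "x (m - L) \<in> S" using m by (auto intro!: less.prems(1))
  show ?case
  proof (cases "m < L")
    case True
    have "gp (x m) (x 0) (x n) = 0"
      using less.prems(2)[of 0 m] less.prems(2)[of m n] less.prems(2)[of 0 n] True m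
        d_sym[OF S(1,2)] by (simp add: gp_def)
    then show ?thesis using delta_nonneg by (simp add: m_def)
  next
    case False
    have IH: "gp (x (m - L)) (x 0) (x m) \<le> \<delta>"
      using less.prems m False by (intro less.IH) auto
    have d1: "d (x (m - L)) (x m) = real L" "d (x m) (x n) = real L" "d (x (m - L)) (x n) = real (2 * L)"
      using less.prems(2)[of "m - L" m] less.prems(2)[of m n] less.prems(2)[of "m - L" n] False m by auto
    have "gp (x m) (x (m - L)) (x 0) = real L - gp (x (m - L)) (x m) (x 0)"
      using gp_flip[of "x m" "x (m - L)" "x 0"] d_sym[of "x m" "x (m - L)"] d1 S by simp
    then have "real L - \<delta> \<le> gp (x m) (x (m - L)) (x 0)"
      using IH gp_sym[of "x (m - L)" "x 0" "x m"] S by simp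
    moreover have "gp (x m) (x (m - L)) (x n) = 0"
      using d1 d_sym[of "x m" "x (m - L)"] S by (simp add: gp_def)
    ultimately show ?thesis
      using gp_min[of "x m" "x (m - L)" "x n" "x 0"] S assms(3) unfolding m_def[symmetric]
      by linarith
  qed
qed

text \<open>The end estimate is applied to the prefix up to \<open>j + L\<close> and to the reversed
  suffix; together they give 2\<delta>. The summand \<open>real L\<close> only covers positions
  within \<open>L\<close> of the right end, where the suffix is too short.\<close>

lemma local_geodesic_mid:
  assumes x: "\<And>i. i \<le> n \<Longrightarrow> x i \<in> S"
    and loc: "\<And>i j. i \<le> j \<Longrightarrow> j \<le> n \<Longrightarrow> j - i \<le> 2 * L \<Longrightarrow> d (x i) (x j) = real (j - i)"
    and L: "3 * \<delta> < real L" and j: "j \<le> n"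
  shows "gp (x j) (x 0) (x n) \<le> real L + 2 * \<delta>"
proof (cases "n - j \<le> L")
  case True
  have "d (x j) (x n) = real (n - j)" using j True by (intro loc) auto
  then show ?thesis using gp_le2[of "x j" "x 0" "x n"] x[of j] x[of 0] x[of n] j True delta_nonneg by simp
next
  case False
  define m where "m = j + L"
  have S: "x 0 \<in> S" "x m \<in> S" "x n \<in> S" "x j \<in> S" using False by (auto intro!: x simp: m_def)
  have L': "2 * \<delta> < real L" using L delta_nonneg by linarith
  have a: "gp (x (m - L)) (x 0) (x m) \<le> \<delta>"
    using False by (intro local_geodesic_end[of m x L] x loc L') (auto simp: m_def)
  have "gp (x (n - (n - j - L))) (x (n - 0)) (x (n - (n - j))) \<le> \<delta>"
  proof (rule local_geodesic_end[of "n - j" "\<lambda>i. x (n - i)" L])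
    fix i k assume "i \<le> k" "k \<le> n - j" "k - i \<le> 2 * L"
    moreover from this have "d (x (n - k)) (x (n - i)) = real (k - i)"
      using loc[of "n - k" "n - i"] by auto
    ultimately show "d (x (n - i)) (x (n - k)) = real (k - i)" using x d_sym by simp
  qed (use False L' x in auto)
  then have b: "gp (x m) (x n) (x j) \<le> \<delta>" using j False by (simp add: m_def add.commute)
  have djm: "d (x j) (x m) = real L" using loc[of j m] False by (simp add: m_def)
  have "real L - \<delta> \<le> gp (x j) (x m) (x n)"
    using gp_flip[of "x j" "x m" "x n"] djm b gp_sym[of "x m" "x n" "x j"] S by linarith
  then have "gp (x j) (x 0) (x n) \<le> 2 * \<delta>"
    using gp_min[of "x j" "x 0" "x m" "x n"] a S L gp_sym[of "x j" "x m" "x n"] by (simp add: m_def)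
  then show ?thesis using L delta_nonneg by linarith
qed

text \<open>The steps are so long compared with the turns that, seen from \<open>x (m + 1)\<close>,
  the start lies behind \<open>x m\<close>; the turn at \<open>x (m + 1)\<close> then separates it
  from the next point.\<close>

lemma chain_end:
  fixes x :: "nat \<Rightarrow> 'p"
  assumes x: "\<And>i. i \<le> n \<Longrightarrow> x i \<in> S"
    and turn: "\<And>i. i + 2 \<le> n \<Longrightarrow> gp (x (i + 1)) (x i) (x (i + 2)) \<le> c"
    and long: "\<And>i. i < n \<Longrightarrow> l \<le> d (x i) (x (i + 1))"
    and l: "2 * c + 2 * \<delta> < l" and c: "0 \<le> c" and m: "m < n"
  shows "gp (x m) (x 0) (x (m + 1)) \<le> c + \<delta>"
  using m
proof (induction m)
  case 0
  then show ?case using x[of 0] x[of 1] c delta_nonneg by simp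
next
  case (Suc m)
  have S: "x 0 \<in> S" "x m \<in> S" "x (m + 1) \<in> S" "x (m + 2) \<in> S" using Suc by (auto intro!: x)
  have IH: "gp (x m) (x 0) (x (m + 1)) \<le> c + \<delta>" using Suc by simp
  have "l - (c + \<delta>) \<le> gp (x (m + 1)) (x m) (x 0)"
    using gp_flip[of "x m" "x (m + 1)" "x 0"] gp_sym[of "x m" "x 0" "x (m + 1)"] IH S
      long[of m] Suc by linarith
  then show ?case
    using gp_min[of "x (m + 1)" "x m" "x (m + 2)" "x 0"] turn[of m] S l Suc by simp
qed

text \<open>The end estimate, read forwards and backwards, meets at \<open>x j\<close>; the
  additional \<delta> in the bound on \<open>l\<close> pays for combining the two.\<close>

lemma chain_mid:
  fixes x :: "nat \<Rightarrow> 'p"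
  assumes x: "\<And>i. i \<le> n \<Longrightarrow> x i \<in> S"
    and turn: "\<And>i. i + 2 \<le> n \<Longrightarrow> gp (x (i + 1)) (x i) (x (i + 2)) \<le> c"
    and long: "\<And>i. i < n \<Longrightarrow> l \<le> d (x i) (x (i + 1))"
    and l: "2 * c + 3 * \<delta> < l" and c: "0 \<le> c" and j: "j \<le> n"
  shows "gp (x j) (x 0) (x n) \<le> c + 2 * \<delta>"
proof (cases "j < n")
  case False
  then show ?thesis using j x[of n] x[of 0] c delta_nonneg by simp
next
  case True
  have S: "x 0 \<in> S" "x j \<in> S" "x (j + 1) \<in> S" "x n \<in> S" using True by (auto intro!: x)
  have l': "2 * c + 2 * \<delta> < l" using l delta_nonneg by linarith
  have a: "gp (x j) (x 0) (x (j + 1)) \<le> c + \<delta>"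
    using True by (intro chain_end[OF x turn long l' c])
  have b: "gp (x (n - (n - (j + 1)))) (x (n - 0)) (x (n - (n - (j + 1) + 1))) \<le> c + \<delta>"
  proof (rule chain_end[of n "\<lambda>i. x (n - i)" c l])
    fix i assume i: "i + 2 \<le> n"
    have "gp (x (n - (i + 2) + 1)) (x (n - (i + 2))) (x (n - (i + 2) + 2)) \<le> c"
      using i by (intro turn) auto
    moreover have "n - (i + 2) + 1 = n - (i + 1)" "n - (i + 2) + 2 = n - i" using i by auto
    ultimately show "gp (x (n - (i + 1))) (x (n - i)) (x (n - (i + 2))) \<le> c"
      using gp_sym[of "x (n - (i + 1))" "x (n - i)" "x (n - (i + 2))"] x by simp
  next
    fix i assume i: "i < n"
    have "l \<le> d (x (n - (i + 1))) (x (n - (i + 1) + 1))" using i by (intro long) auto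
    moreover have "n - (i + 1) + 1 = n - i" using i by auto
    ultimately show "l \<le> d (x (n - i)) (x (n - (i + 1)))"
      using d_sym[of "x (n - i)" "x (n - (i + 1))"] x by simp
  qed (use True l' c x in auto)
  then have b: "gp (x (j + 1)) (x n) (x j) \<le> c + \<delta>" using True by (simp add: Suc_diff_Suc)
  have "l - (c + \<delta>) \<le> gp (x j) (x (j + 1)) (x n)"
    using gp_flip[of "x j" "x (j + 1)" "x n"] b gp_sym[of "x (j + 1)" "x n" "x j"] S long[of j] True
    by linarith
  then show ?thesis
    using gp_min[of "x j" "x 0" "x (j + 1)" "x n"] a S l gp_sym[of "x j" "x (j + 1)" "x n"]
    by linarith
qed

text \<open>By the end estimate each step gains at least l - 2(c + \<delta>), which is at least
  1.\<close>

lemma chain_progress: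
  fixes x :: "nat \<Rightarrow> 'p"
  assumes x: "\<And>i. i \<le> n \<Longrightarrow> x i \<in> S"
    and turn: "\<And>i. i + 2 \<le> n \<Longrightarrow> gp (x (i + 1)) (x i) (x (i + 2)) \<le> c"
    and long: "\<And>i. i < n \<Longrightarrow> l \<le> d (x i) (x (i + 1))"
    and l: "2 * c + 2 * \<delta> + 1 \<le> l" and c: "0 \<le> c"
  shows "real n \<le> d (x 0) (x n)"
proof -
  have "real m \<le> d (x 0) (x m)" if "m \<le> n" for m
    using that
  proof (induction m)
    case 0
    then show ?case using x[of 0] by (simp add: d_refl)
  next
    case (Suc m)
    have S: "x 0 \<in> S" "x m \<in> S" "x (m + 1) \<in> S" using Suc by (auto intro!: x)
    have "gp (x m) (x 0) (x (m + 1)) \<le> c + \<delta>"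
      using Suc l by (intro chain_end[OF x turn long _ c]) auto
    then show ?case
      using dist_gp[of "x 0" "x (m + 1)" "x m"] d_sym[OF S(1,2)] long[of m] Suc l by simp
  qed
  then show ?thesis by simp
qed

end

locale hyperbolic_word_metric = word_metric +
  fixes \<delta> :: real
  assumes delta0: "0 \<le> \<delta>"
    and hyp: "t \<in> carrier G \<Longrightarrow> x \<in> carrier G \<Longrightarrow> y \<in> carrier G \<Longrightarrow> z \<in> carrier G \<Longrightarrow>
      gromov_product G A \<pi> t x y \<ge> min (gromov_product G A \<pi> t x z) (gromov_product G A \<pi> t z y) - \<delta>"
begin

sublocale four_point "carrier G" "\<lambda>x y. real (wdist x y)" \<delta>
proof
  show "real (wdist x z) \<le> real (wdist x y) + real (wdist y z)"
    if "x \<in> carrier G" "y \<in> carrier G" "z \<in> carrier G" for x y z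
    using wdist_triangle[OF that] by linarith
qed (use delta0 hyp in \<open>auto simp: wdist_commute gromov_product_def\<close>)

lemma gp_left:
  "a \<in> carrier G \<Longrightarrow> t \<in> carrier G \<Longrightarrow> x \<in> carrier G \<Longrightarrow> y \<in> carrier G \<Longrightarrow>
    gp (a \<otimes> t) (a \<otimes> x) (a \<otimes> y) = gp t x y"
  by (simp add: gp_def)

lemma gp_left_one:
  "a \<in> carrier G \<Longrightarrow> x \<in> carrier G \<Longrightarrow> y \<in> carrier G \<Longrightarrow> gp a (a \<otimes> x) (a \<otimes> y) = gp \<one> x y"
  using gp_left[of a \<one> x y] by simp

end

lemma word_hyperbolic_metric:
  assumes "word_hyperbolic G"
  shows "\<exists>(n::nat) \<pi> \<delta>. hyperbolic_word_metric G {..<n} \<pi> \<delta>"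
proof -
  obtain n::nat and \<pi> \<delta> where g: "group G" "finite_generating G {..<n} \<pi>"
    and h: "\<And>t x y z. t \<in> carrier G \<Longrightarrow> x \<in> carrier G \<Longrightarrow> y \<in> carrier G \<Longrightarrow> z \<in> carrier G \<Longrightarrow>
           gromov_product G {..<n} \<pi> t x y \<ge>
           min (gromov_product G {..<n} \<pi> t x z) (gromov_product G {..<n} \<pi> t z y) - \<delta>"
    using assms unfolding word_hyperbolic_def by blast
  interpret group G by (rule g)
  \<comment> \<open>The constant in the definition may be negative; enlarging it only weakens the
    inequality.\<close>
  have "hyperbolic_word_metric G {..<n} \<pi> (max \<delta> 0)"
  proof
    show "finite_generating G {..<n} \<pi>" by (rule g)
    fix t x y z assume "t \<in> carrier G" "x \<in> carrier G" "y \<in> carrier G" "z \<in> carrier G"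
    from h[OF this] show "gromov_product G {..<n} \<pi> t x y \<ge>
           min (gromov_product G {..<n} \<pi> t x z) (gromov_product G {..<n} \<pi> t z y) - max \<delta> 0" by linarith
  qed simp
  then show ?thesis by blast
qed

section \<open>Distance to a subgroup\<close>

context word_group
begin

lemma coset_closed [simp]: "subgroup K G \<Longrightarrow> g \<in> carrier G \<Longrightarrow> K #> g \<in> rcosets K"
  by (simp add: rcosetsI subgroup.subset)

lemma rcosetsE:
  assumes "x \<in> rcosets K"
  obtains g where "g \<in> carrier G" "x = K #> g"
  using assms by (auto simp: RCOSETS_def)

lemma coset_act [simp]:
  "subgroup K G \<Longrightarrow> g \<in> carrier G \<Longrightarrow> h \<in> carrier G \<Longrightarrow> (K #> g) #> h = K #> (g \<otimes> h)"
  by (simp add: coset_mult_assoc subgroup.subset)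

lemma rcosets_act_closed:
  "subgroup K G \<Longrightarrow> x \<in> rcosets K \<Longrightarrow> h \<in> carrier G \<Longrightarrow> x #> h \<in> rcosets K"
  by (auto elim!: rcosetsE)

lemma rcosets_act_act:
  "subgroup K G \<Longrightarrow> x \<in> rcosets K \<Longrightarrow> g \<in> carrier G \<Longrightarrow> h \<in> carrier G \<Longrightarrow>
    (x #> g) #> h = x #> (g \<otimes> h)"
  by (auto elim!: rcosetsE simp: m_assoc)

lemma rcosets_act_one: "subgroup K G \<Longrightarrow> x \<in> rcosets K \<Longrightarrow> x #> \<one> = x"
  by (auto elim!: rcosetsE)

lemma rcosets_act_inv:
  "subgroup K G \<Longrightarrow> x \<in> rcosets K \<Longrightarrow> h \<in> carrier G \<Longrightarrow> (x #> h) #> inv h = x"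
  "subgroup K G \<Longrightarrow> x \<in> rcosets K \<Longrightarrow> h \<in> carrier G \<Longrightarrow> (x #> inv h) #> h = x"
  by (simp_all add: rcosets_act_act rcosets_act_one)

lemma rcosets_act_inj:
  "subgroup K G \<Longrightarrow> x \<in> rcosets K \<Longrightarrow> y \<in> rcosets K \<Longrightarrow> h \<in> carrier G \<Longrightarrow> x #> h = y #> h \<Longrightarrow> x = y"
  by (metis rcosets_act_inv(1))

end

context word_metric
begin

text \<open>By left invariance this is the distance from \<open>g\<close> to the subgroup when the
  coset is \<open>K #> g\<close>. Being a function of the coset alone, it can serve as a weight on
  the coset space.\<close>

definition cdist :: "'a set \<Rightarrow> nat" where
  "cdist x = (LEAST n. \<exists>g\<in>x. len g = n)"

lemma cdist_le:
  assumes "subgroup K G" "g \<in> carrier G" "k \<in> K"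
  shows "cdist (K #> g) \<le> wdist k g"
proof -
  have "inv k \<otimes> g \<in> K #> g" using assms by (auto simp: r_coset_def subgroup.m_inv_closed)
  then show ?thesis unfolding cdist_def wdist_len by (intro Least_le) blast
qed

lemma cdist_attained:
  assumes "subgroup K G" "g \<in> carrier G"
  shows "\<exists>k\<in>K. wdist k g = cdist (K #> g)"
proof -
  have "\<exists>n. \<exists>h\<in>K #> g. len h = n" using assms rcos_self by blast
  from LeastI_ex[OF this] obtain h where h: "h \<in> K #> g" "len h = cdist (K #> g)"
    by (auto simp: cdist_def)
  then obtain k where k: "k \<in> K" "h = k \<otimes> g" by (auto simp: r_coset_def)
  then have "k \<in> carrier G" using assms subgroup.mem_carrier by metis
  then have "wdist (inv k) g = cdist (K #> g)" using h k by (simp add: wdist_len)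
  then show ?thesis using k assms subgroup.m_inv_closed by metis
qed

lemma cdist_lipschitz:
  assumes "subgroup K G" "g \<in> carrier G" "h \<in> carrier G"
  shows "cdist (K #> g) \<le> cdist (K #> h) + wdist h g"
proof -
  obtain k where k: "k \<in> K" "wdist k h = cdist (K #> h)" using cdist_attained[OF assms(1,3)] by blast
  have "k \<in> carrier G" using k assms subgroup.mem_carrier by metis
  then show ?thesis using cdist_le[OF assms(1,2) k(1)] wdist_triangle[of k h g] k assms by simp
qed

lemma finite_cdist_ball:
  assumes "subgroup K G"
  shows "finite {x \<in> rcosets K. cdist x \<le> n}"
proof (rule finite_subset)
  show "finite ((\<lambda>g. K #> g) ` {g \<in> carrier G. len g \<le> n})" by (intro finite_imageI finite_ball)
  show "{x \<in> rcosets K. cdist x \<le> n} \<subseteq> (\<lambda>g. K #> g) ` {g \<in> carrier G. len g \<le> n}"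
  proof
    fix x assume "x \<in> {x \<in> rcosets K. cdist x \<le> n}"
    then obtain g where g: "g \<in> carrier G" "x = K #> g" "cdist x \<le> n" by (auto elim: rcosetsE)
    then obtain k where k: "k \<in> K" "wdist k g \<le> n" using cdist_attained[OF assms, of g] by auto
    have kc: "k \<in> carrier G" using k assms subgroup.mem_carrier by metis
    have "inv k \<otimes> g \<in> x"
      using g k assms by (auto simp: r_coset_def subgroup.m_inv_closed)
    then have "x = K #> (inv k \<otimes> g)"
      using g assms repr_independence[of "inv k \<otimes> g" K g] by simp
    then show "x \<in> (\<lambda>g. K #> g) ` {g \<in> carrier G. len g \<le> n}"
      using k kc g by (intro image_eqI[of _ _ "inv k \<otimes> g"]) (auto simp: wdist_len)
  qed
qed

end

context hyperbolic_word_metric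
begin

text \<open>The only property of quasiconvex subgroups that is used: seen from a far away point, the
  subgroup lies in a single direction.\<close>

definition seen_in_one_direction :: "'a set \<Rightarrow> real \<Rightarrow> bool" where
  "seen_in_one_direction K C \<longleftrightarrow>
     (\<forall>g\<in>carrier G. \<forall>k1\<in>K. \<forall>k2\<in>K. real (cdist (K #> g)) - C \<le> gp g k1 k2)"

end

section \<open>Finite automata\<close>

lemma take_lists: "w \<in> lists X \<Longrightarrow> take i w \<in> lists X"
  and drop_lists: "w \<in> lists X \<Longrightarrow> drop i w \<in> lists X"
  by (metis append_in_lists_conv append_take_drop_id)+

lemma dfa_closed:
  assumes "\<forall>q<n. \<forall>x\<in>\<Sigma>. \<delta> q x < (n::nat)" "q < n" "w \<in> lists \<Sigma>"
  shows "foldl \<delta> q w < n"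
  using assms(3,2) by (induction w arbitrary: q) (use assms(1) in auto)

text \<open>A loop between two visits of the same state is cut out until none is left. That no new
  letters appear preserves the shape of padded tails.\<close>

lemma dfa_short:
  assumes \<delta>: "\<forall>q<n. \<forall>x\<in>\<Sigma>. \<delta> q x < (n::nat)" and q: "q < n" and "w \<in> lists \<Sigma>"
  shows "\<exists>v. set v \<subseteq> set w \<and> length v < n \<and> foldl \<delta> q v = foldl \<delta> q w"
  using assms(3)
proof (induction w rule: length_induct)
  case (1 w)
  show ?case
  proof (cases "length w < n")
    case False
    have "(\<lambda>i. foldl \<delta> q (take i w)) ` {..length w} \<subseteq> {..<n}"
      using dfa_closed[OF \<delta> q take_lists[OF 1(2)]] by blast
    then have "card ((\<lambda>i. foldl \<delta> q (take i w)) ` {..length w}) \<le> card {..<n}"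
      by (intro card_mono) auto
    also have "\<dots> < card {..length w}" using False by simp
    finally have "\<not> inj_on (\<lambda>i. foldl \<delta> q (take i w)) {..length w}" by (rule pigeonhole)
    then obtain i' j' where "i' \<le> length w" "j' \<le> length w" "i' \<noteq> j'"
      "foldl \<delta> q (take i' w) = foldl \<delta> q (take j' w)"
      unfolding inj_on_def by auto
    then obtain i j where ij: "i \<le> length w" "j \<le> length w" "i < j"
      "foldl \<delta> q (take i w) = foldl \<delta> q (take j w)"
      by (metis nat_neq_iff)
    define v where "v = take i w @ drop j w"
    have eq: "foldl \<delta> q v = foldl \<delta> q w"
      using ij(4) by (metis append_take_drop_id foldl_append v_def)
    have sub: "set v \<subseteq> set w" by (auto simp: v_def dest: in_set_takeD in_set_dropD)
    have "length v < length w" "v \<in> lists \<Sigma>" using ij 1(2) sub by (auto simp: v_def)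
    then obtain v' where "set v' \<subseteq> set v" "length v' < n" "foldl \<delta> q v' = foldl \<delta> q v"
      using 1(1) by blast
    then show ?thesis using eq sub by auto
  qed auto
qed

lemma pad_pair_Nil [simp]: "pad_pair [] v = map (\<lambda>y. (None, Some y)) v"
  by (induction v) auto

lemma pad_pair_append:
  "length u = length v \<Longrightarrow> pad_pair u (v @ w) = pad_pair u v @ map (\<lambda>y. (None, Some y)) w"
  by (induction u v rule: list_induct2) auto

lemma pad_pair_fst: "List.map_filter fst (pad_pair u v) = u"
  by (induction u v rule: pad_pair.induct) (auto simp: List.map_filter_def)

lemma pad_pair_snd: "List.map_filter snd (pad_pair u v) = v"
  by (induction u v rule: pad_pair.induct) (auto simp: List.map_filter_def)

lemma pad_pair_inject: "pad_pair u v = pad_pair u' v' \<longleftrightarrow> u = u' \<and> v = v'"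
  by (metis pad_pair_fst pad_pair_snd)

lemma regular_relationE:
  assumes "regular_relation \<Sigma> P"
  obtains n \<delta> q0 F where "q0 < (n::nat)"
    "\<forall>q<n. \<forall>x\<in>insert None (Some ` \<Sigma>) \<times> insert None (Some ` \<Sigma>). \<delta> q x < n" "F \<subseteq> {..<n}"
    "(\<lambda>(u, v). pad_pair u v) ` P =
      {w \<in> lists (insert None (Some ` \<Sigma>) \<times> insert None (Some ` \<Sigma>)). foldl \<delta> q0 w \<in> F}"
  using assms unfolding regular_relation_def regular_language_def
  by - (elim conjE exE, rule that, assumption+)

lemma regular_languageE:
  assumes "regular_language \<Sigma> L"
  obtains n \<delta> q0 F where "q0 < (n::nat)" "\<forall>q<n. \<forall>x\<in>\<Sigma>. \<delta> q x < n" "F \<subseteq> {..<n}"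
    "L = {w \<in> lists \<Sigma>. foldl \<delta> q0 w \<in> F}"
  using assms unfolding regular_language_def by - (elim conjE exE, rule that, assumption+)

text \<open>After the end of \<open>u\<close> the automaton reads only pairs with first component
  \<open>None\<close>; cutting loops in that stretch changes the tail of \<open>v\<close>, but
  neither \<open>u\<close> nor acceptance.\<close>

lemma regular_relation_short:
  assumes "regular_relation \<Sigma> P"
  shows "\<exists>N. \<forall>u v. (u, v) \<in> P \<longrightarrow> (\<exists>v'. (u, v') \<in> P \<and> length v' \<le> length u + N)"
proof -
  let ?S = "insert None (Some ` \<Sigma>) \<times> insert None (Some ` \<Sigma>)"
  obtain n \<delta> q0 F where A: "q0 < (n::nat)" "\<forall>q<n. \<forall>x\<in>?S. \<delta> q x < n" "F \<subseteq> {..<n}"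
    and L: "(\<lambda>(u, v). pad_pair u v) ` P = {w \<in> lists ?S. foldl \<delta> q0 w \<in> F}"
    by (rule regular_relationE[OF assms])
  have "\<exists>v'. (u, v') \<in> P \<and> length v' \<le> length u + n" if uv: "(u, v) \<in> P" for u v
  proof (cases "length v \<le> length u")
    case False
    define v1 v2 where "v1 = take (length u) v" and "v2 = drop (length u) v"
    have l1: "length u = length v1" using False by (simp add: v1_def)
    have v: "v = v1 @ v2" by (simp add: v1_def v2_def)
    have acc: "pad_pair u v \<in> lists ?S" "foldl \<delta> q0 (pad_pair u v) \<in> F" using uv L by auto
    have pp: "pad_pair u v = pad_pair u v1 @ map (\<lambda>y. (None, Some y)) v2"
      unfolding v by (rule pad_pair_append[OF l1])
    have in1: "pad_pair u v1 \<in> lists ?S" and in2: "map (\<lambda>y. (None, Some y)) v2 \<in> lists ?S"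
      using acc(1) pp by (simp_all only: append_in_lists_conv)
    have "foldl \<delta> q0 (pad_pair u v1) < n" by (rule dfa_closed[OF A(2,1) in1])
    from dfa_short[OF A(2) this in2] obtain e where
      e: "set e \<subseteq> set (map (\<lambda>y. (None, Some y)) v2)" "length e < n"
        "foldl \<delta> (foldl \<delta> q0 (pad_pair u v1)) e = foldl \<delta> q0 (pad_pair u v)"
      unfolding pp foldl_append by blast
    define f where "f = map (\<lambda>p. the (snd p)) e"
    have ef: "e = map (\<lambda>y. (None, Some y)) f"
      using e(1) unfolding f_def map_map by (intro map_idI[symmetric]) auto
    have "foldl \<delta> q0 (pad_pair u (v1 @ f)) = foldl \<delta> q0 (pad_pair u v)"
      using e(3) by (simp add: pad_pair_append[OF l1] ef)
    moreover have "pad_pair u (v1 @ f) \<in> lists ?S"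
      using in1 in2 e(1) by (auto simp: pad_pair_append[OF l1] ef[symmetric] in_lists_conv_set)
    ultimately have "pad_pair u (v1 @ f) \<in> (\<lambda>(u, v). pad_pair u v) ` P"
      unfolding L using acc(2) by simp
    then have "(u, v1 @ f) \<in> P" by (auto simp: pad_pair_inject)
    moreover have "length (v1 @ f) \<le> length u + n" using l1 e(2) by (simp add: f_def)
    ultimately show ?thesis by blast
  qed (use uv in auto)
  then show ?thesis by blast
qed

section \<open>Rational subgroups of hyperbolic groups\<close>

context word_group
begin

text \<open>An automatic language may contain arbitrarily long words for one element. Multiplying by
  one letter at a time, each time with the bounded growth allowed by the multiplier automaton,
  yields a representative of linear length.\<close>

lemma automatic_short_representatives:
  assumes "automatic_structure G A \<pi> L"
  shows "\<exists>N. \<forall>w\<in>lists (letters A). \<exists>v\<in>L. word_val G \<pi> v = word_val G \<pi> w \<and> length v \<le> N * (length w + 1)"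
proof -
  have fg: "finite_generating G A \<pi>" and reg: "regular_language (letters A) L" and
    onto: "word_val G \<pi> ` L = carrier G" and
    rel: "\<And>x. x \<in> letters A \<Longrightarrow> regular_relation (letters A)
        {(u, v). u \<in> L \<and> v \<in> L \<and> word_val G \<pi> (u @ [x]) = word_val G \<pi> v}"
    using assms by (auto simp: automatic_structure_def)
  interpret word_metric G A \<pi> using fg by unfold_locales
  have LW: "L \<subseteq> Words" using reg by (auto simp: regular_language_def)
  have "\<exists>N. \<forall>u\<in>L. \<exists>v\<in>L. val (u @ [x]) = val v \<and> length v \<le> length u + N" if x: "x \<in> letters A" for x
  proof -
    obtain N where N: "\<And>u v. u \<in> L \<and> v \<in> L \<and> val (u @ [x]) = val v \<Longrightarrow>
      (\<exists>v'. (u \<in> L \<and> v' \<in> L \<and> val (u @ [x]) = val v') \<and> length v' \<le> length u + N)"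
      using regular_relation_short[OF rel[OF x]] by auto
    have "\<exists>v\<in>L. val (u @ [x]) = val v \<and> length v \<le> length u + N" if u: "u \<in> L" for u
    proof -
      have "val (u @ [x]) \<in> val ` L" unfolding onto using u x LW by (intro val_closed) auto
      then obtain v where "v \<in> L" "val (u @ [x]) = val v" by auto
      then show ?thesis using N[of u v] u by auto
    qed
    then show ?thesis by blast
  qed
  then obtain N where N: "\<And>x u. x \<in> letters A \<Longrightarrow> u \<in> L \<Longrightarrow>
      \<exists>v\<in>L. val (u @ [x]) = val v \<and> length v \<le> length u + N x" by metis
  have "\<one> \<in> val ` L" unfolding onto by simp
  then obtain u0 where u0: "u0 \<in> L" "val u0 = \<one>" by auto
  define M where "M = length u0 + sum N (letters A)"
  have NM: "N x \<le> M" if "x \<in> letters A" for x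
    using member_le_sum[of x "letters A" N] that finite_alphabet by (simp add: M_def)
  have "\<exists>v\<in>L. val v = val w \<and> length v \<le> M * (length w + 1)" if "w \<in> Words" for w
    using that
  proof (induction w rule: rev_induct)
    case Nil
    show ?case using u0 by (intro bexI[of _ u0]) (auto simp: M_def)
  next
    case (snoc x w)
    then have x: "x \<in> letters A" and w: "w \<in> Words" by auto
    then obtain u where u: "u \<in> L" "val u = val w" "length u \<le> M * (length w + 1)"
      using snoc by blast
    obtain v where v: "v \<in> L" "val (u @ [x]) = val v" "length v \<le> length u + N x" using N[OF x u(1)] by blast
    have uW: "u \<in> Words" using u LW by blast
    have "val (w @ [x]) = val (u @ [x])"
      using u(2) w x uW val_append[of u "[x]"] val_append[of w "[x]"] by simp
    moreover have "length v \<le> M * (length (w @ [x]) + 1)" using v(3) u(3) NM[OF x] by simp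
    ultimately show ?case using v by metis
  qed
  then show ?thesis by blast
qed

text \<open>From every state on an accepting path, acceptance is less than \<open>N\<close> letters
  away. Applied to the automaton of the preimage of \<open>K\<close>, this keeps all prefixes of the
  word near \<open>K\<close>.\<close>

lemma rational_subgroup_paths:
  assumes "rational_subgroup K G"
  shows "\<exists>(n::nat) \<rho> M N. finite_generating G {..<n} \<rho> \<and>
    (\<forall>w\<in>lists (letters {..<n}). word_val G \<rho> w \<in> K \<longrightarrow>
      (\<exists>v\<in>lists (letters {..<n}). word_val G \<rho> v = word_val G \<rho> w \<and> length v \<le> M * (length w + 1) \<and>
        (\<forall>i. \<exists>s\<in>lists (letters {..<n}). length s \<le> N \<and> word_val G \<rho> (take i v) \<otimes> word_val G \<rho> s \<in> K)))"
proof -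
  obtain n::nat and \<rho> L where aut: "automatic_structure G {..<n} \<rho> L"
    and reg: "regular_language (letters {..<n}) {w \<in> L. word_val G \<rho> w \<in> K}"
    using assms by (auto simp: rational_subgroup_def)
  let ?\<Sigma> = "letters {..<n}"
  have fg: "finite_generating G {..<n} \<rho>" using aut by (simp add: automatic_structure_def)
  interpret word_metric G "{..<n}" \<rho> using fg by unfold_locales
  obtain M where M: "\<And>w. w \<in> Words \<Longrightarrow> \<exists>v\<in>L. val v = val w \<and> length v \<le> M * (length w + 1)"
    using automatic_short_representatives[OF aut] by blast
  obtain N \<delta> q0 F where A: "q0 < (N::nat)" "\<forall>q<N. \<forall>x\<in>?\<Sigma>. \<delta> q x < N" "F \<subseteq> {..<N}"
    and L: "{w \<in> L. val w \<in> K} = {w \<in> Words. foldl \<delta> q0 w \<in> F}"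
    by (rule regular_languageE[OF reg])
  have "\<exists>v\<in>Words. val v = val w \<and> length v \<le> M * (length w + 1) \<and>
        (\<forall>i. \<exists>s\<in>Words. length s \<le> N \<and> val (take i v) \<otimes> val s \<in> K)"
    if w: "w \<in> Words" "val w \<in> K" for w
  proof -
    obtain v where v: "v \<in> L" "val v = val w" "length v \<le> M * (length w + 1)" using M w by blast
    then have "v \<in> {w \<in> L. val w \<in> K}" using w by simp
    then have vW: "v \<in> Words" and vF: "foldl \<delta> q0 v \<in> F" unfolding L by auto
    have "\<exists>s\<in>Words. length s \<le> N \<and> val (take i v) \<otimes> val s \<in> K" for i
    proof -
      have tk: "take i v \<in> Words" and dr: "drop i v \<in> Words"
        using vW by (rule take_lists, rule drop_lists)
      obtain s where s: "set s \<subseteq> set (drop i v)" "length s < N"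
        "foldl \<delta> (foldl \<delta> q0 (take i v)) s = foldl \<delta> (foldl \<delta> q0 (take i v)) (drop i v)"
        using dfa_short[OF A(2) dfa_closed[OF A(2,1) tk] dr] by blast
      have sW: "s \<in> Words" using s(1) dr by auto
      have "foldl \<delta> q0 (take i v @ s) = foldl \<delta> q0 v"
        using s(3) by (metis append_take_drop_id foldl_append)
      then have "take i v @ s \<in> {w \<in> L. val w \<in> K}" unfolding L using tk sW vF by simp
      then show ?thesis using val_append[OF tk sW] sW s(2) by (intro bexI[of _ s]) auto
    qed
    then show ?thesis using v vW by blast
  qed
  then show ?thesis using fg by blast
qed

lemma translate_words:
  assumes "finite_generating G A \<pi>" "finite_generating G B \<rho>"
  shows "\<exists>c. \<forall>w\<in>lists (letters A). \<exists>v\<in>lists (letters B). word_val G \<rho> v = word_val G \<pi> w \<and> length v \<le> c * length w"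
proof -
  interpret A: word_metric G A \<pi> using assms by unfold_locales
  interpret B: word_metric G B \<rho> using assms by unfold_locales
  have "\<forall>x\<in>letters A. \<exists>v\<in>lists (letters B). B.val v = letter_val G \<pi> x"
    using generating_word[OF assms(2)] A.lval_closed by blast
  then obtain t where t: "\<And>x. x \<in> letters A \<Longrightarrow> t x \<in> lists (letters B) \<and> B.val (t x) = letter_val G \<pi> x"
    by metis
  define c where "c = (\<Sum>x\<in>letters A. length (t x))"
  have c: "length (t x) \<le> c" if "x \<in> letters A" for x
    unfolding c_def using member_le_sum[of x "letters A" "\<lambda>x. length (t x)"] that A.finite_alphabet by simp
  have "\<exists>v\<in>lists (letters B). B.val v = A.val w \<and> length v \<le> c * length w" if "w \<in> lists (letters A)" for w
    using that
  proof (induction w)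
    case Nil
    show ?case by (rule bexI[of _ "[]"]) auto
  next
    case (Cons x w)
    then obtain v where v: "v \<in> lists (letters B)" "B.val v = A.val w" "length v \<le> c * length w"
      by auto
    then show ?case using t[of x] c[of x] Cons B.val_append[of "t x" v] 
      by (intro bexI[of _ "t x @ v"]) auto
  qed
  then show ?thesis by blast
qed

end

text \<open>The margin by which a distance \<open>D\<close> beats the logarithmic loss along a path
  with at most M(6D + 1) steps.\<close>

lemma log_eventually_small:
  fixes a \<delta> :: real and M :: nat
  assumes "M > 0"
  shows "\<exists>D0. \<forall>D::nat. D > D0 \<longrightarrow> a + (log 2 (real (M * (6 * D + 1))) + 1) * \<delta> < real D"
proof -
  have "(\<lambda>D::nat. log 2 (6 * real D + 1) / real D) \<longlonglongrightarrow> 0" by real_asymp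
  moreover have "(\<lambda>D::nat. (a + \<delta> + \<delta> * log 2 (real M)) / real D) \<longlonglongrightarrow> 0"
    by (rule lim_const_over_n)
  ultimately have "(\<lambda>D::nat. (a + \<delta> + \<delta> * log 2 (real M)) / real D + \<delta> * (log 2 (6 * real D + 1) / real D)) \<longlonglongrightarrow> 0 + \<delta> * 0"
    by (intro tendsto_intros)
  then have "\<forall>\<^sub>F D in sequentially. (a + \<delta> + \<delta> * log 2 (real M)) / real D + \<delta> * (log 2 (6 * real D + 1) / real D) < 1"
    by (intro order_tendstoD(2)[of _ "0 + \<delta> * 0"]) auto
  then obtain D0 where D0: "\<And>D. D \<ge> D0 \<Longrightarrow>
      (a + \<delta> + \<delta> * log 2 (real M)) / real D + \<delta> * (log 2 (6 * real D + 1) / real D) < 1"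
    unfolding eventually_sequentially by blast
  have "a + (log 2 (real (M * (6 * D + 1))) + 1) * \<delta> < real D" if "D > D0" for D
  proof -
    have Dp: "real D > 0" using that by simp
    have "(a + \<delta> + \<delta> * log 2 (real M)) / real D + \<delta> * (log 2 (6 * real D + 1) / real D) =
      (a + \<delta> + \<delta> * log 2 (real M) + \<delta> * log 2 (6 * real D + 1)) / real D"
      by (simp add: add_divide_distrib)
    then have "(a + \<delta> + \<delta> * log 2 (real M) + \<delta> * log 2 (6 * real D + 1)) < real D"
      using D0[of D] that Dp by (simp add: pos_divide_less_eq)
    moreover have "log 2 (real (M * (6 * D + 1))) = log 2 (real M) + log 2 (6 * real D + 1)"
      using assms log_mult[of 2 "real M" "6 * real D + 1"] by (simp add: algebra_simps)
    ultimately show ?thesis by (simp add: algebra_simps)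
  qed
  then show ?thesis by blast
qed

section \<open>Quasiconvexity of rational subgroups\<close>

context hyperbolic_word_metric
begin

text \<open>What survives of regularity in the hyperbolic word metric. Steps may have length up to
  \<open>a\<close> because the automatic structure may use other generators; the lower bound on
  \<open>m\<close> is the one that \<open>gp_path\<close> asks for.\<close>

definition undistorted_paths :: "'a set \<Rightarrow> nat \<Rightarrow> nat \<Rightarrow> nat \<Rightarrow> bool" where
  "undistorted_paths K M N a \<longleftrightarrow> (\<forall>k\<in>K. \<exists>p m. p 0 = \<one> \<and> p m = k \<and> 1 \<le> m \<and> m \<le> M * (len k + 1) \<and>
     (\<forall>i. p i \<in> carrier G) \<and> (\<forall>i. \<exists>h\<in>K. wdist (p i) h \<le> N) \<and> (\<forall>i. wdist (p i) (p (Suc i)) \<le> a))"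

lemma rational_undistorted_paths:
  assumes K: "subgroup K G" and "rational_subgroup K G"
  shows "\<exists>M N a. M > 0 \<and> undistorted_paths K M N a"
proof -
  obtain n::nat and \<rho> M N where fg: "finite_generating G {..<n} \<rho>" and
    P: "\<And>w. w \<in> lists (letters {..<n}) \<Longrightarrow> word_val G \<rho> w \<in> K \<Longrightarrow>
      \<exists>v\<in>lists (letters {..<n}). word_val G \<rho> v = word_val G \<rho> w \<and> length v \<le> M * (length w + 1) \<and>
        (\<forall>i. \<exists>s\<in>lists (letters {..<n}). length s \<le> N \<and> word_val G \<rho> (take i v) \<otimes> word_val G \<rho> s \<in> K)"
    using rational_subgroup_paths[OF assms(2)] by blast
  interpret B: word_metric G "{..<n}" \<rho> using fg by unfold_locales
  obtain b where b: "\<And>w. w \<in> Words \<Longrightarrow> \<exists>v\<in>B.Words. B.val v = val w \<and> length v \<le> b * length w"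
    using translate_words[OF generating fg] by blast
  obtain c where c: "\<And>w. w \<in> B.Words \<Longrightarrow> \<exists>v\<in>Words. val v = B.val w \<and> length v \<le> c * length w"
    using translate_words[OF fg generating] by blast
  have c': "len (B.val w) \<le> c * length w" if "w \<in> B.Words" for w
    using c[OF that] len_val_le by (metis le_trans)
  have "\<exists>p m. p 0 = \<one> \<and> p m = k \<and> 1 \<le> m \<and> m \<le> (M * (b + 1) + 1) * (len k + 1) \<and>
     (\<forall>i. p i \<in> carrier G) \<and> (\<forall>i. \<exists>h\<in>K. wdist (p i) h \<le> c * N) \<and> (\<forall>i. wdist (p i) (p (Suc i)) \<le> c)"
    if k: "k \<in> K" for k
  proof -
    have kc: "k \<in> carrier G" using k K subgroup.mem_carrier by metis
    obtain w0 where "w0 \<in> Words" "length w0 = len k" "val w0 = k" using len_word[OF kc] by blast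
    then obtain w where w: "w \<in> B.Words" "B.val w = k" "length w \<le> b * len k" using b by metis
    obtain v where v: "v \<in> B.Words" "B.val v = k" "length v \<le> M * (length w + 1)"
      and near: "\<And>i. \<exists>s\<in>B.Words. length s \<le> N \<and> B.val (take i v) \<otimes> B.val s \<in> K"
      using P[OF w(1)] k w(2) by auto
    have tk: "take i v \<in> B.Words" for i using v(1) by (rule take_lists)
    define p where "p i = B.val (take i v)" for i
    have "wdist (p i) (p (Suc i)) \<le> c" for i
    proof (cases "i < length v")
      case True
      then have sp: "take (Suc i) v = take i v @ [v ! i]" by (rule take_Suc_conv_app_nth)
      have x: "[v ! i] \<in> B.Words" using v True by (auto simp: in_lists_conv_set)
      have "p (Suc i) = p i \<otimes> B.val [v ! i]" unfolding p_def sp by (rule B.val_append[OF tk x])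
      then show ?thesis using c'[OF x] B.val_closed[OF tk] B.val_closed[OF x]
        by (simp add: wdist_mult p_def del: B.val_closed)
    qed (simp add: p_def B.val_closed[OF v(1)])
    moreover have "\<exists>h\<in>K. wdist (p i) h \<le> c * N" for i
    proof -
      obtain s where s: "s \<in> B.Words" "length s \<le> N" "p i \<otimes> B.val s \<in> K" using near by (auto simp: p_def)
      have "wdist (p i) (p i \<otimes> B.val s) \<le> c * N"
        using c'[OF s(1)] s(2) B.val_closed[OF tk] B.val_closed[OF s(1)]
        by (simp add: wdist_mult p_def) (meson le_trans mult_le_mono2)
      then show ?thesis using s(3) by blast
    qed
    \<comment> \<open>One step past the end, where the path no longer moves, gives
      \<open>1 \<le> m\<close> even for the empty word.\<close>
    moreover have "length v + 1 \<le> (M * (b + 1) + 1) * (len k + 1)"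
    proof -
      have "M * (length w + 1) \<le> M * ((b + 1) * (len k + 1))"
        using w(3) by (intro mult_le_mono2) (simp add: algebra_simps)
      then show ?thesis using v(3) by (simp add: algebra_simps)
    qed
    moreover have "p 0 = \<one>" "p (length v + 1) = k" "\<And>i. p i \<in> carrier G"
      using v tk by (simp_all add: p_def)
    ultimately show ?thesis by (intro exI[of _ p] exI[of _ "length v + 1"]) auto
  qed
  then have "undistorted_paths K (M * (b + 1) + 1) (c * N) c" unfolding undistorted_paths_def by blast
  then show ?thesis by (metis add_gr_0 zero_less_one)
qed

text \<open>At a point of the geodesic farthest from \<open>K\<close>, say at distance
  \<open>D\<close>, the geodesic passes straight through. A detour through a neighbourhood of
  \<open>K\<close> stays about \<open>D\<close> away from that point and has length linear in
  \<open>D\<close>, so by \<open>gp_path\<close> the two sides have a product of \<open>D\<close>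
  minus a logarithm. For large \<open>D\<close> this contradicts product 0.\<close>

lemma quasiconvex:
  assumes K: "subgroup K G" and P: "undistorted_paths K M N a" and M: "M > 0"
  shows "\<exists>D. \<forall>k1\<in>K. \<forall>k2\<in>K. \<forall>p. p 0 = k1 \<longrightarrow> p (wdist k1 k2) = k2 \<longrightarrow> (\<forall>i. p i \<in> carrier G) \<longrightarrow>
    (\<forall>i j. i \<le> j \<longrightarrow> j \<le> wdist k1 k2 \<longrightarrow> wdist (p i) (p j) = j - i) \<longrightarrow>
    (\<forall>i\<le>wdist k1 k2. cdist (K #> p i) \<le> D)"
proof -
  obtain D0 where D0: "\<And>D::nat. D > D0 \<Longrightarrow> (real N + real a + 2 * \<delta>) + (log 2 (real (M * (6 * D + 1))) + 1) * \<delta> < real D"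
    using log_eventually_small[OF M] by blast
  have Kc: "k \<in> carrier G" if "k \<in> K" for k using that K subgroup.mem_carrier by metis
  have "cdist (K #> p i) \<le> D0"
    if k: "k1 \<in> K" "k2 \<in> K" and p: "p 0 = k1" "p (wdist k1 k2) = k2" "\<And>i. p i \<in> carrier G"
      and geo: "\<And>i j. i \<le> j \<Longrightarrow> j \<le> wdist k1 k2 \<Longrightarrow> wdist (p i) (p j) = j - i"
      and i: "i \<le> wdist k1 k2" for k1 k2 p i
  proof (rule ccontr)
    assume neg: "\<not> cdist (K #> p i) \<le> D0"
    define n where "n = wdist k1 k2"
    define D where "D = Max ((\<lambda>i. cdist (K #> p i)) ` {..n})"
    have Dmax: "cdist (K #> p j) \<le> D" if "j \<le> n" for j
      unfolding D_def using that by (intro Max_ge) auto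
    have "D \<in> (\<lambda>i. cdist (K #> p i)) ` {..n}" unfolding D_def by (intro Max_in) auto
    then obtain i0 where i0: "i0 \<le> n" "cdist (K #> p i0) = D" by auto
    have DD: "D0 < D" using neg Dmax[of i] i unfolding n_def by linarith
    let ?x = "p i0"
    have Dx: "D \<le> wdist k ?x" if "k \<in> K" for k using cdist_le[OF K p(3) that, of i0] i0 by simp
    \<comment> \<open>Positions 2D away on either side, or the end of the geodesic if that comes
      earlier; the natural subtraction truncates at 0.\<close>
    define i1 i2 where "i1 = i0 - 2 * D" and "i2 = min (i0 + 2 * D) n"
    have i12: "i1 \<le> i0" "i0 \<le> i2" "i2 \<le> n" using i0 by (auto simp: i1_def i2_def)
    \<comment> \<open>The link to \<open>K\<close> is either a nearest point, at most
      \<open>D\<close> away from a position that is 2D away from \<open>?x\<close>, or an endpoint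
      that lies in \<open>K\<close> itself.\<close>
    have "\<exists>y'\<in>K. real D \<le> gp ?x (p i1) y' \<and> wdist (p i1) y' \<le> D"
    proof (cases "2 * D \<le> i0")
      case True
      obtain y' where y': "y' \<in> K" "wdist y' (p i1) = cdist (K #> p i1)"
        using cdist_attained[OF K p(3)] by blast
      have "wdist y' (p i1) \<le> D" using y' Dmax[of i1] i12 by simp
      moreover have "wdist ?x (p i1) = 2 * D"
        using geo[of i1 i0] i0 True i12 wdist_commute[OF p(3) p(3)] by (simp add: i1_def n_def)
      ultimately show ?thesis using gp_ge[OF p(3) p(3) Kc[OF y'(1)], of i0 i1] y'(1) wdist_commute[OF p(3) Kc[OF y'(1)]]
        by (intro bexI[of _ y']) auto
    next
      case False
      then have "p i1 = k1" using p by (simp add: i1_def)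
      moreover have "real D \<le> gp ?x k1 k1"
        using Dx[OF k(1)] wdist_commute[OF p(3) Kc[OF k(1)]] Kc[OF k(1)] by (simp add: gp_def)
      ultimately show ?thesis using k Kc by (intro bexI[of _ k1]) auto
    qed
    then obtain y' where y': "y' \<in> K" "real D \<le> gp ?x (p i1) y'" "wdist (p i1) y' \<le> D" by blast
    have "\<exists>z'\<in>K. real D \<le> gp ?x (p i2) z' \<and> wdist (p i2) z' \<le> D"
    proof (cases "i0 + 2 * D \<le> n")
      case True
      obtain z' where z': "z' \<in> K" "wdist z' (p i2) = cdist (K #> p i2)"
        using cdist_attained[OF K p(3)] by blast
      have "wdist z' (p i2) \<le> D" using z' Dmax[of i2] i12 by simp
      moreover have "wdist ?x (p i2) = 2 * D"
        using geo[of i0 i2] i0 True i12 by (simp add: i2_def n_def)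
      ultimately show ?thesis using gp_ge[OF p(3) p(3) Kc[OF z'(1)], of i0 i2] z'(1) wdist_commute[OF p(3) Kc[OF z'(1)]]
        by (intro bexI[of _ z']) auto
    next
      case False
      then have "p i2 = k2" using p by (simp add: i2_def n_def)
      moreover have "real D \<le> gp ?x k2 k2"
        using Dx[OF k(2)] wdist_commute[OF p(3) Kc[OF k(2)]] Kc[OF k(2)] by (simp add: gp_def)
      ultimately show ?thesis using k Kc by (intro bexI[of _ k2]) auto
    qed
    then obtain z' where z': "z' \<in> K" "real D \<le> gp ?x (p i2) z'" "wdist (p i2) z' \<le> D" by blast
    note yc = Kc[OF y'(1)] and zc = Kc[OF z'(1)]
    have "wdist (p i1) (p i2) \<le> 4 * D" using geo[of i1 i2] i12 unfolding n_def i1_def i2_def by simp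
    then have d6: "wdist y' z' \<le> 6 * D"
      using wdist_triangle[OF yc p(3)[of i1] zc] wdist_triangle[OF p(3)[of i1] p(3)[of i2] zc]
        y'(3) z'(3) wdist_commute[OF yc p(3)[of i1]] by simp
    define k where "k = inv y' \<otimes> z'"
    have kK: "k \<in> K" unfolding k_def using y'(1) z'(1) K by (simp add: subgroup.m_closed subgroup.m_inv_closed)
    have lk: "len k \<le> 6 * D" using d6 by (simp add: k_def wdist_len)
    obtain q m where q: "q 0 = \<one>" "q m = k" "1 \<le> m" "m \<le> M * (len k + 1)" "\<And>i. q i \<in> carrier G"
      "\<And>i. \<exists>h\<in>K. wdist (q i) h \<le> N" "\<And>i. wdist (q i) (q (Suc i)) \<le> a"
      using P kK unfolding undistorted_paths_def by metis
    \<comment> \<open>The number of halvings for a path with at most M(6D + 1) steps.\<close>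
    define \<kappa> where "\<kappa> = nat \<lceil>log 2 (real (M * (6 * D + 1)))\<rceil>"
    have "1 \<le> M * (6 * D + 1)" using M by (cases M) auto
    then have pos: "real (M * (6 * D + 1)) \<ge> 1" by (metis of_nat_1 of_nat_le_iff)
    then have lpos: "0 \<le> log 2 (real (M * (6 * D + 1)))" by (subst zero_le_log_cancel_iff) auto
    have k1: "real \<kappa> \<le> log 2 (real (M * (6 * D + 1))) + 1" using lpos unfolding \<kappa>_def by linarith
    have k2: "log 2 (real (M * (6 * D + 1))) \<le> real \<kappa>" unfolding \<kappa>_def by linarith
    have "real (M * (6 * D + 1)) \<le> 2 powr real \<kappa>"
      using k2 pos by (subst (asm) log_le_iff) auto
    then have "real (M * (6 * D + 1)) \<le> real (2 ^ \<kappa>)" by (simp add: powr_realpow)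
    then have "M * (6 * D + 1) \<le> 2 ^ \<kappa>" by (simp only: of_nat_le_iff)
    moreover have "M * (len k + 1) \<le> M * (6 * D + 1)" using lk by (intro mult_le_mono2) simp
    ultimately have m: "m \<le> 2 ^ \<kappa>" using q(4) by linarith
    define A where "A = real D - real N - real a"
    have "A - real \<kappa> * \<delta> \<le> gp ?x (y' \<otimes> q 0) (y' \<otimes> q m)"
    proof (rule gp_path[OF p(3) _ q(3) m])
      fix j
      show "y' \<otimes> q j \<in> carrier G" using yc q(5) by simp
      obtain h where h: "h \<in> K" "wdist (q j) h \<le> N" using q(6) by blast
      have "wdist (y' \<otimes> q j) (y' \<otimes> h) \<le> N" using h yc q(5) Kc by simp
      moreover have "y' \<otimes> h \<in> K" using y'(1) h K by (simp add: subgroup.m_closed)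
      ultimately have "D \<le> wdist ?x (y' \<otimes> q j) + N"
        using Dx[of "y' \<otimes> h"] wdist_triangle[OF p(3)[of i0], of "y' \<otimes> q j" "y' \<otimes> h"] yc q(5) Kc[OF h(1)]
          wdist_commute[OF p(3)[of i0], of "y' \<otimes> h"] by simp
      moreover have "wdist (y' \<otimes> q j) (y' \<otimes> q (Suc j)) \<le> a" using q(5,7) yc by simp
      ultimately show "A \<le> gp ?x (y' \<otimes> q j) (y' \<otimes> q (Suc j))"
        using gp_ge[OF p(3)[of i0], of "y' \<otimes> q j" "y' \<otimes> q (Suc j)"] yc q(5) unfolding A_def by simp
    qed
    moreover have "y' \<otimes> q 0 = y'" "y' \<otimes> q m = z'" using q yc zc by (simp_all add: k_def)
    ultimately have mid: "A - real \<kappa> * \<delta> \<le> gp ?x y' z'" by simp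
    have "0 \<le> real \<kappa> * \<delta>" using delta0 by simp
    then have AD: "A - real \<kappa> * \<delta> \<le> real D" by (simp add: A_def)
    have "A - real \<kappa> * \<delta> - 2 * \<delta> \<le> gp ?x (p i1) (p i2)"
      using y'(2) z'(2) mid AD p(3) yc zc gp_sym[of ?x z' "p i2"]
      by (intro gp_minI3[of ?x _ _ y' z']) auto
    moreover have "gp ?x (p i1) (p i2) = 0"
      using geo[of i1 i0] geo[of i0 i2] geo[of i1 i2] i12 i0 wdist_commute[OF p(3) p(3), of i0 i1]
      by (simp add: gp_def n_def)
    ultimately have "real D \<le> real N + real a + 2 * \<delta> + real \<kappa> * \<delta>" by (simp add: A_def)
    moreover have "real \<kappa> * \<delta> \<le> (log 2 (real (M * (6 * D + 1))) + 1) * \<delta>"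
      using k1 delta0 by (rule mult_right_mono)
    ultimately show False using D0[OF DD] by linarith
  qed
  then show ?thesis by blast
qed

text \<open>Let \<open>k0\<close> be a point of \<open>K\<close> nearest to \<open>g\<close>. Where
  geodesics from \<open>k0\<close> to \<open>g\<close> and to another point of \<open>K\<close>
  still run together, they are close to \<open>K\<close> by quasiconvexity, yet as far from
  \<open>K\<close> as from \<open>k0\<close> by minimality; so they part near \<open>k0\<close>.
  Seen from \<open>g\<close>, all of \<open>K\<close> therefore lies behind
  \<open>k0\<close>.\<close>

lemma rational_seen_in_one_direction:
  assumes K: "subgroup K G" and "rational_subgroup K G"
  shows "\<exists>C. 0 \<le> C \<and> seen_in_one_direction K C"
proof -
  obtain M N a where "M > 0" "undistorted_paths K M N a" using rational_undistorted_paths[OF assms] by blast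
  from quasiconvex[OF K this(2,1)] obtain D where
    "\<forall>k1\<in>K. \<forall>k2\<in>K. \<forall>p. p 0 = k1 \<longrightarrow> p (wdist k1 k2) = k2 \<longrightarrow> (\<forall>i. p i \<in> carrier G) \<longrightarrow>
    (\<forall>i j. i \<le> j \<longrightarrow> j \<le> wdist k1 k2 \<longrightarrow> wdist (p i) (p j) = j - i) \<longrightarrow>
    (\<forall>i\<le>wdist k1 k2. cdist (K #> p i) \<le> D)"
    by (elim exE) (rule that)
  note D = this[THEN bspec, THEN bspec, THEN spec, THEN mp, THEN mp, THEN mp, THEN mp, THEN spec, THEN mp]
  have Kc: "k \<in> carrier G" if "k \<in> K" for k using that K subgroup.mem_carrier by metis
  \<comment> \<open>The summand 1 pays for rounding the product down to the integer
    \<open>r\<close>.\<close>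
  define C0 where "C0 = real D + 4 * \<delta> + 1"
  have near: "\<exists>k0\<in>K. wdist k0 g = cdist (K #> g) \<and> (\<forall>k\<in>K. gp k0 g k \<le> C0)" if g: "g \<in> carrier G" for g
  proof -
    obtain k0 where k0: "k0 \<in> K" "wdist k0 g = cdist (K #> g)" using cdist_attained[OF K g] by blast
    note k0c = Kc[OF k0(1)]
    have "gp k0 g k \<le> C0" if k: "k \<in> K" for k
    proof -
      note kc = Kc[OF k]
      define r where "r = nat \<lfloor>gp k0 g k\<rfloor>"
      have r: "real r \<le> gp k0 g k" "gp k0 g k < real r + 1"
        using gp_nonneg[OF k0c g kc] by (auto simp: r_def)
      have rg: "r \<le> wdist k0 g" and rk: "r \<le> wdist k0 k"
        using r(1) gp_le1[OF k0c g kc] gp_le2[OF k0c g kc] by linarith+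
      obtain p where p: "p 0 = k0" "p (wdist k0 k) = k" "\<And>i. p i \<in> carrier G"
        "\<And>i j. i \<le> j \<Longrightarrow> j \<le> wdist k0 k \<Longrightarrow> wdist (p i) (p j) = j - i"
        using geodesic_path[OF k0c kc] by blast
      obtain q where q: "q \<in> carrier G" "wdist k0 q = r" "wdist q g = wdist k0 g - r"
        using geodesic_point[OF k0c g rg] by blast
      have cp: "cdist (K #> p r) \<le> D" using D[OF k0(1) k p(1,2) _ _ rk] p(3,4) by simp
      have p1: "wdist k0 (p r) = r" "wdist (p r) k = wdist k0 k - r"
        using p(4)[of 0 r] p(4)[of r "wdist k0 k"] rk p(1,2) by auto
      have "gp k0 (p r) k = r" "gp k0 q g = r"
        using p1 q rg rk by (simp_all add: gp_def of_nat_diff)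
      then have "real r - 2 * \<delta> \<le> gp k0 (p r) q"
        using r gp_sym[OF k0c g kc] gp_sym[OF k0c q(1) g] k0c kc g q p(3) by (intro gp_minI3[of k0 _ _ k g]) auto
      then have "real (wdist (p r) q) \<le> 4 * \<delta>"
        using dist_gp[of "p r" q k0] p1 q by simp
      moreover have "r \<le> cdist (K #> q)"
        using cdist_lipschitz[OF K g q(1)] k0(2) q rg by simp
      moreover have "cdist (K #> q) \<le> cdist (K #> p r) + wdist (p r) q"
        by (rule cdist_lipschitz[OF K q(1) p(3)])
      ultimately show ?thesis using r(2) cp unfolding C0_def by linarith
    qed
    then show ?thesis using k0 by blast
  qed
  have "real (cdist (K #> g)) - (C0 + \<delta>) \<le> gp g k1 k2" if g: "g \<in> carrier G" and k: "k1 \<in> K" "k2 \<in> K" for g k1 k2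
  proof -
    obtain k0 where k0: "k0 \<in> K" "wdist k0 g = cdist (K #> g)" "\<And>k. k \<in> K \<Longrightarrow> gp k0 g k \<le> C0"
      using near[OF g] by blast
    note c = Kc[OF k(1)] Kc[OF k(2)] Kc[OF k0(1)]
    have "real (cdist (K #> g)) - C0 \<le> gp g k0 k" if "k \<in> K" for k
      using gp_flip[OF g c(3) Kc[OF that]] k0(3)[OF that] k0(2) wdist_commute[OF g c(3)] by simp
    from this[OF k(1)] this[OF k(2)] have "real (cdist (K #> g)) - C0 - \<delta> \<le> gp g k1 k2"
      using gp_sym[OF g c(3,1)] g c by (intro gp_minI[of g k1 k2 k0]) auto
    then show ?thesis by simp
  qed
  then have "seen_in_one_direction K (C0 + \<delta>)" unfolding seen_in_one_direction_def by blast
  moreover have "0 \<le> C0 + \<delta>" using delta0 by (simp add: C0_def)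
  ultimately show ?thesis by blast
qed

end

section \<open>Non-elementary hyperbolic groups\<close>

lemma discrete_ivt:
  fixes f :: "nat \<Rightarrow> real"
  assumes "\<And>i. \<bar>f (Suc i) - f i\<bar> \<le> h" "f 0 \<le> s" "s \<le> f n"
  shows "\<exists>i\<le>n. \<bar>f i - s\<bar> \<le> h"
  using assms(3)
proof (induction n)
  case 0
  then show ?case using assms(1)[of 0] assms(2) by (intro exI[of _ 0]) auto
next
  case (Suc n)
  show ?case
  proof (cases "s \<le> f n")
    case True
    then show ?thesis using Suc by (meson le_SucI)
  next
    case False
    then show ?thesis using assms(1)[of n] Suc(2) by (intro exI[of _ "Suc n"]) auto
  qed
qed

context hyperbolic_word_metric
begin

text \<open>A local criterion for loxodromic elements. The powers form a chain with turns at most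
  4\<delta>, and 11\<delta>, twice 4\<delta> plus 3\<delta>, is what \<open>chain_mid\<close> asks
  of the step length; the summand 1 makes \<open>chain_progress\<close> available.\<close>

definition lox :: "'a \<Rightarrow> bool" where
  "lox y \<longleftrightarrow> y \<in> carrier G \<and> 11 * \<delta> + 1 < real (len y) \<and> gp \<one> (inv y) y \<le> 4 * \<delta>"

lemma lox_inv: "lox y \<Longrightarrow> lox (inv y)"
  unfolding lox_def using gp_sym[of \<one> y "inv y"] by auto

lemma gp_one: "x \<in> carrier G \<Longrightarrow> y \<in> carrier G \<Longrightarrow>
    gp \<one> x y = (real (len x) + real (len y) - real (len (inv x \<otimes> y))) / 2"
  by (simp add: gp_def wdist_len[of x y])

text \<open>Split a long geodesic word into two halves \<open>u\<close> and \<open>v\<close>. If neither \<open>u\<close> nor \<open>v\<close> nor \<open>uv\<close> were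
  hyperbolic, then \<open>u\<inverse>, u, uv, (uv)\<inverse>, v\<inverse>, v\<close> would all point in the same direction, but
  \<open>u\<inverse>\<close> and \<open>v\<close> do not.\<close>

lemma lox_exists:
  assumes "infinite (carrier G)"
  shows "\<exists>y. lox y"
proof -
  define n where "n = nat \<lceil>11 * \<delta> + 2\<rceil>"
  have n: "11 * \<delta> + 2 \<le> real n" unfolding n_def by linarith
  have "\<exists>g\<in>carrier G. 2 * n < len g"
  proof (rule ccontr)
    assume "\<not> ?thesis"
    then have "carrier G \<subseteq> {g \<in> carrier G. len g \<le> 2 * n}" by (auto simp: not_less)
    then show False using assms finite_ball finite_subset by blast
  qed
  then obtain g where g: "g \<in> carrier G" "2 * n < len g" by blast
  then obtain w where w: "w \<in> Words" "length w = len g" "val w = g" using len_word by blast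
  define a b c where "a = take n w" and "b = take n (drop n w)" and "c = drop (2 * n) w"
  have abc: "w = a @ b @ c"
    unfolding a_def b_def c_def by (metis append_take_drop_id drop_drop mult_2)
  have W: "a \<in> Words" "b \<in> Words" "c \<in> Words" using w(1) unfolding abc by auto
  have lab: "length a = n" "length b = n" using w(2) g(2) by (auto simp: a_def b_def)
  define u v where "u = val a" and "v = val b"
  have uv: "u \<in> carrier G" "v \<in> carrier G" using W by (auto simp: u_def v_def)
  have len: "len u = n" "len v = n" "len (u \<otimes> v) = 2 * n"
    using geodesic_word_sub[of "[]" a "b @ c"] geodesic_word_sub[of a b c] geodesic_word_sub[of "[]" "a @ b" c]
      w lab W by (auto simp: abc u_def v_def val_append)
  have len': "len (inv (u \<otimes> v)) = 2 * n" using len uv by (metis len_inv m_closed)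
  have iuv: "inv (u \<otimes> v) = inv v \<otimes> inv u" using uv by (simp add: inv_mult_group)
  have e0: "gp \<one> (inv u) v = 0" using uv len by (simp add: gp_one)
  have e1: "gp \<one> u (u \<otimes> v) = n" using uv len by (simp add: gp_one)
  have e2: "gp \<one> (inv (u \<otimes> v)) (inv v) = n"
    using uv len len' gp_one[of "inv (u \<otimes> v)" "inv v"] by (simp add: m_assoc)
  have "\<exists>y\<in>{u, v, u \<otimes> v}. gp \<one> (inv y) y \<le> 4 * \<delta>"
  proof (rule ccontr)
    assume "\<not> ?thesis"
    then have h: "gp \<one> (inv u) u > 4 * \<delta>" "gp \<one> (inv v) v > 4 * \<delta>" "gp \<one> (inv (u \<otimes> v)) (u \<otimes> v) > 4 * \<delta>"
      by auto
    \<comment> \<open>The links inv u, u, uv, inv (uv), inv v, v have consecutive products at least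
      \<open>m\<close>, where \<open>real n\<close> accounts for the two links of product exactly
      \<open>n\<close>. Joining the five links costs \<delta> four times, whence the threshold
      4\<delta>.\<close>
    define m where "m = Min {gp \<one> (inv u) u, gp \<one> (inv v) v, gp \<one> (inv (u \<otimes> v)) (u \<otimes> v), real n}"
    have m: "m \<le> gp \<one> (inv u) u" "m \<le> gp \<one> (inv v) v" "m \<le> gp \<one> (inv (u \<otimes> v)) (u \<otimes> v)" "m \<le> real n"
      unfolding m_def by auto
    have mp: "m > 4 * \<delta>" unfolding m_def using h n delta0 by auto
    have s1: "m - \<delta> \<le> gp \<one> (inv u) (u \<otimes> v)"
      using m e1 uv by (intro gp_minI[of \<one> "inv u" "u \<otimes> v" u]) auto
    have s2: "(m - \<delta>) - \<delta> \<le> gp \<one> (inv u) (inv (u \<otimes> v))"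
      using m s1 delta0 uv gp_sym[of \<one> "u \<otimes> v" "inv (u \<otimes> v)"]
      by (intro gp_minI[of \<one> "inv u" "inv (u \<otimes> v)" "u \<otimes> v"]) auto
    have s3: "(m - \<delta> - \<delta>) - \<delta> \<le> gp \<one> (inv u) (inv v)"
      using m s2 delta0 uv e2 by (intro gp_minI[of \<one> "inv u" "inv v" "inv (u \<otimes> v)"]) auto
    have s4: "(m - \<delta> - \<delta> - \<delta>) - \<delta> \<le> gp \<one> (inv u) v"
      using m s3 delta0 uv by (intro gp_minI[of \<one> "inv u" v "inv v"]) auto
    show False using s4 e0 mp by simp
  qed
  then obtain y where y: "y \<in> {u, v, u \<otimes> v}" "gp \<one> (inv y) y \<le> 4 * \<delta>" by blast
  then have "y \<in> carrier G" "n \<le> len y" using uv len by auto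
  then have "lox y" using y n unfolding lox_def by linarith
  then show ?thesis by blast
qed

lemma lox_chain:
  assumes "lox y"
  shows "gp (y [^] (i + 1)) (y [^] i) (y [^] (i + 2 :: nat)) \<le> 4 * \<delta>"
    and "wdist (y [^] i) (y [^] (i + 1)) = len y"
proof -
  have y: "y \<in> carrier G" using assms by (simp add: lox_def)
  have p: "y [^] (i + 1) = y [^] i \<otimes> y" "y [^] (i + 2) = y [^] (i + 1) \<otimes> y" by simp_all
  show "wdist (y [^] i) (y [^] (i + 1)) = len y" unfolding p(1) using y by (simp add: wdist_mult)
  have "y [^] i = y [^] (i + 1) \<otimes> inv y" using y by (simp add: m_assoc)
  then have "gp (y [^] (i + 1)) (y [^] i) (y [^] (i + 2)) = gp \<one> (inv y) y"
    unfolding p(2) using gp_left_one[of "y [^] (i + 1)" "inv y" y] y by simp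
  then show "gp (y [^] (i + 1)) (y [^] i) (y [^] (i + 2 :: nat)) \<le> 4 * \<delta>"
    using assms by (simp add: lox_def)
qed

lemma lox_mid:
  assumes "lox y" "j \<le> (n :: nat)"
  shows "gp (y [^] j) \<one> (y [^] n) \<le> 6 * \<delta>"
proof -
  have y: "y \<in> carrier G" and L: "11 * \<delta> + 1 < real (len y)" using assms by (auto simp: lox_def)
  have "gp (y [^] j) (y [^] (0::nat)) (y [^] n) \<le> 4 * \<delta> + 2 * \<delta>"
    using y lox_chain[OF assms(1)] assms(2) L delta0 by (intro chain_mid[where l = "real (len y)"]) auto
  then show ?thesis by simp
qed

lemma lox_len:
  assumes "lox y"
  shows "n \<le> len (y [^] (n :: nat))"
proof -
  have y: "y \<in> carrier G" and L: "11 * \<delta> + 1 < real (len y)" using assms by (auto simp: lox_def)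
  have "real n \<le> real (wdist (y [^] (0::nat)) (y [^] n))"
    using y lox_chain[OF assms(1)] L delta0 by (intro chain_progress[where l = "real (len y)" and c = "4 * \<delta>"]) auto
  then show ?thesis using y by simp
qed

text \<open>Translation by \<open>y [^] m\<close> turns the base point into an intermediate point of
  the chain of powers of \<open>y\<close> from the identity to the exponent m + n.\<close>

lemma lox_cross:
  assumes "lox y"
  shows "gp \<one> ((inv y) [^] (m :: nat)) (y [^] (n :: nat)) \<le> 6 * \<delta>"
proof -
  have y: "y \<in> carrier G" using assms by (simp add: lox_def)
  have "gp (y [^] m) \<one> (y [^] (m + n)) = gp (y [^] m \<otimes> \<one>) (y [^] m \<otimes> (inv y) [^] m) (y [^] m \<otimes> y [^] n)"
    using y by (simp add: nat_pow_mult nat_pow_inv)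
  also have "\<dots> = gp \<one> ((inv y) [^] m) (y [^] n)" using y by (intro gp_left) auto
  finally show ?thesis using lox_mid[OF assms, of m "m + n"] by simp
qed

lemma lox_len_step:
  assumes "y \<in> carrier G" "x \<in> carrier G" "b \<in> carrier G"
  shows "\<bar>real (wdist b (x \<otimes> y [^] Suc i)) - real (wdist b (x \<otimes> y [^] i))\<bar> \<le> real (len y)"
proof -
  let ?p = "x \<otimes> y [^] i"
  have c: "?p \<in> carrier G" using assms by simp
  have e: "x \<otimes> y [^] Suc i = ?p \<otimes> y" using assms by (simp add: m_assoc)
  have "wdist ?p (?p \<otimes> y) = len y" "wdist (?p \<otimes> y) ?p = len y"
    using wdist_mult[OF c assms(1)] wdist_commute[of ?p "?p \<otimes> y"] c assms by simp_all
  then show ?thesis unfolding e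
    using wdist_triangle[of b ?p "?p \<otimes> y"] wdist_triangle[of b "?p \<otimes> y" ?p] c assms by simp
qed

text \<open>If the rays \<open>t\<eta>\<^sup>i\<close> and \<open>\<theta>\<^sup>j\<close> fellow-travel long enough, the pigeonhole principle in a ball
  produces a commensuration.\<close>

lemma lox_commensurate:
  assumes \<eta>: "lox \<eta>" and \<theta>: "lox \<theta>" and t: "t \<in> carrier G"
    and unb: "\<And>B. \<exists>(n::nat) (m::nat). B \<le> gp \<one> (t \<otimes> \<eta> [^] n) (\<theta> [^] m)"
  shows "\<exists>(a::int) (b::int). b \<noteq> 0 \<and> t \<otimes> \<eta> [^] a \<otimes> inv t = \<theta> [^] b"
proof -
  have ec: "\<eta> \<in> carrier G" and tc: "\<theta> \<in> carrier G" using \<eta> \<theta> by (auto simp: lox_def)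
  define h where "h = real (len \<eta>)"
  \<comment> \<open>The distance at which the two rays fellow-travel: positions are matched up to
    \<open>h\<close>, and the rays deviate from geodesics issuing from the identity by 6\<delta> and
    6\<delta> + \<open>len t\<close>.\<close>
  define c where "c = h + 2 * (6 * \<delta> + (6 * \<delta> + real (len t)) + \<delta>)"
  define X where "X = {g \<in> carrier G. len g \<le> nat \<lfloor>c\<rfloor>}"
  have finX: "finite X" unfolding X_def by (rule finite_ball)
  \<comment> \<open>One exponent more than \<open>X\<close> has elements. Starting at
    \<open>len t\<close> makes these powers at least as long as \<open>t\<close>, the starting point
    of the other ray.\<close>
  define J where "J = {len t..len t + card X}"
  \<comment> \<open>Large enough to exceed the length of every power indexed by \<open>J\<close> and
    to force the exponent \<open>m\<close> beyond \<open>J\<close>.\<close>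
  define B where "B = real (len t + card X) * real (len \<theta>) + real (len t + card X) + 1"
  obtain n m :: nat where nm: "B \<le> gp \<one> (t \<otimes> \<eta> [^] n) (\<theta> [^] m)" using unb[of B] by blast
  have c1: "t \<otimes> \<eta> [^] i \<in> carrier G" "\<theta> [^] i \<in> carrier G" for i :: nat using ec tc t by auto
  have ln: "B \<le> len (t \<otimes> \<eta> [^] n)" and lm: "B \<le> len (\<theta> [^] m)"
    using gp_le1[of \<one> "t \<otimes> \<eta> [^] n" "\<theta> [^] m"] gp_le2[of \<one> "t \<otimes> \<eta> [^] n" "\<theta> [^] m"] nm c1 by simp_all
  have up: "len (\<theta> [^] j) \<le> j * len \<theta>" for j :: nat
  proof (induction j)
    case (Suc j)
    then show ?case using len_mult[of "\<theta> [^] j" \<theta>] tc by simp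
  qed simp
  have "\<exists>i :: nat. inv (\<theta> [^] j) \<otimes> (t \<otimes> \<eta> [^] i) \<in> X" if j: "j \<in> J" for j :: nat
  proof -
    define s where "s = real (len (\<theta> [^] j))"
    have "s \<le> real (j * len \<theta>)" using up[of j] unfolding s_def by linarith
    also have "\<dots> \<le> real ((len t + card X) * len \<theta>)"
      using j unfolding J_def by (intro of_nat_mono mult_le_mono1) auto
    finally have sB: "s \<le> B" unfolding B_def by simp
    have st: "real (len t) \<le> s" using j lox_len[OF \<theta>, of j] unfolding s_def J_def by simp
    have jm: "j \<le> m"
    proof (rule ccontr)
      assume "\<not> j \<le> m"
      then have "m \<le> len t + card X" using j by (auto simp: J_def)
      then have "m * len \<theta> \<le> (len t + card X) * len \<theta>" by (rule mult_le_mono1)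
      then have "real (len (\<theta> [^] m)) \<le> real (len t + card X) * real (len \<theta>)"
        using up[of m] by (metis le_trans of_nat_le_iff of_nat_mult)
      then show False using lm unfolding B_def by simp
    qed
    obtain i where i: "i \<le> n" "\<bar>real (wdist \<one> (t \<otimes> \<eta> [^] i)) - s\<bar> \<le> h"
      using discrete_ivt[of "\<lambda>i. real (wdist \<one> (t \<otimes> \<eta> [^] i))" h s n] lox_len_step[OF ec t one_closed]
        st sB ln c1 t unfolding h_def by auto
    have m1: "gp (\<theta> [^] j) \<one> (\<theta> [^] m) \<le> 6 * \<delta>" by (rule lox_mid[OF \<theta> jm])
    have "gp (t \<otimes> \<eta> [^] i) (t \<otimes> \<one>) (t \<otimes> \<eta> [^] n) = gp (\<eta> [^] i) \<one> (\<eta> [^] n)"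
      using ec t by (intro gp_left) auto
    then have "gp (t \<otimes> \<eta> [^] i) t (t \<otimes> \<eta> [^] n) \<le> 6 * \<delta>" using lox_mid[OF \<eta> i(1)] t by simp
    moreover have "gp (t \<otimes> \<eta> [^] i) (t \<otimes> \<eta> [^] n) \<one> \<le> gp (t \<otimes> \<eta> [^] i) (t \<otimes> \<eta> [^] n) t + wdist \<one> t"
      by (rule gp_arg) (use c1 t in auto)
    ultimately have m2: "gp (t \<otimes> \<eta> [^] i) \<one> (t \<otimes> \<eta> [^] n) \<le> 6 * \<delta> + real (len t)"
      using gp_sym[of "t \<otimes> \<eta> [^] i" "t \<otimes> \<eta> [^] n" \<one>] gp_sym[of "t \<otimes> \<eta> [^] i" "t \<otimes> \<eta> [^] n" t] c1 t by simp
    have f1: "real (wdist \<one> (\<theta> [^] j)) - 6 * \<delta> \<le> gp \<one> (\<theta> [^] j) (\<theta> [^] m)"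
      using gp_flip[of \<one> "\<theta> [^] j" "\<theta> [^] m"] m1 c1 by simp
    have f2: "real (wdist \<one> (t \<otimes> \<eta> [^] i)) - (6 * \<delta> + real (len t)) \<le> gp \<one> (t \<otimes> \<eta> [^] i) (t \<otimes> \<eta> [^] n)"
      using gp_flip[of \<one> "t \<otimes> \<eta> [^] i" "t \<otimes> \<eta> [^] n"] m2 c1 by simp
    let ?P = "\<theta> [^] j" and ?Q = "t \<otimes> \<eta> [^] i"
    have up2: "real (len ?Q) \<le> s + h" "s \<le> real (len ?Q) + h" using i(2) c1 by auto
    have iL: "min (s - 6 * \<delta>) (real (len ?Q) - (6 * \<delta> + real (len t))) - 2 * \<delta> \<le> gp \<one> ?P ?Q"
    proof (rule gp_minI3[of \<one> ?P ?Q "\<theta> [^] m" "t \<otimes> \<eta> [^] n"])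
      show "min (s - 6 * \<delta>) (real (len ?Q) - (6 * \<delta> + real (len t))) \<le> gp \<one> (\<theta> [^] m) (t \<otimes> \<eta> [^] n)"
        using nm sB delta0 gp_sym[of \<one> "\<theta> [^] m" "t \<otimes> \<eta> [^] n"] c1 by simp
    qed (use f1 f2 c1 gp_sym[of \<one> "t \<otimes> \<eta> [^] n" ?Q] in \<open>auto simp: s_def\<close>)
    have "real (wdist ?P ?Q) = s + real (len ?Q) - 2 * gp \<one> ?P ?Q"
      using dist_gp[of ?P ?Q \<one>] c1 by (simp add: s_def)
    also have "\<dots> \<le> c"
      using iL up2 delta0 unfolding c_def by (simp add: min_def algebra_simps split: if_splits)
    finally have "wdist ?P ?Q \<le> nat \<lfloor>c\<rfloor>" by (simp add: le_nat_floor)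
    then show ?thesis using c1 by (intro exI[of _ i]) (simp add: X_def wdist_len)
  qed
  then obtain I where I: "\<And>j. j \<in> J \<Longrightarrow> inv (\<theta> [^] j) \<otimes> (t \<otimes> \<eta> [^] (I j :: nat)) \<in> X" by metis
  have "(\<lambda>j. inv (\<theta> [^] j) \<otimes> (t \<otimes> \<eta> [^] I j)) ` J \<subseteq> X" using I by blast
  then have "card ((\<lambda>j. inv (\<theta> [^] j) \<otimes> (t \<otimes> \<eta> [^] I j)) ` J) \<le> card X"
    by (rule card_mono[OF finX])
  also have "\<dots> < card J" by (simp add: J_def)
  finally have "\<not> inj_on (\<lambda>j. inv (\<theta> [^] j) \<otimes> (t \<otimes> \<eta> [^] I j)) J" by (rule pigeonhole)
  then obtain j j' where jj: "j \<noteq> j'" "inv (\<theta> [^] j) \<otimes> (t \<otimes> \<eta> [^] I j) = inv (\<theta> [^] j') \<otimes> (t \<otimes> \<eta> [^] I j')"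
    unfolding inj_on_def by blast
  let ?a = "int (I j) - int (I j')" and ?b = "int j - int j'"
  have A: "t \<otimes> \<eta> [^] I j = \<theta> [^] j \<otimes> (inv (\<theta> [^] j') \<otimes> (t \<otimes> \<eta> [^] I j'))"
    using arg_cong[OF jj(2), of "\<lambda>z. \<theta> [^] j \<otimes> z"] c1 by simp
  have "t \<otimes> \<eta> [^] ?a \<otimes> inv t = t \<otimes> (\<eta> [^] I j \<otimes> inv (\<eta> [^] I j')) \<otimes> inv t"
    using ec by (simp add: int_pow_diff int_pow_int)
  also have "\<dots> = (t \<otimes> \<eta> [^] I j) \<otimes> inv (t \<otimes> \<eta> [^] I j')"
    using ec t by (simp add: m_assoc inv_mult_group)
  also have "\<dots> = \<theta> [^] j \<otimes> inv (\<theta> [^] j')"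
    unfolding A using ec tc t by (simp add: m_assoc)
  also have "\<dots> = \<theta> [^] ?b" using tc by (simp add: int_pow_diff int_pow_int)
  finally show ?thesis using jj(1) by (intro exI[of _ ?a] exI[of _ ?b]) auto
qed

lemma lox_int_pow_len:
  assumes "lox y"
  shows "nat \<bar>i\<bar> \<le> len (y [^] (i::int))"
proof -
  have y: "y \<in> carrier G" using assms by (simp add: lox_def)
  consider n where "i = int n" | n where "i = - int n" by (metis int_cases2)
  then show ?thesis
  proof cases
    case 1
    then show ?thesis using lox_len[OF assms, of n] by (simp add: int_pow_int)
  next
    case 2
    then show ?thesis using lox_len[OF assms, of n] y by (simp add: int_pow_neg_int)
  qed
qed

lemma lox_int_cross:
  assumes "lox y"
  shows "gp \<one> (y [^] (- i)) (y [^] (i::int)) \<le> 6 * \<delta>"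
proof -
  have y: "y \<in> carrier G" using assms by (simp add: lox_def)
  have *: "gp \<one> (y [^] (- int n)) (y [^] int n) \<le> 6 * \<delta>" for n
    using lox_cross[OF assms, of n n] y by (simp add: int_pow_neg_int int_pow_int nat_pow_inv)
  consider n where "i = int n" | n where "i = - int n" by (metis int_cases2)
  then show ?thesis
  proof cases
    case 1
    then show ?thesis using * by simp
  next
    case 2
    then show ?thesis using *[of n] gp_sym[of \<one> "y [^] i" "y [^] (- i)"] y by simp
  qed
qed

section \<open>Elements near the axis of a loxodromic element\<close>

lemma lox_near_line:
  assumes lox: "lox y" and t: "t \<in> carrier G" and near: "gp t (y [^] (- int m)) (y [^] int m) \<le> 8 * \<delta>"
  shows "\<exists>j::int. real (wdist t (y [^] j)) \<le> real (len y) + 30 * \<delta>"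
proof -
  have y: "y \<in> carrier G" using lox by (simp add: lox_def)
  define b where "b = y [^] (- int m)"
  define e where "e = y [^] int m"
  have bc: "b \<in> carrier G" "e \<in> carrier G" using y by (auto simp: b_def e_def)
  have pt: "b \<otimes> y [^] i = y [^] (int i - int m)" for i :: nat
    unfolding b_def using y int_pow_mult[of y "- int m" "int i"] by (simp add: int_pow_int)
  have e: "e = b \<otimes> y [^] (2 * m)" using pt[of "2 * m"] by (simp add: e_def)
  define s where "s = real (wdist b t)"
  have te: "s - 8 * \<delta> \<le> gp b t e"
    using gp_flip[of b t e] near bc t unfolding s_def b_def[symmetric] e_def[symmetric] by simp
  show ?thesis
  proof (cases "s \<le> real (wdist b e)")
    case True
    have "\<exists>i\<le>2 * m. \<bar>real (wdist b (b \<otimes> y [^] i)) - s\<bar> \<le> real (len y)"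
      using True bc lox_len_step[OF y bc(1) bc(1)] e by (intro discrete_ivt) (auto simp: s_def)
    then obtain i where i: "i \<le> 2 * m" "\<bar>real (wdist b (b \<otimes> y [^] i)) - s\<bar> \<le> real (len y)" by blast
    let ?q = "b \<otimes> y [^] i"
    have qc: "?q \<in> carrier G" using bc y by simp
    have "gp ?q (b \<otimes> \<one>) (b \<otimes> y [^] (2 * m)) = gp (y [^] i) \<one> (y [^] (2 * m))"
      using bc y by (intro gp_left) auto
    then have "gp ?q b e \<le> 6 * \<delta>" using lox_mid[OF lox i(1)] bc e by simp
    then have qe: "real (wdist b ?q) - 6 * \<delta> \<le> gp b ?q e"
      using gp_flip[OF bc(1) qc bc(2)] by simp
    have "real (wdist t ?q) \<le> real (len y) + 2 * (8 * \<delta> + 6 * \<delta> + \<delta>)"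
      using te qe i(2) delta0 unfolding s_def by (intro near_points[OF bc(1) bc(2) t qc]) auto
    then show ?thesis unfolding pt by (intro exI[of _ "int i - int m"]) simp
  next
    case False
    have "real (wdist t e) = s + real (wdist b e) - 2 * gp b t e" using dist_gp[of t e b] by (simp add: s_def)
    also have "\<dots> \<le> 16 * \<delta>" using te False by simp
    finally show ?thesis unfolding e_def using delta0 by (intro exI[of _ "int m"]) simp
  qed
qed

text \<open>The relation says \<open>Q i\<close> is \<open>P i\<close> times \<open>t\<close>, so
  both points stay at distance \<open>len t\<close>. The points \<open>Q (- int k)\<close> and
  \<open>Q (int k)\<close> are nearly opposite as seen from \<open>t\<close>; for large
  \<open>k\<close> so are the corresponding powers \<open>P\<close>, and thus \<open>t\<close> is
  near the line of powers of \<open>y\<close>.\<close>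

lemma commensurated_near_line:
  assumes lox: "lox y" and t: "t \<in> carrier G" and ab: "(a::int) \<noteq> 0" "(b::int) \<noteq> 0"
    and comm: "t \<otimes> y [^] a \<otimes> inv t = y [^] b"
  shows "\<exists>j::int. real (wdist t (y [^] j)) \<le> real (len y) + 30 * \<delta>"
proof -
  have y: "y \<in> carrier G" using lox by (simp add: lox_def)
  define k where "k = len t + nat \<lceil>8 * \<delta>\<rceil> + 1"
  have k: "real (len t) + 8 * \<delta> < real k" unfolding k_def using delta0 by linarith
  have ta: "t \<otimes> y [^] (a * i) = y [^] (b * i) \<otimes> t" for i :: int
  proof -
    have conj: "group_hom G G (\<lambda>x. t \<otimes> x \<otimes> inv t)"
      using t by unfold_locales (auto simp: hom_def m_assoc)
    have "t \<otimes> y [^] (a * i) \<otimes> inv t = (t \<otimes> (y [^] a) [^] i \<otimes> inv t)"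
      using y by (simp add: int_pow_pow)
    also have "\<dots> = (t \<otimes> (y [^] a) \<otimes> inv t) [^] i"
      using group_hom.hom_int_pow[OF conj, of "y [^] a" i] y by simp
    also have "\<dots> = y [^] (b * i)" unfolding comm using y by (simp add: int_pow_pow)
    finally have "t \<otimes> y [^] (a * i) \<otimes> inv t \<otimes> t = y [^] (b * i) \<otimes> t" by simp
    then show ?thesis using t y by (simp add: m_assoc)
  qed
  define P where "P i = y [^] (b * i)" for i :: int
  define Q where "Q i = t \<otimes> y [^] (a * i)" for i :: int
  have PQ: "P i \<in> carrier G" "Q i \<in> carrier G" for i using y t by (auto simp: P_def Q_def)
  have dPQ: "wdist (P i) (Q i) = len t" for i unfolding P_def Q_def ta using y t by (simp add: wdist_mult)
  have far: "8 * \<delta> < gp t (P i) (Q i)" if i: "\<bar>i\<bar> = int k" for i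
  proof -
    have "int k \<le> \<bar>a * i\<bar>"
      using mult_right_mono[of 1 "\<bar>a\<bar>" "int k"] ab(1) i by (simp add: abs_mult)
    then have "k \<le> nat \<bar>a * i\<bar>" by simp
    also have "\<dots> \<le> wdist t (Q i)" unfolding Q_def using lox_int_pow_len[OF lox] y t by (simp add: wdist_mult)
    finally have "real k - real (len t) \<le> gp t (Q i) (P i)"
      using gp_ge[OF t PQ(2) PQ(1), of i i] dPQ[of i] wdist_commute[OF PQ(1) PQ(2), of i i] by simp
    then show ?thesis using k gp_sym[OF t PQ(1) PQ(2), of i i] by simp
  qed
  have cr: "gp t (Q (- int k)) (Q (int k)) \<le> 6 * \<delta>"
    unfolding Q_def using gp_left_one[OF t, of "y [^] (a * - int k)" "y [^] (a * int k)"]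
      lox_int_cross[OF lox, of "a * int k"] y by simp
  have "gp t (P (- int k)) (P (int k)) \<le> 8 * \<delta>"
  proof (rule ccontr)
    assume *: "\<not> ?thesis"
    define m where "m = min (gp t (P (- int k)) (P (int k))) (min (gp t (P (- int k)) (Q (- int k))) (gp t (P (int k)) (Q (int k))))"
    have "m - 2 * \<delta> \<le> gp t (Q (- int k)) (Q (int k))"
      using gp_sym[OF t PQ(1) PQ(2), of "- int k" "- int k"]
      by (intro gp_minI3[OF t PQ(2) PQ(2) PQ(1) PQ(1), of m "- int k" "- int k" "int k" "int k"]) (auto simp: m_def)
    moreover have "8 * \<delta> < m" using * far[of "int k"] far[of "- int k"] by (simp add: m_def)
    ultimately show False using cr by simp
  qed
  then have near: "gp t (y [^] (- (b * int k))) (y [^] (b * int k)) \<le> 8 * \<delta>" by (simp add: P_def)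
  \<comment> \<open>The sign of \<open>b\<close> is unknown, so the two ends may have to be
    exchanged.\<close>
  define m where "m = nat \<bar>b * int k\<bar>"
  have "gp t (y [^] (- int m)) (y [^] int m) \<le> 8 * \<delta>"
  proof (cases "0 \<le> b * int k")
    case True
    then show ?thesis using near by (simp add: m_def)
  next
    case False
    then have "int m = - (b * int k)" by (simp add: m_def)
    then show ?thesis using near gp_sym[OF t, of "y [^] (b * int k)" "y [^] (- (b * int k))"] y by simp
  qed
  then show ?thesis by (rule lox_near_line[OF lox t])
qed

text \<open>If every \<open>t\<close> had unbounded products for some choice of signs, every
  \<open>t\<close> would commensurate \<open>y\<close> and hence lie near a power of
  \<open>y\<close>; the cyclic subgroup of \<open>y\<close> would then have finite index.\<close>

lemma lox_independent_translate:
  assumes lox: "lox y" and nvc: "\<not> virtually_cyclic G"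
  shows "\<exists>t\<in>carrier G. \<exists>c. \<forall>\<eta>\<in>{y, inv y}. \<forall>\<theta>\<in>{y, inv y}. \<forall>(n::nat) (m::nat). gp \<one> (t \<otimes> \<eta> [^] n) (\<theta> [^] m) \<le> c"
proof (rule ccontr)
  assume neg: "\<not> ?thesis"
  have y: "y \<in> carrier G" using lox by (simp add: lox_def)
  define Cy where "Cy = range (\<lambda>i::int. y [^] i)"
  have Cg: "Cy = generate G {y}" using generate_pow[OF y] by (auto simp: Cy_def)
  have sub: "subgroup Cy G" unfolding Cg using y by (intro generate_is_subgroup) auto
  have inv_pow: "(inv y) [^] i = y [^] (- i)" for i :: int using y by (simp add: int_pow_inv int_pow_neg)
  define r where "r = nat \<lfloor>real (len y) + 30 * \<delta>\<rfloor>"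
  have "\<exists>j::int. wdist t (y [^] j) \<le> r" if t: "t \<in> carrier G" for t
  proof -
    have "\<exists>\<eta>\<in>{y, inv y}. \<exists>\<theta>\<in>{y, inv y}. \<forall>B. \<exists>(n::nat) (m::nat). B \<le> gp \<one> (t \<otimes> \<eta> [^] n) (\<theta> [^] m)"
    proof (rule ccontr)
      assume bd: "\<not> ?thesis"
      have "\<exists>B. \<forall>(n::nat) (m::nat). gp \<one> (t \<otimes> \<eta> [^] n) (\<theta> [^] m) \<le> B"
        if et: "\<eta> \<in> {y, inv y}" "\<theta> \<in> {y, inv y}" for \<eta> \<theta>
      proof -
        obtain B where "\<And>(n::nat) (m::nat). \<not> B \<le> gp \<one> (t \<otimes> \<eta> [^] n) (\<theta> [^] m)"
          using bd et by blast
        then show ?thesis by (intro exI[of _ B]) (auto simp: not_le less_imp_le)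
      qed
      then obtain B where B: "\<And>\<eta> \<theta> n m. \<eta> \<in> {y, inv y} \<Longrightarrow> \<theta> \<in> {y, inv y} \<Longrightarrow>
          gp \<one> (t \<otimes> \<eta> [^] (n::nat)) (\<theta> [^] (m::nat)) \<le> B \<eta> \<theta>" by metis
      \<comment> \<open>There are only four pairs of signs, so separate bounds give a common
        one.\<close>
      let ?S = "{y, inv y} \<times> {y, inv y}"
      have "gp \<one> (t \<otimes> \<eta> [^] (n::nat)) (\<theta> [^] (m::nat)) \<le> Max ((\<lambda>(a, b). B a b) ` ?S)"
        if "\<eta> \<in> {y, inv y}" "\<theta> \<in> {y, inv y}" for \<eta> \<theta> n m
        using B[OF that, of n m] that
        by (intro order_trans[OF _ Max_ge[of _ "B \<eta> \<theta>"]]) (force intro!: finite_imageI)+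
      then show False using neg t by blast
    qed
    then obtain \<eta> \<theta> where et: "\<eta> \<in> {y, inv y}" "\<theta> \<in> {y, inv y}"
      and unb: "\<And>B. \<exists>(n::nat) (m::nat). B \<le> gp \<one> (t \<otimes> \<eta> [^] n) (\<theta> [^] m)" by blast
    have le: "lox \<eta>" "lox \<theta>" using et lox lox_inv by auto
    obtain a b :: int where ab: "b \<noteq> 0" "t \<otimes> \<eta> [^] a \<otimes> inv t = \<theta> [^] b"
      using lox_commensurate[OF le t unb] by blast
    obtain a' where a': "\<eta> [^] a = y [^] (a' :: int)" using et inv_pow by auto
    obtain b' where b': "\<theta> [^] b = y [^] (b' :: int)" "b' \<noteq> 0" using et inv_pow ab(1) by (metis insertE neg_equal_0_iff_equal singletonD)
    \<comment> \<open>Only the second exponent is known to be nonzero. A vanishing first one would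
      make a nonzero power of \<open>y\<close> trivial, but the powers of \<open>y\<close> grow in
      length.\<close>
    have "a' \<noteq> 0"
    proof
      assume "a' = 0"
      then have "y [^] b' = \<one>" using ab(2) t a' b' by simp
      then show False using lox_int_pow_len[OF lox, of b'] b'(2) by simp
    qed
    then obtain j :: int where "real (wdist t (y [^] j)) \<le> real (len y) + 30 * \<delta>"
      using commensurated_near_line[OF lox t _ b'(2)] ab(2) a' b'(1) by metis
    then show ?thesis unfolding r_def by (metis le_nat_floor)
  qed
  then have near: "\<exists>j::int. wdist t (y [^] j) \<le> r" if "t \<in> carrier G" for t using that by blast
  have "rcosets Cy \<subseteq> (\<lambda>u. Cy #> u) ` {g \<in> carrier G. len g \<le> r}"
  proof
    fix x assume "x \<in> rcosets Cy"
    then obtain t where t: "t \<in> carrier G" "x = Cy #> t" by (rule rcosetsE)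
    obtain j :: int where j: "wdist t (y [^] j) \<le> r" using near[OF t(1)] by blast
    let ?u = "inv (y [^] j) \<otimes> t"
    have "len ?u \<le> r" using j wdist_commute[OF t(1), of "y [^] j"] y by (simp add: wdist_len)
    moreover have "inv (y [^] j) \<in> Cy" using sub by (auto simp: subgroup.m_inv_closed Cy_def)
    then have "Cy #> ?u = x"
      using t y sub by (metis coset_act coset_join2 int_pow_closed inv_closed coset_mult_assoc subgroup.subset)
    ultimately show "x \<in> (\<lambda>u. Cy #> u) ` {g \<in> carrier G. len g \<le> r}" using t y by (intro image_eqI[of _ _ ?u]) auto
  qed
  then have "finite (rcosets Cy)" using finite_ball finite_subset by blast
  then have fin: "finite_index G Cy" using sub by (simp add: finite_index_def)
  have "group (G\<lparr>carrier := Cy\<rparr>)" using sub subgroup_imp_group by blast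
  then have "cyclic_group (G\<lparr>carrier := Cy\<rparr>)"
  proof (subst group.cyclic_group)
    have yC: "y \<in> Cy" unfolding Cy_def by (metis int_pow_1 rangeI y)
    moreover have "y [^]\<^bsub>G\<lparr>carrier := Cy\<rparr>\<^esub> i = y [^] i" for i :: int
      using int_pow_consistent[OF sub yC] by simp
    ultimately show "\<exists>x\<in>carrier (G\<lparr>carrier := Cy\<rparr>). carrier (G\<lparr>carrier := Cy\<rparr>) = range (\<lambda>n::int. x [^]\<^bsub>G\<lparr>carrier := Cy\<rparr>\<^esub> n)"
      by (intro bexI[of _ y]) (auto simp: Cy_def)
  qed
  then show False using fin nvc by (auto simp: virtually_cyclic_def)
qed

section \<open>Four diverging elements of nearly equal length\<close>

lemma gp_change:
  assumes "x \<in> carrier G" "y \<in> carrier G" "t \<in> carrier G"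
  shows "gp \<one> (x \<otimes> t) y \<le> gp \<one> x y + real (len t)"
  using gp_arg[of \<one> y "x \<otimes> t" x] gp_sym[of \<one> y x] gp_sym[of \<one> y "x \<otimes> t"] wdist_mult[of x t] wdist_commute[of x "x \<otimes> t"] assms
  by simp

text \<open>A large power of \<open>y\<close>, its inverse, and their conjugates by an independent
  \<open>t\<close>. The order of quantifiers matters: \<open>\<Delta>\<close> and \<open>c\<close>
  are fixed before the exponent, so that both become negligible against \<open>L\<close>.\<close>

lemma diverging_set:
  assumes "infinite (carrier G)" and nvc: "\<not> virtually_cyclic G"
  shows "\<exists>\<Delta> c. 0 \<le> c \<and> (\<forall>L0. \<exists>F L. L0 \<le> L \<and> finite F \<and> F \<subseteq> carrier G \<and> card F = 4 \<and> (\<forall>f\<in>F. inv f \<in> F) \<and>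
    (\<forall>f\<in>F. L \<le> real (len f) \<and> real (len f) \<le> L + \<Delta>) \<and> (\<forall>f\<in>F. \<forall>f'\<in>F. f \<noteq> f' \<longrightarrow> gp \<one> f f' \<le> c))"
proof -
  obtain y where lox: "lox y" using lox_exists[OF assms(1)] by blast
  have y: "y \<in> carrier G" using lox by (simp add: lox_def)
  obtain t c0 where t: "t \<in> carrier G" and c0: "\<And>\<eta> \<theta> n m. \<eta>\<in>{y, inv y} \<Longrightarrow> \<theta>\<in>{y, inv y} \<Longrightarrow>
      gp \<one> (t \<otimes> \<eta> [^] (n::nat)) (\<theta> [^] (m::nat)) \<le> c0"
    using lox_independent_translate[OF lox nvc] by blast
  define \<tau> where "\<tau> = real (len t)"
  have c00: "0 \<le> c0" using c0[of y y 0 0] gp_nonneg[of \<one> "t \<otimes> y [^] (0::nat)" "y [^] (0::nat)"] y t by simp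
  define c where "c = c0 + 6 * \<delta> + 4 * \<tau>"
  have cc: "0 \<le> c" using c00 delta0 by (simp add: c_def \<tau>_def)
  have "\<exists>F L. L0 \<le> L \<and> finite F \<and> F \<subseteq> carrier G \<and> card F = 4 \<and> (\<forall>f\<in>F. inv f \<in> F) \<and>
    (\<forall>f\<in>F. L \<le> real (len f) \<and> real (len f) \<le> L + 4 * \<tau>) \<and> (\<forall>f\<in>F. \<forall>f'\<in>F. f \<noteq> f' \<longrightarrow> gp \<one> f f' \<le> c)" for L0
  proof -
    \<comment> \<open>Large enough for \<open>L0 \<le> L\<close> and for all four lengths to exceed
      \<open>c\<close>.\<close>
    define N where "N = nat \<lceil>max L0 0 + c + 2 * \<tau> + 1\<rceil>"
    have N: "max L0 0 + c + 2 * \<tau> + 1 \<le> real N" unfolding N_def by linarith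
    define a a' where "a = y [^] N" and "a' = inv y [^] N"
    define b b' where "b = t \<otimes> a \<otimes> inv t" and "b' = t \<otimes> a' \<otimes> inv t"
    have cl: "a \<in> carrier G" "a' \<in> carrier G" "b \<in> carrier G" "b' \<in> carrier G"
      using y t by (auto simp: a_def a'_def b_def b'_def)
    have ia: "inv a = a'" "inv a' = a" using y by (auto simp: a_def a'_def nat_pow_inv)
    have ib: "inv b = b'" "inv b' = b" using y t cl ia by (auto simp: b_def b'_def inv_mult_group m_assoc)
    define L where "L = real (len a) - 2 * \<tau>"
    have la': "len a' = len a" using ia(1) len_inv[OF cl(1)] by simp
    have LN: "real N \<le> real (len a)" using lox_len[OF lox, of N] by (simp add: a_def)
    have lb1: "real (len (t \<otimes> x \<otimes> inv t)) \<le> real (len x) + 2 * \<tau>" if "x \<in> carrier G" for x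
      using len_mult[of "t \<otimes> x" "inv t"] len_mult[of t x] t that by (simp add: \<tau>_def)
    have "real (len a) \<le> real (len b) + 2 * \<tau>"
    proof -
      have "a = inv t \<otimes> b \<otimes> t" using t cl by (simp add: b_def m_assoc)
      then show ?thesis using len_mult[of "inv t \<otimes> b" t] len_mult[of "inv t" b] t cl by (simp add: \<tau>_def)
    qed
    moreover have "len b' = len b" using ib(1) len_inv[OF cl(3)] by simp
    ultimately have lens: "L \<le> real (len f) \<and> real (len f) \<le> L + 4 * \<tau>" if "f \<in> {a, a', b, b'}" for f
      using that lb1[OF cl(1)] la' by (auto simp: L_def b_def \<tau>_def)
    have tp: "0 \<le> \<tau>" by (simp add: \<tau>_def)
    have ga: "gp \<one> a' a \<le> c" using lox_cross[OF lox, of N N] c00 tp by (simp add: a_def a'_def c_def)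
    have gt: "gp \<one> (t \<otimes> \<eta> [^] N \<otimes> inv t) (\<theta> [^] N) \<le> c" if "\<eta> \<in> {y, inv y}" "\<theta> \<in> {y, inv y}" for \<eta> \<theta>
    proof -
      have "\<eta> \<in> carrier G" "\<theta> \<in> carrier G" using that y by auto
      then show ?thesis
        using gp_change[of "t \<otimes> \<eta> [^] N" "\<theta> [^] N" "inv t"] c0[OF that, of N N] t delta0 tp
        by (simp add: c_def \<tau>_def)
    qed
    have gb: "gp \<one> b' b \<le> c"
    proof -
      have "gp \<one> b' b \<le> gp \<one> (t \<otimes> a') b + \<tau>"
        using gp_change[of "t \<otimes> a'" b "inv t"] t cl by (simp add: b'_def \<tau>_def)
      also have "gp \<one> (t \<otimes> a') b = gp \<one> b (t \<otimes> a')" using gp_sym t cl by simp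
      also have "\<dots> \<le> gp \<one> (t \<otimes> a) (t \<otimes> a') + \<tau>"
        using gp_change[of "t \<otimes> a" "t \<otimes> a'" "inv t"] t cl by (simp add: b_def \<tau>_def)
      also have "gp \<one> (t \<otimes> a) (t \<otimes> a') \<le> gp t (t \<otimes> a) (t \<otimes> a') + \<tau>"
        using gp_base[of \<one> t "t \<otimes> a" "t \<otimes> a'"] t cl by (simp add: \<tau>_def)
      also have "gp t (t \<otimes> a) (t \<otimes> a') = gp \<one> a a'" by (rule gp_left_one[OF t cl(1,2)])
      finally show ?thesis
        using lox_cross[OF lox, of N N] gp_sym[of \<one> a a'] cl c00 tp by (simp add: a_def a'_def c_def)
    qed
    note g = ga gb gt[of y y] gt[of "inv y" y] gt[of y "inv y"] gt[of "inv y" "inv y"]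
    have g6: "gp \<one> a' a \<le> c" "gp \<one> b' b \<le> c" "gp \<one> b a \<le> c" "gp \<one> b' a \<le> c" "gp \<one> b a' \<le> c" "gp \<one> b' a' \<le> c"
      using g by (auto simp: a_def a'_def b_def b'_def)
    have g12: "gp \<one> f f' \<le> c" if "f \<in> {a, a', b, b'}" "f' \<in> {a, a', b, b'}" "f \<noteq> f'" for f f'
      using that g6 gp_sym[OF one_closed] cl by (elim insertE; simp)
    have big: "c < real (len f)" if "f \<in> {a, a', b, b'}" for f
      using lens[OF that] LN N tp unfolding L_def by linarith
    \<comment> \<open>Equal elements would have a product equal to their length, which exceeds
      \<open>c\<close>; hence the four are distinct.\<close>
    have gpff: "gp \<one> f f = real (len f)" if "f \<in> carrier G" for f using that by (simp add: gp_def)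
    have "a' \<noteq> a" "b' \<noteq> b" "b \<noteq> a" "b' \<noteq> a" "b \<noteq> a'" "b' \<noteq> a'"
      using g6 big gpff cl by force+
    then have "card {a, a', b, b'} = 4" by auto
    moreover have "L0 \<le> L" using N LN cc tp unfolding L_def by linarith
    ultimately show ?thesis using lens g12 cl ia ib
      by (intro exI[of _ "{a, a', b, b'}"] exI[of _ L]) auto
  qed
  then show ?thesis using cc by blast
qed

end

section \<open>Non-amenable coset spaces\<close>

text \<open>Any finite set of translations is allowed, generating or not, so that the four diverging
  elements can be used directly and no generating sets have to be compared.\<close>

definition nonamenable_cosets :: "'g monoid \<Rightarrow> 'g set \<Rightarrow> bool" where
  "nonamenable_cosets G K \<longleftrightarrow> (\<exists>F \<epsilon>::real. finite F \<and> F \<subseteq> carrier G \<and> \<epsilon> > 0 \<and>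
     (\<forall>S. S \<subseteq> rcosets\<^bsub>G\<^esub> K \<longrightarrow> finite S \<longrightarrow>
       \<epsilon> * real (card S) \<le> (\<Sum>f\<in>F. real (card {x \<in> S. x #>\<^bsub>G\<^esub> f \<notin> S}))))"

context word_group
begin

text \<open>By the inequality of arithmetic and geometric means, 1 is at most half the sum of the
  ratio of the weights along an edge and its reciprocal. Reversing the edges inside
  \<open>S\<close>, from \<open>(x, f)\<close> to \<open>(x #> f, inv f)\<close>, shows that both
  halves have the same sum.\<close>

lemma schur_test:
  assumes K: "subgroup K G" and S: "S \<subseteq> rcosets K" "finite S"
    and F: "finite F" "F \<subseteq> carrier G" "\<And>f. f \<in> F \<Longrightarrow> inv f \<in> F"
    and u: "\<And>x. 0 < (u x :: real)" and l: "\<And>x. x \<in> S \<Longrightarrow> (\<Sum>f\<in>F. u (x #> f) / u x) \<le> l"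
  shows "(\<Sum>f\<in>F. real (card {x \<in> S. x #> f \<in> S})) \<le> l * real (card S)"
proof -
  define P where "P = {p \<in> S \<times> F. fst p #> snd p \<in> S}"
  have fP: "finite P" unfolding P_def using S F by simp
  have "(\<Sum>f\<in>F. real (card {x \<in> S. x #> f \<in> S})) = (\<Sum>f\<in>F. \<Sum>x\<in>S. if x #> f \<in> S then 1 else 0)"
    using S by (intro sum.cong refl) (simp add: sum.If_cases Int_def)
  also have "\<dots> = (\<Sum>p\<in>S \<times> F. if fst p #> snd p \<in> S then 1 else 0)"
    by (subst sum.swap) (simp add: sum.cartesian_product case_prod_unfold)
  also have "\<dots> = (\<Sum>p\<in>P. 1)"
    unfolding P_def using S F by (intro sum.mono_neutral_cong_right) auto
  also have "\<dots> \<le> (\<Sum>p\<in>P. (u (fst p #> snd p) / u (fst p) + u (fst p) / u (fst p #> snd p)) / 2)"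
  proof (rule sum_mono)
    fix p
    define a b where "a = u (fst p #> snd p)" and "b = u (fst p)"
    have "a > 0" "b > 0" using u by (auto simp: a_def b_def)
    moreover have "0 \<le> (a - b)\<^sup>2" by simp
    ultimately show "(1::real) \<le> (u (fst p #> snd p) / u (fst p) + u (fst p) / u (fst p #> snd p)) / 2"
      unfolding a_def[symmetric] b_def[symmetric] by (simp add: field_simps power2_eq_square)
  qed
  also have "\<dots> = ((\<Sum>p\<in>P. u (fst p #> snd p) / u (fst p)) + (\<Sum>p\<in>P. u (fst p) / u (fst p #> snd p))) / 2"
    by (simp add: sum_divide_distrib sum.distrib add_divide_distrib)
  also have "(\<Sum>p\<in>P. u (fst p) / u (fst p #> snd p)) = (\<Sum>p\<in>P. u (fst p #> snd p) / u (fst p))"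
  proof (rule sum.reindex_bij_witness[of _ "\<lambda>p. (fst p #> snd p, inv (snd p))" "\<lambda>p. (fst p #> snd p, inv (snd p))"])
    fix p assume "p \<in> P"
    then have p: "fst p \<in> rcosets K" "snd p \<in> F" "snd p \<in> carrier G" "fst p \<in> S" "fst p #> snd p \<in> S"
      using S F by (auto simp: P_def)
    have e: "(fst p #> snd p) #> inv (snd p) = fst p" by (rule rcosets_act_inv(1)[OF K p(1,3)])
    show "(fst (fst p #> snd p, inv (snd p)) #> snd (fst p #> snd p, inv (snd p)), inv (snd (fst p #> snd p, inv (snd p)))) = p"
      using e p by (simp add: prod_eq_iff)
    then show "(fst (fst p #> snd p, inv (snd p)) #> snd (fst p #> snd p, inv (snd p)), inv (snd (fst p #> snd p, inv (snd p)))) = p" .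
    show "(fst p #> snd p, inv (snd p)) \<in> P" using e p F by (auto simp: P_def)
    then show "(fst p #> snd p, inv (snd p)) \<in> P" .
    show "u (fst (fst p #> snd p, inv (snd p)) #> snd (fst p #> snd p, inv (snd p))) / u (fst (fst p #> snd p, inv (snd p))) = u (fst p) / u (fst p #> snd p)"
      using e by simp
  qed
  also have "((\<Sum>p\<in>P. u (fst p #> snd p) / u (fst p)) + (\<Sum>p\<in>P. u (fst p #> snd p) / u (fst p))) / 2 = (\<Sum>p\<in>P. u (fst p #> snd p) / u (fst p))"
    by simp
  also have "\<dots> \<le> (\<Sum>p\<in>S \<times> F. u (fst p #> snd p) / u (fst p))"
    using S F u by (intro sum_mono2) (auto simp: P_def less_imp_le)
  also have "\<dots> = (\<Sum>x\<in>S. \<Sum>f\<in>F. u (x #> f) / u x)"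
    by (simp add: sum.cartesian_product case_prod_unfold)
  also have "\<dots> \<le> (\<Sum>x\<in>S. l)" using l by (intro sum_mono) auto
  also have "\<dots> = l * real (card S)" by simp
  finally show ?thesis .
qed

end

text \<open>Its role is to give every nonempty finite set of cosets an outgoing edge when the index
  is infinite.\<close>

lemma (in word_metric) cosets_connected:
  assumes K: "subgroup K G" and S: "S \<subseteq> rcosets K" "S \<noteq> {}"
    and cl: "\<And>x a. x \<in> S \<Longrightarrow> a \<in> letters A \<Longrightarrow> x #> letter_val G \<pi> a \<in> S"
  shows "S = rcosets K"
proof -
  have step: "x #> val w \<in> S" if "x \<in> S" "w \<in> Words" for x w
    using that(2,1)
  proof (induction w arbitrary: x)
    case Nil
    then show ?case using S rcosets_act_one[OF K] by auto
  next
    case (Cons a w)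
    then have "(x #> letter_val G \<pi> a) #> val w \<in> S" using cl by auto
    then show ?case using rcosets_act_act[OF K, of x "letter_val G \<pi> a" "val w"] Cons S by auto
  qed
  obtain x where x: "x \<in> S" using S by blast
  then obtain g where g: "g \<in> carrier G" "x = K #> g" using S by (auto elim: rcosetsE)
  have "z \<in> S" if z: "z \<in> rcosets K" for z
  proof -
    obtain h where h: "h \<in> carrier G" "z = K #> h" using z by (rule rcosetsE)
    obtain w where w: "w \<in> Words" "val w = inv g \<otimes> h"
      using generating_word[OF generating, of "inv g \<otimes> h"] g h by auto
    have "x #> val w = z" using K g h w by simp
    then show ?thesis using step[OF x w(1)] by simp
  qed
  then show ?thesis using S by blast
qed

section \<open>The weight argument for subgroups of infinite index\<close>

context hyperbolic_word_metric
begin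

text \<open>If neither step moved away from \<open>K\<close> as claimed, then, seen from
  \<open>g\<close>, each would point towards a nearest point of \<open>K\<close>. Since all of
  \<open>K\<close> lies in one direction, the two steps would share more than
  \<open>c\<close>.\<close>

lemma diverging_step:
  assumes K: "subgroup K G" and one: "seen_in_one_direction K C" and c: "0 \<le> c"
    and g: "g \<in> carrier G" "c + 2 * \<delta> + C < real (cdist (K #> g))"
    and f: "f1 \<in> carrier G" "f2 \<in> carrier G" "gp \<one> f1 f2 \<le> c"
  shows "(\<exists>f\<in>{f1, f2}. real (cdist (K #> g)) + real (len f) - 2 * (c + 2 * \<delta>) \<le> real (cdist (K #> (g \<otimes> f))))"
proof (rule ccontr)
  assume neg: "\<not> ?thesis"
  have Kc: "k \<in> carrier G" if "k \<in> K" for k using that K subgroup.mem_carrier by metis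
  have bad: "\<exists>k\<in>K. c + 2 * \<delta> < gp g (g \<otimes> f) k" if f: "f \<in> {f1, f2}" for f
  proof -
    have fc: "f \<in> carrier G" using assms f by auto
    obtain k where k: "k \<in> K" "wdist k (g \<otimes> f) = cdist (K #> (g \<otimes> f))"
      using cdist_attained[OF K, of "g \<otimes> f"] g fc by auto
    have kc: "k \<in> carrier G" by (rule Kc[OF k(1)])
    have "real (wdist k (g \<otimes> f)) = real (wdist g k) + real (len f) - 2 * gp g (g \<otimes> f) k"
      using dist_gp[of "g \<otimes> f" k g] wdist_commute[OF kc, of "g \<otimes> f"] wdist_mult[OF g(1) fc] g fc by simp
    moreover have "cdist (K #> g) \<le> wdist g k" using cdist_le[OF K g(1) k(1)] wdist_commute[OF kc g(1)] by simp
    moreover have "real (wdist k (g \<otimes> f)) < real (cdist (K #> g)) + real (len f) - 2 * (c + 2 * \<delta>)"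
    proof -
      have "\<not> real (cdist (K #> g)) + real (len f) - 2 * (c + 2 * \<delta>) \<le> real (cdist (K #> (g \<otimes> f)))"
        using neg f by blast
      then show ?thesis using k by simp
    qed
    ultimately have "c + 2 * \<delta> < gp g (g \<otimes> f) k" by (simp add: algebra_simps)
    then show ?thesis using k by blast
  qed
  obtain k1 where k1: "k1 \<in> K" "c + 2 * \<delta> < gp g (g \<otimes> f1) k1" using bad[of f1] by blast
  obtain k2 where k2: "k2 \<in> K" "c + 2 * \<delta> < gp g (g \<otimes> f2) k2" using bad[of f2] by blast
  have k12: "c + 2 * \<delta> < gp g k1 k2"
    using one g k1(1) k2(1) unfolding seen_in_one_direction_def by force
  define m where "m = min (min (gp g (g \<otimes> f1) k1) (gp g (g \<otimes> f2) k2)) (gp g k1 k2)"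
  have "m - 2 * \<delta> \<le> gp g (g \<otimes> f1) (g \<otimes> f2)"
    using gp_sym[of g "g \<otimes> f2" k2] g f Kc k1 k2
    by (intro gp_minI3[of g _ _ k1 k2]) (auto simp: m_def)
  then show False using gp_left_one[OF g(1) f(1,2)] f(3) k12 k1 k2 by (simp add: m_def)
qed

text \<open>At most one of the four elements is not good; it contributes at most 2q and the others
  at most q/2 each, where q = 2^(1/10) absorbs the errors of size L/10. The total 3.5 q is at most
  3.85, and what matters is that this stays below 4.\<close>

lemma schur_weights:
  assumes K: "subgroup K G" and one: "seen_in_one_direction K C" and c: "0 \<le> c"
    and x: "x \<in> rcosets K" "c + 2 * \<delta> + C < real (cdist x)"
    and F: "finite F" "F \<subseteq> carrier G" "card F = 4"
      "\<And>f. f \<in> F \<Longrightarrow> L \<le> real (len f) \<and> real (len f) \<le> L + \<Delta>"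
      "\<And>f f'. f \<in> F \<Longrightarrow> f' \<in> F \<Longrightarrow> f \<noteq> f' \<Longrightarrow> gp \<one> f f' \<le> c"
    and L: "0 < L" "0 \<le> \<Delta>" "\<Delta> \<le> L / 10" "2 * (c + 2 * \<delta>) \<le> L / 10"
  shows "(\<Sum>f\<in>F. 2 powr (- (real (cdist (x #> f)) / L)) / 2 powr (- (real (cdist x) / L))) \<le> 39 / 10"
proof -
  obtain g where g: "g \<in> carrier G" "x = K #> g" using x(1) by (rule rcosetsE)
  define R where "R = real (cdist x)"
  define good where "good f \<longleftrightarrow> R + real (len f) - 2 * (c + 2 * \<delta>) \<le> real (cdist (x #> f))" for f
  have g2: "good f1 \<or> good f2" if "f1 \<in> F" "f2 \<in> F" "f1 \<noteq> f2" for f1 f2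
  proof -
    have fc: "f1 \<in> carrier G" "f2 \<in> carrier G" using that F(2) by auto
    show ?thesis
      using diverging_step[OF K one c g(1) _ fc F(5)[OF that]] x(2) coset_act[OF K g(1) fc(1)] coset_act[OF K g(1) fc(2)]
      unfolding good_def R_def g(2) by auto
  qed
  \<comment> \<open>When all elements are good, any of them can play the exceptional one.\<close>
  obtain f0 where f0: "f0 \<in> F" "\<And>f. f \<in> F - {f0} \<Longrightarrow> good f"
  proof (cases "\<exists>f\<in>F. \<not> good f")
    case True
    then obtain f where "f \<in> F" "\<not> good f" by blast
    then show ?thesis using g2 that by (metis DiffE insertCI)
  next
    case False
    then show ?thesis using F(1,3) that by (metis DiffD1 card.empty ex_in_conv zero_neq_numeral)
  qed
  define q where "q = (2::real) powr (1/10)"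
  have q: "q \<le> 11 / 10"
  proof (rule ccontr)
    assume "\<not> ?thesis"
    then have "(11/10) ^ 10 < q ^ 10" by (intro power_strict_mono) auto
    also have "q ^ 10 = 2" unfolding q_def by (simp add: powr_realpow[symmetric] powr_powr)
    finally show False by (simp add: power_divide)
  qed
  have ratio: "2 powr (- (real (cdist (x #> f)) / L)) / 2 powr (- (real (cdist x) / L)) = 2 powr ((R - real (cdist (x #> f))) / L)" for f
    unfolding R_def by (subst powr_diff[symmetric]) (simp add: diff_divide_distrib)
  have b1: "2 powr ((R - real (cdist (x #> f))) / L) \<le> 2 * q" if f: "f \<in> F" for f
  proof -
    have fc: "f \<in> carrier G" using f F by blast
    have "cdist x \<le> cdist (x #> f) + len f"
      using cdist_lipschitz[OF K g(1), of "g \<otimes> f"] wdist_commute[of g "g \<otimes> f"] wdist_mult[OF g(1) fc] g fc K by simp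
    then have "(R - real (cdist (x #> f))) / L \<le> 1 + 1/10"
      using F(4)[OF f] L unfolding R_def by (simp add: pos_divide_le_eq)
    then have "2 powr ((R - real (cdist (x #> f))) / L) \<le> 2 powr (1 + 1/10)" by (rule powr_mono) auto
    also have "\<dots> = 2 * q" unfolding q_def by (subst powr_add) simp
    finally show ?thesis .
  qed
  have b2: "2 powr ((R - real (cdist (x #> f))) / L) \<le> q / 2" if f: "f \<in> F - {f0}" for f
  proof -
    have "(R - real (cdist (x #> f))) / L \<le> 1/10 - 1"
      using f0(2)[OF f] F(4)[of f] f L unfolding good_def by (simp add: pos_divide_le_eq)
    then have "2 powr ((R - real (cdist (x #> f))) / L) \<le> 2 powr (1/10 - 1)" by (rule powr_mono) auto
    also have "\<dots> = q / 2" unfolding q_def by (subst powr_diff) simp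
    finally show ?thesis .
  qed
  have "(\<Sum>f\<in>F. 2 powr ((R - real (cdist (x #> f))) / L)) =
      2 powr ((R - real (cdist (x #> f0))) / L) + (\<Sum>f\<in>F - {f0}. 2 powr ((R - real (cdist (x #> f))) / L))"
    by (rule sum.remove[OF F(1) f0(1)])
  also have "\<dots> \<le> 2 * q + (\<Sum>f\<in>F - {f0}. q / 2)"
    using b1[OF f0(1)] b2 by (intro add_mono sum_mono) auto
  also have "(\<Sum>f\<in>F - {f0}. q / 2) = 3 * (q / 2)" using F f0 by simp
  finally show ?thesis unfolding ratio using q by simp
qed

text \<open>The weights work only outside a ball \<open>B\<close> of cosets. A set much larger than
  \<open>B\<close> loses little when \<open>B\<close> is removed. A small set has at least one
  outgoing edge, because the coset space is connected and infinite; for this the generators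
  \<open>U\<close> are added to \<open>F\<close>.\<close>

theorem infinite_index_nonamenable:
  assumes K: "subgroup K G" and one: "seen_in_one_direction K C" and inf: "infinite (rcosets K)"
    and nvc: "\<not> virtually_cyclic G"
  shows "nonamenable_cosets G K"
proof -
  have "infinite (carrier G)"
  proof
    assume "finite (carrier G)"
    then have "finite ((\<lambda>g. K #> g) ` carrier G)" by simp
    moreover have "rcosets K = (\<lambda>g. K #> g) ` carrier G" by (auto simp: RCOSETS_def)
    ultimately show False using inf by simp
  qed
  then obtain \<Delta> c where c: "0 \<le> c" and div: "\<And>L0. \<exists>F L. L0 \<le> L \<and> finite F \<and> F \<subseteq> carrier G \<and> card F = 4 \<and> (\<forall>f\<in>F. inv f \<in> F) \<and>
    (\<forall>f\<in>F. L \<le> real (len f) \<and> real (len f) \<le> L + \<Delta>) \<and> (\<forall>f\<in>F. \<forall>f'\<in>F. f \<noteq> f' \<longrightarrow> gp \<one> f f' \<le> c)"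
    using diverging_set[OF _ nvc] by blast
  obtain F L where L: "1 + 10 * \<bar>\<Delta>\<bar> + 20 * (c + 2 * \<delta>) \<le> L" and F: "finite F" "F \<subseteq> carrier G" "card F = 4" "\<And>f. f \<in> F \<Longrightarrow> inv f \<in> F"
    and F4: "\<And>f. f \<in> F \<Longrightarrow> L \<le> real (len f) \<and> real (len f) \<le> L + \<Delta>"
    and F5: "\<And>f f'. f \<in> F \<Longrightarrow> f' \<in> F \<Longrightarrow> f \<noteq> f' \<Longrightarrow> gp \<one> f f' \<le> c"
    using div[of "1 + 10 * \<bar>\<Delta>\<bar> + 20 * (c + 2 * \<delta>)"] by blast
  have L': "0 < L" "\<bar>\<Delta>\<bar> \<le> L / 10" "2 * (c + 2 * \<delta>) \<le> L / 10" using L c delta0 by auto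
  have F4': "\<And>f. f \<in> F \<Longrightarrow> L \<le> real (len f) \<and> real (len f) \<le> L + \<bar>\<Delta>\<bar>" using F4 by fastforce
  define B where "B = {x \<in> rcosets K. cdist x \<le> nat \<lfloor>c + 2 * \<delta> + C\<rfloor>}"
  have fB: "finite B" unfolding B_def by (rule finite_cdist_ball[OF K])
  define U where "U = letter_val G \<pi> ` letters A"
  have fU: "finite U" "U \<subseteq> carrier G" using finite_alphabet by (auto simp: U_def)
  define \<beta> where "\<beta> = real (card B)"
  \<comment> \<open>The first value serves large sets; the second makes the left side at most 1 for
    sets with fewer than 100(\<beta> + 1) elements.\<close>
  define \<epsilon> where "\<epsilon> = min (1 / 20) (1 / (100 * (\<beta> + 1)))"
  have \<beta>: "0 \<le> \<beta>" by (simp add: \<beta>_def)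
  have "\<epsilon> > 0" using \<beta> by (simp add: \<epsilon>_def)
  moreover have "\<epsilon> * real (card S) \<le> (\<Sum>f\<in>F \<union> U. real (card {x \<in> S. x #> f \<notin> S}))"
    if S: "S \<subseteq> rcosets K" "finite S" for S
  proof (cases "100 * (\<beta> + 1) \<le> real (card S)")
    case True
    define S' where "S' = S - B"
    have S': "S' \<subseteq> rcosets K" "finite S'" using S by (auto simp: S'_def)
    have "(\<Sum>f\<in>F. 2 powr (- (real (cdist (x #> f)) / L)) / 2 powr (- (real (cdist x) / L))) \<le> 39 / 10" if x: "x \<in> S'" for x
    proof (rule schur_weights[OF K one c _ _ F(1-3) F4' F5])
      show "x \<in> rcosets K" using x S' by blast
      show "c + 2 * \<delta> + C < real (cdist x)"
      proof -
        have "nat \<lfloor>c + 2 * \<delta> + C\<rfloor> < cdist x" using x S by (auto simp: S'_def B_def)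
        then show ?thesis by linarith
      qed
    qed (use L' in auto)
    then have sch: "(\<Sum>f\<in>F. real (card {x \<in> S'. x #> f \<in> S'})) \<le> 39 / 10 * real (card S')"
      by (intro schur_test[OF K S' F(1,2,4), of "\<lambda>x. 2 powr (- (real (cdist x) / L))"]) auto
    have "real (card S') \<le> real (card {x \<in> S'. x #> f \<in> S'}) + real (card {x \<in> S. x #> f \<notin> S}) + \<beta>" if f: "f \<in> F" for f
    proof -
      have fc: "f \<in> carrier G" using f F by blast
      have "S' \<subseteq> {x \<in> S'. x #> f \<in> S'} \<union> ({x \<in> S. x #> f \<notin> S} \<union> {x \<in> S. x #> f \<in> B})" by (auto simp: S'_def)
      then have "card S' \<le> card ({x \<in> S'. x #> f \<in> S'} \<union> ({x \<in> S. x #> f \<notin> S} \<union> {x \<in> S. x #> f \<in> B}))"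
        using S S' by (intro card_mono) auto
      also have "\<dots> \<le> card {x \<in> S'. x #> f \<in> S'} + (card {x \<in> S. x #> f \<notin> S} + card {x \<in> S. x #> f \<in> B})"
        by (meson add_left_mono card_Un_le order_trans)
      also have "card {x \<in> S. x #> f \<in> B} \<le> card B"
        using S fc fB by (intro card_inj_on_le[of "\<lambda>x. x #> f"]) (auto intro!: inj_onI dest: rcosets_act_inj[OF K])
      finally show ?thesis by (simp add: \<beta>_def)
    qed
    then have "(\<Sum>f\<in>F. real (card S')) \<le> (\<Sum>f\<in>F. real (card {x \<in> S'. x #> f \<in> S'}) + real (card {x \<in> S. x #> f \<notin> S}) + \<beta>)"
      by (rule sum_mono)
    \<comment> \<open>Four translations against the bound 3.9 of the Schur test leave a tenth of
      \<open>S'\<close> for the boundary, up to the contribution of \<open>B\<close>.\<close>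
    then have "4 * real (card S') \<le> 39 / 10 * real (card S') + (\<Sum>f\<in>F. real (card {x \<in> S. x #> f \<notin> S})) + 4 * \<beta>"
      using sch F(3) by (simp add: sum.distrib)
    moreover have "real (card S) \<le> real (card S') + \<beta>"
      using card_mono[of "S' \<union> B" S] card_Un_le[of S' B] S' fB by (auto simp: S'_def \<beta>_def)
    ultimately have "1 / 10 * real (card S) - 41 / 10 * \<beta> \<le> (\<Sum>f\<in>F. real (card {x \<in> S. x #> f \<notin> S}))" by simp
    moreover have "\<epsilon> * real (card S) \<le> 1 / 20 * real (card S)" by (intro mult_right_mono) (auto simp: \<epsilon>_def)
    moreover have "100 * \<beta> + 100 \<le> real (card S)" using True by simp
    ultimately have "\<epsilon> * real (card S) \<le> (\<Sum>f\<in>F. real (card {x \<in> S. x #> f \<notin> S}))" using \<beta> by linarith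
    also have "\<dots> \<le> (\<Sum>f\<in>F \<union> U. real (card {x \<in> S. x #> f \<notin> S}))"
      using F fU by (intro sum_mono2) auto
    finally show ?thesis .
  next
    case False
    show ?thesis
    proof (cases "S = {}")
      case True
      then show ?thesis by simp
    next
      case nonempty: False
      have "\<not> (\<forall>x\<in>S. \<forall>a\<in>letters A. x #> letter_val G \<pi> a \<in> S)"
        using cosets_connected[OF K S(1) nonempty] S(2) inf by blast
      then obtain x f where xf: "x \<in> S" "f \<in> U" "x #> f \<notin> S" by (auto simp: U_def)
      have "\<epsilon> * real (card S) \<le> 1 / (100 * (\<beta> + 1)) * (100 * (\<beta> + 1))"
        using False \<beta> by (intro mult_mono) (auto simp: \<epsilon>_def)
      also have "\<dots> = 1" using \<beta> by simp
      also have "1 \<le> real (card {x \<in> S. x #> f \<notin> S})"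
        using xf S(2) card_0_eq[of "{x \<in> S. x #> f \<notin> S}"] by (simp add: Suc_le_eq card_gt_0_iff) blast
      also have "\<dots> \<le> (\<Sum>f\<in>F \<union> U. real (card {x \<in> S. x #> f \<notin> S}))"
        using xf F fU by (intro member_le_sum[of f "F \<union> U" "\<lambda>f. real (card {x \<in> S. x #> f \<notin> S})"]) auto
      finally show ?thesis .
    qed
  qed
  ultimately show ?thesis unfolding nonamenable_cosets_def
    using F fU by (intro exI[of _ "F \<union> U"] exI[of _ \<epsilon>]) auto
qed

end

section \<open>Counting closed paths in non-amenable graphs\<close>

text \<open>A graph with edges labelled by \<open>X\<close>, the reversed edge of \<open>x\<close>
  being labelled \<open>iv x\<close>; parallel edges count separately. There may be infinitely many
  vertices, so functions are finitely supported and all sums are finite.\<close>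

locale symmetric_action =
  fixes V :: "'v set" and X :: "'x set" and iv :: "'x \<Rightarrow> 'x" and act :: "'v \<Rightarrow> 'x \<Rightarrow> 'v"
  assumes finite_X: "finite X"
    and iv_closed: "x \<in> X \<Longrightarrow> iv x \<in> X" and iv_iv: "x \<in> X \<Longrightarrow> iv (iv x) = x"
    and act_closed: "v \<in> V \<Longrightarrow> x \<in> X \<Longrightarrow> act v x \<in> V"
    and act_iv: "v \<in> V \<Longrightarrow> x \<in> X \<Longrightarrow> act (act v x) (iv x) = v"
begin

lemma act_iv': "v \<in> V \<Longrightarrow> x \<in> X \<Longrightarrow> act (act v (iv x)) x = v"
  using act_iv[of v "iv x"] iv_iv iv_closed by simp

definition adj :: "('v \<Rightarrow> real) \<Rightarrow> 'v \<Rightarrow> real" where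
  "adj f v = (if v \<in> V then \<Sum>x\<in>X. f (act v x) else 0)"

definition nb :: "'v set \<Rightarrow> 'v set" where
  "nb S = S \<union> (\<lambda>p. act (fst p) (snd p)) ` (S \<times> X)"

lemma finite_nb: "finite S \<Longrightarrow> finite (nb S)"
  using finite_X by (simp add: nb_def)

lemma nb_closed: "S \<subseteq> V \<Longrightarrow> nb S \<subseteq> V"
  by (auto simp: nb_def act_closed)

lemma subset_nb: "S \<subseteq> nb S"
  by (auto simp: nb_def)

lemma act_nb: "v \<in> S \<Longrightarrow> x \<in> X \<Longrightarrow> act v x \<in> nb S"
  by (force simp: nb_def)

lemma act_in_nb:
  assumes "S \<subseteq> V" "v \<in> V" "x \<in> X" "act v x \<in> S"
  shows "v \<in> nb S"
  using act_nb[OF assms(4) iv_closed[OF assms(3)]] act_iv[OF assms(2,3)] by simp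

lemma adj_supp:
  assumes "S \<subseteq> V" "\<And>v. v \<notin> S \<Longrightarrow> f v = 0" "v \<notin> nb S"
  shows "adj f v = 0"
  using assms act_in_nb[OF assms(1)] by (auto simp: adj_def intro!: sum.neutral)

text \<open>Acting by \<open>x\<close> is a bijection of \<open>V\<close>, and \<open>nb S\<close>
  contains the preimage of \<open>S\<close>, so no term of the support is lost.\<close>

lemma sum_shift:
  assumes S: "finite S" "S \<subseteq> V" and h: "\<And>v. v \<notin> S \<Longrightarrow> h v = (0::real)" and x: "x \<in> X"
  shows "(\<Sum>v\<in>nb S. h (act v x)) = (\<Sum>u\<in>S. h u)"
proof -
  have "(\<Sum>v\<in>nb S. h (act v x)) = (\<Sum>v\<in>{v \<in> nb S. act v x \<in> S}. h (act v x))"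
    using finite_nb[OF S(1)] h by (intro sum.mono_neutral_right) auto
  also have "\<dots> = (\<Sum>u\<in>S. h u)"
  proof (rule sum.reindex_bij_witness[of _ "\<lambda>u. act u (iv x)" "\<lambda>v. act v x"])
    fix v assume "v \<in> {v \<in> nb S. act v x \<in> S}"
    then have "v \<in> V" using nb_closed[OF S(2)] by blast
    then show "act (act v x) (iv x) = v" using act_iv x by blast
  next
    fix u assume u: "u \<in> S"
    then show "act (act u (iv x)) x = u" using act_iv'[of u x] x S by blast
    then show "act u (iv x) \<in> {v \<in> nb S. act v x \<in> S}" using u act_nb[OF u iv_closed[OF x]] by simp
  qed auto
  finally show ?thesis .
qed

lemma adj_ip:
  assumes "S \<subseteq> V"
  shows "(\<Sum>v\<in>S. f v * adj g v) = (\<Sum>x\<in>X. \<Sum>v\<in>S. f v * g (act v x))"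
proof -
  have "(\<Sum>v\<in>S. f v * adj g v) = (\<Sum>v\<in>S. \<Sum>x\<in>X. f v * g (act v x))"
    using assms by (intro sum.cong refl) (auto simp: adj_def sum_distrib_left)
  then show ?thesis by (subst sum.swap) simp
qed

text \<open>Moving \<open>x\<close> from one factor to the other replaces it by \<open>iv x\<close>,
  which only permutes \<open>X\<close>.\<close>

lemma adj_symmetric:
  assumes S: "finite S" "S \<subseteq> V" and f: "\<And>v. v \<notin> S \<Longrightarrow> f v = 0" and g: "\<And>v. v \<notin> S \<Longrightarrow> g v = 0"
  shows "(\<Sum>v\<in>S. f v * adj g v) = (\<Sum>v\<in>S. g v * adj f v)"
proof -
  have "(\<Sum>v\<in>S. f v * g (act v x)) = (\<Sum>v\<in>S. g v * f (act v (iv x)))" if x: "x \<in> X" for x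
  proof -
    have "(\<Sum>v\<in>S. f v * g (act v x)) = (\<Sum>v\<in>nb S. f v * g (act v x))"
      using finite_nb[OF S(1)] f subset_nb by (intro sum.mono_neutral_left) auto
    also have "\<dots> = (\<Sum>v\<in>nb S. g (act v x) * f (act (act v x) (iv x)))"
      using nb_closed[OF S(2)] act_iv x by (intro sum.cong) auto
    also have "\<dots> = (\<Sum>v\<in>S. g v * f (act v (iv x)))"
      using g x by (intro sum_shift[OF S, of "\<lambda>u. g u * f (act u (iv x))"]) auto
    finally show ?thesis .
  qed
  then have "(\<Sum>v\<in>S. f v * adj g v) = (\<Sum>x\<in>X. \<Sum>v\<in>S. g v * f (act v (iv x)))"
    by (simp add: adj_ip[OF S(2)])
  also have "\<dots> = (\<Sum>x\<in>X. \<Sum>v\<in>S. g v * f (act v x))"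
    by (rule sum.reindex_bij_witness[of _ iv iv]) (auto simp: iv_iv iv_closed)
  finally show ?thesis by (simp add: adj_ip[OF S(2)])
qed

end

section \<open>From the isoperimetric inequality to a spectral gap\<close>

locale nonamenable_action = symmetric_action +
  fixes \<epsilon> :: real
  assumes eps_pos: "0 < \<epsilon>"
    and isoperimetric: "finite S \<Longrightarrow> S \<subseteq> V \<Longrightarrow>
      \<epsilon> * real (card S) \<le> (\<Sum>x\<in>X. real (card {v \<in> S. act v x \<notin> S}))"
begin

text \<open>The layer cake decomposition, peeling off the smallest positive level.\<close>

lemma layer_cake:
  assumes S: "finite S" "S \<subseteq> V" and g: "\<And>v. v \<notin> S \<Longrightarrow> g v = 0" "\<And>v. 0 \<le> g v"
  shows "\<epsilon> * (\<Sum>v\<in>S. g v) \<le> (\<Sum>x\<in>X. \<Sum>v\<in>S. max 0 (g v - g (act v x)))"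
  using g
proof (induction "card {v \<in> S. g v \<noteq> 0}" arbitrary: g rule: less_induct)
  case less
  define T where "T = {v \<in> S. g v \<noteq> 0}"
  have T: "finite T" "T \<subseteq> V" "T \<subseteq> S" using S by (auto simp: T_def)
  have gT: "g v \<noteq> 0 \<longleftrightarrow> v \<in> T" for v using less.prems(1) by (auto simp: T_def)
  show ?case
  proof (cases "T = {}")
    case True
    then have "g v = 0" for v using gT by auto
    then show ?thesis by simp
  next
    case False
    define m where "m = Min (g ` T)"
    have "m \<in> g ` T" unfolding m_def using T False by (intro Min_in) auto
    then obtain t where t: "t \<in> T" "g t = m" by auto
    have mle: "m \<le> g v" if "v \<in> T" for v unfolding m_def using T that by (intro Min_le) auto
    have mpos: "0 < m" using t gT[of t] less.prems(2)[of t] by linarith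
    define g' where "g' v = (if v \<in> T then g v - m else 0)" for v
    have "{v \<in> S. g' v \<noteq> 0} \<subset> T" using t T by (auto simp: g'_def)
    then have lt: "card {v \<in> S. g' v \<noteq> 0} < card {v \<in> S. g v \<noteq> 0}"
      using T(1) psubset_card_mono unfolding T_def[symmetric] by blast
    have IH: "\<epsilon> * (\<Sum>v\<in>S. g' v) \<le> (\<Sum>x\<in>X. \<Sum>v\<in>S. max 0 (g' v - g' (act v x)))"
      using T mle by (intro less.hyps[OF lt]) (auto simp: g'_def)
    have gd: "g v = g' v + (if v \<in> T then m else 0)" for v using gT[of v] by (auto simp: g'_def)
    have s1: "(\<Sum>v\<in>S. g v) = (\<Sum>v\<in>S. g' v) + m * real (card T)"
    proof -
      have "(\<Sum>v\<in>S. if v \<in> T then m else 0) = (\<Sum>v\<in>T. m)"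
        using S T by (intro sum.mono_neutral_cong_right) auto
      then show ?thesis unfolding gd by (simp add: sum.distrib)
    qed
    have s2: "(\<Sum>v\<in>S. max 0 (g v - g (act v x))) =
        (\<Sum>v\<in>S. max 0 (g' v - g' (act v x))) + m * real (card {v \<in> T. act v x \<notin> T})" for x
    proof -
      have "max 0 (g v - g (act v x)) = max 0 (g' v - g' (act v x)) + (if v \<in> T \<and> act v x \<notin> T then m else 0)" for v
      proof -
        have nn: "0 \<le> g' u" and z: "u \<notin> T \<Longrightarrow> g' u = 0" for u using mle by (auto simp: g'_def)
        show ?thesis
          using gd[of v] gd[of "act v x"] nn[of v] nn[of "act v x"] z[of v] z[of "act v x"] mpos
          by (cases "v \<in> T"; cases "act v x \<in> T") (simp_all add: max_def)
      qed
      moreover have "(\<Sum>v\<in>S. if v \<in> T \<and> act v x \<notin> T then m else 0) = (\<Sum>v\<in>{v \<in> T. act v x \<notin> T}. m)"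
        using S T by (intro sum.mono_neutral_cong_right) auto
      ultimately show ?thesis by (simp add: sum.distrib)
    qed
    have "\<epsilon> * (\<Sum>v\<in>S. g v) = \<epsilon> * (\<Sum>v\<in>S. g' v) + m * (\<epsilon> * real (card T))"
      unfolding s1 by (simp add: algebra_simps)
    also have "\<dots> \<le> (\<Sum>x\<in>X. \<Sum>v\<in>S. max 0 (g' v - g' (act v x))) + m * (\<Sum>x\<in>X. real (card {v \<in> T. act v x \<notin> T}))"
      using IH isoperimetric[OF T(1,2)] mpos by (intro add_mono mult_left_mono) auto
    also have "\<dots> = (\<Sum>x\<in>X. \<Sum>v\<in>S. max 0 (g v - g (act v x)))"
      unfolding s2 by (simp add: sum.distrib sum_distrib_left)
    finally show ?thesis .
  qed
qed

text \<open>The layer cake inequality is applied to the square of \<open>f\<close>. Factoring the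
  differences of squares and using the Cauchy-Schwarz inequality leaves the product of the sums of
  the squared differences and of the squared sums along edges, which are 2dN - 2I and 2dN +
  2I.\<close>

lemma cheeger:
  assumes S: "finite S" "S \<subseteq> V" and f: "\<And>v. v \<notin> S \<Longrightarrow> f v = 0" "\<And>v. 0 \<le> f v"
  shows "(\<Sum>v\<in>S. f v * adj f v)\<^sup>2 \<le> ((real (card X))\<^sup>2 - \<epsilon>\<^sup>2) * (\<Sum>v\<in>S. (f v)\<^sup>2)\<^sup>2"
proof -
  define d where "d = real (card X)"
  define N where "N = (\<Sum>v\<in>S. (f v)\<^sup>2)"
  define I where "I = (\<Sum>v\<in>S. f v * adj f v)"
  define W where "W = nb S"
  have W: "finite W" "W \<subseteq> V" "S \<subseteq> W" using S by (auto simp: W_def finite_nb subset_nb dest: subsetD[OF nb_closed])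
  let ?P = "X \<times> W"
  have sumP: "(\<Sum>p\<in>?P. h (fst p) (snd p)) = (\<Sum>x\<in>X. \<Sum>v\<in>W. h x v)" for h :: "_ \<Rightarrow> _ \<Rightarrow> real"
    by (simp add: sum.cartesian_product case_prod_unfold)
  have n1: "(\<Sum>v\<in>W. (f v)\<^sup>2) = N"
    unfolding N_def using W f by (intro sum.mono_neutral_right) auto
  have n2: "(\<Sum>v\<in>W. (f (act v x))\<^sup>2) = N" if "x \<in> X" for x
    unfolding N_def W_def using f that by (intro sum_shift[OF S, of "\<lambda>u. (f u)\<^sup>2"]) auto
  have n3: "(\<Sum>x\<in>X. \<Sum>v\<in>W. f v * f (act v x)) = I"
  proof -
    have "(\<Sum>v\<in>W. f v * f (act v x)) = (\<Sum>v\<in>S. f v * f (act v x))" for x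
      using W f by (intro sum.mono_neutral_right) auto
    then show ?thesis by (simp add: I_def adj_ip[OF S(2)])
  qed
  define a where "a p = \<bar>f (snd p) - f (act (snd p) (fst p))\<bar>" for p
  define b where "b p = f (snd p) + f (act (snd p) (fst p))" for p
  have sa: "(\<Sum>p\<in>?P. (a p)\<^sup>2) = 2 * d * N - 2 * I"
  proof -
    have "(\<Sum>p\<in>?P. (a p)\<^sup>2) = (\<Sum>x\<in>X. \<Sum>v\<in>W. (f v)\<^sup>2 + (f (act v x))\<^sup>2 - 2 * (f v * f (act v x)))"
      unfolding a_def by (subst sumP[symmetric]) (simp add: power2_eq_square algebra_simps)
    also have "\<dots> = (\<Sum>x\<in>X. N + N) - 2 * I"
      unfolding n3[symmetric] by (simp add: sum.distrib sum_subtractf n1 n2 sum_distrib_left)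
    finally show ?thesis by (simp add: d_def)
  qed
  have sb: "(\<Sum>p\<in>?P. (b p)\<^sup>2) = 2 * d * N + 2 * I"
  proof -
    have "(\<Sum>p\<in>?P. (b p)\<^sup>2) = (\<Sum>x\<in>X. \<Sum>v\<in>W. (f v)\<^sup>2 + (f (act v x))\<^sup>2 + 2 * (f v * f (act v x)))"
      unfolding b_def by (subst sumP[symmetric]) (simp add: power2_eq_square algebra_simps)
    also have "\<dots> = (\<Sum>x\<in>X. N + N) + 2 * I"
      unfolding n3[symmetric] by (simp add: sum.distrib n1 n2 sum_distrib_left)
    finally show ?thesis by (simp add: d_def)
  qed
  have "\<epsilon> * N \<le> (\<Sum>x\<in>X. \<Sum>v\<in>S. max 0 ((f v)\<^sup>2 - (f (act v x))\<^sup>2))"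
    unfolding N_def using f by (intro layer_cake[OF S]) auto
  also have "\<dots> = (\<Sum>x\<in>X. \<Sum>v\<in>W. max 0 ((f v)\<^sup>2 - (f (act v x))\<^sup>2))"
    using W f by (intro sum.cong refl sum.mono_neutral_left) auto
  \<comment> \<open>Positive parts become absolute values because the signed differences sum to
    zero.\<close>
  finally have "2 * (\<epsilon> * N) \<le> 2 * (\<Sum>x\<in>X. \<Sum>v\<in>W. max 0 ((f v)\<^sup>2 - (f (act v x))\<^sup>2)) - (\<Sum>x\<in>X. \<Sum>v\<in>W. (f v)\<^sup>2 - (f (act v x))\<^sup>2)"
    by (simp add: sum_subtractf n1 n2)
  also have "\<dots> = (\<Sum>x\<in>X. \<Sum>v\<in>W. \<bar>(f v)\<^sup>2 - (f (act v x))\<^sup>2\<bar>)"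
    unfolding sum_distrib_left sum_subtractf[symmetric]
    by (intro sum.cong refl) (simp add: max_def abs_if)
  also have "\<dots> = (\<Sum>p\<in>?P. a p * b p)"
  proof -
    have "\<bar>(f v)\<^sup>2 - (f u)\<^sup>2\<bar> = \<bar>f v - f u\<bar> * (f v + f u)" for u v
    proof -
      have "(f v)\<^sup>2 - (f u)\<^sup>2 = (f v - f u) * (f v + f u)" by (simp add: power2_eq_square algebra_simps)
      then show ?thesis using f(2)[of u] f(2)[of v] by (simp add: abs_mult)
    qed
    then show ?thesis unfolding a_def b_def by (subst sumP[of "\<lambda>x v. \<bar>f v - f (act v x)\<bar> * (f v + f (act v x))"]) simp
  qed
  finally have le: "2 * (\<epsilon> * N) \<le> (\<Sum>p\<in>?P. a p * b p)" .
  have N0: "0 \<le> N" unfolding N_def by (intro sum_nonneg) auto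
  have "(2 * (\<epsilon> * N))\<^sup>2 \<le> (\<Sum>p\<in>?P. a p * b p)\<^sup>2"
    using le N0 eps_pos by (intro power_mono) auto
  also have "\<dots> \<le> (\<Sum>p\<in>?P. (a p)\<^sup>2) * (\<Sum>p\<in>?P. (b p)\<^sup>2)" by (rule Cauchy_Schwarz_ineq_sum)
  also have "\<dots> = (2 * d * N - 2 * I) * (2 * d * N + 2 * I)" by (simp add: sa sb)
  finally have "4 * I\<^sup>2 \<le> 4 * ((d\<^sup>2 - \<epsilon>\<^sup>2) * N\<^sup>2)" by (simp add: power2_eq_square algebra_simps)
  then show ?thesis unfolding I_def N_def d_def by simp
qed

text \<open>Polarization passes from the quadratic form to the bilinear form, and testing the latter
  against \<open>adj f\<close> divided by \<open>q\<close> bounds the norm of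
  \<open>adj f\<close>.\<close>

lemma spectral_gap:
  assumes "V \<noteq> {}"
  shows "\<exists>q. 0 < q \<and> q < real (card X) \<and> (\<forall>S f. finite S \<longrightarrow> S \<subseteq> V \<longrightarrow> (\<forall>v. v \<notin> S \<longrightarrow> f v = 0) \<longrightarrow>
    (\<Sum>v\<in>nb S. (adj f v)\<^sup>2) \<le> q\<^sup>2 * (\<Sum>v\<in>S. (f v)\<^sup>2))"
proof -
  define d where "d = real (card X)"
  obtain v0 where v0: "v0 \<in> V" using assms by blast
  have "\<epsilon> * real (card {v0}) \<le> (\<Sum>x\<in>X. real (card {v \<in> {v0}. act v x \<notin> {v0}}))"
    using v0 by (intro isoperimetric) auto
  also have "\<dots> \<le> (\<Sum>x\<in>X. 1)"
  proof (rule sum_mono)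
    fix x
    have "card {v \<in> {v0}. act v x \<notin> {v0}} \<le> card {v0}" by (rule card_mono) auto
    then show "real (card {v \<in> {v0}. act v x \<notin> {v0}}) \<le> 1" by simp
  qed
  finally have ed: "\<epsilon> \<le> d" by (simp add: d_def)
  have d0: "0 < d" using ed eps_pos by linarith
  define r where "r = sqrt (d\<^sup>2 - \<epsilon>\<^sup>2)"
  have e2: "\<epsilon>\<^sup>2 \<le> d\<^sup>2" using ed eps_pos by (intro power_mono) auto
  have r0: "0 \<le> r" unfolding r_def using e2 by simp
  have rd: "r < d" unfolding r_def by (rule real_less_lsqrt) (use d0 eps_pos in auto)
  \<comment> \<open>The midpoint rather than \<open>r\<close>, which may be 0, because
    \<open>q\<close> is used as a divisor.\<close>
  define q where "q = (r + d) / 2"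
  have q: "0 < q" "q < d" "r \<le> q" using r0 rd d0 by (auto simp: q_def)
  have I1: "\<bar>\<Sum>v\<in>S. h v * adj h v\<bar> \<le> q * (\<Sum>v\<in>S. (h v)\<^sup>2)"
    if S: "finite S" "S \<subseteq> V" and h: "\<And>v. v \<notin> S \<Longrightarrow> h v = 0" for S h
  proof -
    define k where "k v = \<bar>h v\<bar>" for v
    have "\<bar>\<Sum>v\<in>S. h v * adj h v\<bar> \<le> (\<Sum>v\<in>S. k v * adj k v)"
    proof (rule order_trans[OF sum_abs sum_mono])
      fix v
      have "\<bar>adj h v\<bar> \<le> adj k v" by (auto simp: adj_def k_def)
      then show "\<bar>h v * adj h v\<bar> \<le> k v * adj k v" by (simp add: abs_mult k_def mult_left_mono)
    qed
    also have "\<dots> \<le> r * (\<Sum>v\<in>S. (k v)\<^sup>2)"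
    proof (rule power2_le_imp_le)
      have "(\<Sum>v\<in>S. k v * adj k v)\<^sup>2 \<le> (d\<^sup>2 - \<epsilon>\<^sup>2) * (\<Sum>v\<in>S. (k v)\<^sup>2)\<^sup>2"
        unfolding d_def using h by (intro cheeger[OF S]) (auto simp: k_def)
      also have "d\<^sup>2 - \<epsilon>\<^sup>2 = r\<^sup>2" unfolding r_def using e2 by simp
      finally show "(\<Sum>v\<in>S. k v * adj k v)\<^sup>2 \<le> (r * (\<Sum>v\<in>S. (k v)\<^sup>2))\<^sup>2" by (simp add: power_mult_distrib)
      show "0 \<le> r * (\<Sum>v\<in>S. (k v)\<^sup>2)" using r0 by (simp add: sum_nonneg)
    qed
    also have "\<dots> \<le> q * (\<Sum>v\<in>S. (k v)\<^sup>2)" using q by (intro mult_right_mono sum_nonneg) auto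
    finally show ?thesis by (simp add: k_def)
  qed
  have I2: "2 * (\<Sum>v\<in>S. f v * adj g v) \<le> q * ((\<Sum>v\<in>S. (f v)\<^sup>2) + (\<Sum>v\<in>S. (g v)\<^sup>2))"
    if S: "finite S" "S \<subseteq> V" and f: "\<And>v. v \<notin> S \<Longrightarrow> f v = 0" and g: "\<And>v. v \<notin> S \<Longrightarrow> g v = 0" for S f g
  proof -
    have ap: "adj (\<lambda>v. f v + g v) v = adj f v + adj g v" for v by (simp add: adj_def sum.distrib)
    have am: "adj (\<lambda>v. f v - g v) v = adj f v - adj g v" for v by (simp add: adj_def sum_subtractf)
    have "(\<Sum>v\<in>S. (f v + g v) * adj (\<lambda>v. f v + g v) v) - (\<Sum>v\<in>S. (f v - g v) * adj (\<lambda>v. f v - g v) v)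
      = 2 * (\<Sum>v\<in>S. f v * adj g v) + 2 * (\<Sum>v\<in>S. g v * adj f v)"
      unfolding ap am by (simp add: sum_distrib_left sum.distrib[symmetric] sum_subtractf[symmetric] algebra_simps)
    also have "\<dots> = 4 * (\<Sum>v\<in>S. f v * adj g v)" using adj_symmetric[OF S f g] by simp
    finally have e4: "(\<Sum>v\<in>S. (f v + g v) * adj (\<lambda>v. f v + g v) v) - (\<Sum>v\<in>S. (f v - g v) * adj (\<lambda>v. f v - g v) v)
      = 4 * (\<Sum>v\<in>S. f v * adj g v)" .
    have "q * (\<Sum>v\<in>S. (f v + g v)\<^sup>2) + q * (\<Sum>v\<in>S. (f v - g v)\<^sup>2) = 2 * (q * ((\<Sum>v\<in>S. (f v)\<^sup>2) + (\<Sum>v\<in>S. (g v)\<^sup>2)))"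
      by (simp add: sum_distrib_left sum.distrib[symmetric] power2_eq_square algebra_simps)
    then show ?thesis
      using e4 I1[OF S, of "\<lambda>v. f v + g v"] I1[OF S, of "\<lambda>v. f v - g v"] f g by (simp add: abs_le_iff)
  qed
  have "(\<Sum>v\<in>nb S. (adj f v)\<^sup>2) \<le> q\<^sup>2 * (\<Sum>v\<in>S. (f v)\<^sup>2)"
    if S: "finite S" "S \<subseteq> V" and f: "\<forall>v. v \<notin> S \<longrightarrow> f v = 0" for S f
  proof -
    define N where "N = (\<Sum>v\<in>nb S. (adj f v)\<^sup>2)"
    define M where "M = (\<Sum>v\<in>S. (f v)\<^sup>2)"
    have "2 * (\<Sum>v\<in>nb S. (adj f v / q) * adj f v) \<le> q * ((\<Sum>v\<in>nb S. (adj f v / q)\<^sup>2) + (\<Sum>v\<in>nb S. (f v)\<^sup>2))"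
      using f subset_nb[of S] adj_supp[OF S(2), of f]
      by (intro I2[OF finite_nb[OF S(1)] nb_closed[OF S(2)]]) auto
    moreover have "(\<Sum>v\<in>nb S. (adj f v / q) * adj f v) = N / q"
      unfolding N_def by (simp add: sum_divide_distrib power2_eq_square)
    moreover have "(\<Sum>v\<in>nb S. (adj f v / q)\<^sup>2) = N / q\<^sup>2"
      unfolding N_def by (simp add: sum_divide_distrib power_divide)
    moreover have "(\<Sum>v\<in>nb S. (f v)\<^sup>2) = M"
      unfolding M_def using f subset_nb finite_nb[OF S(1)] by (intro sum.mono_neutral_right) auto
    ultimately have "2 * (N / q) \<le> q * (N / q\<^sup>2 + M)" by simp
    then have "N \<le> q\<^sup>2 * M" using q(1) by (simp add: field_simps power2_eq_square)
    then show ?thesis by (simp add: N_def M_def)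
  qed
  then show ?thesis using q unfolding d_def by blast
qed

text \<open>The numbers of paths of length \<open>n\<close> ending in \<open>v0\<close> arise by
  applying \<open>adj\<close> to the indicator of \<open>v0\<close> \<open>n\<close> times. Their
  norm is thus at most \<open>q ^ n\<close>, and a single value never exceeds the norm.\<close>

theorem few_closed_paths:
  assumes v0: "v0 \<in> V"
  shows "\<exists>q. 0 < q \<and> q < real (card X) \<and>
    (\<forall>n. real (card {w \<in> lists X. length w = n \<and> foldl act v0 w = v0}) \<le> q ^ n)"
proof -
  obtain q where q: "0 < q" "q < real (card X)" and gap: "\<And>S f. finite S \<Longrightarrow> S \<subseteq> V \<Longrightarrow> (\<And>v. v \<notin> S \<Longrightarrow> f v = 0) \<Longrightarrow>
    (\<Sum>v\<in>nb S. (adj f v)\<^sup>2) \<le> q\<^sup>2 * (\<Sum>v\<in>S. (f v)\<^sup>2)"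
    using spectral_gap v0 by blast
  define p where "p n v = (if v \<in> V then real (card {w \<in> lists X. length w = n \<and> foldl act v w = v0}) else 0)" for n v
  have fin: "finite {w \<in> lists X. length w = n \<and> Q w}" for n Q
    by (rule finite_subset[OF _ finite_lists_length_eq[OF finite_X, of n]]) auto
  have p_Suc: "p (Suc n) = adj (p n)" for n
  proof
    fix v
    show "p (Suc n) v = adj (p n) v"
    proof (cases "v \<in> V")
      case True
      have "{w \<in> lists X. length w = Suc n \<and> foldl act v w = v0} =
        (\<Union>x\<in>X. (\<lambda>w. x # w) ` {w \<in> lists X. length w = n \<and> foldl act (act v x) w = v0})"
        by (auto simp: length_Suc_conv image_iff)
      moreover have "card (\<Union>x\<in>X. (\<lambda>w. x # w) ` {w \<in> lists X. length w = n \<and> foldl act (act v x) w = v0}) =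
        (\<Sum>x\<in>X. card ((\<lambda>w. x # w) ` {w \<in> lists X. length w = n \<and> foldl act (act v x) w = v0}))"
        using finite_X fin by (intro card_UN_disjoint) auto
      ultimately show ?thesis using True by (simp add: p_def adj_def act_closed card_image)
    qed (simp_all add: p_def adj_def)
  qed
  define S where "S n = (nb ^^ n) {v0}" for n
  have S: "finite (S n) \<and> S n \<subseteq> V \<and> (\<forall>v. v \<notin> S n \<longrightarrow> p n v = 0) \<and> (\<Sum>v\<in>S n. (p n v)\<^sup>2) \<le> (q\<^sup>2) ^ n" for n
  proof (induction n)
    case 0
    have "{w \<in> lists X. length w = 0 \<and> foldl act v w = v0} = (if v = v0 then {[]} else {})" for v by auto
    then have "p 0 v = (if v = v0 then 1 else 0)" for v using v0 by (simp add: p_def)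
    then show ?case using v0 by (simp add: S_def)
  next
    case (Suc n)
    have "S (Suc n) = nb (S n)" by (simp add: S_def)
    moreover have "finite (nb (S n))" "nb (S n) \<subseteq> V" using Suc finite_nb nb_closed by auto
    moreover have "adj (p n) v = 0" if "v \<notin> nb (S n)" for v using Suc that by (intro adj_supp[of "S n"]) auto
    moreover have "(\<Sum>v\<in>nb (S n). (adj (p n) v)\<^sup>2) \<le> (q\<^sup>2) ^ Suc n"
    proof -
      have "(\<Sum>v\<in>nb (S n). (adj (p n) v)\<^sup>2) \<le> q\<^sup>2 * (\<Sum>v\<in>S n. (p n v)\<^sup>2)" using Suc by (intro gap) auto
      also have "\<dots> \<le> q\<^sup>2 * (q\<^sup>2) ^ n" using Suc by (intro mult_left_mono) auto
      finally show ?thesis by simp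
    qed
    ultimately show ?case unfolding p_Suc by auto
  qed
  have "p n v0 \<le> q ^ n" for n
  proof (cases "v0 \<in> S n")
    case True
    then have "(p n v0)\<^sup>2 \<le> (\<Sum>v\<in>S n. (p n v)\<^sup>2)"
      using S[of n] by (intro member_le_sum) auto
    also have "\<dots> \<le> (q\<^sup>2) ^ n" using S by blast
    also have "\<dots> = (q ^ n)\<^sup>2" unfolding power_mult[symmetric] by (simp only: mult.commute)
    finally have "(p n v0)\<^sup>2 \<le> (q ^ n)\<^sup>2" .
    then show ?thesis by (rule power2_le_imp_le) (use q in simp)
  next
    case False
    then have "p n v0 = 0" using S[of n] by blast
    then show ?thesis using q by simp
  qed
  moreover have "p n v0 = real (card {w \<in> lists X. length w = n \<and> foldl act v0 w = v0})" for n
    unfolding p_def using v0 by (rule if_P)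
  ultimately have "\<forall>n. real (card {w \<in> lists X. length w = n \<and> foldl act v0 w = v0}) \<le> q ^ n" by simp
  with q show ?thesis by blast
qed

end

section \<open>Turing machines with structured states\<close>

instance letter :: (countable) countable
  by countable_datatype

instance tape_symbol :: (countable) countable
  by countable_datatype

type_synonym 'x tape = "(int \<Rightarrow> 'x tape_symbol) \<times> int"

text \<open>States of a \<open>tm\<close> are natural numbers. The machines below are programmed
  with datatypes as states, which \<open>to_nat\<close> embeds.\<close>

definition compile ::
    "nat \<Rightarrow> 's::countable set \<Rightarrow> 'x tape_symbol set \<Rightarrow> 's \<Rightarrow> 's \<Rightarrow> 's \<Rightarrow>
     ('s \<Rightarrow> 'x tape_symbol list \<Rightarrow> 's \<times> ('x tape_symbol \<times> head_move) list) \<Rightarrow> 'x tm" where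
  "compile k Q \<Gamma> s0 sa sr \<delta> =
     \<lparr>num_tapes = k, tm_states = to_nat ` Q, tape_alphabet = \<Gamma>, start_state = to_nat s0,
      accept_state = to_nat sa, reject_state = to_nat sr,
      transition = (\<lambda>q ss. (to_nat (fst (\<delta> (from_nat q) ss)), snd (\<delta> (from_nat q) ss)))\<rparr>"

lemma wf_compile:
  assumes "1 \<le> k" "finite Q" "finite \<Gamma>" "{s0, sa, sr} \<subseteq> Q" "sa \<noteq> sr" "insert Blank (Input ` X) \<subseteq> \<Gamma>"
    and "\<And>s ss. s \<in> Q \<Longrightarrow> ss \<in> lists \<Gamma> \<Longrightarrow> length ss = k \<Longrightarrow>
      fst (\<delta> s ss) \<in> Q \<and> length (snd (\<delta> s ss)) = k \<and> fst ` set (snd (\<delta> s ss)) \<subseteq> \<Gamma>"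
  shows "wf_tm X (compile k Q \<Gamma> s0 sa sr \<delta>)"
  using assms unfolding wf_tm_def compile_def by simp

text \<open>Started from an arbitrary configuration, so that a run can be assembled backwards: each
  phase is shown to halt from the assumption that the phase after it does.\<close>

definition halts_within :: "'x tm \<Rightarrow> 'x config \<Rightarrow> nat \<Rightarrow> bool \<Rightarrow> bool" where
  "halts_within M c N b \<longleftrightarrow> (\<exists>n\<le>N. halted M ((tm_step M ^^ n) c) \<and>
     (fst ((tm_step M ^^ n) c) = accept_state M \<longleftrightarrow> b))"

lemma halts_within_halted:
  "halted M c \<Longrightarrow> (fst c = accept_state M \<longleftrightarrow> b) \<Longrightarrow> halts_within M c N b"
  unfolding halts_within_def by (intro exI[of _ 0]) simp

lemma halts_within_step:
  assumes "halts_within M (tm_step M c) N b" "Suc N \<le> N'"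
  shows "halts_within M c N' b"
proof -
  obtain n where "n \<le> N" "halted M ((tm_step M ^^ n) (tm_step M c))"
    "fst ((tm_step M ^^ n) (tm_step M c)) = accept_state M \<longleftrightarrow> b"
    using assms(1) unfolding halts_within_def by blast
  then show ?thesis using assms(2) unfolding halts_within_def
    by (intro exI[of _ "Suc n"]) (simp del: funpow.simps add: funpow_Suc_right)
qed

lemma halts_within_mono: "halts_within M c N b \<Longrightarrow> N \<le> N' \<Longrightarrow> halts_within M c N' b"
  unfolding halts_within_def by (meson order_trans)

lemma halted_funpow: "halted M c \<Longrightarrow> (tm_step M ^^ n) c = c"
  by (induction n) (simp_all add: tm_step_def)

lemma halts_within_run_time:
  assumes "halts_within M (initial_config M w) N b"
  shows "(\<exists>n. halted M (tm_run M w n)) \<and> run_time M w \<le> N \<and>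
    (fst (tm_run M w (run_time M w)) = accept_state M \<longleftrightarrow> b)"
proof -
  obtain n where n: "n \<le> N" "halted M (tm_run M w n)" "fst (tm_run M w n) = accept_state M \<longleftrightarrow> b"
    using assms unfolding halts_within_def tm_run_def by blast
  have h: "halted M (tm_run M w (run_time M w))" unfolding run_time_def using n(2) by (rule LeastI)
  have le: "run_time M w \<le> n" unfolding run_time_def using n(2) by (rule Least_le)
  have "tm_run M w n = (tm_step M ^^ (n - run_time M w)) (tm_run M w (run_time M w))"
    unfolding tm_run_def using le by (simp add: funpow_add[symmetric, THEN fun_cong, unfolded o_def])
  then have "tm_run M w n = tm_run M w (run_time M w)" using halted_funpow[OF h] by simp
  then show ?thesis using n le by auto
qed

lemma decidesI:
  assumes "wf_tm X M" "D \<subseteq> lists X"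
    and "\<And>w. w \<in> lists X \<Longrightarrow> halts_within M (initial_config M w) (T w) (w \<in> D)"
  shows "decides M X D \<and> (\<forall>w\<in>lists X. run_time M w \<le> T w)"
  using assms halts_within_run_time unfolding decides_def by metis

lemma accept_compile [simp]: "accept_state (compile k Q \<Gamma> s0 sa sr \<delta>) = to_nat sa"
  by (simp add: compile_def)

lemma halted_compile:
  "halted (compile k Q \<Gamma> s0 sa sr \<delta>) (to_nat s, ts) \<longleftrightarrow> s = sa \<or> s = sr"
  by (auto simp: halted_def compile_def)

lemma compile_step2:
  assumes "s \<noteq> sa" "s \<noteq> sr" "\<delta> s [t0 i0, t1 i1] = (s', [(a0, m0), (a1, m1)])"
    and "halts_within (compile 2 Q \<Gamma> st sa sr \<delta>) (to_nat s', [(t0(i0 := a0), i0 + shift m0), (t1(i1 := a1), i1 + shift m1)]) N b"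
    and "Suc N \<le> N'"
  shows "halts_within (compile 2 Q \<Gamma> st sa sr \<delta>) (to_nat s, [(t0, i0), (t1, i1)]) N' b"
proof (rule halts_within_step[OF _ assms(5)])
  have "tm_step (compile 2 Q \<Gamma> st sa sr \<delta>) (to_nat s, [(t0, i0), (t1, i1)]) =
      (to_nat s', [(t0(i0 := a0), i0 + shift m0), (t1(i1 := a1), i1 + shift m1)])"
    using assms(1-3) halted_compile[of 2 Q \<Gamma> st sa sr \<delta> s "[(t0, i0), (t1, i1)]"]
    by (simp add: tm_step_def) (simp add: compile_def)
  then show "halts_within (compile 2 Q \<Gamma> st sa sr \<delta>) (tm_step (compile 2 Q \<Gamma> st sa sr \<delta>) (to_nat s, [(t0, i0), (t1, i1)])) N b"
    using assms(4) by simp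
qed

text \<open>Describes a whole half tape from the head on, trailing blanks included. Its mirror image
  \<open>leftof\<close> lists cells from the head outwards, like a stack with its top in
  front.\<close>

definition rightof :: "(int \<Rightarrow> 'x tape_symbol) \<Rightarrow> int \<Rightarrow> 'x tape_symbol list \<Rightarrow> bool" where
  "rightof t i ss \<longleftrightarrow> (\<forall>m::nat. t (i + int m) = (if m < length ss then ss ! m else Blank))"

definition leftof :: "(int \<Rightarrow> 'x tape_symbol) \<Rightarrow> int \<Rightarrow> 'x tape_symbol list \<Rightarrow> bool" where
  "leftof t i ss \<longleftrightarrow> (\<forall>m::nat. t (i - int m) = (if m < length ss then ss ! m else Blank))"

lemma rightof_Cons: "rightof t i (s # ss) \<longleftrightarrow> t i = s \<and> rightof t (i + 1) ss"
proof
  assume r: "rightof t i (s # ss)"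
  have "t (i + 1 + int m) = (if m < length ss then ss ! m else Blank)" for m
    using r[unfolded rightof_def, rule_format, of "Suc m"] by (simp add: algebra_simps)
  moreover have "t i = s" using r[unfolded rightof_def, rule_format, of 0] by simp
  ultimately show "t i = s \<and> rightof t (i + 1) ss" by (simp add: rightof_def)
next
  assume r: "t i = s \<and> rightof t (i + 1) ss"
  show "rightof t i (s # ss)" unfolding rightof_def
  proof
    fix m :: nat
    show "t (i + int m) = (if m < length (s # ss) then (s # ss) ! m else Blank)"
      using r by (cases m) (auto simp: rightof_def algebra_simps)
  qed
qed

lemma leftof_Cons: "leftof t i (s # ss) \<longleftrightarrow> t i = s \<and> leftof t (i - 1) ss"
proof
  assume r: "leftof t i (s # ss)"
  have "t (i - 1 - int m) = (if m < length ss then ss ! m else Blank)" for m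
    using r[unfolded leftof_def, rule_format, of "Suc m"] by (simp add: algebra_simps)
  moreover have "t i = s" using r[unfolded leftof_def, rule_format, of 0] by simp
  ultimately show "t i = s \<and> leftof t (i - 1) ss" by (simp add: leftof_def)
next
  assume r: "t i = s \<and> leftof t (i - 1) ss"
  show "leftof t i (s # ss)" unfolding leftof_def
  proof
    fix m :: nat
    show "t (i - int m) = (if m < length (s # ss) then (s # ss) ! m else Blank)"
      using r by (cases m) (auto simp: leftof_def algebra_simps)
  qed
qed

lemma rightof_Nil: "rightof t i [] \<Longrightarrow> t i = Blank"
  unfolding rightof_def by (drule spec[of _ 0]) simp

lemma leftof_Nil: "leftof t i [] \<Longrightarrow> t i = Blank"
  unfolding leftof_def by (drule spec[of _ 0]) simp

lemma rightof_upd [simp]: "j < i \<Longrightarrow> rightof (t(j := s)) i ss = rightof t i ss"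
  unfolding rightof_def by auto

lemma leftof_upd [simp]: "i < j \<Longrightarrow> leftof (t(j := s)) i ss = leftof t i ss"
  unfolding leftof_def by auto

lemma rightof_write: "rightof t (i + 1) ss \<Longrightarrow> rightof (t(i := s)) i (s # ss)"
  unfolding rightof_Cons by (auto simp: rightof_def)

lemma leftof_write: "leftof t (i - 1) ss \<Longrightarrow> leftof (t(i := s)) i (s # ss)"
  unfolding leftof_Cons by (auto simp: leftof_def)

lemma initial_rightof:
  "rightof (\<lambda>i. if 0 \<le> i \<and> i < int (length w) then Input (w ! nat i) else Blank) 0 (map Input w)"
  by (auto simp: rightof_def)

lemma finite_bounded_lists: "finite Y \<Longrightarrow> finite {w \<in> lists Y. length w \<le> n}"
  by (rule finite_subset[OF _ finite_lists_length_le[of Y n]]) auto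

section \<open>A stack machine for Dehn's algorithm\<close>

text \<open>The first tape holds the unread part of the word, the second tape the already reduced part
  except for its last letters, which are kept in the state (topmost first). A subword which is not
  geodesic is replaced by a shorter word, written back in front of the unread part.\<close>

datatype 'x dehn_state =
  Read "'x list" | Push 'x "'x list" | Back "'x list" | Check nat "'x list" | Yes | No

instance dehn_state :: (countable) countable
  by countable_datatype

text \<open>The machine only handles words: \<open>gd\<close> stands for being geodesic,
  \<open>sh\<close> for a shorter equivalent word and \<open>ev\<close> for the value in the group.
  The automaton reads the reversed word because the stack is emptied from its top. All group theory
  of the final test is contained in \<open>local_geodesic_iff\<close>.\<close>

locale dehn_machine =
  fixes Y :: "'x::countable set" and k :: nat and gd :: "'x list \<Rightarrow> bool" and sh :: "'x list \<Rightarrow> 'x list"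
    and q0 n :: nat and next_state :: "nat \<Rightarrow> 'x \<Rightarrow> nat" and F :: "nat set"
    and ev :: "'x list \<Rightarrow> 'v" and D :: "'v set"
  assumes finite_Y: "finite Y" and k2: "2 \<le> k"
    and gd_sub: "gd (a @ b @ c) \<Longrightarrow> gd b" and gd_Nil: "gd []"
    and sh: "w \<in> lists Y \<Longrightarrow> \<not> gd w \<Longrightarrow> sh w \<in> lists Y \<and> length (sh w) < length w"
    and sh_ev: "w \<in> lists Y \<Longrightarrow> \<not> gd w \<Longrightarrow> a \<in> lists Y \<Longrightarrow> c \<in> lists Y \<Longrightarrow> ev (a @ sh w @ c) = ev (a @ w @ c)"
    and q0: "q0 < n" and next_state: "q < n \<Longrightarrow> y \<in> Y \<Longrightarrow> next_state q y < n"
    and local_geodesic_iff: "u \<in> lists Y \<Longrightarrow> (\<And>a b c. u = a @ b @ c \<Longrightarrow> length b \<le> k \<Longrightarrow> gd b) \<Longrightarrow>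
      foldl next_state q0 (rev u) \<in> F \<longleftrightarrow> ev u \<in> D"
begin

text \<open>Before an input letter is read, the state is refilled from the stack to
  \<open>k - 1\<close> letters if possible, so that the tested window has length \<open>k\<close>. A
  replacement is written from right to left, beginning in the cell of the current letter, which puts
  it in front of the unread part.\<close>

fun trans :: "'x dehn_state \<Rightarrow> 'x tape_symbol \<Rightarrow> 'x tape_symbol \<Rightarrow>
    'x dehn_state \<times> ('x tape_symbol \<times> head_move) list" where
  "trans (Read t) a b =
    (if length t < k - 1 \<and> b \<in> range Input then
       (Read (t @ [case b of Input y \<Rightarrow> y]), [(a, Stay), (Blank, Move_Left)])
     else case a of Input x \<Rightarrow>
        let w = rev t @ [x] in
        if gd w then
          if length t < k - 1 then (Read (x # t), [(a, Move_Right), (b, Stay)])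
          else (Push (last t) (x # butlast t), [(a, Move_Right), (b, Move_Right)])
        else if sh w = [] then (Read [], [(a, Move_Right), (b, Stay)])
        else (Back (rev (sh w)), [(a, Stay), (b, Stay)])
      | _ \<Rightarrow> (Check q0 t, [(a, Stay), (b, Stay)]))"
| "trans (Push y t) a b = (Read t, [(a, Stay), (Input y, Stay)])"
| "trans (Back []) a b = (No, [(a, Stay), (b, Stay)])"
| "trans (Back [y]) a b = (Read [], [(Input y, Stay), (b, Stay)])"
| "trans (Back (y # z # l)) a b = (Back (z # l), [(Input y, Move_Left), (b, Stay)])"
| "trans (Check q (y # t)) a b = (Check (next_state q y) t, [(a, Stay), (b, Stay)])"
| "trans (Check q []) a b = (case b of Input y \<Rightarrow> (Check (next_state q y) [], [(a, Stay), (b, Move_Left)])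
      | _ \<Rightarrow> (if q \<in> F then Yes else No, [(a, Stay), (b, Stay)]))"
| "trans Yes a b = (No, [(a, Stay), (b, Stay)])"
| "trans No a b = (No, [(a, Stay), (b, Stay)])"

definition T :: "'x list set" where "T = {t \<in> lists Y. length t \<le> k}"

definition Q :: "'x dehn_state set" where
  "Q = Read ` {t \<in> T. length t \<le> k - 1} \<union> (\<lambda>(y, t). Push y t) ` (Y \<times> {t \<in> T. length t \<le> k - 1}) \<union> Back ` T \<union>
     (\<lambda>(q, t). Check q t) ` ({..<n} \<times> T) \<union> {Yes, No}"

lemma mem_Q [simp]:
  "Read t \<in> Q \<longleftrightarrow> t \<in> lists Y \<and> length t \<le> k - 1"
  "Push y t \<in> Q \<longleftrightarrow> y \<in> Y \<and> t \<in> lists Y \<and> length t \<le> k - 1"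
  "Back t \<in> Q \<longleftrightarrow> t \<in> lists Y \<and> length t \<le> k"
  "Check q t \<in> Q \<longleftrightarrow> q < n \<and> t \<in> lists Y \<and> length t \<le> k"
  "Yes \<in> Q" "No \<in> Q"
  by (auto simp: Q_def T_def)

definition \<Gamma> :: "'x tape_symbol set" where "\<Gamma> = insert Blank (Input ` Y)"

definition M :: "'x tm" where
  "M = compile 2 Q \<Gamma> (Read []) Yes No (\<lambda>s ss. trans s (ss ! 0) (ss ! 1))"

lemma trans_closed:
  assumes "s \<in> Q" "a \<in> \<Gamma>" "b \<in> \<Gamma>"
  shows "fst (trans s a b) \<in> Q \<and> length (snd (trans s a b)) = 2 \<and> fst ` set (snd (trans s a b)) \<subseteq> \<Gamma>"
proof (cases s)
  case (Read t)
  then have t: "t \<in> lists Y" "length t \<le> k - 1" using assms by auto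
  have TT: "length t \<le> k" using t by simp
  show ?thesis
  proof (cases "length t < k - 1 \<and> b \<in> range Input")
    case True
    then obtain y where y: "b = Input y" "y \<in> Y" using assms(3) by (auto simp: \<Gamma>_def)
    then have "t @ [y] \<in> lists Y" "length (t @ [y]) \<le> k - 1" using t True by auto
    then show ?thesis using True Read y assms by (auto simp: \<Gamma>_def)
  next
    case False
    show ?thesis
    proof (cases a)
      case (Input x)
      then have x: "x \<in> Y" using assms(2) by (auto simp: \<Gamma>_def)
      let ?w = "rev t @ [x]"
      have w: "?w \<in> lists Y" using t x by auto
      have e: "trans s a b = (if gd ?w then
          if length t < k - 1 then (Read (x # t), [(a, Move_Right), (b, Stay)])
          else (Push (last t) (x # butlast t), [(a, Move_Right), (b, Move_Right)])
        else if sh ?w = [] then (Read [], [(a, Move_Right), (b, Stay)])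
        else (Back (rev (sh ?w)), [(a, Stay), (b, Stay)]))"
        using Read False Input by (simp add: Let_def)
      have "Read (x # t) \<in> Q" if "length t < k - 1" using that x t by auto
      moreover have "Push (last t) (x # butlast t) \<in> Q" if l: "\<not> length t < k - 1"
      proof -
        have ne: "t \<noteq> []" using l k2 by auto
        then have "last t \<in> Y" using t last_in_set[OF ne] by auto
        moreover have "x # butlast t \<in> lists Y" "length (x # butlast t) \<le> k - 1"
          using t x ne k2 by (auto dest: in_set_butlastD)
        ultimately show ?thesis by auto
      qed
      moreover have "Back (rev (sh ?w)) \<in> Q" if "\<not> gd ?w"
        using sh[OF w that] t by auto
      moreover have "Read [] \<in> Q" by auto
      ultimately show ?thesis unfolding e using assms(2,3) by auto
    next
      case Blank
      then show ?thesis using Read False assms TT q0 by auto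
    next
      case (Aux m)
      then show ?thesis using assms(2) by (auto simp: \<Gamma>_def)
    qed
  qed
next
  case (Push y t)
  then show ?thesis using assms by (auto simp: \<Gamma>_def)
next
  case (Back l)
  consider "l = []" | y where "l = [y]" | y z l' where "l = y # z # l'" by (metis neq_Nil_conv)
  then show ?thesis using Back assms by cases (auto simp: \<Gamma>_def)
next
  case (Check q t)
  show ?thesis
  proof (cases t)
    case Nil
    then show ?thesis using Check assms by (cases b) (auto simp: \<Gamma>_def next_state)
  next
    case (Cons y t')
    then show ?thesis using Check assms by (auto simp: \<Gamma>_def next_state)
  qed
qed (use assms in \<open>auto\<close>)

lemma wf_M: "wf_tm Y M"
  unfolding M_def
proof (rule wf_compile)
  have "finite T" unfolding T_def using finite_Y by (rule finite_bounded_lists)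
  then show "finite Q" unfolding Q_def using finite_Y by simp
  show "{Read [], Yes, No} \<subseteq> Q" by (auto simp: Q_def T_def)
  fix s ss assume "s \<in> Q" "ss \<in> lists \<Gamma>" "length ss = 2"
  moreover from this obtain a b where "ss = [a, b]" by (auto simp: length_Suc_conv numeral_2_eq_2)
  ultimately show "fst (trans s (ss ! 0) (ss ! 1)) \<in> Q \<and> length (snd (trans s (ss ! 0) (ss ! 1))) = 2 \<and>
      fst ` set (snd (trans s (ss ! 0) (ss ! 1))) \<subseteq> \<Gamma>"
    using trans_closed by simp
qed (use finite_Y in \<open>auto simp: \<Gamma>_def\<close>)

lemma M_step:
  assumes "trans s (t0 i0) (t1 i1) = (s', [(a0, m0), (a1, m1)])" "s \<noteq> Yes" "s \<noteq> No"
    and "halts_within M (to_nat s', [(t0(i0 := a0), i0 + shift m0), (t1(i1 := a1), i1 + shift m1)]) N b"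
    and "Suc N \<le> N'"
  shows "halts_within M (to_nat s, [(t0, i0), (t1, i1)]) N' b"
  unfolding M_def using assms by (intro compile_step2[of s Yes No _ t0 i0 t1 i1 s']) (auto simp: M_def)

lemma M_Yes: "halts_within M (to_nat (Yes :: 'x dehn_state), ts) N True"
  unfolding M_def by (rule halts_within_halted) (simp_all add: halted_compile)

lemma M_No: "halts_within M (to_nat (No :: 'x dehn_state), ts) N False"
  unfolding M_def by (rule halts_within_halted) (simp_all add: halted_compile)

lemma run_Check:
  assumes "leftof t1 i1 (map Input s)"
  shows "halts_within M (to_nat (Check q t), [(t0, i0), (t1, i1)]) (length t + length s + 1)
    (foldl next_state q (t @ s) \<in> F)"
  using assms
proof (induction t arbitrary: q)
  case Nil
  then show ?case
  proof (induction s arbitrary: q t1 i1)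
    case Nil
    then have b: "t1 i1 = Blank" by (simp add: leftof_Nil)
    show ?case
      by (rule M_step[of _ _ _ _ _ "if q \<in> F then Yes else No" "t0 i0" Stay "t1 i1" Stay 0])
        (use b M_Yes M_No in \<open>auto simp: fun_upd_idem\<close>)
  next
    case (Cons y s)
    then have b: "t1 i1 = Input y" and l: "leftof t1 (i1 - 1) (map Input s)" by (auto simp: leftof_Cons)
    show ?case
      by (rule M_step[of _ _ _ _ _ "Check (next_state q y) []" "t0 i0" Stay "t1 i1" Move_Left "length s + 1"])
        (use b Cons.IH[OF l, of "next_state q y"] in \<open>auto simp: fun_upd_idem\<close>)
  qed
next
  case (Cons y t)
  show ?case
    by (rule M_step[of _ _ _ _ _ "Check (next_state q y) t" "t0 i0" Stay "t1 i1" Stay "length t + length s + 1"])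
      (use Cons.IH[OF Cons.prems, of "next_state q y"] in \<open>auto simp: fun_upd_idem\<close>)
qed

lemma run_Back:
  assumes "l \<noteq> []" "rightof t0 (i0 + 1) (map Input P)"
    and "\<And>t0 i0. rightof t0 i0 (map Input (rev l @ P)) \<Longrightarrow> halts_within M (to_nat (Read [] :: 'x dehn_state), [(t0, i0), (t1, i1)]) N b"
  shows "halts_within M (to_nat (Back l), [(t0, i0), (t1, i1)]) (N + length l) b"
  using assms
proof (induction l arbitrary: t0 i0 P rule: induct_list012)
  case (2 y)
  have "halts_within M (to_nat (Read [] :: 'x dehn_state), [(t0(i0 := Input y), i0), (t1, i1)]) N b"
  proof (rule 2(3))
    have "map Input (rev [y] @ P) = Input y # map Input P" by simp
    then show "rightof (t0(i0 := Input y)) i0 (map Input (rev [y] @ P))"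
      using rightof_write[OF 2(2), of "Input y"] by argo
  qed
  then show ?case
    by - (rule M_step[of _ _ _ _ _ "Read []" "Input y" Stay "t1 i1" Stay N],
            simp_all add: fun_upd_idem)
next
  case (3 y z l)
  have r: "rightof (t0(i0 := Input y)) (i0 - 1 + 1) (map Input (y # P))" using rightof_write[OF 3(4), of "Input y"] by simp
  have "halts_within M (to_nat (Back (z # l)), [(t0(i0 := Input y), i0 - 1), (t1, i1)]) (N + length (z # l)) b"
  proof (rule 3(2)[OF _ r])
    fix t0 i0 assume "rightof t0 i0 (map Input (rev (z # l) @ y # P))"
    then show "halts_within M (to_nat (Read [] :: 'x dehn_state), [(t0, i0), (t1, i1)]) N b" by (intro 3(5)) simp
  qed simp
  then show ?case
    by - (rule M_step[of _ _ _ _ _ "Back (z # l)" "Input y" Move_Left "t1 i1" Stay "N + length (z # l)"],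
            simp_all add: fun_upd_idem)
qed simp

definition lgd :: "'x list \<Rightarrow> bool" where
  "lgd u \<longleftrightarrow> (\<forall>a b c. u = a @ b @ c \<longrightarrow> length b \<le> k \<longrightarrow> gd b)"

text \<open>A subword of length at most \<open>k\<close> that is not already inside
  \<open>u @ v\<close> ends with \<open>x\<close> and therefore lies in the window
  \<open>v @ [x]\<close>.\<close>

lemma lgd_snoc:
  assumes "lgd (u @ v)" "gd (v @ [x])" "k \<le> length v + 1 \<or> u = []"
  shows "lgd (u @ v @ [x])"
  unfolding lgd_def
proof (intro allI impI)
  fix a b c assume e: "u @ v @ [x] = a @ b @ c" and b: "length b \<le> k"
  show "gd b"
  proof (cases c rule: rev_cases)
    case (snoc c' y)
    then have "u @ v = a @ b @ c'" using e by (metis append.assoc butlast_snoc)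
    then show ?thesis using assms(1) b by (auto simp: lgd_def)
  next
    case Nil
    have "length a \<ge> length u" using arg_cong[OF e, of length] Nil b assms(3) by auto
    then obtain a' where "a = u @ a'" using e by (metis append_eq_append_conv_if append_take_drop_id)
    then have "v @ [x] = a' @ b @ []" using e Nil by simp
    then show ?thesis using assms(2) gd_sub by metis
  qed
qed

text \<open>A potential for the running time. Refilling is paid from \<open>length s\<close>.
  Reading a letter frees three units, one of which is stored again if a letter is pushed. A
  replacement shortens the whole word by at least one letter, and \<open>5 * k + 5\<close> pays for
  writing back and rereading at most \<open>k\<close> letters.\<close>

definition pot :: "'x list \<Rightarrow> 'x list \<Rightarrow> 'x list \<Rightarrow> nat" where
  "pot s t P = (5 * k + 5) * (length s + length t + length P) + 3 * length P + length s + 2"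

text \<open>The stack together with the letters in the state remains locally geodesic, and the value
  of the whole word is preserved. A replacement consumes the letters in the state, and the stack
  alone is still locally geodesic.\<close>

lemma run_Read:
  assumes "t \<in> lists Y" "length t \<le> k - 1" "s \<in> lists Y" "P \<in> lists Y"
    "rightof t0 i0 (map Input P)" "leftof t1 i1 (map Input s)" "lgd (rev s @ rev t)"
  shows "halts_within M (to_nat (Read t), [(t0, i0), (t1, i1)]) (pot s t P) (ev (rev s @ rev t @ P) \<in> D)"
  using assms
proof (induction "pot s t P" arbitrary: s t P t0 i0 t1 i1 rule: less_induct)
  case less
  note IH = less.hyps and p = less.prems
  show ?case
  proof (cases "length t < k - 1 \<and> s \<noteq> []")
    case True
    then obtain y s' where s: "s = y # s'" by (cases s) auto
    have t1: "t1 i1 = Input y" and l: "leftof t1 (i1 - 1) (map Input s')" using p(6) s by (auto simp: leftof_Cons)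
    have lt: "pot s' (t @ [y]) P < pot s t P" by (simp add: pot_def s)
    have "halts_within M (to_nat (Read (t @ [y])), [(t0, i0), (t1(i1 := Blank), i1 - 1)]) (pot s' (t @ [y]) P)
        (ev (rev s' @ rev (t @ [y]) @ P) \<in> D)"
      using p True l s by (intro IH[OF lt]) auto
    then show ?thesis
      by - (rule M_step[of _ _ _ _ _ "Read (t @ [y])" "t0 i0" Stay Blank Move_Left "pot s' (t @ [y]) P"],
            use True t1 lt s in \<open>auto simp: fun_upd_idem\<close>)
  next
    case nr: False
    have nb: "\<not> (length t < k - 1 \<and> t1 i1 \<in> range Input)"
      using nr p(6) leftof_Nil[of t1 i1] by auto
    show ?thesis
    proof (cases P)
      case Nil
      have a: "t0 i0 = Blank" using p(5) Nil by (simp add: rightof_Nil)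
      have "ev (rev s @ rev t @ P) \<in> D \<longleftrightarrow> foldl next_state q0 (t @ s) \<in> F"
      proof -
        have "rev s @ rev t \<in> lists Y" using p(1,3) by auto
        moreover have "\<And>a b c. rev s @ rev t = a @ b @ c \<Longrightarrow> length b \<le> k \<Longrightarrow> gd b"
          using p(7) unfolding lgd_def by blast
        ultimately have "foldl next_state q0 (rev (rev s @ rev t)) \<in> F \<longleftrightarrow> ev (rev s @ rev t) \<in> D"
          by (rule local_geodesic_iff)
        then show ?thesis using Nil by simp
      qed
      moreover have "Suc (length t + length s + 1) \<le> pot s t P" by (simp add: pot_def algebra_simps)
      ultimately show ?thesis
        using run_Check[OF p(6), of q0 t t0 i0] nb a
        by - (rule M_step[of _ _ _ _ _ "Check q0 t" "t0 i0" Stay "t1 i1" Stay "length t + length s + 1"],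
            auto simp: fun_upd_idem)
    next
      case (Cons x P')
      have a: "t0 i0 = Input x" and r: "rightof t0 (i0 + 1) (map Input P')" using p(5) Cons by (auto simp: rightof_Cons)
      have x: "x \<in> Y" "P' \<in> lists Y" using p(4) Cons by auto
      let ?w = "rev t @ [x]"
      have w: "?w \<in> lists Y" using p(1) x by auto
      have tr: "trans (Read t) (t0 i0) (t1 i1) = (if gd ?w then
          if length t < k - 1 then (Read (x # t), [(t0 i0, Move_Right), (t1 i1, Stay)])
          else (Push (last t) (x # butlast t), [(t0 i0, Move_Right), (t1 i1, Move_Right)])
        else if sh ?w = [] then (Read [], [(t0 i0, Move_Right), (t1 i1, Stay)])
        else (Back (rev (sh ?w)), [(t0 i0, Stay), (t1 i1, Stay)]))"
        using nb a by (simp add: Let_def)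
      show ?thesis
      proof (cases "gd ?w")
        case gw: True
        have lg: "lgd (rev s @ rev t @ [x])"
          using nr p(2,7) gw by (intro lgd_snoc) auto
        show ?thesis
        proof (cases "length t < k - 1")
          case True
          have lt: "pot s (x # t) P' < pot s t P" by (simp add: pot_def Cons)
          have "halts_within M (to_nat (Read (x # t)), [(t0, i0 + 1), (t1, i1)]) (pot s (x # t) P')
            (ev (rev s @ rev (x # t) @ P') \<in> D)"
            using p True r x lg by (intro IH[OF lt]) auto
          then show ?thesis
            by - (rule M_step[of _ _ _ _ _ "Read (x # t)" "t0 i0" Move_Right "t1 i1" Stay "pot s (x # t) P'"],
            use True gw tr lt Cons in \<open>auto simp: fun_upd_idem\<close>)
        next
          case False
          have ne: "t \<noteq> []" using False k2 by auto
          define y t' where "y = last t" and "t' = x # butlast t"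
          have tt: "t = butlast t @ [y]" using ne by (simp add: y_def)
          have yY: "y \<in> Y" "butlast t \<in> lists Y" using p(1) tt by (metis append_in_lists_conv Cons_in_lists_iff)+
          have l1: "length t' = length t" using ne by (simp add: t'_def)
          have lt: "pot (y # s) t' P' < pot s t P" and lt2: "Suc (Suc (pot (y # s) t' P')) \<le> pot s t P"
            by (simp_all add: pot_def l1 Cons)
          have re: "rev (y # s) @ rev t' = rev s @ rev t @ [x]" unfolding t'_def by (subst (2) tt) simp
          have h1: "halts_within M (to_nat (Read t'), [(t0, i0 + 1), (t1(i1 + 1 := Input y), i1 + 1)]) (pot (y # s) t' P')
            (ev (rev (y # s) @ rev t' @ P') \<in> D)"
          proof (rule IH[OF lt])
            show "t' \<in> lists Y" "length t' \<le> k - 1" "y # s \<in> lists Y" using p yY x l1 by (auto simp: t'_def)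
            show "lgd (rev (y # s) @ rev t')" unfolding re by (rule lg)
            show "leftof (t1(i1 + 1 := Input y)) (i1 + 1) (map Input (y # s))"
              using leftof_write[of t1 "i1 + 1" "map Input s" "Input y"] p(6) by simp
          qed (use r x in \<open>auto simp: fun_upd_idem\<close>)
          have h2: "halts_within M (to_nat (Push y t'), [(t0, i0 + 1), (t1, i1 + 1)]) (Suc (pot (y # s) t' P'))
            (ev (rev (y # s) @ rev t' @ P') \<in> D)"
            by - (rule M_step[of _ _ _ _ _ "Read t'" "t0 (i0 + 1)" Stay "Input y" Stay "pot (y # s) t' P'"],
            use h1 in \<open>auto simp: fun_upd_idem\<close>)
          have "rev (y # s) @ rev t' @ P' = rev s @ rev t @ P" using re Cons by (metis append.assoc append_Cons append_Nil)
          then show ?thesis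
            using h2 by - (rule M_step[of _ _ _ _ _ "Push y t'" "t0 i0" Move_Right "t1 i1" Move_Right "Suc (pot (y # s) t' P')"],
            use False gw tr lt2 in \<open>auto simp: y_def t'_def fun_upd_idem\<close>)
        qed
      next
        case ngw: False
        have s: "sh ?w \<in> lists Y" "length (sh ?w) \<le> length t" using sh[OF w ngw] by auto
        have ee: "ev (rev s @ rev t @ P) = ev (rev s @ sh ?w @ P')"
        proof -
          have "rev s \<in> lists Y" using p(3) by auto
          from sh_ev[OF w ngw this x(2)] show ?thesis using Cons by simp
        qed
        have le: "(5 * k + 5) * (length s + length (sh ?w @ P') + 1) \<le> (5 * k + 5) * (length s + length t + length P)"
          using s by (intro mult_le_mono2) (simp add: Cons)
        have lsk: "length (sh ?w) \<le> k" using s p(2) by simp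
        have lt2: "pot s [] (sh ?w @ P') + length (sh ?w) + 1 \<le> pot s t P"
          using le lsk unfolding pot_def by (simp add: Cons algebra_simps)
        have lt: "pot s [] (sh ?w @ P') < pot s t P" using lt2 by simp
        have lgs: "lgd (rev s @ rev [])" unfolding lgd_def
        proof (intro allI impI)
          fix a b c assume "rev s @ rev [] = a @ b @ c" "length b \<le> k"
          then show "gd b" using p(7)[unfolded lgd_def, rule_format, of a b "c @ rev t"] by simp
        qed
        have h: "halts_within M (to_nat (Read [] :: 'x dehn_state), [(t0', i0'), (t1, i1)]) (pot s [] (sh ?w @ P'))
            (ev (rev s @ rev [] @ sh ?w @ P') \<in> D)"
          if "rightof t0' i0' (map Input (sh ?w @ P'))" for t0' i0'
          using p s x lgs that by (intro IH[OF lt]) auto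
        show ?thesis
        proof (cases "sh ?w = []")
          case True
          have "halts_within M (to_nat (Read [] :: 'x dehn_state), [(t0, i0 + 1), (t1, i1)]) (pot s [] (sh ?w @ P')) (ev (rev s @ rev t @ P) \<in> D)"
            using h[of t0 "i0 + 1"] r True ee by simp
          then show ?thesis
            by - (rule M_step[of _ _ _ _ _ "Read []" "t0 i0" Move_Right "t1 i1" Stay "pot s [] (sh ?w @ P')"],
            use True ngw tr lt in \<open>auto simp: fun_upd_idem\<close>)
        next
          case False
          have "halts_within M (to_nat (Back (rev (sh ?w))), [(t0, i0), (t1, i1)])
              (pot s [] (sh ?w @ P') + length (rev (sh ?w))) (ev (rev s @ rev [] @ sh ?w @ P') \<in> D)"
            using False h by (intro run_Back[OF _ r]) auto
          then show ?thesis
            using ee by - (rule M_step[of _ _ _ _ _ "Back (rev (sh ?w))" "t0 i0" Stay "t1 i1" Stay "pot s [] (sh ?w @ P') + length (rev (sh ?w))"],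
            use False ngw tr lt2 in \<open>auto simp: fun_upd_idem\<close>)
        qed
      qed
    qed
  qed
qed

theorem decides_linear:
  "\<exists>M C. decides M Y {w \<in> lists Y. ev w \<in> D} \<and> (\<forall>w\<in>lists Y. run_time M w \<le> C * (length w + 1))"
proof -
  have "decides M Y {w \<in> lists Y. ev w \<in> D} \<and> (\<forall>w\<in>lists Y. run_time M w \<le> (5 * k + 8) * (length w + 1))"
  proof (rule decidesI[OF wf_M])
    fix w assume w: "w \<in> lists Y"
    let ?t = "\<lambda>i. if 0 \<le> i \<and> i < int (length w) then Input (w ! nat i) else Blank"
    have ic: "initial_config M w = (to_nat (Read [] :: 'x dehn_state), [(?t, 0), (\<lambda>_. Blank, 0)])"
      by (simp add: initial_config_def M_def compile_def)
    have "halts_within M (initial_config M w) (pot [] [] w) (ev (rev [] @ rev [] @ w) \<in> D)"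
      unfolding ic
    proof (rule run_Read)
      show "rightof ?t 0 (map Input w)" by (rule initial_rightof)
      show "lgd (rev [] @ rev [])" by (auto simp: lgd_def gd_Nil)
    qed (use w in \<open>auto simp: leftof_def\<close>)
    moreover have "pot [] [] w \<le> (5 * k + 8) * (length w + 1)" by (simp add: pot_def algebra_simps)
    ultimately have "halts_within M (initial_config M w) ((5 * k + 8) * (length w + 1)) (ev (rev [] @ rev [] @ w) \<in> D)"
      by (rule halts_within_mono)
    then show "halts_within M (initial_config M w) ((5 * k + 8) * (length w + 1)) (w \<in> {w \<in> lists Y. ev w \<in> D})"
      using w by simp
  qed auto
  then show ?thesis by blast
qed

end

section \<open>A machine computing normal forms in automatic groups\<close>

text \<open>The second tape holds a word \<open>u\<close> of the automatic language with a blank to its left. To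
  multiply by a letter \<open>x\<close>, a pass to the right runs the subset construction of the multiplier
  automaton of \<open>x\<close> on \<open>u\<close>, its second component being unknown, and records the set of reachable
  states in every cell; then a pass to the left resolves the choices into an accepted word \<open>v\<close>.\<close>

datatype 'x auto_state =
  Init "'x list" | Rewind | Scan | Fwd 'x "nat list" | Ext 'x "'x list" nat | Bwd 'x nat | Fin nat | Acc | Rej

instance auto_state :: (countable) countable
  by countable_datatype

lemma rightof_blanks: "rightof t i (ss @ replicate m Blank) \<longleftrightarrow> rightof t i ss"
  by (auto simp: rightof_def nth_append)

locale automatic_machine =
  fixes Y :: "'x::countable set" and L :: "'x list set" and ev :: "'x list \<Rightarrow> 'v" and D :: "'v set"
    and ns :: "'x \<Rightarrow> nat" and \<delta> :: "'x \<Rightarrow> nat \<Rightarrow> 'x option \<times> 'x option \<Rightarrow> nat" and q0 :: "'x \<Rightarrow> nat" and F :: "'x \<Rightarrow> nat set"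
    and nf :: nat and \<delta>f :: "nat \<Rightarrow> 'x \<Rightarrow> nat" and qf :: nat and Ff :: "nat set" and u0 :: "'x list"
  assumes finite_Y: "finite Y" and LY: "L \<subseteq> lists Y"
    and q0: "x \<in> Y \<Longrightarrow> q0 x < ns x"
    and \<delta>: "x \<in> Y \<Longrightarrow> \<forall>q<ns x. \<forall>p\<in>insert None (Some ` Y) \<times> insert None (Some ` Y). \<delta> x q p < ns x"
    and multiplier: "x \<in> Y \<Longrightarrow> (\<lambda>(u, v). pad_pair u v) ` {(u, v). u \<in> L \<and> v \<in> L \<and> ev (u @ [x]) = ev v} =
      {w \<in> lists (insert None (Some ` Y) \<times> insert None (Some ` Y)). foldl (\<delta> x) (q0 x) w \<in> F x}"
    and onto: "w \<in> lists Y \<Longrightarrow> \<exists>u\<in>L. ev u = ev w"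
    and ev_snoc: "u \<in> lists Y \<Longrightarrow> v \<in> lists Y \<Longrightarrow> x \<in> Y \<Longrightarrow> ev u = ev v \<Longrightarrow> ev (u @ [x]) = ev (v @ [x])"
    and qf: "qf < nf" and \<delta>f: "q < nf \<Longrightarrow> y \<in> Y \<Longrightarrow> \<delta>f q y < nf"
    and final: "{u \<in> L. ev u \<in> D} = {w \<in> lists Y. foldl \<delta>f qf w \<in> Ff}"
    and u0: "u0 \<in> L" "ev u0 = ev []"
begin

definition opts :: "'x option set" where "opts = insert None (Some ` Y)"

definition K :: nat where "K = sum ns Y + nf"

lemma ns_le: "x \<in> Y \<Longrightarrow> ns x \<le> K"
  using member_le_sum[of x Y ns] finite_Y by (simp add: K_def)

text \<open>Sets of states are kept as sorted lists, a canonical representation of countable type,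
  because they have to be written on the tape.\<close>

definition post :: "'x \<Rightarrow> nat list \<Rightarrow> 'x \<Rightarrow> nat list" where
  "post x S y = sorted_list_of_set ({\<delta> x q (Some y, b) | q b. q \<in> set S \<and> b \<in> opts} \<inter> {..<ns x})"

definition SS :: "nat list set" where "SS = sorted_list_of_set ` Pow {..<K}"

definition good_ext :: "'x \<Rightarrow> nat list \<Rightarrow> nat \<times> 'x list \<Rightarrow> bool" where
  "good_ext x S p \<longleftrightarrow> fst p \<in> set S \<and> fst p < ns x \<and> snd p \<in> lists Y \<and> length (snd p) \<le> K \<and>
     foldl (\<delta> x) (fst p) (map (\<lambda>y. (None, Some y)) (snd p)) \<in> F x"

definition good_pred :: "'x \<Rightarrow> nat list \<Rightarrow> 'x \<Rightarrow> nat \<Rightarrow> nat \<times> 'x option \<Rightarrow> bool" where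
  "good_pred x S y q p \<longleftrightarrow> fst p \<in> set S \<and> fst p < ns x \<and> snd p \<in> opts \<and> \<delta> x (fst p) (Some y, snd p) = q"

fun sym :: "'x option \<Rightarrow> 'x tape_symbol" where
  "sym None = Blank" | "sym (Some y) = Input y"

fun mark :: "'x \<times> nat list \<Rightarrow> 'x tape_symbol" where
  "mark p = Aux (to_nat p)"

text \<open>The choices by \<open>SOME\<close> depend only on the state and the scanned symbols, so
  they are fixed entries of the transition table. A padding \<open>None\<close> in the second
  component is written as \<open>Blank\<close>; on an accepted path it only occurs at the right end,
  where the new word is shorter.\<close>

fun trans :: "'x auto_state \<Rightarrow> 'x tape_symbol \<Rightarrow> 'x tape_symbol \<Rightarrow>
    'x auto_state \<times> ('x tape_symbol \<times> head_move) list" where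
  "trans (Init (y # l)) a b = (Init l, [(a, Stay), (Input y, Move_Right)])"
| "trans (Init []) a b = (Rewind, [(a, Stay), (b, Move_Left)])"
| "trans Rewind a b = (if b = Blank then (Scan, [(a, Stay), (b, Stay)]) else (Rewind, [(a, Stay), (b, Move_Left)]))"
| "trans Scan a b = (case a of Input x \<Rightarrow> (Fwd x [q0 x], [(a, Move_Right), (b, Move_Right)])
     | _ \<Rightarrow> (Fin qf, [(a, Stay), (b, Move_Right)]))"
| "trans (Fwd x S) a b = (case b of Input y \<Rightarrow> (Fwd x (post x S y), [(a, Stay), (mark (y, S), Move_Right)])
     | _ \<Rightarrow> if \<exists>p. good_ext x S p then (Ext x (snd (SOME p. good_ext x S p)) (fst (SOME p. good_ext x S p)), [(a, Stay), (b, Stay)])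
        else (Rej, [(a, Stay), (b, Stay)]))"
| "trans (Ext x (y # e) q) a b = (Ext x e q, [(a, Stay), (Input y, Move_Right)])"
| "trans (Ext x [] q) a b = (Bwd x q, [(a, Stay), (b, Move_Left)])"
| "trans (Bwd x q) a b = (case b of Input y \<Rightarrow> (Bwd x q, [(a, Stay), (b, Move_Left)])
     | Blank \<Rightarrow> (Scan, [(a, Stay), (b, Stay)])
     | Aux m \<Rightarrow> let y = fst (from_nat m :: 'x \<times> nat list); S = snd (from_nat m :: 'x \<times> nat list) in
        if \<exists>p. good_pred x S y q p then
          (Bwd x (fst (SOME p. good_pred x S y q p)), [(a, Stay), (sym (snd (SOME p. good_pred x S y q p)), Move_Left)])
        else (Rej, [(a, Stay), (b, Stay)]))"
| "trans (Fin q) a b = (case b of Input y \<Rightarrow> (Fin (\<delta>f q y), [(a, Stay), (b, Move_Right)])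
     | _ \<Rightarrow> (if q \<in> Ff then Acc else Rej, [(a, Stay), (b, Stay)]))"
| "trans Acc a b = (Rej, [(a, Stay), (b, Stay)])"
| "trans Rej a b = (Rej, [(a, Stay), (b, Stay)])"

definition Q :: "'x auto_state set" where
  "Q = Init ` {l \<in> lists Y. length l \<le> length u0} \<union> {Rewind, Scan, Acc, Rej} \<union> (\<lambda>(x, S). Fwd x S) ` (Y \<times> SS) \<union>
     (\<lambda>(x, e, q). Ext x e q) ` (Y \<times> {e \<in> lists Y. length e \<le> K} \<times> {..<K}) \<union>
     (\<lambda>(x, q). Bwd x q) ` (Y \<times> {..<K}) \<union> Fin ` {..<nf}"

lemma mem_Q [simp]:
  "Init l \<in> Q \<longleftrightarrow> l \<in> lists Y \<and> length l \<le> length u0"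
  "Rewind \<in> Q" "Scan \<in> Q" "Acc \<in> Q" "Rej \<in> Q"
  "Fwd x S \<in> Q \<longleftrightarrow> x \<in> Y \<and> S \<in> SS"
  "Ext x e q \<in> Q \<longleftrightarrow> x \<in> Y \<and> e \<in> lists Y \<and> length e \<le> K \<and> q < K"
  "Bwd x q \<in> Q \<longleftrightarrow> x \<in> Y \<and> q < K"
  "Fin q \<in> Q \<longleftrightarrow> q < nf"
  unfolding Q_def by (auto simp: image_iff)

definition \<Gamma> :: "'x tape_symbol set" where
  "\<Gamma> = insert Blank (Input ` Y) \<union> mark ` (Y \<times> SS)"

definition M :: "'x tm" where
  "M = compile 2 Q \<Gamma> (Init u0) Acc Rej (\<lambda>s ss. trans s (ss ! 0) (ss ! 1))"

lemma post_SS: "x \<in> Y \<Longrightarrow> post x S y \<in> SS"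
  unfolding post_def SS_def using ns_le by (intro imageI) fastforce

lemma sing_SS: "x \<in> Y \<Longrightarrow> [q0 x] \<in> SS"
proof -
  assume x: "x \<in> Y"
  have "[q0 x] = sorted_list_of_set {q0 x}" by simp
  moreover have "{q0 x} \<in> Pow {..<K}" using q0[OF x] ns_le[OF x] by auto
  ultimately show ?thesis unfolding SS_def by blast
qed

lemma finite_Q: "finite Q"
  unfolding Q_def using finite_Y
  by (intro finite_UnI finite_imageI finite_cartesian_product finite_bounded_lists) (auto simp: SS_def)

lemma trans_closed:
  assumes s: "s \<in> Q" and a: "a \<in> \<Gamma>" and b: "b \<in> \<Gamma>"
  shows "fst (trans s a b) \<in> Q \<and> length (snd (trans s a b)) = 2 \<and> fst ` set (snd (trans s a b)) \<subseteq> \<Gamma>"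
proof -
  have aY: "x \<in> Y" if "a = Input x" for x using that a by (auto simp: \<Gamma>_def)
  have bY: "x \<in> Y" if "b = Input x" for x using that b by (auto simp: \<Gamma>_def)
  show ?thesis
  proof (cases s)
    case (Init l)
    then show ?thesis using s a b by (cases l) (auto simp: \<Gamma>_def)
  next
    case Rewind
    then show ?thesis using a b by auto
  next
    case Scan
    then show ?thesis using a b aY sing_SS qf by (cases a) auto
  next
    case (Fwd x S)
    then have x: "x \<in> Y" "S \<in> SS" using s by auto
    have ext: "Ext x (snd (SOME p. good_ext x S p)) (fst (SOME p. good_ext x S p)) \<in> Q" if "\<exists>p. good_ext x S p"
      using someI_ex[OF that] ns_le[OF x(1)] x by (auto simp: good_ext_def)
    show ?thesis
    proof (cases b)
      case (Input y)
      then have "mark (y, S) \<in> \<Gamma>" using bY x by (auto simp: \<Gamma>_def simp del: mark.simps)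
      then show ?thesis using Input Fwd x post_SS a by (simp del: mark.simps)
    qed (use Fwd ext a b in auto)
  next
    case (Ext x e q)
    then show ?thesis using s a b by (cases e) (auto simp: \<Gamma>_def)
  next
    case (Bwd x q)
    then have x: "x \<in> Y" "q < K" using s by auto
    show ?thesis
    proof (cases b)
      case (Aux m)
      let ?y = "fst (from_nat m :: 'x \<times> nat list)" and ?S = "snd (from_nat m :: 'x \<times> nat list)"
      have g: "fst (SOME p. good_pred x ?S ?y q p) < K \<and> sym (snd (SOME p. good_pred x ?S ?y q p)) \<in> \<Gamma>"
        if "\<exists>p. good_pred x ?S ?y q p"
        using someI_ex[OF that] ns_le[OF x(1)] by (auto simp: good_pred_def opts_def \<Gamma>_def)
      show ?thesis using Bwd Aux x g a b by (auto simp: Let_def)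
    qed (use Bwd x a b in auto)
  next
    case (Fin q)
    then show ?thesis using s a b bY \<delta>f by (cases b) auto
  qed (use a b in auto)
qed

lemma wf_M: "wf_tm Y M"
  unfolding M_def
proof (rule wf_compile)
  show "finite Q" by (rule finite_Q)
  show "{Init u0, Acc, Rej} \<subseteq> Q" using u0 LY by auto
  show "finite \<Gamma>" unfolding \<Gamma>_def using finite_Y by (simp add: SS_def)
  fix s ss assume "s \<in> Q" "ss \<in> lists \<Gamma>" "length ss = 2"
  moreover from this obtain a b where "ss = [a, b]" by (auto simp: length_Suc_conv numeral_2_eq_2)
  ultimately show "fst (trans s (ss ! 0) (ss ! 1)) \<in> Q \<and> length (snd (trans s (ss ! 0) (ss ! 1))) = 2 \<and>
      fst ` set (snd (trans s (ss ! 0) (ss ! 1))) \<subseteq> \<Gamma>"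
    using trans_closed by simp
qed (auto simp: \<Gamma>_def)

definition hw :: "'x auto_state \<Rightarrow> 'x tape \<Rightarrow> 'x tape \<Rightarrow> nat \<Rightarrow> bool \<Rightarrow> bool" where
  "hw s p0 p1 N b \<longleftrightarrow> halts_within M (to_nat s, [p0, p1]) N b"

lemma hw_mono: "hw s p0 p1 N b \<Longrightarrow> N \<le> N' \<Longrightarrow> hw s p0 p1 N' b"
  unfolding hw_def by (rule halts_within_mono)

lemma hw_step:
  assumes "trans s (t0 i0) (t1 i1) = (s', [(t0 i0, m0), (a1, m1)])" "s \<noteq> Acc" "s \<noteq> Rej"
    and "hw s' (t0, i0 + shift m0) (t1(i1 := a1), i1 + shift m1) N b"
  shows "hw s (t0, i0) (t1, i1) (Suc N) b"
  unfolding hw_def M_def using assms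
  by (intro compile_step2[of s Acc Rej "\<lambda>s ss. trans s (ss ! 0) (ss ! 1)" t0 i0 t1 i1 s' "t0 i0" m0 a1 m1
      Q \<Gamma> "Init u0" N b "Suc N"])
    (simp_all add: hw_def M_def)

lemma hw_step_keep:
  assumes "trans s (t0 i0) (t1 i1) = (s', [(t0 i0, m0), (t1 i1, m1)])" "s \<noteq> Acc" "s \<noteq> Rej"
    and "hw s' (t0, i0 + shift m0) (t1, i1 + shift m1) N b"
  shows "hw s (t0, i0) (t1, i1) (Suc N) b"
  using hw_step[of s t0 i0 t1 i1 s' m0 "t1 i1" m1 N b] assms by simp

lemma hw_Acc: "hw Acc p0 p1 N True"
  unfolding hw_def M_def by (rule halts_within_halted) (simp_all add: halted_compile)

lemma hw_Rej: "hw Rej p0 p1 N False"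
  unfolding hw_def M_def by (rule halts_within_halted) (simp_all add: halted_compile)

lemma run_Init:
  assumes "leftof t1 (i1 - 1) X" "rightof t1 i1 []"
    and "\<And>t1 i1. leftof t1 (i1 - 1) (rev (map Input l) @ X) \<Longrightarrow> rightof t1 i1 [] \<Longrightarrow> hw (Init []) p0 (t1, i1) N b"
  shows "hw (Init l) p0 (t1, i1) (N + length l) b"
  using assms
proof (induction l arbitrary: t1 i1 X)
  case Nil
  show ?case using Nil(3)[OF _ Nil(2)] Nil(1) by simp
next
  case (Cons y l)
  obtain t0 i0 where p0: "p0 = (t0, i0)" by (cases p0)
  let ?t = "t1(i1 := Input y)"
  have l: "leftof ?t (i1 + 1 - 1) (Input y # X)" using leftof_write[OF Cons(2)] by simp
  have r: "rightof ?t (i1 + 1) []" using Cons(3) by (auto simp: rightof_def) (metis add.assoc of_nat_Suc)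
  have "hw (Init l) p0 (?t, i1 + 1) (N + length l) b"
  proof (rule Cons.IH[OF l r])
    fix t1 i1 assume "leftof t1 (i1 - 1) (rev (map Input l) @ Input y # X)" "rightof t1 i1 []"
    then show "hw (Init []) p0 (t1, i1) N b" by (intro Cons(4)) simp_all
  qed
  then have "hw (Init (y # l)) (t0, i0) (t1, i1) (Suc (N + length l)) b"
    unfolding p0 by - (rule hw_step[where s' = "Init l" and ?m0.0 = Stay and ?a1.0 = "Input y" and ?m1.0 = Move_Right], simp_all)
  then show ?case by (simp add: p0)
qed

lemma run_Rewind:
  assumes "leftof t1 i1 (map Input (rev l))" "rightof t1 (i1 + 1) (map Input r)"
    and "\<And>i1. leftof t1 i1 [] \<Longrightarrow> rightof t1 (i1 + 1) (map Input (l @ r)) \<Longrightarrow> hw Scan p0 (t1, i1) N b"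
  shows "hw Rewind p0 (t1, i1) (N + length l + 1) b"
  using assms
proof (induction l arbitrary: i1 r rule: rev_induct)
  case Nil
  obtain t0 i0 where p0: "p0 = (t0, i0)" by (cases p0)
  have b: "t1 i1 = Blank" using Nil(1) leftof_Nil by simp
  have h: "hw Scan (t0, i0) (t1, i1) N b" using Nil(3)[of i1] Nil(1,2) by (simp add: p0)
  have "hw Rewind (t0, i0) (t1, i1) (Suc N) b"
    by (rule hw_step_keep[where s' = Scan and ?m0.0 = Stay and ?m1.0 = Stay]) (use b h in simp_all)
  then show ?case by (simp add: p0)
next
  case (snoc y l)
  obtain t0 i0 where p0: "p0 = (t0, i0)" by (cases p0)
  have b: "t1 i1 = Input y" and lf: "leftof t1 (i1 - 1) (map Input (rev l))" using snoc(2) by (auto simp: leftof_Cons)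
  have r: "rightof t1 (i1 - 1 + 1) (map Input (y # r))" using snoc(3) b by (simp add: rightof_Cons)
  have "hw Rewind p0 (t1, i1 - 1) (N + length l + 1) b"
  proof (rule snoc.IH[OF lf r])
    fix i1 assume "leftof t1 i1 []" "rightof t1 (i1 + 1) (map Input (l @ y # r))"
    then show "hw Scan p0 (t1, i1) N b" by (intro snoc(4)) simp_all
  qed
  then have "hw Rewind (t0, i0) (t1, i1) (Suc (N + length l + 1)) b"
    unfolding p0 by - (rule hw_step_keep[where s' = Rewind and ?m0.0 = Stay and ?m1.0 = Move_Left], simp_all add: b)
  then show ?case by (simp add: p0)
qed

fun marks :: "'x \<Rightarrow> nat list \<Rightarrow> 'x list \<Rightarrow> 'x tape_symbol list" where
  "marks x S [] = []"
| "marks x S (y # u) = mark (y, S) # marks x (post x S y) u"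

lemma marks_snoc: "marks x S (u @ [y]) = marks x S u @ [mark (y, foldl (post x) S u)]"
  by (induction u arbitrary: S) auto

lemma run_Fwd:
  assumes "leftof t1 (i1 - 1) X" "rightof t1 i1 (map Input u)"
    and "\<And>t1 i1. leftof t1 (i1 - 1) (rev (marks x S u) @ X) \<Longrightarrow> rightof t1 i1 [] \<Longrightarrow>
      hw (Fwd x (foldl (post x) S u)) p0 (t1, i1) N b"
  shows "hw (Fwd x S) p0 (t1, i1) (N + length u) b"
  using assms
proof (induction u arbitrary: t1 i1 X S)
  case Nil
  show ?case using Nil(3)[of t1 i1] Nil(1,2) by simp
next
  case (Cons y u)
  obtain t0 i0 where p0: "p0 = (t0, i0)" by (cases p0)
  let ?t = "t1(i1 := mark (y, S))"
  have b: "t1 i1 = Input y" and r1: "rightof t1 (i1 + 1) (map Input u)" using Cons(3) by (auto simp: rightof_Cons)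
  have l: "leftof ?t (i1 + 1 - 1) (mark (y, S) # X)" using leftof_write[OF Cons(2)] by simp
  have r: "rightof ?t (i1 + 1) (map Input u)" using r1 by (simp del: mark.simps)
  have "hw (Fwd x (post x S y)) p0 (?t, i1 + 1) (N + length u) b"
  proof (rule Cons.IH[OF l r])
    fix t1 i1 assume "leftof t1 (i1 - 1) (rev (marks x (post x S y) u) @ mark (y, S) # X)" "rightof t1 i1 []"
    then have "hw (Fwd x (foldl (post x) S (y # u))) p0 (t1, i1) N b" by (intro Cons(4)) simp_all
    then show "hw (Fwd x (foldl (post x) (post x S y) u)) p0 (t1, i1) N b" by simp
  qed
  then have "hw (Fwd x S) (t0, i0) (t1, i1) (Suc (N + length u)) b"
    unfolding p0 by - (rule hw_step[where s' = "Fwd x (post x S y)" and ?m0.0 = Stay and ?a1.0 = "mark (y, S)" and ?m1.0 = Move_Right],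
      simp_all add: b del: mark.simps)
  then show ?case by (simp add: p0)
qed

lemma run_Ext:
  assumes "leftof t1 (i1 - 1) X" "rightof t1 i1 []"
    and "\<And>t1 i1. leftof t1 (i1 - 1) (rev (map Input e) @ X) \<Longrightarrow> rightof t1 i1 [] \<Longrightarrow> hw (Ext x [] q) p0 (t1, i1) N b"
  shows "hw (Ext x e q) p0 (t1, i1) (N + length e) b"
  using assms
proof (induction e arbitrary: t1 i1 X)
  case Nil
  show ?case using Nil(3)[OF _ Nil(2)] Nil(1) by simp
next
  case (Cons y e)
  obtain t0 i0 where p0: "p0 = (t0, i0)" by (cases p0)
  let ?t = "t1(i1 := Input y)"
  have l: "leftof ?t (i1 + 1 - 1) (Input y # X)" using leftof_write[OF Cons(2)] by simp
  have r: "rightof ?t (i1 + 1) []" using Cons(3) by (auto simp: rightof_def) (metis add.assoc of_nat_Suc)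
  have "hw (Ext x e q) p0 (?t, i1 + 1) (N + length e) b"
  proof (rule Cons.IH[OF l r])
    fix t1 i1 assume "leftof t1 (i1 - 1) (rev (map Input e) @ Input y # X)" "rightof t1 i1 []"
    then show "hw (Ext x [] q) p0 (t1, i1) N b" by (intro Cons(4)) simp_all
  qed
  then have "hw (Ext x (y # e) q) (t0, i0) (t1, i1) (Suc (N + length e)) b"
    unfolding p0 by - (rule hw_step[where s' = "Ext x e q" and ?m0.0 = Stay and ?a1.0 = "Input y" and ?m1.0 = Move_Right], simp_all)
  then show ?case by (simp add: p0)
qed

lemma run_Bwd_skip:
  assumes "leftof t1 i1 (map Input (rev e) @ X)" "rightof t1 (i1 + 1) (map Input r)"
    and "\<And>i1. leftof t1 i1 X \<Longrightarrow> rightof t1 (i1 + 1) (map Input (e @ r)) \<Longrightarrow> hw (Bwd x q) p0 (t1, i1) N b"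
  shows "hw (Bwd x q) p0 (t1, i1) (N + length e) b"
  using assms
proof (induction e arbitrary: i1 r rule: rev_induct)
  case Nil
  show ?case using Nil(3)[of i1] Nil(1,2) by simp
next
  case (snoc y e)
  obtain t0 i0 where p0: "p0 = (t0, i0)" by (cases p0)
  have b: "t1 i1 = Input y" and lf: "leftof t1 (i1 - 1) (map Input (rev e) @ X)" using snoc(2) by (auto simp: leftof_Cons)
  have r: "rightof t1 (i1 - 1 + 1) (map Input (y # r))" using snoc(3) b by (simp add: rightof_Cons)
  have "hw (Bwd x q) p0 (t1, i1 - 1) (N + length e) b"
  proof (rule snoc.IH[OF lf r])
    fix i1 assume "leftof t1 i1 X" "rightof t1 (i1 + 1) (map Input (e @ y # r))"
    then show "hw (Bwd x q) p0 (t1, i1) N b" by (intro snoc(4)) simp_all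
  qed
  then have "hw (Bwd x q) (t0, i0) (t1, i1) (Suc (N + length e)) b"
    unfolding p0 by - (rule hw_step_keep[where s' = "Bwd x q" and ?m0.0 = Stay and ?m1.0 = Move_Left], simp_all add: b)
  then show ?case by (simp add: p0)
qed

lemma set_post: "set (post x S y) = {\<delta> x q (Some y, b) | q b. q \<in> set S \<and> b \<in> opts} \<inter> {..<ns x}"
  unfolding post_def by (rule set_sorted_list_of_set) simp

text \<open>The word \<open>z\<close> of pairs is chosen by the machine; it is a path of the multiplier automaton
  whose first component spells \<open>u\<close>.\<close>

definition path :: "'x \<Rightarrow> nat list \<Rightarrow> 'x list \<Rightarrow> nat \<Rightarrow> ('x option \<times> 'x option) list \<Rightarrow> bool" where
  "path x S u q z \<longleftrightarrow> map fst z = map Some u \<and> snd ` set z \<subseteq> opts \<and> (\<exists>q'\<in>set S. foldl (\<delta> x) q' z = q)"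

text \<open>Each mark holds the set of states reached before its letter was read, so the state to be
  reached has a predecessor in that set. Whatever predecessors are chosen, they assemble into a path
  from a state of \<open>S\<close>.\<close>

lemma run_Bwd:
  assumes "leftof t1 i1 (rev (marks x S u))" "rightof t1 (i1 + 1) (map (\<lambda>p. sym (snd p)) z)"
    and "q \<in> set (foldl (post x) S u)" "set S \<subseteq> {..<ns x}"
    and "\<And>t1 i1 z'. leftof t1 i1 [] \<Longrightarrow> path x S u q z' \<Longrightarrow> rightof t1 (i1 + 1) (map (\<lambda>p. sym (snd p)) (z' @ z)) \<Longrightarrow>
      hw Scan p0 (t1, i1) N b"
  shows "hw (Bwd x q) p0 (t1, i1) (N + length u + 1) b"
  using assms
proof (induction u arbitrary: t1 i1 q z rule: rev_induct)
  case Nil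
  obtain t0 i0 where p0: "p0 = (t0, i0)" by (cases p0)
  have b: "t1 i1 = Blank" using Nil(1) leftof_Nil by simp
  have "path x S [] q []" using Nil(3) by (auto simp: path_def)
  then have h: "hw Scan (t0, i0) (t1, i1) N b" using Nil(5)[of t1 i1 "[]"] Nil(1,2) by (simp add: p0)
  have "hw (Bwd x q) (t0, i0) (t1, i1) (Suc N) b"
    by (rule hw_step_keep[where s' = Scan and ?m0.0 = Stay and ?m1.0 = Stay]) (use b h in simp_all)
  then show ?case by (simp add: p0)
next
  case (snoc y u)
  obtain t0 i0 where p0: "p0 = (t0, i0)" by (cases p0)
  define S' where "S' = foldl (post x) S u"
  have b: "t1 i1 = mark (y, S')" and lf: "leftof t1 (i1 - 1) (rev (marks x S u))"
    using snoc(2) by (simp_all add: marks_snoc leftof_Cons S'_def)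
  have sub: "set S' \<subseteq> {..<ns x}"
    unfolding S'_def by (cases u rule: rev_cases) (use snoc(5) set_post in auto)
  have "q \<in> set (post x S' y)" using snoc(4) by (simp add: S'_def)
  then have ex: "\<exists>p. good_pred x S' y q p" using sub by (auto simp: set_post good_pred_def)
  define p where "p = (SOME p. good_pred x S' y q p)"
  have g: "good_pred x S' y q p" unfolding p_def using ex by (rule someI_ex)
  let ?t = "t1(i1 := sym (snd p))"
  have l: "leftof ?t (i1 - 1) (rev (marks x S u))" using lf by simp
  have r: "rightof ?t (i1 - 1 + 1) (map (\<lambda>p. sym (snd p)) ((Some y, snd p) # z))"
    using rightof_write[OF snoc(3)] by simp
  have "hw (Bwd x (fst p)) p0 (?t, i1 - 1) (N + length u + 1) b"
  proof (rule snoc.IH[OF l r _ snoc(5)])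
    show "fst p \<in> set (foldl (post x) S u)" using g by (simp add: good_pred_def S'_def)
    fix t1 i1 z'
    assume h: "leftof t1 i1 []" "path x S u (fst p) z'" "rightof t1 (i1 + 1) (map (\<lambda>p. sym (snd p)) (z' @ (Some y, snd p) # z))"
    obtain q' where q': "q' \<in> set S" "foldl (\<delta> x) q' z' = fst p" using h(2) by (auto simp: path_def)
    have "foldl (\<delta> x) q' (z' @ [(Some y, snd p)]) = q" using q' g by (simp add: good_pred_def)
    then have "path x S (u @ [y]) q (z' @ [(Some y, snd p)])"
      unfolding path_def using h(2) g q'(1) by (auto simp: path_def good_pred_def simp del: foldl_append)
    moreover have "rightof t1 (i1 + 1) (map (\<lambda>p. sym (snd p)) ((z' @ [(Some y, snd p)]) @ z))" using h(3) by simp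
    ultimately show "hw Scan p0 (t1, i1) N b" by (rule snoc(6)[OF h(1)])
  qed
  then have h: "hw (Bwd x (fst p)) (t0, i0) (?t, i1 - 1) (N + length u + 1) b" by (simp add: p0)
  have "trans (Bwd x q) (t0 i0) (t1 i1) = (Bwd x (fst p), [(t0 i0, Stay), (sym (snd p), Move_Left)])"
    using ex by (simp add: b p_def)
  then have "hw (Bwd x q) (t0, i0) (t1, i1) (Suc (N + length u + 1)) b"
    by (rule hw_step) (use h in simp_all)
  then show ?case by (simp add: p0)
qed

lemma reach_post:
  assumes x: "x \<in> Y" and z: "map fst z = map Some u" "snd ` set z \<subseteq> opts" "u \<in> lists Y"
    and q: "q \<in> set S" "set S \<subseteq> {..<ns x}"
  shows "foldl (\<delta> x) q z \<in> set (foldl (post x) S u)"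
  using z q
proof (induction u arbitrary: z q S)
  case Nil
  then show ?case by simp
next
  case (Cons y u)
  then obtain b z' where z: "z = (Some y, b) # z'" "map fst z' = map Some u" by (cases z) auto
  have b: "b \<in> opts" "y \<in> Y" using Cons.prems z by auto
  have "q < ns x" using Cons.prems by auto
  then have "\<delta> x q (Some y, b) < ns x" using \<delta>[OF x] b by (auto simp: opts_def)
  then have "\<delta> x q (Some y, b) \<in> set (post x S y)" using Cons.prems b by (auto simp: set_post)
  then show ?case using Cons.IH[of z' "\<delta> x q (Some y, b)" "post x S y"] Cons.prems z by (auto simp: set_post)
qed

lemma sym_pad_pair:
  "map (\<lambda>p. sym (snd p)) (pad_pair u v) = map Input v @ replicate (length u - length v) Blank"
  by (induction u v rule: pad_pair.induct) auto

lemma length_pad_pair: "length (pad_pair u v) = max (length u) (length v)"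
  by (induction u v rule: pad_pair.induct) auto

text \<open>For a representative \<open>v\<close> of the product, the run on
  \<open>pad_pair u v\<close> passes after \<open>length u\<close> letters through a state found by
  the subset construction. The remaining tail of \<open>v\<close> is cut down to fewer than
  \<open>ns x\<close> letters.\<close>

lemma ext_exists:
  assumes x: "x \<in> Y" and u: "u \<in> L"
  shows "\<exists>p. good_ext x (foldl (post x) [q0 x] u) p"
proof -
  let ?S = "insert None (Some ` Y) \<times> insert None (Some ` Y)"
  have uY: "u \<in> lists Y" using u LY by blast
  then have "u @ [x] \<in> lists Y" using x by auto
  then obtain v where v: "v \<in> L" "ev v = ev (u @ [x])" using onto by blast
  have "pad_pair u v \<in> (\<lambda>(u, v). pad_pair u v) ` {(u, v). u \<in> L \<and> v \<in> L \<and> ev (u @ [x]) = ev v}"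
    using u v by force
  then have acc: "pad_pair u v \<in> lists ?S" "foldl (\<delta> x) (q0 x) (pad_pair u v) \<in> F x"
    unfolding multiplier[OF x] by auto
  define z1 z2 where "z1 = take (length u) (pad_pair u v)" and "z2 = drop (length u) (pad_pair u v)"
  have zz: "pad_pair u v = z1 @ z2" by (simp add: z1_def z2_def)
  have fst_take: "map fst (take (length u) (pad_pair u v)) = map Some u \<and>
      drop (length u) (pad_pair u v) = map (\<lambda>y. (None, Some y)) (drop (length u) v)" for u v :: "'x list"
    by (induction u v rule: pad_pair.induct) auto
  have f1: "map fst z1 = map Some u" using fst_take[of u v] by (simp add: z1_def)
  obtain e0 where e0: "z2 = map (\<lambda>y. (None, Some y)) e0" using fst_take[of u v] by (auto simp: z2_def)
  have in1: "z1 \<in> lists ?S" and in2: "z2 \<in> lists ?S" using acc(1) unfolding zz by auto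
  define q where "q = foldl (\<delta> x) (q0 x) z1"
  have qn: "q < ns x" unfolding q_def by (rule dfa_closed[OF \<delta>[OF x] q0[OF x] in1])
  have "snd ` set z1 \<subseteq> opts" using in1 by (auto simp: opts_def in_lists_conv_set)
  then have qS: "q \<in> set (foldl (post x) [q0 x] u)"
    unfolding q_def using q0[OF x] by (intro reach_post[OF x f1 _ uY]) auto
  obtain e where e: "set e \<subseteq> set z2" "length e < ns x" "foldl (\<delta> x) q e = foldl (\<delta> x) q z2"
    using dfa_short[OF \<delta>[OF x] qn in2] by blast
  define f where "f = map (\<lambda>p. the (snd p)) e"
  have ef: "e = map (\<lambda>y. (None, Some y)) f"
    using e(1) e0 unfolding f_def map_map by (intro map_idI[symmetric]) auto
  have "f \<in> lists Y" using e(1) in2 unfolding ef by (auto simp: in_lists_conv_set subset_iff)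
  moreover have "foldl (\<delta> x) q (map (\<lambda>y. (None, Some y)) f) \<in> F x"
    using e(3) acc(2) unfolding ef[symmetric] zz q_def by simp
  moreover have "length f \<le> K" using e(2) ns_le[OF x] by (simp add: f_def)
  ultimately have "good_ext x (foldl (post x) [q0 x] u) (q, f)" using qS qn by (simp add: good_ext_def)
  then show ?thesis by blast
qed

text \<open>The right pass, the extension and the left pass produce some accepted path whose first
  component spells \<open>u\<close>. Acceptance alone shows that this path is
  \<open>pad_pair u v\<close> for a correct \<open>v\<close>, independently of the choices
  made.\<close>

lemma run_multiply:
  assumes x: "x \<in> Y" and u: "u \<in> L" and a: "t0 i0 = Input x"
    and tape: "leftof t1 i1 []" "rightof t1 (i1 + 1) (map Input u)"
    and cont: "\<And>t1 i1 v. v \<in> L \<Longrightarrow> ev (u @ [x]) = ev v \<Longrightarrow> length v \<le> length u + K \<Longrightarrow> leftof t1 i1 [] \<Longrightarrow>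
      rightof t1 (i1 + 1) (map Input v) \<Longrightarrow> hw Scan (t0, i0 + 1) (t1, i1) N b"
  shows "hw Scan (t0, i0) (t1, i1) (N + 2 * length u + 2 * K + 4) b"
proof -
  let ?S = "insert None (Some ` Y) \<times> insert None (Some ` Y)"
  define S where "S = foldl (post x) [q0 x] u"
  define p where "p = (SOME p. good_ext x S p)"
  have ex: "\<exists>p. good_ext x S p" unfolding S_def by (rule ext_exists[OF x u])
  have g: "good_ext x S p" unfolding p_def using ex by (rule someI_ex)
  define q e where "q = fst p" and "e = snd p"
  have eY: "e \<in> lists Y" "length e \<le> K" and qS: "q \<in> set S" and acc: "foldl (\<delta> x) q (map (\<lambda>y. (None, Some y)) e) \<in> F x"
    using g by (auto simp: good_ext_def q_def e_def)
  have uY: "u \<in> lists Y" using u LY by blast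
  let ?z = "map (\<lambda>y. (None, Some y)) e :: ('x option \<times> 'x option) list"
  have sz: "map (\<lambda>p. sym (snd p)) ?z = map Input e" by simp
  have h1: "hw (Bwd x q) (t0, i0 + 1) (t1, i1) (N + length u + 1) b"
    if "leftof t1 i1 (rev (marks x [q0 x] u))" "rightof t1 (i1 + 1) (map Input e)" for t1 i1
  proof (rule run_Bwd)
    show "leftof t1 i1 (rev (marks x [q0 x] u))" by (rule that)
    show "rightof t1 (i1 + 1) (map (\<lambda>p. sym (snd p)) ?z)" unfolding sz by (rule that)
    show "q \<in> set (foldl (post x) [q0 x] u)" using qS by (simp add: S_def)
    show "set [q0 x] \<subseteq> {..<ns x}" using q0[OF x] by simp
    fix t1 i1 z'
    assume h: "leftof t1 i1 []" "path x [q0 x] u q z'" "rightof t1 (i1 + 1) (map (\<lambda>p. sym (snd p)) (z' @ ?z))"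
    have "fst ` set z' \<subseteq> opts"
    proof -
      have "fst ` set z' = Some ` set u" using h(2) by (metis list.set_map path_def)
      then show ?thesis using uY by (auto simp: opts_def in_lists_conv_set)
    qed
    then have "z' \<in> lists (opts \<times> opts)" using h(2) by (force simp: path_def in_lists_conv_set)
    moreover have "?z \<in> lists (opts \<times> opts)" using eY by (auto simp: opts_def in_lists_conv_set)
    ultimately have "z' @ ?z \<in> lists ?S" by (simp add: opts_def)
    moreover have "foldl (\<delta> x) (q0 x) (z' @ ?z) \<in> F x" using h(2) acc by (auto simp: path_def)
    ultimately have "z' @ ?z \<in> (\<lambda>(u, v). pad_pair u v) ` {(u, v). u \<in> L \<and> v \<in> L \<and> ev (u @ [x]) = ev v}"
      unfolding multiplier[OF x] by simp
    then obtain u' v where uv: "z' @ ?z = pad_pair u' v" "v \<in> L" "ev (u' @ [x]) = ev v" by auto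
    \<comment> \<open>Every first component of \<open>z'\<close> is a letter and those of the
      extension are padding, so the first word can only be \<open>u\<close>.\<close>
    have mf: "List.map_filter fst z' = u"
    proof -
      have "List.map_filter fst z' = List.map_filter id (map fst z')"
        by (induction z') (auto simp: List.map_filter_def)
      also have "\<dots> = List.map_filter id (map Some u)" using h(2) by (simp add: path_def)
      also have "\<dots> = u" by (induction u) (auto simp: List.map_filter_def)
      finally show ?thesis .
    qed
    have "List.map_filter fst (z' @ ?z) = u" using mf by (simp add: List.map_filter_def)
    then have u': "u' = u" unfolding uv(1) pad_pair_fst .
    have "length z' = length u" using h(2) by (metis length_map path_def)
    then have "length v \<le> length u + K" using arg_cong[OF uv(1), of length] eY(2) by (simp add: length_pad_pair)
    moreover have "rightof t1 (i1 + 1) (map Input v)"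
      using h(3) unfolding uv(1) sym_pad_pair rightof_blanks .
    ultimately show "hw Scan (t0, i0 + 1) (t1, i1) N b" using cont uv h(1) u' by blast
  qed
  have h2: "hw (Ext x [] q) (t0, i0 + 1) (t1, i1) (Suc (N + length u + 1 + length e)) b"
    if "leftof t1 (i1 - 1) (rev (map Input e) @ rev (marks x [q0 x] u))" "rightof t1 i1 []" for t1 i1
  proof (rule hw_step_keep[where s' = "Bwd x q" and ?m0.0 = Stay and ?m1.0 = Move_Left])
    have "hw (Bwd x q) (t0, i0 + 1) (t1, i1 - 1) (N + length u + 1 + length e) b"
    proof (rule run_Bwd_skip[where X = "rev (marks x [q0 x] u)" and r = "[]"])
      show "leftof t1 (i1 - 1) (map Input (rev e) @ rev (marks x [q0 x] u))" using that(1) by (simp add: rev_map)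
      show "rightof t1 (i1 - 1 + 1) (map Input [])" using that(2) by simp
      fix i1 assume "leftof t1 i1 (rev (marks x [q0 x] u))" "rightof t1 (i1 + 1) (map Input (e @ []))"
      then show "hw (Bwd x q) (t0, i0 + 1) (t1, i1) (N + length u + 1) b" by (intro h1) simp_all
    qed
    then show "hw (Bwd x q) (t0, i0 + 1 + shift Stay) (t1, i1 + shift Move_Left) (N + length u + 1 + length e) b" by simp
  qed simp_all
  have h3: "hw (Fwd x S) (t0, i0 + 1) (t1, i1) (Suc (Suc (N + length u + 1 + length e) + length e)) b"
    if "leftof t1 (i1 - 1) (rev (marks x [q0 x] u))" "rightof t1 i1 []" for t1 i1
  proof (rule hw_step_keep[where s' = "Ext x e q" and ?m0.0 = Stay and ?m1.0 = Stay])
    have "t1 i1 = Blank" using that(2) by (rule rightof_Nil)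
    then show "trans (Fwd x S) (t0 (i0 + 1)) (t1 i1) = (Ext x e q, [(t0 (i0 + 1), Stay), (t1 i1, Stay)])"
      using ex by (simp add: p_def q_def e_def)
    have "hw (Ext x e q) (t0, i0 + 1) (t1, i1) (Suc (N + length u + 1 + length e) + length e) b"
      by (rule run_Ext[OF that h2])
    then show "hw (Ext x e q) (t0, i0 + 1 + shift Stay) (t1, i1 + shift Stay) (Suc (N + length u + 1 + length e) + length e) b"
      by simp
  qed simp_all
  have "hw (Fwd x [q0 x]) (t0, i0 + 1) (t1, i1 + 1) (Suc (Suc (N + length u + 1 + length e) + length e) + length u) b"
  proof (rule run_Fwd[where X = "[]"])
    show "leftof t1 (i1 + 1 - 1) []" using tape(1) by simp
    show "rightof t1 (i1 + 1) (map Input u)" by (rule tape(2))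
    fix t1 i1 assume "leftof t1 (i1 - 1) (rev (marks x [q0 x] u) @ [])" "rightof t1 i1 []"
    then have "hw (Fwd x S) (t0, i0 + 1) (t1, i1) (Suc (Suc (N + length u + 1 + length e) + length e)) b"
      by (intro h3) simp_all
    then show "hw (Fwd x (foldl (post x) [q0 x] u)) (t0, i0 + 1) (t1, i1) (Suc (Suc (N + length u + 1 + length e) + length e)) b"
      by (simp add: S_def)
  qed
  then have "hw Scan (t0, i0) (t1, i1) (Suc (Suc (Suc (N + length u + 1 + length e) + length e) + length u)) b"
    by - (rule hw_step_keep[where s' = "Fwd x [q0 x]" and ?m0.0 = Move_Right and ?m1.0 = Move_Right], simp_all add: a)
  then show ?thesis using eY(2) by (elim hw_mono) simp
qed

lemma run_Fin:
  assumes "rightof t1 i1 (map Input u)"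
  shows "hw (Fin q) (t0, i0) (t1, i1) (length u + 1) (foldl \<delta>f q u \<in> Ff)"
  using assms
proof (induction u arbitrary: q i1)
  case Nil
  have b: "t1 i1 = Blank" using Nil rightof_Nil by simp
  have "hw (if q \<in> Ff then Acc else Rej) (t0, i0) (t1, i1) 0 (q \<in> Ff)" using hw_Acc hw_Rej by simp
  then have "hw (Fin q) (t0, i0) (t1, i1) (Suc 0) (q \<in> Ff)"
    by - (rule hw_step_keep[where s' = "if q \<in> Ff then Acc else Rej" and ?m0.0 = Stay and ?m1.0 = Stay], simp_all add: b)
  then show ?case by simp
next
  case (Cons y u)
  have b: "t1 i1 = Input y" and r: "rightof t1 (i1 + 1) (map Input u)" using Cons(2) by (auto simp: rightof_Cons)
  have "hw (Fin (\<delta>f q y)) (t0, i0) (t1, i1 + 1) (length u + 1) (foldl \<delta>f (\<delta>f q y) u \<in> Ff)"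
    by (rule Cons.IH[OF r])
  then have "hw (Fin q) (t0, i0) (t1, i1) (Suc (length u + 1)) (foldl \<delta>f (\<delta>f q y) u \<in> Ff)"
    by - (rule hw_step_keep[where s' = "Fin (\<delta>f q y)" and ?m0.0 = Stay and ?m1.0 = Move_Right], simp_all add: b)
  then show ?case by simp
qed

text \<open>One multiplication is linear in the current length, which is at most \<open>m\<close> in
  the beginning and grows by at most \<open>K\<close> per letter; the total is therefore quadratic
  in \<open>p\<close>.\<close>

definition cost :: "nat \<Rightarrow> nat \<Rightarrow> nat" where
  "cost m p = p * (2 * (m + K * p) + 2 * K + 4) + m + 2"

lemma run_Scan:
  assumes "u \<in> L" "w \<in> lists Y" "P \<in> lists Y" "ev u = ev w" "length u \<le> m"
    "rightof t0 i0 (map Input P)" "leftof t1 i1 []" "rightof t1 (i1 + 1) (map Input u)"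
  shows "hw Scan (t0, i0) (t1, i1) (cost m (length P)) (ev (w @ P) \<in> D)"
  using assms
proof (induction P arbitrary: u w m i0 t1 i1)
  case Nil
  have b: "t0 i0 = Blank" using Nil(6) rightof_Nil by simp
  have "u \<in> {u \<in> L. ev u \<in> D} \<longleftrightarrow> foldl \<delta>f qf u \<in> Ff" unfolding final using Nil(1) LY by auto
  then have "foldl \<delta>f qf u \<in> Ff \<longleftrightarrow> ev (w @ []) \<in> D" using Nil(1,4) by simp
  then have "hw (Fin qf) (t0, i0) (t1, i1 + 1) (length u + 1) (ev (w @ []) \<in> D)"
    using run_Fin[OF Nil(8), of qf t0 i0] by simp
  then have "hw Scan (t0, i0) (t1, i1) (Suc (length u + 1)) (ev (w @ []) \<in> D)"
    by - (rule hw_step_keep[where s' = "Fin qf" and ?m0.0 = Stay and ?m1.0 = Move_Right], simp_all add: b)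
  then show ?case using Nil(5) by (elim hw_mono) (simp add: cost_def)
next
  case (Cons x P)
  have a: "t0 i0 = Input x" and r: "rightof t0 (i0 + 1) (map Input P)" using Cons(7) by (auto simp: rightof_Cons)
  have x: "x \<in> Y" "P \<in> lists Y" using Cons(4) by auto
  have "hw Scan (t0, i0) (t1, i1) (cost (m + K) (length P) + 2 * length u + 2 * K + 4) (ev (w @ x # P) \<in> D)"
  proof (rule run_multiply[of x u t0 i0 t1 i1, OF x(1) Cons(2) a Cons(8,9)])
    fix t1 i1 v
    assume v: "v \<in> L" "ev (u @ [x]) = ev v" "length v \<le> length u + K" "leftof t1 i1 []" "rightof t1 (i1 + 1) (map Input v)"
    have "ev v = ev (w @ [x])" using ev_snoc[of u w x] v(2) Cons.prems x LY by auto
    then have "hw Scan (t0, i0 + 1) (t1, i1) (cost (m + K) (length P)) (ev ((w @ [x]) @ P) \<in> D)"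
      using v Cons.prems x r by (intro Cons.IH[of v]) auto
    then show "hw Scan (t0, i0 + 1) (t1, i1) (cost (m + K) (length P)) (ev (w @ x # P) \<in> D)" by simp
  qed
  moreover have "cost (m + K) (length P) + 2 * length u + 2 * K + 4 \<le> cost m (length (x # P))"
    using Cons(6) by (simp add: cost_def algebra_simps)
  ultimately show ?case by (rule hw_mono)
qed

theorem decides_quadratic:
  "\<exists>M C. decides M Y {w \<in> lists Y. ev w \<in> D} \<and> (\<forall>w\<in>lists Y. run_time M w \<le> C * ((length w)\<^sup>2 + 1))"
proof -
  define C where "C = 6 * K + 6 + 4 * length u0 + 10"
  have "decides M Y {w \<in> lists Y. ev w \<in> D} \<and> (\<forall>w\<in>lists Y. run_time M w \<le> C * ((length w)\<^sup>2 + 1))"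
  proof (rule decidesI[OF wf_M])
    fix w assume w: "w \<in> lists Y"
    let ?t = "\<lambda>i. if 0 \<le> i \<and> i < int (length w) then Input (w ! nat i) else Blank"
    have ic: "initial_config M w = (to_nat (Init u0), [(?t, 0), (\<lambda>_. Blank, 0)])"
      by (simp add: initial_config_def M_def compile_def)
    have uY: "u0 \<in> lists Y" using u0 LY by blast
    have h1: "hw Scan (?t, 0) (t1, i1) (cost (length u0) (length w)) (ev ([] @ w) \<in> D)"
      if "leftof t1 i1 []" "rightof t1 (i1 + 1) (map Input u0)" for t1 i1
      using that w u0 by (intro run_Scan[OF u0(1) _ w _ _ initial_rightof]) auto
    have h2: "hw (Init []) (?t, 0) (t1, i1) (Suc (cost (length u0) (length w) + length u0 + 1)) (ev ([] @ w) \<in> D)"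
      if "leftof t1 (i1 - 1) (rev (map Input u0) @ [])" "rightof t1 i1 []" for t1 i1
    proof -
      have "hw Rewind (?t, 0) (t1, i1 - 1) (cost (length u0) (length w) + length u0 + 1) (ev ([] @ w) \<in> D)"
      proof (rule run_Rewind[where r = "[]"])
        show "leftof t1 (i1 - 1) (map Input (rev u0))" using that(1) by (simp add: rev_map)
        show "rightof t1 (i1 - 1 + 1) (map Input [])" using that(2) by simp
        fix i1 assume "leftof t1 i1 []" "rightof t1 (i1 + 1) (map Input (u0 @ []))"
        then show "hw Scan (?t, 0) (t1, i1) (cost (length u0) (length w)) (ev ([] @ w) \<in> D)" by (intro h1) simp_all
      qed
      then show ?thesis
        by - (rule hw_step_keep[where s' = Rewind and ?m0.0 = Stay and ?m1.0 = Move_Left], simp_all)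
    qed
    have "hw (Init u0) (?t, 0) (\<lambda>_. Blank, 0) (Suc (cost (length u0) (length w) + length u0 + 1) + length u0) (ev ([] @ w) \<in> D)"
      by (rule run_Init[where X = "[]", OF _ _ h2]) (auto simp: leftof_def rightof_def)
    moreover have "Suc (cost (length u0) (length w) + length u0 + 1) + length u0 \<le> C * ((length w)\<^sup>2 + 1)"
    proof -
      have "length w \<le> (length w)\<^sup>2" by (cases "length w") (auto simp: power2_eq_square)
      then have a: "(2 * length u0 + 2 * K + 4) * length w \<le> (2 * length u0 + 2 * K + 4) * (length w)\<^sup>2" by (rule mult_le_mono2)
      have "Suc (cost (length u0) (length w) + length u0 + 1) + length u0 =
        (2 * length u0 + 2 * K + 4) * length w + 2 * K * (length w)\<^sup>2 + 3 * length u0 + 4"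
        by (simp add: cost_def algebra_simps power2_eq_square)
      also have "\<dots> \<le> C * ((length w)\<^sup>2 + 1)" using a unfolding C_def by (simp add: algebra_simps)
      finally show ?thesis .
    qed
    ultimately have "hw (Init u0) (?t, 0) (\<lambda>_. Blank, 0) (C * ((length w)\<^sup>2 + 1)) (ev ([] @ w) \<in> D)" by (rule hw_mono)
    then show "halts_within M (initial_config M w) (C * ((length w)\<^sup>2 + 1)) (w \<in> {w \<in> lists Y. ev w \<in> D})"
      unfolding ic hw_def using w by simp
  qed auto
  then show ?thesis by blast
qed

end

section \<open>Filtering one machine by another\<close>

text \<open>The input is translated by a finite-state transducer into inputs for two machines, each with
  its own tapes. The second machine is only run when the first one accepts.\<close>

datatype 'y comb_state = Copy nat "(bool \<times> 'y) list" | Turn bool | Rew bool | Run bool nat | CAcc | CRej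

instance comb_state :: (countable) countable
  by countable_datatype

definition stay :: "'x tape_symbol list \<Rightarrow> ('x tape_symbol \<times> head_move) list" where
  "stay ss = map (\<lambda>s. (s, Stay)) ss"

definition reads :: "'x tape list \<Rightarrow> 'x tape_symbol list" where
  "reads ts = map (\<lambda>(t, i). t i) ts"

definition apply_acts :: "'x tape list \<Rightarrow> ('x tape_symbol \<times> head_move) list \<Rightarrow> 'x tape list" where
  "apply_acts ts acts = map2 (\<lambda>(t, i) (s, m). (t(i := s), i + shift m)) ts acts"

lemma apply_stay [simp]: "apply_acts ts (stay (reads ts)) = ts"
  by (induction ts) (auto simp: apply_acts_def stay_def reads_def)

lemma apply_append:
  "length ts = length acts \<Longrightarrow> apply_acts (ts @ ts') (acts @ acts') = apply_acts ts acts @ apply_acts ts' acts'"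
  by (simp add: apply_acts_def)

lemma apply_Cons [simp]: "apply_acts ((t, i) # ts) ((s, m) # acts) = (t(i := s), i + shift m) # apply_acts ts acts"
  by (simp add: apply_acts_def)

lemma length_stay [simp]: "length (stay ss) = length ss"
  by (simp add: stay_def)

lemma length_reads [simp]: "length (reads ts) = length ts"
  by (simp add: reads_def)

lemma length_apply [simp]: "length ts = length acts \<Longrightarrow> length (apply_acts ts acts) = length ts"
  by (simp add: apply_acts_def)

lemma reads_append [simp]: "reads (ts @ ts') = reads ts @ reads ts'"
  by (simp add: reads_def)

lemma reads_Cons [simp]: "reads ((t, i) # ts) = t i # reads ts"
  by (simp add: reads_def)

lemma fst_stay: "fst ` set (stay ss) = set ss"
  by (force simp: stay_def)

lemma tm_step_apply:
  "\<not> halted M (q, ts) \<Longrightarrow> tm_step M (q, ts) =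
    (fst (transition M q (reads ts)), apply_acts ts (snd (transition M q (reads ts))))"
  by (simp add: tm_step_def reads_def apply_acts_def case_prod_beta Let_def)

text \<open>Symbols of the component machines become auxiliary symbols, distinct from the input
  letters. Only \<open>Blank\<close> is kept, so that untouched tapes of the combined machine are
  blank for the component as well.\<close>

fun enc :: "'y::countable tape_symbol \<Rightarrow> 'x tape_symbol" where
  "enc Blank = Blank"
| "enc s = Aux (to_nat s)"

fun dec :: "'x tape_symbol \<Rightarrow> 'y::countable tape_symbol" where
  "dec (Aux k) = from_nat k"
| "dec s = Blank"

lemma dec_enc [simp]: "dec (enc s) = s"
  by (cases s) auto

lemma enc_neq_Input [simp]: "enc s \<noteq> Input x" "Input x \<noteq> enc s"
  by (cases s; simp)+

lemma enc_eq_Blank [simp]: "enc s = Blank \<longleftrightarrow> s = Blank"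
  by (cases s) auto

definition enc_tape :: "'y::countable tape \<Rightarrow> 'x tape" where
  "enc_tape p = (\<lambda>i. enc (fst p i), snd p)"

definition enc_act :: "'y::countable tape_symbol \<times> head_move \<Rightarrow> 'x tape_symbol \<times> head_move" where
  "enc_act a = (enc (fst a), snd a)"

lemma reads_enc: "map dec (reads (map enc_tape ts)) = reads ts"
  by (auto simp: reads_def enc_tape_def)

lemma apply_enc:
  "length ts = length acts \<Longrightarrow> apply_acts (map enc_tape ts) (map enc_act acts) = map enc_tape (apply_acts ts acts)"
  by (induction ts acts rule: list_induct2) (auto simp: apply_acts_def enc_tape_def enc_act_def)

lemma decides_halts_within:
  assumes "decides M X D" "w \<in> lists X"
  shows "halts_within M (initial_config M w) (run_time M w) (w \<in> D)"
proof -
  have "\<exists>n. halted M (tm_run M w n)" and v: "fst (tm_run M w (run_time M w)) = accept_state M \<longleftrightarrow> w \<in> D"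
    using assms by (auto simp: decides_def)
  then have "halted M (tm_run M w (run_time M w))" unfolding run_time_def by (auto intro: LeastI_ex)
  then show ?thesis using v unfolding halts_within_def tm_run_def by blast
qed

text \<open>\<open>False\<close> indexes the fast machine and \<open>True\<close> the slow one. The
  transducer emits letters tagged by their addressee; an input on which it ends outside
  \<open>fin\<close> is rejected without running either machine.\<close>

locale machine_filter =
  fixes X :: "'x set" and nq :: nat and q0 :: nat and next_q :: "nat \<Rightarrow> 'x \<Rightarrow> nat"
    and out :: "nat \<Rightarrow> 'x \<Rightarrow> (bool \<times> 'y::countable) list" and fin :: "nat set"
    and mach :: "bool \<Rightarrow> 'y tm" and Y :: "bool \<Rightarrow> 'y set" and D :: "bool \<Rightarrow> 'y list set"
  assumes finite_X: "finite X" and finite_Y: "finite (Y c)" and q0: "q0 < nq"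
    and next_q: "q < nq \<Longrightarrow> x \<in> X \<Longrightarrow> next_q q x < nq"
    and out: "q < nq \<Longrightarrow> x \<in> X \<Longrightarrow> (c, y) \<in> set (out q x) \<Longrightarrow> y \<in> Y c"
    and dec_mach: "decides (mach c) (Y c) (D c)"
begin

definition kk :: "bool \<Rightarrow> nat" where "kk c = num_tapes (mach c)"

definition off :: "bool \<Rightarrow> nat" where "off c = (if c then 1 + kk False else 1)"

definition put :: "nat \<Rightarrow> ('x tape_symbol \<Rightarrow> 'x tape_symbol \<times> head_move) \<Rightarrow> 'x tape_symbol list \<Rightarrow> ('x tape_symbol \<times> head_move) list" where
  "put i f ss = stay (take i ss) @ f (ss ! i) # stay (drop (Suc i) ss)"

definition run_acts :: "bool \<Rightarrow> nat \<Rightarrow> 'x tape_symbol list \<Rightarrow> nat \<times> ('x tape_symbol \<times> head_move) list" where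
  "run_acts c p ss = (let r = transition (mach c) p (map dec (take (kk c) (drop (off c) ss))) in
     (fst r, stay (take (off c) ss) @ map enc_act (snd r) @ stay (drop (off c + kk c) ss)))"

text \<open>The guard in \<open>Run\<close> is there because the common alphabet is larger than that
  of a component, whose transitions are controlled only on its own symbols. By the invariant
  \<open>good\<close> it is satisfied in all simulated runs.\<close>

fun trans :: "'y comb_state \<Rightarrow> 'x tape_symbol list \<Rightarrow> 'y comb_state \<times> ('x tape_symbol \<times> head_move) list" where
  "trans (Copy q ((c, y) # l)) ss = (Copy q l, put (off c) (\<lambda>_. (enc (Input y), Move_Right)) ss)"
| "trans (Copy q []) ss = (case ss ! 0 of Input x \<Rightarrow> (Copy (next_q q x) (out q x), put 0 (\<lambda>s. (s, Move_Right)) ss)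
     | _ \<Rightarrow> (if q \<in> fin then Turn False else CRej, stay ss))"
| "trans (Turn c) ss = (Rew c, put (off c) (\<lambda>s. (s, Move_Left)) ss)"
| "trans (Rew c) ss = (if ss ! off c = Blank
     then (if c then Run False (start_state (mach False)) else Turn True, put (off c) (\<lambda>s. (s, Move_Right)) ss)
     else (Rew c, put (off c) (\<lambda>s. (s, Move_Left)) ss))"
| "trans (Run c p) ss =
     (if p = accept_state (mach c) then (if c then CAcc else Run True (start_state (mach True)), stay ss)
      else if p = reject_state (mach c) then (CRej, stay ss)
      else if set (map dec (take (kk c) (drop (off c) ss))) \<subseteq> tape_alphabet (mach c)
      then (Run c (fst (run_acts c p ss)), snd (run_acts c p ss)) else (CRej, stay ss))"
| "trans CAcc ss = (CRej, stay ss)"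
| "trans CRej ss = (CRej, stay ss)"

definition cmax :: nat where "cmax = (\<Sum>q<nq. \<Sum>x\<in>X. length (out q x))"

lemma length_out: "q < nq \<Longrightarrow> x \<in> X \<Longrightarrow> length (out q x) \<le> cmax"
proof -
  assume q: "q < nq" "x \<in> X"
  have "length (out q x) \<le> (\<Sum>x\<in>X. length (out q x))" using q finite_X by (intro member_le_sum) auto
  also have "\<dots> \<le> cmax" unfolding cmax_def using q by (intro member_le_sum[of q _ "\<lambda>q. \<Sum>x\<in>X. length (out q x)"]) auto
  finally show ?thesis .
qed

definition Pend :: "(bool \<times> 'y) list set" where
  "Pend = {l \<in> lists (Sigma UNIV Y). length l \<le> cmax}"

definition Q :: "'y comb_state set" where
  "Q = (\<lambda>(q, l). Copy q l) ` ({..<nq} \<times> Pend) \<union> range Turn \<union> range Rew \<union>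
     (\<lambda>(c, p). Run c p) ` (SIGMA c:UNIV. tm_states (mach c)) \<union> {CAcc, CRej}"

lemma mem_Q [simp]:
  "Copy q l \<in> Q \<longleftrightarrow> q < nq \<and> l \<in> Pend"
  "Turn c \<in> Q" "Rew c \<in> Q" "CAcc \<in> Q" "CRej \<in> Q"
  "Run c p \<in> Q \<longleftrightarrow> p \<in> tm_states (mach c)"
  unfolding Q_def by (auto simp: image_iff)

definition \<Gamma> :: "'x tape_symbol set" where
  "\<Gamma> = insert Blank (Input ` X) \<union> enc ` (tape_alphabet (mach False) \<union> tape_alphabet (mach True))"

definition k :: nat where "k = 1 + kk False + kk True"

definition M :: "'x tm" where
  "M = compile k Q \<Gamma> (Copy q0 []) CAcc CRej trans"

lemma wf_mach: "wf_tm (Y c) (mach c)"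
  using dec_mach by (simp add: decides_def)

lemma kk_pos: "1 \<le> kk c"
  using wf_mach[of c] by (simp add: wf_tm_def kk_def)

lemma finite_states: "finite (tm_states (mach c))" "finite (tape_alphabet (mach c))"
  using wf_mach[of c] by (simp_all add: wf_tm_def)

lemma enc_alphabet: "s \<in> tape_alphabet (mach c) \<Longrightarrow> enc s \<in> \<Gamma>"
  by (cases c) (auto simp: \<Gamma>_def)

lemma mach_alphabet: "Blank \<in> tape_alphabet (mach c)" "y \<in> Y c \<Longrightarrow> Input y \<in> tape_alphabet (mach c)"
  using wf_mach[of c] by (auto simp: wf_tm_def)

lemma mach_states: "start_state (mach c) \<in> tm_states (mach c)"
  using wf_mach[of c] by (auto simp: wf_tm_def)

lemma mach_trans:
  assumes "p \<in> tm_states (mach c)" "set ss \<subseteq> tape_alphabet (mach c)" "length ss = kk c"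
  shows "fst (transition (mach c) p ss) \<in> tm_states (mach c)" "length (snd (transition (mach c) p ss)) = kk c"
    "fst ` set (snd (transition (mach c) p ss)) \<subseteq> tape_alphabet (mach c)"
proof -
  have "ss \<in> lists (tape_alphabet (mach c))" using assms(2) by auto
  then show "fst (transition (mach c) p ss) \<in> tm_states (mach c)" "length (snd (transition (mach c) p ss)) = kk c"
    "fst ` set (snd (transition (mach c) p ss)) \<subseteq> tape_alphabet (mach c)"
    using wf_mach[of c] assms(1,3) unfolding wf_tm_def kk_def by blast+
qed

lemma off_less: "off c < k" "off c + kk c \<le> k"
  using kk_pos[of True] kk_pos[of c] by (auto simp: off_def k_def)

lemma put_ok:
  assumes "set ss \<subseteq> \<Gamma>" "length ss = k" "i < k" "fst (f (ss ! i)) \<in> \<Gamma>"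
  shows "length (put i f ss) = k \<and> fst ` set (put i f ss) \<subseteq> \<Gamma>"
  using assms by (auto simp: put_def image_Un fst_stay dest: in_set_takeD in_set_dropD)

lemma stay_ok: "set ss \<subseteq> \<Gamma> \<Longrightarrow> length ss = k \<Longrightarrow> length (stay ss) = k \<and> fst ` set (stay ss) \<subseteq> \<Gamma>"
  by (simp add: fst_stay)

lemma nth_ok: "set ss \<subseteq> \<Gamma> \<Longrightarrow> length ss = k \<Longrightarrow> i < k \<Longrightarrow> ss ! i \<in> \<Gamma>"
  by (auto simp: subset_iff)

lemma trans_closed:
  assumes s: "s \<in> Q" and ss: "set ss \<subseteq> \<Gamma>" "length ss = k"
  shows "fst (trans s ss) \<in> Q \<and> length (snd (trans s ss)) = k \<and> fst ` set (snd (trans s ss)) \<subseteq> \<Gamma>"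
proof (cases s)
  case (Copy q l)
  then have q: "q < nq" "l \<in> Pend" using s by auto
  show ?thesis
  proof (cases l)
    case Nil
    show ?thesis
    proof (cases "ss ! 0")
      case (Input x)
      have "ss ! 0 \<in> \<Gamma>" using ss by (intro nth_ok) (auto simp: k_def)
      then have x: "x \<in> X" using Input by (auto simp: \<Gamma>_def)
      have "out q x \<in> Pend" using out[OF q(1) x] length_out[OF q(1) x] by (auto simp: Pend_def in_lists_conv_set)
      then show ?thesis
        using Copy Nil Input q x next_q put_ok[OF ss, of 0 "\<lambda>s. (s, Move_Right)"] nth_ok[OF ss, of 0] by (simp add: k_def)
    qed (use Copy Nil stay_ok[OF ss] in auto)
  next
    case (Cons p l')
    obtain c y where p: "p = (c, y)" by (cases p)
    have y: "y \<in> Y c" "l' \<in> Pend" using q Cons p by (auto simp: Pend_def)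
    have "enc (Input y) \<in> \<Gamma>" by (rule enc_alphabet[OF mach_alphabet(2)[OF y(1)]])
    then show ?thesis
      using Copy Cons p q put_ok[OF ss off_less(1)[of c], of "\<lambda>_. (enc (Input y), Move_Right)"] y by (simp del: enc.simps)
  qed
next
  case (Turn c)
  then show ?thesis using put_ok[OF ss off_less(1)[of c], of "\<lambda>s. (s, Move_Left)"] nth_ok[OF ss off_less(1)] by simp
next
  case (Rew c)
  then show ?thesis
    using put_ok[OF ss off_less(1)[of c], of "\<lambda>s. (s, Move_Left)"] put_ok[OF ss off_less(1)[of c], of "\<lambda>s. (s, Move_Right)"]
      nth_ok[OF ss off_less(1), of c] mach_states by simp
next
  case (Run c p)
  then have p: "p \<in> tm_states (mach c)" using s by simp
  let ?m = "map dec (take (kk c) (drop (off c) ss)) :: 'y tape_symbol list"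
  have "length (snd (run_acts c p ss)) = k \<and> fst ` set (snd (run_acts c p ss)) \<subseteq> \<Gamma> \<and> fst (run_acts c p ss) \<in> tm_states (mach c)"
    if m: "set ?m \<subseteq> tape_alphabet (mach c)"
  proof -
    have l: "length ?m = kk c" using ss off_less(2)[of c] by simp
    note t = mach_trans[OF p m l]
    have "length (snd (run_acts c p ss)) = k"
      using t(2) ss off_less(2)[of c] by (simp add: run_acts_def Let_def)
    moreover have "fst ` set (snd (run_acts c p ss)) \<subseteq> \<Gamma>"
      using t(3) ss enc_alphabet[of _ c]
      by (auto simp: run_acts_def Let_def image_Un fst_stay enc_act_def dest: in_set_takeD in_set_dropD)
    ultimately show ?thesis using t(1) by (simp add: run_acts_def Let_def)
  qed
  note r = this
  show ?thesis
  proof (cases "p = accept_state (mach c)")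
    case True
    then show ?thesis using Run stay_ok[OF ss] mach_states by simp
  next
    case na: False
    show ?thesis
    proof (cases "p = reject_state (mach c)")
      case True
      then show ?thesis using Run na stay_ok[OF ss] by simp
    next
      case nr: False
      have e: "trans s ss = (if set ?m \<subseteq> tape_alphabet (mach c)
        then (Run c (fst (run_acts c p ss)), snd (run_acts c p ss)) else (CRej, stay ss))"
        unfolding Run trans.simps if_not_P[OF na] if_not_P[OF nr] ..
      show ?thesis unfolding e using r stay_ok[OF ss]
        by (cases "set ?m \<subseteq> tape_alphabet (mach c)") (simp_all del: set_map)
    qed
  qed
qed (use stay_ok[OF ss] in auto)

lemma wf_M: "wf_tm X M"
  unfolding M_def
proof (rule wf_compile)
  have "finite Pend" unfolding Pend_def using finite_Y by (intro finite_bounded_lists finite_SigmaI) auto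
  then show "finite Q" unfolding Q_def using finite_states by (intro finite_UnI finite_imageI finite_cartesian_product finite_SigmaI) auto
  show "finite \<Gamma>" unfolding \<Gamma>_def using finite_X finite_states by simp
  show "{Copy q0 [], CAcc, CRej} \<subseteq> Q" using q0 by (auto simp: Pend_def)
  show "fst (trans s ss) \<in> Q \<and> length (snd (trans s ss)) = k \<and> fst ` set (snd (trans s ss)) \<subseteq> \<Gamma>"
    if "s \<in> Q" "ss \<in> lists \<Gamma>" "length ss = k" for s ss
    using that by (intro trans_closed) (auto simp: in_lists_conv_set)
qed (auto simp: \<Gamma>_def k_def)

definition hw :: "'y comb_state \<Rightarrow> 'x tape list \<Rightarrow> nat \<Rightarrow> bool \<Rightarrow> bool" where
  "hw s ts N b \<longleftrightarrow> halts_within M (to_nat s, ts) N b"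

lemma hw_mono: "hw s ts N b \<Longrightarrow> N \<le> N' \<Longrightarrow> hw s ts N' b"
  unfolding hw_def by (rule halts_within_mono)

lemma hw_step:
  assumes "trans s (reads ts) = (s', acts)" "s \<noteq> CAcc" "s \<noteq> CRej" "hw s' (apply_acts ts acts) N b"
  shows "hw s ts (Suc N) b"
  unfolding hw_def
proof (rule halts_within_step)
  have "\<not> halted M (to_nat s, ts)" using assms(2,3) by (simp add: M_def halted_compile)
  from tm_step_apply[OF this] have "tm_step M (to_nat s, ts) = (to_nat s', apply_acts ts acts)"
    using assms(1) by (simp add: M_def compile_def)
  then show "halts_within M (tm_step M (to_nat s, ts)) N b" using assms(4) by (simp add: hw_def)
qed simp

lemma hw_CAcc: "hw CAcc ts N True"
  unfolding hw_def M_def by (rule halts_within_halted) (simp_all add: halted_compile)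

lemma hw_CRej: "hw CRej ts N False"
  unfolding hw_def M_def by (rule halts_within_halted) (simp_all add: halted_compile)

lemma apply_put:
  assumes "length pre = i"
  shows "apply_acts (pre @ (t, j) # suf) (put i f (reads (pre @ (t, j) # suf))) =
    pre @ (t(j := fst (f (t j))), j + shift (snd (f (t j)))) # suf"
proof -
  have "put i f (reads (pre @ (t, j) # suf)) = stay (reads pre) @ f (t j) # stay (reads suf)"
    using assms by (simp add: put_def nth_append)
  then show ?thesis by (simp add: apply_append) (metis apply_Cons apply_stay prod.collapse)
qed

lemma apply_put0:
  "apply_acts ((t, j) # suf) (put 0 f (reads ((t, j) # suf))) = (t(j := fst (f (t j))), j + shift (snd (f (t j)))) # suf"
  using apply_put[of "[]" 0 t j suf f] by simp

lemma reads_nth: "length pre = i \<Longrightarrow> reads (pre @ (t, j) # suf) ! i = t j"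
  by (simp add: nth_append)

section \<open>Simulating one component machine\<close>

definition good :: "bool \<Rightarrow> nat \<Rightarrow> 'y tape list \<Rightarrow> bool" where
  "good c p ts \<longleftrightarrow> p \<in> tm_states (mach c) \<and> length ts = kk c \<and> (\<forall>t\<in>set ts. \<forall>j. fst t j \<in> tape_alphabet (mach c))"

lemma good_reads: "good c p ts \<Longrightarrow> set (reads ts) \<subseteq> tape_alphabet (mach c)"
  by (force simp: good_def reads_def)

lemma good_apply:
  assumes "good c p ts" "p' \<in> tm_states (mach c)" "length acts = kk c" "fst ` set acts \<subseteq> tape_alphabet (mach c)"
  shows "good c p' (apply_acts ts acts)"
proof -
  have l: "length ts = length acts" using assms by (simp add: good_def)
  have "fst t j \<in> tape_alphabet (mach c)" if tin: "t \<in> set (apply_acts ts acts)" for t j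
  proof -
    obtain i where "i < length (apply_acts ts acts)" and t: "t = apply_acts ts acts ! i"
      using tin unfolding in_set_conv_nth by blast
    then have i: "i < length ts" using l by simp
    have "ts ! i \<in> set ts" "acts ! i \<in> set acts" using i l by simp_all
    then have "fst (ts ! i) j \<in> tape_alphabet (mach c)" "fst (acts ! i) \<in> tape_alphabet (mach c)"
      using assms(1,4) unfolding good_def by blast+
    then show ?thesis using i l unfolding t by (simp add: apply_acts_def case_prod_beta)
  qed
  then show ?thesis using assms l by (simp add: good_def)
qed

text \<open>The tapes of the component sit between \<open>pre\<close> and \<open>suf\<close>, which
  its steps leave alone. After acceptance the contents of these tapes are arbitrary; only their
  number is passed on.\<close>

lemma run_mach:
  assumes "good c p ts" "length pre = off c"
    and "halted (mach c) ((tm_step (mach c) ^^ n) (p, ts))" "fst ((tm_step (mach c) ^^ n) (p, ts)) = accept_state (mach c) \<longleftrightarrow> b1"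
    and "\<And>ts'. length ts' = kk c \<Longrightarrow> b1 \<Longrightarrow> hw (if c then CAcc else Run True (start_state (mach True))) (pre @ ts' @ suf) N b"
    and "\<not> b1 \<Longrightarrow> \<not> b"
  shows "hw (Run c p) (pre @ map enc_tape ts @ suf) (N + n + 1) b"
  using assms(1,3,4)
proof (induction n arbitrary: p ts)
  case 0
  have l: "length ts = kk c" using 0 by (simp add: good_def)
  have ne: "accept_state (mach c) \<noteq> reject_state (mach c)" using wf_mach[of c] by (simp add: wf_tm_def)
  show ?case
  proof (cases b1)
    case True
    then have p: "p = accept_state (mach c)" using 0 by simp
    have "hw (Run c p) (pre @ map enc_tape ts @ suf) (Suc N) b"
    proof (rule hw_step)
      show "trans (Run c p) (reads (pre @ map enc_tape ts @ suf)) =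
        (if c then CAcc else Run True (start_state (mach True)), stay (reads (pre @ map enc_tape ts @ suf)))"
        using p by simp
      show "hw (if c then CAcc else Run True (start_state (mach True)))
        (apply_acts (pre @ map enc_tape ts @ suf) (stay (reads (pre @ map enc_tape ts @ suf)))) N b"
        unfolding apply_stay using assms(5) True l by simp
    qed simp_all
    then show ?thesis by simp
  next
    case False
    then have p: "p = reject_state (mach c)" "p \<noteq> accept_state (mach c)" using 0 ne by (auto simp: halted_def)
    have "hw (Run c p) (pre @ map enc_tape ts @ suf) (Suc N) False"
      using p by (intro hw_step[where s' = CRej and acts = "stay (reads (pre @ map enc_tape ts @ suf))"]) (simp_all add: hw_CRej)
    then show ?thesis using assms(6) False by simp
  qed
next
  case (Suc n)
  have l: "length ts = kk c" and p: "p \<in> tm_states (mach c)" using Suc(2) by (auto simp: good_def)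
  show ?case
  proof (cases "halted (mach c) (p, ts)")
    case True
    then have e: "(tm_step (mach c) ^^ m) (p, ts) = (p, ts)" for m by (rule halted_funpow)
    have "hw (Run c p) (pre @ map enc_tape ts @ suf) (N + n + 1) b"
      using Suc(3,4) unfolding e by (intro Suc.IH[OF Suc(2)]) (simp_all add: e)
    then show ?thesis by (rule hw_mono) simp
  next
    case False
    define r where "r = transition (mach c) p (reads ts)"
    have st: "tm_step (mach c) (p, ts) = (fst r, apply_acts ts (snd r))"
      unfolding r_def by (rule tm_step_apply[OF False])
    note mt = mach_trans[OF p good_reads[OF Suc(2)], unfolded length_reads, OF l, folded r_def]
    have g: "good c (fst r) (apply_acts ts (snd r))" by (rule good_apply[OF Suc(2) mt])
    have h: "hw (Run c (fst r)) (pre @ map enc_tape (apply_acts ts (snd r)) @ suf) (N + n + 1) b"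
      using Suc(3,4) st by (intro Suc.IH[OF g]) (simp_all add: funpow_Suc_right del: funpow.simps)
    have mid: "map dec (take (kk c) (drop (off c) (reads (pre @ map enc_tape ts @ suf)))) = reads ts"
      using assms(2) l by (simp add: reads_enc)
    have ra: "run_acts c p (reads (pre @ map enc_tape ts @ suf)) =
      (fst r, stay (reads pre) @ map enc_act (snd r) @ stay (reads suf))"
      unfolding run_acts_def mid r_def[symmetric] Let_def using assms(2) l by simp
    have "hw (Run c p) (pre @ map enc_tape ts @ suf) (Suc (N + n + 1)) b"
    proof (rule hw_step)
      have "p \<noteq> accept_state (mach c)" "p \<noteq> reject_state (mach c)" using False by (auto simp: halted_def)
      then show "trans (Run c p) (reads (pre @ map enc_tape ts @ suf)) =
        (Run c (fst r), stay (reads pre) @ map enc_act (snd r) @ stay (reads suf))"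
        using good_reads[OF Suc(2)] mid ra by simp
      have "apply_acts (pre @ map enc_tape ts @ suf) (stay (reads pre) @ map enc_act (snd r) @ stay (reads suf)) =
        pre @ map enc_tape (apply_acts ts (snd r)) @ suf"
        using l mt(2) by (simp add: apply_append apply_enc)
      then show "hw (Run c (fst r)) (apply_acts (pre @ map enc_tape ts @ suf)
          (stay (reads pre) @ map enc_act (snd r) @ stay (reads suf))) (N + n + 1) b"
        using h by simp
    qed simp_all
    then show ?thesis by simp
  qed
qed

section \<open>Distributing the translated input over the tapes\<close>

definition written :: "'y list \<Rightarrow> int \<Rightarrow> 'x tape_symbol" where
  "written v = (\<lambda>i. if 0 \<le> i \<and> i < int (length v) then enc (Input (v ! nat i)) else Blank)"

lemma written_snoc: "(written v)(int (length v) := enc (Input y)) = written (v @ [y])"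
  by (auto simp: written_def nth_append fun_eq_iff)

definition blanks :: "bool \<Rightarrow> 'x tape list" where
  "blanks c = replicate (kk c - 1) (\<lambda>_. Blank, 0)"

lemma initial_written:
  "map enc_tape (snd (initial_config (mach c) v)) = (written v, 0) # blanks c"
  by (auto simp: initial_config_def enc_tape_def written_def blanks_def kk_def)

lemma good_initial: "v \<in> lists (Y c) \<Longrightarrow> good c (start_state (mach c)) (snd (initial_config (mach c) v))"
  using kk_pos[of c] mach_states mach_alphabet[where c = c]
  by (auto simp: good_def initial_config_def kk_def in_lists_conv_set split: if_splits)

definition layout :: "'x tape \<Rightarrow> 'y list \<Rightarrow> int \<Rightarrow> 'y list \<Rightarrow> int \<Rightarrow> 'x tape list" where
  "layout p v1 j1 v2 j2 = p # (written v1, j1) # blanks False @ (written v2, j2) # blanks True"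

lemma layout_False: "layout p v1 j1 v2 j2 = [p] @ (written v1, j1) # (blanks False @ (written v2, j2) # blanks True)"
  by (simp add: layout_def)

lemma layout_True: "layout p v1 j1 v2 j2 = (p # (written v1, j1) # blanks False) @ (written v2, j2) # blanks True"
  by (simp add: layout_def)

lemma length_pre: "length [p] = off False" "length (p # (t, j) # blanks False) = off True"
  using kk_pos[of False] by (simp_all add: off_def blanks_def)

definition proj :: "bool \<Rightarrow> (bool \<times> 'y) list \<Rightarrow> 'y list" where
  "proj c l = map snd (filter (\<lambda>p. fst p = c) l)"

lemma run_pending:
  assumes "hw (Copy q []) (layout p (v1 @ proj False l) (int (length (v1 @ proj False l)))
      (v2 @ proj True l) (int (length (v2 @ proj True l)))) N b"
  shows "hw (Copy q l) (layout p v1 (int (length v1)) v2 (int (length v2))) (N + length l) b"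
  using assms
proof (induction l arbitrary: v1 v2)
  case Nil
  then show ?case by (simp add: proj_def)
next
  case (Cons a l)
  obtain c y where a: "a = (c, y)" by (cases a)
  show ?case
  proof (cases c)
    case False
    have "hw (Copy q l) (layout p (v1 @ [y]) (int (length (v1 @ [y]))) v2 (int (length v2))) (N + length l) b"
      using Cons(2) False by (intro Cons.IH) (simp add: a proj_def)
    moreover have "apply_acts (layout p v1 (int (length v1)) v2 (int (length v2)))
        (put (off False) (\<lambda>_. (enc (Input y), Move_Right)) (reads (layout p v1 (int (length v1)) v2 (int (length v2))))) =
      layout p (v1 @ [y]) (int (length (v1 @ [y]))) v2 (int (length v2))"
      unfolding layout_False apply_put[OF length_pre(1)] fst_conv snd_conv written_snoc by (simp add: add.commute)
    ultimately have "hw (Copy q (a # l)) (layout p v1 (int (length v1)) v2 (int (length v2))) (Suc (N + length l)) b"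
      using False by (intro hw_step[where s' = "Copy q l" and acts = "put (off False) (\<lambda>_. (enc (Input y), Move_Right)) (reads (layout p v1 (int (length v1)) v2 (int (length v2))))"]) (simp_all add: a del: enc.simps)
    then show ?thesis by simp
  next
    case True
    have "hw (Copy q l) (layout p v1 (int (length v1)) (v2 @ [y]) (int (length (v2 @ [y])))) (N + length l) b"
      using Cons(2) True by (intro Cons.IH) (simp add: a proj_def)
    moreover have "apply_acts (layout p v1 (int (length v1)) v2 (int (length v2)))
        (put (off True) (\<lambda>_. (enc (Input y), Move_Right)) (reads (layout p v1 (int (length v1)) v2 (int (length v2))))) =
      layout p v1 (int (length v1)) (v2 @ [y]) (int (length (v2 @ [y])))"
      unfolding layout_True apply_put[OF length_pre(2)] fst_conv snd_conv written_snoc by (simp add: add.commute)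
    ultimately have "hw (Copy q (a # l)) (layout p v1 (int (length v1)) v2 (int (length v2))) (Suc (N + length l)) b"
      using True by (intro hw_step[where s' = "Copy q l" and acts = "put (off True) (\<lambda>_. (enc (Input y), Move_Right)) (reads (layout p v1 (int (length v1)) v2 (int (length v2))))"]) (simp_all add: a del: enc.simps)
    then show ?thesis by simp
  qed
qed

fun emit :: "nat \<Rightarrow> 'x list \<Rightarrow> (bool \<times> 'y) list" where
  "emit q [] = []"
| "emit q (x # w) = out q x @ emit (next_q q x) w"

lemma length_emit: "q < nq \<Longrightarrow> w \<in> lists X \<Longrightarrow> length (emit q w) \<le> cmax * length w"
proof (induction w arbitrary: q)
  case (Cons x w)
  then have x: "x \<in> X" "w \<in> lists X" by auto
  have "length (emit (next_q q x) w) \<le> cmax * length w" by (rule Cons.IH[OF next_q[OF Cons(2) x(1)] x(2)])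
  then show ?case using length_out[OF Cons(2) x(1)] by simp
qed simp

lemma emit_lists: "q < nq \<Longrightarrow> w \<in> lists X \<Longrightarrow> proj c (emit q w) \<in> lists (Y c)"
proof (induction w arbitrary: q)
  case (Cons x w)
  then have x: "x \<in> X" "w \<in> lists X" by auto
  have "proj c (emit (next_q q x) w) \<in> lists (Y c)" by (rule Cons.IH[OF next_q[OF Cons(2) x(1)] x(2)])
  moreover have "proj c (out q x) \<in> lists (Y c)" using out[OF Cons(2) x(1)] by (auto simp: proj_def)
  ultimately show ?case by (simp add: proj_def)
qed (simp add: proj_def)

lemma proj_append: "proj c (l @ l') = proj c l @ proj c l'"
  by (simp add: proj_def)

lemma run_copy:
  assumes "rightof t0 i0 (map Input w)" "w \<in> lists X" "q < nq"
    and "\<And>i0. t0 i0 = Blank \<Longrightarrow> hw (Copy (foldl next_q q w) []) (layout (t0, i0) (v1 @ proj False (emit q w)) (int (length (v1 @ proj False (emit q w))))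
      (v2 @ proj True (emit q w)) (int (length (v2 @ proj True (emit q w))))) N b"
  shows "hw (Copy q []) (layout (t0, i0) v1 (int (length v1)) v2 (int (length v2))) (N + (cmax + 1) * length w) b"
  using assms
proof (induction w arbitrary: i0 q v1 v2)
  case Nil
  then show ?case using rightof_Nil[of t0 i0] by (simp add: proj_def)
next
  case (Cons x w)
  have a: "t0 i0 = Input x" and r: "rightof t0 (i0 + 1) (map Input w)" using Cons(2) by (auto simp: rightof_Cons)
  have x: "x \<in> X" "w \<in> lists X" using Cons(3) by auto
  let ?v1 = "v1 @ proj False (out q x)" and ?v2 = "v2 @ proj True (out q x)"
  have "hw (Copy (next_q q x) []) (layout (t0, i0 + 1) ?v1 (int (length ?v1)) ?v2 (int (length ?v2))) (N + (cmax + 1) * length w) b"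
    using r x next_q[OF Cons(4) x(1)] Cons(5) by (intro Cons.IH) (simp_all add: proj_append)
  then have "hw (Copy (next_q q x) (out q x)) (layout (t0, i0 + 1) v1 (int (length v1)) v2 (int (length v2))) (N + (cmax + 1) * length w + length (out q x)) b"
    by (rule run_pending)
  moreover have "apply_acts (layout (t0, i0) v1 (int (length v1)) v2 (int (length v2))) (put 0 (\<lambda>s. (s, Move_Right)) (reads (layout (t0, i0) v1 (int (length v1)) v2 (int (length v2))))) =
    layout (t0, i0 + 1) v1 (int (length v1)) v2 (int (length v2))"
    unfolding layout_def by (subst apply_put0) simp
  ultimately have "hw (Copy q []) (layout (t0, i0) v1 (int (length v1)) v2 (int (length v2))) (Suc (N + (cmax + 1) * length w + length (out q x))) b"
    by - (rule hw_step[where s' = "Copy (next_q q x) (out q x)" and acts = "put 0 (\<lambda>s. (s, Move_Right)) (reads (layout (t0, i0) v1 (int (length v1)) v2 (int (length v2))))"],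
      simp_all add: a layout_def)
  then show ?case using length_out[OF Cons(4) x(1)] by (elim hw_mono) simp
qed

text \<open>The shift of the head by one makes the empty word a regular case, in which the head
  already stands on the blank at position -1.\<close>

lemma run_rewind:
  assumes "length pre = off c" "n \<le> length v"
    and "hw (if c then Run False (start_state (mach False)) else Turn True) (pre @ (written v, 0) # suf) N b"
  shows "hw (Rew c) (pre @ (written v, int n - 1) # suf) (N + n + 1) b"
  using assms(2)
proof (induction n)
  case 0
  have ap: "apply_acts (pre @ (written v, - 1) # suf) (put (off c) (\<lambda>s. (s, Move_Right)) (reads (pre @ (written v, - 1) # suf))) = pre @ (written v, 0) # suf"
    using apply_put[OF assms(1), of "written v" "- 1" suf "\<lambda>s. (s, Move_Right)"] by simp
  have "hw (Rew c) (pre @ (written v, - 1) # suf) (Suc N) b"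
  proof (rule hw_step)
    show "trans (Rew c) (reads (pre @ (written v, - 1) # suf)) = (if c then Run False (start_state (mach False)) else Turn True,
        put (off c) (\<lambda>s. (s, Move_Right)) (reads (pre @ (written v, - 1) # suf)))"
      using reads_nth[OF assms(1), of "written v" "- 1" suf] by (simp add: written_def)
    show "hw (if c then Run False (start_state (mach False)) else Turn True)
      (apply_acts (pre @ (written v, - 1) # suf) (put (off c) (\<lambda>s. (s, Move_Right)) (reads (pre @ (written v, - 1) # suf)))) N b"
      unfolding ap by (rule assms(3))
  qed simp_all
  then show ?case by simp
next
  case (Suc n)
  have nb: "written v (int n) \<noteq> Blank" using Suc(2) by (simp add: written_def)
  have ap: "apply_acts (pre @ (written v, int n) # suf) (put (off c) (\<lambda>s. (s, Move_Left)) (reads (pre @ (written v, int n) # suf))) = pre @ (written v, int n - 1) # suf"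
    using apply_put[OF assms(1), of "written v" "int n" suf "\<lambda>s. (s, Move_Left)"] by simp
  have "hw (Rew c) (pre @ (written v, int n) # suf) (Suc (N + n + 1)) b"
  proof (rule hw_step)
    show "trans (Rew c) (reads (pre @ (written v, int n) # suf)) = (Rew c, put (off c) (\<lambda>s. (s, Move_Left)) (reads (pre @ (written v, int n) # suf)))"
      using nb reads_nth[OF assms(1), of "written v" "int n" suf] by simp
    show "hw (Rew c) (apply_acts (pre @ (written v, int n) # suf) (put (off c) (\<lambda>s. (s, Move_Left)) (reads (pre @ (written v, int n) # suf)))) (N + n + 1) b"
      unfolding ap using Suc by simp
  qed simp_all
  then show ?case by simp
qed

lemma run_turn:
  assumes "length pre = off c"
    and "hw (if c then Run False (start_state (mach False)) else Turn True) (pre @ (written v, 0) # suf) N b"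
  shows "hw (Turn c) (pre @ (written v, int (length v)) # suf) (N + length v + 2) b"
proof -
  have ap: "apply_acts (pre @ (written v, int (length v)) # suf) (put (off c) (\<lambda>s. (s, Move_Left)) (reads (pre @ (written v, int (length v)) # suf))) = pre @ (written v, int (length v) - 1) # suf"
    using apply_put[OF assms(1), of "written v" "int (length v)" suf "\<lambda>s. (s, Move_Left)"] by simp
  have "hw (Turn c) (pre @ (written v, int (length v)) # suf) (Suc (N + length v + 1)) b"
  proof (rule hw_step)
    show "trans (Turn c) (reads (pre @ (written v, int (length v)) # suf)) = (Rew c, put (off c) (\<lambda>s. (s, Move_Left)) (reads (pre @ (written v, int (length v)) # suf)))"
      by simp
    show "hw (Rew c) (apply_acts (pre @ (written v, int (length v)) # suf) (put (off c) (\<lambda>s. (s, Move_Left)) (reads (pre @ (written v, int (length v)) # suf)))) (N + length v + 1) b"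
      unfolding ap by (rule run_rewind[OF assms(1) _ assms(2)]) simp
  qed simp_all
  then show ?thesis by simp
qed

definition image_word :: "bool \<Rightarrow> 'x list \<Rightarrow> 'y list" where
  "image_word c w = proj c (emit q0 w)"

definition total_time :: "'x list \<Rightarrow> nat" where
  "total_time w = (if foldl next_q q0 w \<in> fin then run_time (mach False) (image_word False w) +
     (if image_word False w \<in> D False then run_time (mach True) (image_word True w) else 0) else 0)"

lemma run_machines:
  assumes v: "v1 \<in> lists (Y False)" "v2 \<in> lists (Y True)"
  shows "hw (Run False (start_state (mach False))) (layout p v1 0 v2 0)
    (run_time (mach False) v1 + (if v1 \<in> D False then run_time (mach True) v2 else 0) + 2) (v1 \<in> D False \<and> v2 \<in> D True)"
proof -
  obtain n1 where n1: "n1 \<le> run_time (mach False) v1" "halted (mach False) ((tm_step (mach False) ^^ n1) (initial_config (mach False) v1))"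
    "fst ((tm_step (mach False) ^^ n1) (initial_config (mach False) v1)) = accept_state (mach False) \<longleftrightarrow> v1 \<in> D False"
    using decides_halts_within[OF dec_mach v(1)] unfolding halts_within_def by blast
  obtain n2 where n2: "n2 \<le> run_time (mach True) v2" "halted (mach True) ((tm_step (mach True) ^^ n2) (initial_config (mach True) v2))"
    "fst ((tm_step (mach True) ^^ n2) (initial_config (mach True) v2)) = accept_state (mach True) \<longleftrightarrow> v2 \<in> D True"
    using decides_halts_within[OF dec_mach v(2)] unfolding halts_within_def by blast
  have ic: "initial_config (mach c) u = (start_state (mach c), snd (initial_config (mach c) u))" for c u
    by (simp add: initial_config_def)
  let ?N = "if v1 \<in> D False then n2 + 1 else 0"
  have "hw (Run False (start_state (mach False))) ([p] @ map enc_tape (snd (initial_config (mach False) v1)) @ map enc_tape (snd (initial_config (mach True) v2)))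
    (?N + n1 + 1) (v1 \<in> D False \<and> v2 \<in> D True)"
  proof (rule run_mach[OF good_initial[OF v(1)] length_pre(1)])
    show "halted (mach False) ((tm_step (mach False) ^^ n1) (start_state (mach False), snd (initial_config (mach False) v1)))"
      using n1(2) ic by metis
    show "(fst ((tm_step (mach False) ^^ n1) (start_state (mach False), snd (initial_config (mach False) v1))) = accept_state (mach False)) = (v1 \<in> D False)"
      using n1(3) ic by metis
    fix ts' :: "'x tape list" assume ts': "length ts' = kk False" and D1: "v1 \<in> D False"
    have "hw (Run True (start_state (mach True))) ((p # ts') @ map enc_tape (snd (initial_config (mach True) v2)) @ []) (0 + n2 + 1) (v2 \<in> D True)"
    proof (rule run_mach[OF good_initial[OF v(2)]])
      show "length (p # ts') = off True" using ts' by (simp add: off_def)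
      show "halted (mach True) ((tm_step (mach True) ^^ n2) (start_state (mach True), snd (initial_config (mach True) v2)))"
        using n2(2) ic by metis
      show "(fst ((tm_step (mach True) ^^ n2) (start_state (mach True), snd (initial_config (mach True) v2))) = accept_state (mach True)) = (v2 \<in> D True)"
        using n2(3) ic by metis
    qed (auto simp: hw_CAcc)
    then show "hw (if False then CAcc else Run True (start_state (mach True))) ([p] @ ts' @ map enc_tape (snd (initial_config (mach True) v2))) ?N (v1 \<in> D False \<and> v2 \<in> D True)"
      using D1 by simp
  qed simp
  then have "hw (Run False (start_state (mach False))) (layout p v1 0 v2 0) (?N + n1 + 1) (v1 \<in> D False \<and> v2 \<in> D True)"
    unfolding initial_written layout_def by simp
  then show ?thesis using n1(1) n2(1) by (elim hw_mono) auto
qed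

theorem filter_decides:
  "\<exists>C. decides M X {w \<in> lists X. foldl next_q q0 w \<in> fin \<and> image_word False w \<in> D False \<and> image_word True w \<in> D True} \<and>
    (\<forall>w\<in>lists X. run_time M w \<le> C * (length w + 1) + total_time w)"
proof -
  define C where "C = 3 * cmax + 10"
  have "decides M X {w \<in> lists X. foldl next_q q0 w \<in> fin \<and> image_word False w \<in> D False \<and> image_word True w \<in> D True} \<and>
    (\<forall>w\<in>lists X. run_time M w \<le> C * (length w + 1) + total_time w)"
  proof (rule decidesI[OF wf_M])
    fix w assume w: "w \<in> lists X"
    let ?t = "\<lambda>i. if 0 \<le> i \<and> i < int (length w) then Input (w ! nat i) else Blank"
    let ?v1 = "image_word False w" and ?v2 = "image_word True w"
    let ?b = "foldl next_q q0 w \<in> fin \<and> ?v1 \<in> D False \<and> ?v2 \<in> D True"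
    have v: "?v1 \<in> lists (Y False)" "?v2 \<in> lists (Y True)"
      unfolding image_word_def by (rule emit_lists[OF q0 w])+
    have lv: "length ?v1 + length ?v2 \<le> 2 * (cmax * length w)"
      using length_emit[OF q0 w] length_filter_le[of "\<lambda>p. fst p = False" "emit q0 w"] length_filter_le[of "\<lambda>p. fst p = True" "emit q0 w"]
      unfolding image_word_def proj_def length_map by linarith
    have wr: "written [] = (\<lambda>_. Blank)" by (simp add: written_def fun_eq_iff)
    have rep: "replicate (kk False + kk True) (\<lambda>_. Blank, 0) = (written [], 0) # blanks False @ (written [], 0) # blanks True"
    proof -
      obtain a b where "kk False = Suc a" "kk True = Suc b" using kk_pos by (metis Suc_le_D One_nat_def)
      then show ?thesis unfolding wr blanks_def by (simp add: replicate_add[of "Suc a" "Suc b", simplified] replicate_add replicate_app_Cons_same)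
    qed
    have ic: "initial_config M w = (to_nat (Copy q0 [] :: 'y comb_state), layout (?t, 0) [] 0 [] 0)"
      unfolding layout_def using rep by (simp add: initial_config_def M_def compile_def k_def)
    have R: "hw (Copy (foldl next_q q0 w) []) (layout (?t, i0) ?v1 (int (length ?v1)) ?v2 (int (length ?v2)))
        (total_time w + length ?v1 + length ?v2 + 7) ?b" if bl: "?t i0 = Blank" for i0
    proof (cases "foldl next_q q0 w \<in> fin")
      case True
      let ?T = "run_time (mach False) ?v1 + (if ?v1 \<in> D False then run_time (mach True) ?v2 else 0) + 2"
      have "hw (Run False (start_state (mach False))) (layout (?t, i0) ?v1 0 ?v2 0) ?T (?v1 \<in> D False \<and> ?v2 \<in> D True)"
        by (rule run_machines[OF v])
      then have "hw (Turn True) (layout (?t, i0) ?v1 0 ?v2 (int (length ?v2))) (?T + length ?v2 + 2) (?v1 \<in> D False \<and> ?v2 \<in> D True)"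
        unfolding layout_True by (intro run_turn[OF length_pre(2)]) simp
      then have "hw (Turn False) (layout (?t, i0) ?v1 (int (length ?v1)) ?v2 (int (length ?v2))) (?T + length ?v2 + 2 + length ?v1 + 2) (?v1 \<in> D False \<and> ?v2 \<in> D True)"
        unfolding layout_False by (intro run_turn[OF length_pre(1)]) simp
      then have "hw (Copy (foldl next_q q0 w) []) (layout (?t, i0) ?v1 (int (length ?v1)) ?v2 (int (length ?v2))) (Suc (?T + length ?v2 + 2 + length ?v1 + 2)) (?v1 \<in> D False \<and> ?v2 \<in> D True)"
        using True bl
        by - (rule hw_step[where s' = "Turn False" and acts = "stay (reads (layout (?t, i0) ?v1 (int (length ?v1)) ?v2 (int (length ?v2))))"], simp add: layout_def, simp_all)
      then have "hw (Copy (foldl next_q q0 w) []) (layout (?t, i0) ?v1 (int (length ?v1)) ?v2 (int (length ?v2))) (total_time w + length ?v1 + length ?v2 + 7) (?v1 \<in> D False \<and> ?v2 \<in> D True)"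
        by (rule hw_mono) (use True in \<open>simp add: total_time_def\<close>)
      then show ?thesis using True by simp
    next
      case False
      have "hw (Copy (foldl next_q q0 w) []) (layout (?t, i0) ?v1 (int (length ?v1)) ?v2 (int (length ?v2))) (Suc 0) False"
        using False bl hw_CRej
        by - (rule hw_step[where s' = CRej and acts = "stay (reads (layout (?t, i0) ?v1 (int (length ?v1)) ?v2 (int (length ?v2))))"], simp add: layout_def, simp_all)
      then have "hw (Copy (foldl next_q q0 w) []) (layout (?t, i0) ?v1 (int (length ?v1)) ?v2 (int (length ?v2))) (total_time w + length ?v1 + length ?v2 + 7) False"
        by (rule hw_mono) simp
      then show ?thesis using False by simp
    qed
    have "hw (Copy q0 []) (layout (?t, 0) [] (int (length ([] :: 'y list))) [] (int (length ([] :: 'y list)))) (total_time w + length ?v1 + length ?v2 + 7 + (cmax + 1) * length w) ?b"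
    proof (rule run_copy[OF initial_rightof w q0])
      fix i0 assume "?t i0 = (Blank :: 'x tape_symbol)"
      from R[OF this] show "hw (Copy (foldl next_q q0 w) []) (layout (?t, i0) ([] @ proj False (emit q0 w)) (int (length ([] @ proj False (emit q0 w))))
          ([] @ proj True (emit q0 w)) (int (length ([] @ proj True (emit q0 w))))) (total_time w + length ?v1 + length ?v2 + 7) ?b"
        by (simp add: image_word_def)
    qed
    moreover have "total_time w + length ?v1 + length ?v2 + 7 + (cmax + 1) * length w \<le> C * (length w + 1) + total_time w"
      using lv unfolding C_def by (simp add: algebra_simps)
    ultimately have "hw (Copy q0 []) (layout (?t, 0) [] 0 [] 0) (C * (length w + 1) + total_time w) ?b"
      using hw_mono by simp
    then show "halts_within M (initial_config M w) (C * (length w + 1) + total_time w)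
        (w \<in> {w \<in> lists X. foldl next_q q0 w \<in> fin \<and> image_word False w \<in> D False \<and> image_word True w \<in> D True})"
      unfolding ic hw_def using w by simp
  qed auto
  then show ?thesis by blast
qed

end

section \<open>Deciding membership in rational subgroups\<close>

context hyperbolic_word_metric
begin

definition geodesic :: "'b letter list \<Rightarrow> bool" where
  "geodesic w \<longleftrightarrow> w \<in> Words \<and> len (val w) = length w"

lemma geodesic_sub: "geodesic (a @ b @ c) \<Longrightarrow> geodesic b"
  using geodesic_word_sub[of a b c] by (auto simp: geodesic_def)

definition shorten :: "'b letter list \<Rightarrow> 'b letter list" where
  "shorten w = (SOME v. v \<in> Words \<and> length v = len (val w) \<and> val v = val w)"

lemma shorten:
  assumes "w \<in> Words"
  shows "shorten w \<in> Words" "length (shorten w) = len (val w)" "val (shorten w) = val w"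
proof -
  have "\<exists>v. v \<in> Words \<and> length v = len (val w) \<and> val v = val w" using len_word[of "val w"] assms by auto
  from someI_ex[OF this] show "shorten w \<in> Words" "length (shorten w) = len (val w)" "val (shorten w) = val w"
    by (auto simp: shorten_def)
qed

text \<open>Both ends of the locally geodesic path lie in \<open>K\<close>. An intermediate point
  far from \<open>K\<close> would see them in the same direction, whereas their product at a point
  of a local geodesic is bounded.\<close>

lemma local_geodesic_near:
  assumes K: "subgroup K G" and one: "seen_in_one_direction K C"
    and L: "3 * \<delta> < real L" and u: "p @ s \<in> Words" "val (p @ s) \<in> K"
    and loc: "\<And>a b c. p @ s = a @ b @ c \<Longrightarrow> length b \<le> 2 * L \<Longrightarrow> geodesic b"
  shows "real (cdist (K #> val p)) \<le> real L + 2 * \<delta> + C"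
proof -
  define w where "w = p @ s"
  define x where "x i = val (take i w)" for i
  have W: "w \<in> Words" using u by (simp add: w_def)
  have tk: "take i w \<in> Words" for i using W by (rule take_lists)
  have xc: "x i \<in> carrier G" for i using tk by (simp add: x_def)
  have "wdist (x i) (x j) = j - i" if ij: "i \<le> j" "j \<le> length w" "j - i \<le> 2 * L" for i j
  proof -
    have sp: "take j w = take i w @ take (j - i) (drop i w)" using take_add[of i "j - i" w] ij(1) by simp
    have m: "take (j - i) (drop i w) \<in> Words" by (rule take_lists[OF drop_lists[OF W]])
    have "w = take j w @ drop j w" by simp
    also have "\<dots> = take i w @ take (j - i) (drop i w) @ drop j w" by (simp only: sp append.assoc)
    finally have dec: "p @ s = take i w @ take (j - i) (drop i w) @ drop j w" by (simp only: w_def)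
    have g: "geodesic (take (j - i) (drop i w))"
      by (rule loc[OF dec]) (use ij(3) in simp)
    have "x j = x i \<otimes> val (take (j - i) (drop i w))" unfolding x_def sp by (rule val_append[OF tk m])
    then show ?thesis using g ij m xc[of i] by (simp add: wdist_mult geodesic_def)
  qed
  then have "gp (x (length p)) (x 0) (x (length w)) \<le> real L + 2 * \<delta>"
    using xc L by (intro local_geodesic_mid) (auto simp: w_def)
  moreover have "x 0 = \<one>" "x (length p) = val p" "x (length w) = val w" by (simp_all add: x_def w_def)
  moreover have "real (cdist (K #> val p)) - C \<le> gp (val p) \<one> (val w)"
    using one xc[of "length p"] u(2) subgroup.one_closed[OF K] unfolding seen_in_one_direction_def
    by (auto simp: x_def w_def)
  ultimately show ?thesis by simp
qed

lemma coset_memD: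
  assumes "subgroup K G" "g \<in> carrier G" "K #> g = K"
  shows "g \<in> K"
  using rcos_self[OF assms(2,1)] assms(3) by simp

end

text \<open>The automaton of the final test has the finitely many cosets within \<open>R\<close> of
  \<open>K\<close> as states, and a sink. Reading from the end of the word, it follows the coset of
  the inverse of the suffix read so far; for a word with value in \<open>K\<close> this is the coset
  of the complementary prefix, hence within \<open>R\<close>.\<close>

theorem hyperbolic_membership_linear:
  fixes G :: "'g monoid" (structure) and \<pi> :: "nat \<Rightarrow> 'g"
  assumes hyp: "hyperbolic_word_metric G {..<n} \<pi> \<delta>" and K: "subgroup K G"
    and one: "hyperbolic_word_metric.seen_in_one_direction G {..<n} \<pi> K C"
  shows "\<exists>M c. decides M (letters {..<n}) {w \<in> lists (letters {..<n}). word_val G \<pi> w \<in> K} \<and>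
    (\<forall>w\<in>lists (letters {..<n}). run_time M w \<le> c * (length w + 1))"
proof -
  interpret hyperbolic_word_metric G "{..<n}" \<pi> \<delta> by (rule hyp)
  define L where "L = nat \<lceil>3 * \<delta>\<rceil> + 1"
  have L: "3 * \<delta> < real L" "1 \<le> L" unfolding L_def using delta0 by linarith+
  define R where "R = nat \<lfloor>real L + 2 * \<delta> + C\<rfloor>"
  define B where "B = {x \<in> rcosets K. cdist x \<le> R}"
  have fB: "finite B" unfolding B_def by (rule finite_cdist_ball[OF K])
  define N where "N = card B"
  obtain e where e: "bij_betw e {..<N} B"
    using ex_bij_betw_nat_finite[OF fB] unfolding N_def atLeast0LessThan by blast
  define ix where "ix = inv_into {..<N} e"
  have ix: "ix x < N" "e (ix x) = x" if "x \<in> B" for x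
    using bij_betw_inv_into_right[OF e that] inv_into_into[of x e "{..<N}"] that e
    unfolding ix_def bij_betw_def by auto
  have K1: "K = K #> \<one>" using K subgroup.subset by (metis coset_mult_one)
  have KB: "K \<in> B"
  proof -
    have "cdist (K #> \<one>) \<le> wdist \<one> \<one>" by (rule cdist_le[OF K]) (simp_all add: subgroup.one_closed[OF K])
    then have "cdist K = 0" using K1 by simp
    then show ?thesis unfolding B_def using coset_closed[OF K one_closed] K1 by simp
  qed
  \<comment> \<open>The state \<open>N\<close> is absorbing: leaving \<open>B\<close> once means
    rejection.\<close>
  define nxt where "nxt q y = (if q < N \<and> e q #> inv (letter_val G \<pi> y) \<in> B then ix (e q #> inv (letter_val G \<pi> y)) else N)" for q y
  have acc: "foldl nxt (ix K) (rev s) = ix (K #> inv (val s))"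
    if "s \<in> Words" "\<forall>a b. s = a @ b \<longrightarrow> K #> inv (val b) \<in> B" for s
    using that
  proof (induction s rule: list.induct)
    case Nil
    then show ?case using K1 by simp
  next
    case (Cons y s)
    have s: "y \<in> letters {..<n}" "s \<in> Words" using Cons.prems(1) by auto
    have tails: "K #> inv (val b) \<in> B" if "y # s = a @ b" for a b using Cons.prems(2) that by blast
    have st: "K #> inv (val s) \<in> B" by (rule tails[of "[y]"]) simp
    have "K #> inv (val b) \<in> B" if "s = a @ b" for a b by (rule tails[of "y # a"]) (simp add: that)
    then have IH: "foldl nxt (ix K) (rev s) = ix (K #> inv (val s))" using s by (intro Cons.IH) blast+
    have m: "(K #> inv (val s)) #> inv (letter_val G \<pi> y) = K #> inv (val (y # s))"
      using K s by (simp add: inv_mult_group)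
    have "K #> inv (val (y # s)) \<in> B" by (rule tails[of "[]"]) simp
    then have "nxt (ix (K #> inv (val s))) y = ix (K #> inv (val (y # s)))"
      using m ix[OF st] by (simp add: nxt_def del: word_val_Cons)
    then show ?case using IH by (simp del: word_val_Cons)
  qed
  have sound: "e (foldl nxt (ix K) (rev s)) = K #> inv (val s)" if "s \<in> Words" "foldl nxt (ix K) (rev s) < N" for s
    using that
  proof (induction s rule: list.induct)
    case Nil
    then show ?case using K1 ix[OF KB] by simp
  next
    case (Cons y s)
    have s: "y \<in> letters {..<n}" "s \<in> Words" using Cons by auto
    define q where "q = foldl nxt (ix K) (rev s)"
    have "nxt q y < N" using Cons(3) by (simp add: q_def)
    then have q: "q < N" "e q #> inv (letter_val G \<pi> y) \<in> B" by (auto simp: nxt_def split: if_splits)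
    have "e q = K #> inv (val s)" using Cons.IH s q(1) by (simp add: q_def)
    then have m: "e q #> inv (letter_val G \<pi> y) = K #> inv (val (y # s))" using K s by (simp add: inv_mult_group)
    have "e (nxt q y) = e q #> inv (letter_val G \<pi> y)" using q ix[OF q(2)] by (simp add: nxt_def)
    then show ?case using m by (simp add: q_def del: word_val_Cons)
  qed
  interpret dehn_machine "letters {..<n}" "2 * L" geodesic shorten "ix K" "N + 1" nxt "{ix K}" val K
  proof
    show "finite (letters {..<n})" by simp
    show "2 \<le> 2 * L" using L by simp
    show "geodesic (a @ b @ c) \<Longrightarrow> geodesic b" for a b c by (rule geodesic_sub)
    show "geodesic []" by (simp add: geodesic_def)
    show "shorten w \<in> Words \<and> length (shorten w) < length w" if "w \<in> Words" "\<not> geodesic w" for w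
      using that shorten[OF that(1)] len_val_le[OF that(1)] by (simp add: geodesic_def)
    show "val (a @ shorten w @ c) = val (a @ w @ c)" if "w \<in> Words" "\<not> geodesic w" "a \<in> Words" "c \<in> Words" for w a c
      using that shorten[OF that(1)] by (simp add: val_append)
    show "ix K < N + 1" using ix[OF KB] by simp
    show "nxt q y < N + 1" for q y using ix by (simp add: nxt_def less_SucI)
    fix u assume u: "u \<in> Words" and loc: "\<And>a b c. u = a @ b @ c \<Longrightarrow> length b \<le> 2 * L \<Longrightarrow> geodesic b"
    show "(foldl nxt (ix K) (rev u) \<in> {ix K}) = (val u \<in> K)"
    proof
      assume "foldl nxt (ix K) (rev u) \<in> {ix K}"
      then have "e (ix K) = K #> inv (val u)" using sound[OF u] ix[OF KB] by simp
      then have "inv (val u) \<in> K" using coset_memD[OF K, of "inv (val u)"] ix[OF KB] u by simp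
      then show "val u \<in> K" using subgroup.m_inv_closed[OF K, of "inv (val u)"] u by simp
    next
      assume uK: "val u \<in> K"
      have "K #> inv (val b) \<in> B" if ab: "u = a @ b" for a b
      proof -
        have W: "a \<in> Words" "b \<in> Words" using u ab by auto
        \<comment> \<open>Since \<open>val u\<close> lies in \<open>K\<close>, the prefix and the
          inverse of the suffix define the same coset.\<close>
        have "val a = val u \<otimes> inv (val b)" unfolding ab using W by (simp add: val_append m_assoc)
        then have eq: "K #> inv (val b) = K #> val a"
          using W K uK coset_act[OF K, of "val u" "inv (val b)"] coset_join2[of "val u" K] u by simp
        have "real (cdist (K #> val a)) \<le> real L + 2 * \<delta> + C"
          using local_geodesic_near[OF K one L(1), of a b] u uK loc unfolding ab by blast
        then have "cdist (K #> val a) \<le> R" unfolding R_def by (simp add: le_nat_floor)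
        then show ?thesis unfolding eq B_def using W K by simp
      qed
      then have "foldl nxt (ix K) (rev u) = ix (K #> inv (val u))" by (intro acc[OF u]) blast
      also have "K #> inv (val u) = K" using K uK u by (intro coset_join2) (auto simp: subgroup.m_inv_closed)
      finally show "foldl nxt (ix K) (rev u) \<in> {ix K}" by simp
    qed
  qed
  from decides_linear show ?thesis by blast
qed

text \<open>The alphabet is that of the automatic structure in which \<open>K\<close> is rational,
  so the automaton of the preimage of \<open>K\<close> can be run on the final normal form.\<close>

theorem rational_membership_quadratic:
  fixes G :: "'g monoid" (structure)
  assumes G: "group G" and rat: "rational_subgroup K G"
  shows "\<exists>(n::nat) \<pi> M c. finite_generating G {..<n} \<pi> \<and>
    decides M (letters {..<n}) {w \<in> lists (letters {..<n}). word_val G \<pi> w \<in> K} \<and>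
    (\<forall>w\<in>lists (letters {..<n}). run_time M w \<le> c * ((length w)\<^sup>2 + 1))"
proof -
  interpret word_group G using G by (simp add: word_group_def)
  obtain n::nat and \<pi> L where aut: "automatic_structure G {..<n} \<pi> L"
    and reg: "regular_language (letters {..<n}) {w \<in> L. word_val G \<pi> w \<in> K}"
    using rat by (auto simp: rational_subgroup_def)
  let ?Y = "letters {..<n}"
  let ?S = "insert None (Some ` ?Y) \<times> insert None (Some ` ?Y)"
  have fg: "finite_generating G {..<n} \<pi>" and regL: "regular_language ?Y L" and onto: "word_val G \<pi> ` L = carrier G"
    and rel: "\<And>x. x \<in> ?Y \<Longrightarrow> regular_relation ?Y {(u, v). u \<in> L \<and> v \<in> L \<and> word_val G \<pi> (u @ [x]) = word_val G \<pi> v}"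
    using aut by (auto simp: automatic_structure_def)
  interpret word_metric G "{..<n}" \<pi> using fg by unfold_locales
  have LY: "L \<subseteq> Words" using regL by (auto simp: regular_language_def)
  define ok where "ok x p \<longleftrightarrow> (case p of (m, \<delta>, q, F) \<Rightarrow> q < (m::nat) \<and> (\<forall>q<m. \<forall>x\<in>?S. \<delta> q x < m) \<and>
      (\<lambda>(u, v). pad_pair u v) ` {(u, v). u \<in> L \<and> v \<in> L \<and> val (u @ [x]) = val v} = {w \<in> lists ?S. foldl \<delta> q w \<in> F})" for x p
  have "\<forall>x\<in>?Y. \<exists>p. ok x p"
  proof
    fix x assume "x \<in> ?Y"
    from rel[OF this] show "\<exists>p. ok x p"
    proof (rule regular_relationE)
      fix m \<delta> q F
      assume "q < (m::nat)" "\<forall>q<m. \<forall>x\<in>?S. \<delta> q x < m"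
        "(\<lambda>(u, v). pad_pair u v) ` {(u, v). u \<in> L \<and> v \<in> L \<and> val (u @ [x]) = val v} = {w \<in> lists ?S. foldl \<delta> q w \<in> F}"
      then show "\<exists>p. ok x p" unfolding ok_def by (intro exI[of _ "(m, \<delta>, q, F)"]) simp
    qed
  qed
  then obtain P where P: "\<And>x. x \<in> ?Y \<Longrightarrow> ok x (P x)" by metis
  obtain nf \<delta>f qf Ff where fin: "qf < (nf::nat)" "\<forall>q<nf. \<forall>x\<in>?Y. \<delta>f q x < nf" "Ff \<subseteq> {..<nf}"
    "{w \<in> L. val w \<in> K} = {w \<in> Words. foldl \<delta>f qf w \<in> Ff}"
    by (rule regular_languageE[OF reg])
  have "\<one> \<in> val ` L" unfolding onto by simp
  then obtain u0 where u0: "u0 \<in> L" "val u0 = \<one>" by auto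
  interpret automatic_machine ?Y L val K "\<lambda>x. fst (P x)" "\<lambda>x. fst (snd (P x))" "\<lambda>x. fst (snd (snd (P x)))"
    "\<lambda>x. snd (snd (snd (P x)))" nf \<delta>f qf Ff u0
  proof
    show "finite ?Y" by simp
    show "L \<subseteq> Words" by (rule LY)
    fix x assume x: "x \<in> ?Y"
    show "fst (snd (snd (P x))) < fst (P x)"
      "\<forall>q<fst (P x). \<forall>p\<in>?S. fst (snd (P x)) q p < fst (P x)"
      "(\<lambda>(u, v). pad_pair u v) ` {(u, v). u \<in> L \<and> v \<in> L \<and> val (u @ [x]) = val v} =
        {w \<in> lists ?S. foldl (fst (snd (P x))) (fst (snd (snd (P x)))) w \<in> snd (snd (snd (P x)))}"
      using P[OF x] unfolding ok_def case_prod_beta by blast+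
  next
    fix w assume "w \<in> Words"
    then have "val w \<in> val ` L" unfolding onto by simp
    then show "\<exists>u\<in>L. val u = val w" by auto
  next
    fix u v x assume "u \<in> Words" "v \<in> Words" "x \<in> ?Y" "val u = val v"
    then show "val (u @ [x]) = val (v @ [x])" using val_append[of u "[x]"] val_append[of v "[x]"] by simp
  qed (use fin u0 in auto)
  from decides_quadratic fg show ?thesis by blast
qed

section \<open>Non-amenable Schreier graphs\<close>

text \<open>The graph counts edges by labels, while \<open>nonamenable_cosets\<close> counts
  translations by group elements. Several labels with the same value cost at most a factor, the
  number of labels.\<close>

theorem schreier_nonamenable_cosets:
  fixes G :: "'g monoid" (structure)
  assumes G: "group G" and K: "subgroup K G" and na: "nonamenable_schreier G K"
  shows "nonamenable_cosets G K"
proof -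
  interpret word_group G using G by (simp add: word_group_def)
  obtain n::nat and \<pi> \<epsilon> where fg: "finite_generating G {..<n} \<pi>" and e: "0 < (\<epsilon>::real)" and
    iso: "\<And>S. S \<subseteq> rcosets K \<Longrightarrow> finite S \<Longrightarrow> S \<noteq> {} \<Longrightarrow>
      \<epsilon> * real (card S) \<le> real (card {a \<in> (rcosets K) \<times> letters {..<n}. fst a \<in> S \<and> fst a #> letter_val G \<pi> (snd a) \<notin> S})"
    using na unfolding nonamenable_schreier_def nonamenable_graph_def schreier_graph_def by (auto simp: case_prod_beta)
  interpret word_metric G "{..<n}" \<pi> using fg by unfold_locales
  let ?Y = "letters {..<n}"
  define F where "F = letter_val G \<pi> ` ?Y"
  have F: "finite F" "F \<subseteq> carrier G" by (auto simp: F_def)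
  define d where "d = real (card ?Y) + 1"
  have d: "0 < d" by (simp add: d_def)
  have "\<epsilon> / d * real (card S) \<le> (\<Sum>f\<in>F. real (card {x \<in> S. x #> f \<notin> S}))" if S: "S \<subseteq> rcosets K" "finite S" for S
  proof (cases "S = {}")
    case False
    have "{a \<in> (rcosets K) \<times> ?Y. fst a \<in> S \<and> fst a #> letter_val G \<pi> (snd a) \<notin> S} =
      (\<Union>y\<in>?Y. (\<lambda>v. (v, y)) ` {v \<in> S. v #> letter_val G \<pi> y \<notin> S})" using S by auto
    also have "card \<dots> \<le> (\<Sum>y\<in>?Y. card ((\<lambda>v. (v, y)) ` {v \<in> S. v #> letter_val G \<pi> y \<notin> S}))"
      by (intro card_UN_le) simp
    also have "\<dots> \<le> (\<Sum>y\<in>?Y. card {v \<in> S. v #> letter_val G \<pi> y \<notin> S})"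
      using S by (intro sum_mono card_image_le) auto
    also have "\<dots> \<le> (\<Sum>y\<in>?Y. \<Sum>f\<in>F. card {x \<in> S. x #> f \<notin> S})"
      using F by (intro sum_mono member_le_sum) (auto simp: F_def)
    also have "\<dots> = card ?Y * (\<Sum>f\<in>F. card {x \<in> S. x #> f \<notin> S})" by simp
    finally have "real (card {a \<in> (rcosets K) \<times> ?Y. fst a \<in> S \<and> fst a #> letter_val G \<pi> (snd a) \<notin> S}) \<le>
        real (card ?Y * (\<Sum>f\<in>F. card {x \<in> S. x #> f \<notin> S}))" by (rule of_nat_mono)
    also have "\<dots> = real (card ?Y) * (\<Sum>f\<in>F. real (card {x \<in> S. x #> f \<notin> S}))" by simp
    also have "\<dots> \<le> d * (\<Sum>f\<in>F. real (card {x \<in> S. x #> f \<notin> S}))"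
      by (intro mult_right_mono sum_nonneg) (auto simp: d_def)
    finally have "\<epsilon> * real (card S) \<le> d * (\<Sum>f\<in>F. real (card {x \<in> S. x #> f \<notin> S}))"
      using iso[OF S False] by linarith
    then show ?thesis using d by (simp add: field_simps)
  qed simp
  then show ?thesis unfolding nonamenable_cosets_def using F e d
    by (intro exI[of _ F] exI[of _ "\<epsilon> / d"]) auto
qed

section \<open>Average-case complexity\<close>

text \<open>On words of equal length the measure is constant, so only the mean running time on each
  sphere matters. The sum over all words is controlled through finite sets, enlarged to balls and
  grouped by length.\<close>

lemma solves_on_averageI:
  assumes dec: "decides M X D" and X: "finite X" and f: "mono f" "\<And>n. 0 < f n" and C: "0 < C"
    and bound: "\<And>n. (\<Sum>w\<in>{w \<in> lists X. length w = n}. real (run_time M w)) \<le> C * f n * real (card X) ^ n"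
  shows "solves_on_average M X D f {\<mu>. discrete_prob X \<mu> \<and> length_invariant X \<mu>}"
proof -
  define W where "W n = {w \<in> lists X. length w = n}" for n
  have fW: "finite (W n)" for n
    unfolding W_def by (rule finite_subset[OF _ finite_lists_length_eq[OF X, of n]]) auto
  have cW: "card (W n) = card X ^ n" for n
  proof -
    have "W n = {w. set w \<subseteq> X \<and> length w = n}" unfolding W_def by auto
    then show ?thesis using card_lists_length_eq[OF X] by simp
  qed
  have main: "(\<lambda>w. real (run_time M w) / f (length w) * \<mu> w) summable_on lists X \<and>
      (\<Sum>\<^sub>\<infinity>w\<in>lists X. real (run_time M w) / f (length w) * \<mu> w) \<le> C"
    if \<mu>: "discrete_prob X \<mu>" "length_invariant X \<mu>" for \<mu>
  proof -
    define g where "g w = real (run_time M w) / f (length w) * \<mu> w" for w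
    have \<mu>0: "0 \<le> \<mu> w" if "w \<in> lists X" for w using \<mu>(1) that by (simp add: discrete_prob_def)
    have hs: "(\<mu> has_sum 1) (lists X)" using \<mu>(1) by (simp add: discrete_prob_def)
    have g0: "0 \<le> g w" if "w \<in> lists X" for w
      using \<mu>0[OF that] f(2)[of "length w"] by (simp add: g_def)
    have level: "sum g (W n) \<le> C * sum \<mu> (W n)" for n
    proof (cases "W n = {}")
      case False
      then obtain w0 where w0: "w0 \<in> W n" by blast
      have m: "\<mu> w = \<mu> w0" if "w \<in> W n" for w
        using \<mu>(2) that w0 by (simp add: length_invariant_def W_def)
      have "sum g (W n) = (\<Sum>w\<in>W n. real (run_time M w)) * (\<mu> w0 / f n)"
        unfolding sum_distrib_right by (intro sum.cong refl) (simp add: g_def m, simp add: W_def)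
      also have "\<dots> \<le> (C * f n * real (card X) ^ n) * (\<mu> w0 / f n)"
        unfolding W_def using bound f(2)[of n] \<mu>0[of w0] w0 by (intro mult_right_mono) (auto simp: W_def)
      also have "\<dots> = C * (real (card (W n)) * \<mu> w0)" using f(2)[of n] by (simp add: cW)
      also have "real (card (W n)) * \<mu> w0 = sum \<mu> (W n)" using m by simp
      finally show ?thesis .
    qed simp
    have fin: "sum g F \<le> C" if F: "finite F" "F \<subseteq> lists X" for F
    proof -
      define N where "N = Max (insert 0 (length ` F))"
      define U where "U = {w \<in> lists X. length w \<le> N}"
      have fU: "finite U" unfolding U_def by (rule finite_bounded_lists[OF X])
      have "length w \<le> N" if "w \<in> F" for w unfolding N_def using F that by (intro Max_ge) auto
      then have FU: "F \<subseteq> U" using F by (auto simp: U_def)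
      have grp: "sum h U = (\<Sum>n\<in>{..N}. sum h (W n))" for h :: "_ \<Rightarrow> real"
      proof -
        have "(\<Sum>n\<in>{..N}. sum h {w \<in> U. length w = n}) = sum h U" by (rule sum.group[OF fU]) (auto simp: U_def)
        moreover have "{w \<in> U. length w = n} = W n" if "n \<in> {..N}" for n using that by (auto simp: U_def W_def)
        ultimately show ?thesis by simp
      qed
      have "sum g F \<le> sum g U" using fU FU g0 by (intro sum_mono2) (auto simp: U_def)
      also have "\<dots> \<le> (\<Sum>n\<in>{..N}. C * sum \<mu> (W n))" unfolding grp by (intro sum_mono level)
      also have "\<dots> = C * sum \<mu> U" unfolding grp by (simp add: sum_distrib_left)
      also have "sum \<mu> U \<le> infsum \<mu> (lists X)"
        using hs fU \<mu>0 by (intro finite_sum_le_infsum) (auto simp: U_def summable_on_def)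
      also have "infsum \<mu> (lists X) = 1" using hs by (rule infsumI)
      finally show ?thesis using C by simp
    qed
    have "g summable_on lists X"
    proof (rule nonneg_bdd_above_summable_on)
      show "bdd_above (sum g ` {F. F \<subseteq> lists X \<and> finite F})" using fin by (intro bdd_aboveI[of _ C]) auto
    qed (rule g0)
    then show ?thesis using infsum_le_finite_sums[of g "lists X" C] fin unfolding g_def by blast
  qed
  show ?thesis unfolding solves_on_average_def using dec f C main by blast
qed

text \<open>Here \<open>c\<close> is the factor by which translated words may be longer. With r^(c +
  1) = 1/\<rho>, growth bounded by a multiple of r^m for m \<le> c n is absorbed by \<rho>^n; the
  exponent c + 1 instead of c also covers c = 0.\<close>

lemma subexponential_decay:
  assumes f: "subexponential f" and \<rho>: "0 < \<rho>" "\<rho> < (1::real)"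
  shows "\<exists>B>0. \<forall>n m. m \<le> c * n \<longrightarrow> f m * \<rho> ^ n \<le> B"
proof -
  define r where "r = root (c + 1) (1 / \<rho>)"
  have r1: "1 < r" unfolding r_def using \<rho> by simp
  have rr: "r ^ (c + 1) * \<rho> = 1" unfolding r_def using \<rho> by (simp del: power_Suc)
  have "(\<lambda>n. f n / r ^ n) \<longlonglongrightarrow> 0" using f r1 by (simp add: subexponential_def)
  then have "Bseq (\<lambda>n. f n / r ^ n)" by (intro convergent_imp_Bseq convergentI)
  then obtain B where B: "0 < B" "\<And>n. norm (f n / r ^ n) \<le> B" unfolding Bseq_def by blast
  have "f m * \<rho> ^ n \<le> B" if m: "m \<le> c * n" for n m
  proof -
    have rp: "0 < r ^ m" using r1 by simp
    have "f m / r ^ m \<le> B" using B(2)[of m] unfolding real_norm_def by (rule abs_le_D1)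
    then have "f m \<le> B * r ^ m" using rp by (simp add: pos_divide_le_eq)
    also have "\<dots> \<le> B * r ^ ((c + 1) * n)" using m r1 B(1) by (intro mult_left_mono power_increasing) auto
    finally have "f m * \<rho> ^ n \<le> B * r ^ ((c + 1) * n) * \<rho> ^ n" using \<rho> by (intro mult_right_mono) auto
    also have "\<dots> = B * (r ^ (c + 1) * \<rho>) ^ n" by (simp only: power_mult power_mult_distrib mult.assoc)
    finally show ?thesis unfolding rr by simp
  qed
  then show ?thesis using B(1) by blast
qed

section \<open>Passing to a finite-index subgroup and a quotient\<close>

text \<open>A point carried out of \<open>S\<close> by a word crosses the boundary at one of the
  letters, and each letter acts injectively.\<close>

lemma (in symmetric_action) word_boundary:
  assumes S: "finite S" "S \<subseteq> V" and w: "w \<in> lists X"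
  shows "card {s \<in> S. foldl act s w \<notin> S} \<le> length w * (\<Sum>x\<in>X. card {s \<in> S. act s x \<notin> S})"
  using w
proof (induction w)
  case Nil
  then show ?case by simp
next
  case (Cons x w)
  have inj: "inj_on (\<lambda>s. act s x) S"
    using S act_iv Cons.hyps(1) by (intro inj_on_inverseI[of _ "\<lambda>s. act s (iv x)"]) auto
  have "{s \<in> S. foldl act s (x # w) \<notin> S} \<subseteq> {s \<in> S. act s x \<notin> S} \<union> {s \<in> S. act s x \<in> S \<and> foldl act (act s x) w \<notin> S}" by auto
  then have "card {s \<in> S. foldl act s (x # w) \<notin> S} \<le> card ({s \<in> S. act s x \<notin> S} \<union> {s \<in> S. act s x \<in> S \<and> foldl act (act s x) w \<notin> S})"
    using S by (intro card_mono) auto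
  also have "\<dots> \<le> card {s \<in> S. act s x \<notin> S} + card {s \<in> S. act s x \<in> S \<and> foldl act (act s x) w \<notin> S}" by (rule card_Un_le)
  also have "card {s \<in> S. act s x \<in> S \<and> foldl act (act s x) w \<notin> S} \<le> card {s \<in> S. foldl act s w \<notin> S}"
    using S by (intro card_inj_on_le[of "\<lambda>s. act s x"]) (auto intro: inj_on_subset[OF inj])
  also have "\<dots> \<le> length w * (\<Sum>x\<in>X. card {s \<in> S. act s x \<notin> S})" by (rule Cons.IH)
  also have "card {s \<in> S. act s x \<notin> S} \<le> (\<Sum>x\<in>X. card {s \<in> S. act s x \<notin> S})"
    using finite_X Cons.hyps(1) by (intro member_le_sum) auto
  finally show ?case by simp
qed

lemma (in word_group) transversal:
  assumes "finite_index G G1"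
  shows "\<exists>(m::nat) g i0. i0 < m \<and> g i0 = \<one> \<and> (\<forall>i<m. g i \<in> carrier G) \<and>
    (\<forall>x\<in>carrier G. \<exists>!i. i < m \<and> x \<otimes> inv (g i) \<in> G1)"
proof -
  have sub: "subgroup G1 G" and fin: "finite (rcosets G1)" using assms by (auto simp: finite_index_def)
  obtain e where e: "bij_betw e {..<card (rcosets G1)} (rcosets G1)"
    using ex_bij_betw_nat_finite[OF fin] unfolding atLeast0LessThan by blast
  define m where "m = card (rcosets G1)"
  \<comment> \<open>The identity represents its own coset, so that words with value in
    \<open>G1\<close> return to the starting index without a correction by conjugation.\<close>
  define g where "g i = (if \<one> \<in> e i then \<one> else SOME y. y \<in> e i)" for i
  have ei: "e i \<in> rcosets G1" if "i < m" for i using e that unfolding bij_betw_def m_def by blast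
  have gi: "g i \<in> e i" if "i < m" for i
  proof -
    have "e i \<noteq> {}" using subgroup.rcosets_non_empty[OF sub ei[OF that]] .
    then show ?thesis unfolding g_def using some_in_eq[of "e i"] by simp
  qed
  have gc: "g i \<in> carrier G" if "i < m" for i
    using gi[OF that] ei[OF that] rcosets_part_G[OF sub] by blast
  have eg: "e i = G1 #> g i" if i: "i < m" for i
  proof -
    obtain h where h: "h \<in> carrier G" "e i = G1 #> h" using ei[OF i] by (rule rcosetsE)
    then show ?thesis using gi[OF i] repr_independence[of "g i" G1 h] sub by simp
  qed
  have uniq: "\<exists>!i. i < m \<and> x \<otimes> inv (g i) \<in> G1" if x: "x \<in> carrier G" for x
  proof -
    have iff: "x \<otimes> inv (g i) \<in> G1 \<longleftrightarrow> e i = G1 #> x" if i: "i < m" for i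
    proof
      assume a: "x \<otimes> inv (g i) \<in> G1"
      have "G1 #> x = (G1 #> (x \<otimes> inv (g i))) #> g i" using sub x gc[OF i] by (simp add: m_assoc)
      also have "G1 #> (x \<otimes> inv (g i)) = G1" using sub a x gc[OF i] by (intro coset_join2) auto
      finally show "e i = G1 #> x" using eg[OF i] by simp
    next
      assume "e i = G1 #> x"
      then have "G1 #> (x \<otimes> inv (g i)) = G1"
        using eg[OF i] sub x gc[OF i] coset_act[OF sub x, of "inv (g i)"] coset_act[OF sub gc[OF i], of "inv (g i)"]
        by (simp add: coset_mult_one[OF subgroup.subset[OF sub]])
      then show "x \<otimes> inv (g i) \<in> G1" using rcos_self[OF _ sub, of "x \<otimes> inv (g i)"] x gc[OF i] by simp
    qed
    have "G1 #> x \<in> rcosets G1" using sub x by simp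
    then have "G1 #> x \<in> e ` {..<m}" using e by (simp add: bij_betw_def m_def)
    then obtain i where i: "i < m" "e i = G1 #> x" by auto
    have ei_inj: "inj_on e {..<m}" using e by (simp add: bij_betw_def m_def)
    show ?thesis
    proof (rule ex1I[of _ i])
      show "i < m \<and> x \<otimes> inv (g i) \<in> G1" using i iff by simp
      fix j assume j: "j < m \<and> x \<otimes> inv (g j) \<in> G1"
      then have "e j = e i" using i iff[of j] by simp
      then show "j = i" using inj_onD[OF ei_inj] i(1) j by simp
    qed
  qed
  obtain i0 where i0: "i0 < m" "\<one> \<otimes> inv (g i0) \<in> G1" using uniq[of \<one>] by blast
  then have "inv (g i0) \<in> G1" using gc[OF i0(1)] by simp
  from subgroup.m_inv_closed[OF sub this] have "g i0 \<in> G1" using gc[OF i0(1)] by simp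
  then have "e i0 = G1" using eg[OF i0(1)] sub gc[OF i0(1)] coset_join2 by simp
  then have "g i0 = \<one>" unfolding g_def using subgroup.one_closed[OF sub] by simp
  then show ?thesis
    by - (rule exI[of _ m], rule exI[of _ g], rule exI[of _ i0], intro conjI allI impI ballI i0(1) gc uniq, assumption+)
qed

text \<open>The setting of an induced action: \<open>G1\<close> acts on the cosets of
  \<open>K\<close> through \<open>\<phi>\<close>, and the transversal \<open>g\<close> extends this
  to an action of the words over \<open>A\<close> on pairs of an index and a coset.\<close>

locale coset_transfer = word_metric G A \<pi> + B: word_group Gb
  for G :: "'g monoid" (structure) and A :: "'b set" and \<pi> and Gb :: "'h monoid" +
  fixes G1 :: "'g set" and \<phi> :: "'g \<Rightarrow> 'h" and K :: "'h set" and m :: nat and g :: "nat \<Rightarrow> 'g" and i0 :: nat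
  assumes G1: "subgroup G1 G" and hom: "\<phi> \<in> hom (G\<lparr>carrier := G1\<rparr>) Gb" and surj: "\<phi> ` G1 = carrier Gb"
    and K: "subgroup K Gb" and g_closed: "i < m \<Longrightarrow> g i \<in> carrier G"
    and uniq: "x \<in> carrier G \<Longrightarrow> \<exists>!i. i < m \<and> x \<otimes> inv (g i) \<in> G1"
    and i0: "i0 < m" "g i0 = \<one>"
begin

lemma phi_closed: "x \<in> G1 \<Longrightarrow> \<phi> x \<in> carrier Gb"
  using surj by blast

lemma phi_mult: "x \<in> G1 \<Longrightarrow> y \<in> G1 \<Longrightarrow> \<phi> (x \<otimes> y) = \<phi> x \<otimes>\<^bsub>Gb\<^esub> \<phi> y"
  using hom by (simp add: hom_def)

lemma G1_carrier: "x \<in> G1 \<Longrightarrow> x \<in> carrier G"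
  using G1 subgroup.mem_carrier by metis

lemma phi_one: "\<phi> \<one> = \<one>\<^bsub>Gb\<^esub>"
proof -
  have o: "\<one> \<in> G1" using G1 by (rule subgroup.one_closed)
  have "\<phi> \<one> \<otimes>\<^bsub>Gb\<^esub> \<phi> \<one> = \<phi> \<one>" using phi_mult[OF o o] by simp
  then show ?thesis using phi_closed[OF o] by (metis B.one_unique B.r_cancel_one)
qed

lemma phi_inv: "x \<in> G1 \<Longrightarrow> \<phi> (inv x) = inv\<^bsub>Gb\<^esub> (\<phi> x)"
proof -
  assume x: "x \<in> G1"
  then have ix: "inv x \<in> G1" using G1 by (rule subgroup.m_inv_closed[rotated])
  have "\<phi> (inv x) \<otimes>\<^bsub>Gb\<^esub> \<phi> x = \<one>\<^bsub>Gb\<^esub>" using phi_mult[OF ix x] phi_one G1_carrier[OF x] by simp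
  then show ?thesis using phi_closed x ix by (metis B.inv_equality)
qed

definition nx :: "nat \<Rightarrow> 'b letter \<Rightarrow> nat" where
  "nx i x = (THE j. j < m \<and> g i \<otimes> letter_val G \<pi> x \<otimes> inv (g j) \<in> G1)"

text \<open>Schreier rewriting: the letter \<open>x\<close>, read at the index \<open>i\<close>,
  contributes the element of \<open>G1\<close> formed with the representatives before and after it,
  mapped to \<open>Gb\<close>.\<close>

definition co :: "nat \<Rightarrow> 'b letter \<Rightarrow> 'h" where
  "co i x = \<phi> (g i \<otimes> letter_val G \<pi> x \<otimes> inv (g (nx i x)))"

lemma nx:
  assumes "i < m" "x \<in> letters A"
  shows "nx i x < m" "g i \<otimes> letter_val G \<pi> x \<otimes> inv (g (nx i x)) \<in> G1"
  using theI'[OF uniq[of "g i \<otimes> letter_val G \<pi> x"]] g_closed[OF assms(1)] assms(2) unfolding nx_def by auto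

lemma index_unique:
  "x \<in> carrier G \<Longrightarrow> i < m \<Longrightarrow> j < m \<Longrightarrow> x \<otimes> inv (g i) \<in> G1 \<Longrightarrow> x \<otimes> inv (g j) \<in> G1 \<Longrightarrow> i = j"
  using uniq by blast

lemma co_closed: "i < m \<Longrightarrow> x \<in> letters A \<Longrightarrow> co i x \<in> carrier Gb"
  unfolding co_def by (intro phi_closed nx)

fun coc :: "nat \<Rightarrow> 'b letter list \<Rightarrow> 'h" where
  "coc i [] = \<one>\<^bsub>Gb\<^esub>"
| "coc i (x # w) = co i x \<otimes>\<^bsub>Gb\<^esub> coc (nx i x) w"

text \<open>The product telescopes, because each factor ends with the inverse of the representative
  with which the next one begins.\<close>

lemma cocycle:
  assumes "i < m" "w \<in> Words"
  shows "foldl nx i w < m \<and> g i \<otimes> val w \<otimes> inv (g (foldl nx i w)) \<in> G1 \<and>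
    coc i w = \<phi> (g i \<otimes> val w \<otimes> inv (g (foldl nx i w)))"
  using assms
proof (induction w arbitrary: i rule: list.induct)
  case Nil
  then show ?case using g_closed[of i] phi_one subgroup.one_closed[OF G1] by simp
next
  case (Cons x w)
  have x: "x \<in> letters A" "w \<in> Words" using Cons.prems by auto
  define j where "j = nx i x"
  define l where "l = foldl nx j w"
  have j: "j < m" "g i \<otimes> letter_val G \<pi> x \<otimes> inv (g j) \<in> G1" using nx[OF Cons.prems(1) x(1)] by (auto simp: j_def)
  have IH: "l < m" "g j \<otimes> val w \<otimes> inv (g l) \<in> G1" "coc j w = \<phi> (g j \<otimes> val w \<otimes> inv (g l))"
    using Cons.IH[OF j(1) x(2)] by (auto simp: l_def)
  have e: "g i \<otimes> val (x # w) \<otimes> inv (g l) = (g i \<otimes> letter_val G \<pi> x \<otimes> inv (g j)) \<otimes> (g j \<otimes> val w \<otimes> inv (g l))"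
    using g_closed[OF Cons.prems(1)] g_closed[OF j(1)] g_closed[OF IH(1)] x by (simp add: m_assoc)
  have "foldl nx i (x # w) = l" by (simp add: l_def j_def)
  then show ?case using IH j subgroup.m_closed[OF G1 j(2) IH(2)] phi_mult[OF j(2) IH(2)]
    by (simp add: e co_def j_def[symmetric] del: word_val_Cons)
qed

lemma coc_closed: "i < m \<Longrightarrow> w \<in> Words \<Longrightarrow> coc i w \<in> carrier Gb"
  using cocycle phi_closed by metis

lemma nx_inv:
  assumes i: "i < m" and x: "x \<in> letters A"
  shows "nx (nx i x) (formal_inv x) = i" "co (nx i x) (formal_inv x) = inv\<^bsub>Gb\<^esub> (co i x)"
proof -
  let ?j = "nx i x"
  note j = nx[OF i x]
  have ix: "formal_inv x \<in> letters A" using x by simp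
  have v: "letter_val G \<pi> (formal_inv x) = inv (letter_val G \<pi> x)" by (rule letter_val_formal_inv[OF map_closed x])
  have e: "inv (g i \<otimes> letter_val G \<pi> x \<otimes> inv (g ?j)) = g ?j \<otimes> letter_val G \<pi> (formal_inv x) \<otimes> inv (g i)"
    unfolding v using g_closed[OF i] g_closed[OF j(1)] x by (simp add: inv_mult_group m_assoc)
  then have "g ?j \<otimes> letter_val G \<pi> (formal_inv x) \<otimes> inv (g i) \<in> G1" using subgroup.m_inv_closed[OF G1 j(2)] by simp
  then show n: "nx ?j (formal_inv x) = i"
    using index_unique[of "g ?j \<otimes> letter_val G \<pi> (formal_inv x)"] nx[OF j(1) ix] i g_closed[OF j(1)] ix by simp
  show "co ?j (formal_inv x) = inv\<^bsub>Gb\<^esub> (co i x)"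
    unfolding co_def n e[symmetric] by (rule phi_inv[OF j(2)])
qed

text \<open>The necessary condition tested by the fast machine. Its converse fails in general, which
  is why the slow machine remains.\<close>

lemma word_in_H:
  assumes w: "w \<in> Words" and H: "H \<subseteq> G1" "\<phi> ` H \<subseteq> K" "val w \<in> H"
  shows "foldl nx i0 w = i0" "coc i0 w \<in> K"
proof -
  have c: "foldl nx i0 w < m" "val w \<otimes> inv (g (foldl nx i0 w)) \<in> G1" "coc i0 w = \<phi> (val w \<otimes> inv (g (foldl nx i0 w)))"
    using cocycle[OF i0(1) w] i0(2) w by simp_all
  have "val w \<otimes> inv (g i0) \<in> G1" using i0(2) w H by auto
  then show e: "foldl nx i0 w = i0" using index_unique[of "val w"] c(1,2) i0(1) w by simp
  have "coc i0 w = \<phi> (val w)" using c(3) w unfolding e i0(2) by simp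
  then show "coc i0 w \<in> K" using H by auto
qed

definition act :: "nat \<times> 'h set \<Rightarrow> 'b letter \<Rightarrow> nat \<times> 'h set" where
  "act p x = (nx (fst p) x, snd p #>\<^bsub>Gb\<^esub> co (fst p) x)"

definition V :: "(nat \<times> 'h set) set" where "V = {..<m} \<times> rcosets\<^bsub>Gb\<^esub> K"

lemma foldl_act:
  assumes "i < m" "w \<in> Words" "v \<in> rcosets\<^bsub>Gb\<^esub> K"
  shows "foldl act (i, v) w = (foldl nx i w, v #>\<^bsub>Gb\<^esub> coc i w)"
  using assms
proof (induction w arbitrary: i v rule: list.induct)
  case Nil
  then show ?case using B.rcosets_act_one[OF K] by simp
next
  case (Cons x w)
  have x: "x \<in> letters A" "w \<in> Words" using Cons.prems by auto
  have "v #>\<^bsub>Gb\<^esub> co i x \<in> rcosets\<^bsub>Gb\<^esub> K" using Cons.prems co_closed x by (intro B.rcosets_act_closed[OF K]) auto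
  then show ?case
    using Cons.IH[OF nx(1)[OF Cons.prems(1) x(1)] x(2)] Cons.prems x
      B.rcosets_act_act[OF K Cons.prems(3) co_closed[OF Cons.prems(1) x(1)] coc_closed[OF nx(1)[OF Cons.prems(1) x(1)] x(2)]]
    by (simp add: act_def)
qed

lemma symmetric_act: "symmetric_action V (letters A) formal_inv act"
proof (rule symmetric_action.intro)
  show "finite (letters A)" using finite_alphabet by simp
  show "formal_inv x \<in> letters A" if "x \<in> letters A" for x using that by (simp only: formal_inv_letters)
  show "formal_inv (formal_inv x) = x" if "x \<in> letters A" for x by (rule formal_inv_formal_inv)
  show "act v x \<in> V" if "v \<in> V" "x \<in> letters A" for v x
  proof -
    have v: "fst v < m" "snd v \<in> rcosets\<^bsub>Gb\<^esub> K" using that(1) by (auto simp: V_def)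
    have "snd v #>\<^bsub>Gb\<^esub> co (fst v) x \<in> rcosets\<^bsub>Gb\<^esub> K"
      using B.rcosets_act_closed[OF K v(2) co_closed[OF v(1) that(2)]] .
    then show ?thesis unfolding V_def act_def using nx(1)[OF v(1) that(2)] by blast
  qed
  show "act (act v x) (formal_inv x) = v" if "v \<in> V" "x \<in> letters A" for v x
  proof -
    have v: "fst v < m" "snd v \<in> rcosets\<^bsub>Gb\<^esub> K" using that(1) by (auto simp: V_def)
    have "snd v #>\<^bsub>Gb\<^esub> co (fst v) x #>\<^bsub>Gb\<^esub> inv\<^bsub>Gb\<^esub> co (fst v) x = snd v"
      by (rule B.rcosets_act_inv(1)[OF K v(2) co_closed[OF v(1) that(2)]])
    then have "act (act v x) (formal_inv x) = (fst v, snd v)"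
      unfolding act_def fst_conv snd_conv nx_inv[OF v(1) that(2)] by (rule arg_cong)
    then show ?thesis by simp
  qed
qed

text \<open>Surjectivity of \<open>\<phi>\<close>, conjugated by \<open>g i\<close>. Thus every
  translation of the cosets of \<open>K\<close> is realized by a word inside a single fibre of the
  action.\<close>

lemma loop_word:
  assumes i: "i < m" and f: "f \<in> carrier Gb"
  shows "\<exists>w\<in>Words. foldl nx i w = i \<and> coc i w = f"
proof -
  have "f \<in> \<phi> ` G1" using f unfolding surj .
  then obtain h where h: "h \<in> G1" "\<phi> h = f" by blast
  note hc = G1_carrier[OF h(1)] and gi = g_closed[OF i]
  have "inv (g i) \<otimes> h \<otimes> g i \<in> carrier G" using hc gi by simp
  from generating_word[OF generating this]
  obtain w where w: "w \<in> Words" "val w = inv (g i) \<otimes> h \<otimes> g i" by blast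
  have e: "g i \<otimes> val w \<otimes> inv (g i) = h" unfolding w(2) using hc gi by (simp add: m_assoc)
  note c = cocycle[OF i w(1)]
  have "foldl nx i w = i"
  proof (rule index_unique)
    show "g i \<otimes> val w \<in> carrier G" using gi w(1) by simp
    show "g i \<otimes> val w \<otimes> inv (g (foldl nx i w)) \<in> G1" "foldl nx i w < m" using c by blast+
    show "g i \<otimes> val w \<otimes> inv (g i) \<in> G1" unfolding e by (rule h(1))
  qed (rule i)
  then show ?thesis using c e h(2) w(1) by (intro bexI[of _ w]) simp_all
qed

text \<open>A finite set is cut into its fibres. A translation from \<open>F\<close> is realized on
  each fibre by a loop word; points that leave the slice under the translation leave
  \<open>S\<close> under the word, and this costs a factor of the word's length.\<close>

lemma transfer_isoperimetry:
  assumes "nonamenable_cosets Gb K"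
  shows "\<exists>\<epsilon>. nonamenable_action V (letters A) formal_inv act \<epsilon>"
proof -
  obtain F \<epsilon> where F: "finite F" "F \<subseteq> carrier Gb" and e: "0 < (\<epsilon>::real)" and
    iso: "\<forall>S. S \<subseteq> rcosets\<^bsub>Gb\<^esub> K \<longrightarrow> finite S \<longrightarrow> \<epsilon> * real (card S) \<le> (\<Sum>f\<in>F. real (card {x \<in> S. x #>\<^bsub>Gb\<^esub> f \<notin> S}))"
    using assms unfolding nonamenable_cosets_def by (elim exE conjE) (rule that)
  define W where "W p = (SOME w. w \<in> Words \<and> foldl nx (fst p) w = fst p \<and> coc (fst p) w = snd p)" for p
  have W: "W (i, f) \<in> Words \<and> foldl nx i (W (i, f)) = i \<and> coc i (W (i, f)) = f" if i: "i < m" and f: "f \<in> F" for i f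
  proof -
    have "f \<in> carrier Gb" using f F(2) by (rule subsetD[rotated])
    from loop_word[OF i this] have "\<exists>w. w \<in> Words \<and> foldl nx i w = i \<and> coc i w = f" unfolding Bex_def .
    then show ?thesis unfolding W_def fst_conv snd_conv by (rule someI_ex)
  qed
  \<comment> \<open>Bounds the total length of all loop words at once; the summand 1 keeps it
    positive.\<close>
  define \<Lambda> where "\<Lambda> = (\<Sum>i<m. \<Sum>f\<in>F. length (W (i, f))) + 1"
  have Lp: "0 < real \<Lambda>" unfolding \<Lambda>_def of_nat_0_less_iff by simp
  have "nonamenable_action V (letters A) formal_inv act (\<epsilon> / real \<Lambda>)"
  proof (intro nonamenable_action.intro nonamenable_action_axioms.intro symmetric_act)
    show "0 < \<epsilon> / real \<Lambda>" using e Lp by simp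
    fix S assume S: "finite S" "S \<subseteq> V"
    define d where "d = (\<Sum>x\<in>letters A. card {v \<in> S. act v x \<notin> S})"
    define T where "T i = {v. (i, v) \<in> S}" for i
    have fT: "finite (T i)" for i
    proof -
      have "T i \<subseteq> snd ` S" unfolding T_def by force
      then show ?thesis using S(1) finite_subset by blast
    qed
    have TK: "T i \<subseteq> rcosets\<^bsub>Gb\<^esub> K" for i using S(2) by (auto simp: T_def V_def)
    have "S = (\<Union>i\<in>{..<m}. (\<lambda>v. (i, v)) ` T i)" using S(2) by (auto simp: T_def V_def)
    then have "card S = card (\<Union>i\<in>{..<m}. (\<lambda>v. (i, v)) ` T i)" by simp
    also have "\<dots> = (\<Sum>i<m. card ((\<lambda>v. (i, v)) ` T i))" using fT by (intro card_UN_disjoint) auto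
    also have "\<dots> = (\<Sum>i<m. card (T i))" by (simp add: card_image inj_on_def)
    finally have cS: "card S = (\<Sum>i<m. card (T i))" .
    have bd: "card {v \<in> T i. v #>\<^bsub>Gb\<^esub> f \<notin> T i} \<le> length (W (i, f)) * d" if i: "i < m" and f: "f \<in> F" for i f
    proof -
      have "card {v \<in> T i. v #>\<^bsub>Gb\<^esub> f \<notin> T i} \<le> card {s \<in> S. foldl act s (W (i, f)) \<notin> S}"
      proof (rule card_inj_on_le[of "\<lambda>v. (i, v)"])
        show "(\<lambda>v. (i, v)) ` {v \<in> T i. v #>\<^bsub>Gb\<^esub> f \<notin> T i} \<subseteq> {s \<in> S. foldl act s (W (i, f)) \<notin> S}"
        proof
          fix s assume "s \<in> (\<lambda>v. (i, v)) ` {v \<in> T i. v #>\<^bsub>Gb\<^esub> f \<notin> T i}"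
          then obtain v where v: "s = (i, v)" "v \<in> T i" "v #>\<^bsub>Gb\<^esub> f \<notin> T i" by auto
          have "foldl act (i, v) (W (i, f)) = (i, v #>\<^bsub>Gb\<^esub> f)"
            using foldl_act[OF i, of "W (i, f)" v] W[OF i f] v(2) TK by auto
          then show "s \<in> {s \<in> S. foldl act s (W (i, f)) \<notin> S}" using v by (simp add: T_def)
        qed
      qed (use S in \<open>auto simp: inj_on_def\<close>)
      also have "\<dots> \<le> length (W (i, f)) * d" unfolding d_def using W[OF i f] by (intro symmetric_action.word_boundary[OF symmetric_act S]) blast
      finally show ?thesis .
    qed
    have "\<epsilon> * real (card S) = (\<Sum>i<m. \<epsilon> * real (card (T i)))" unfolding cS by (simp add: sum_distrib_left)
    also have "\<dots> \<le> (\<Sum>i<m. \<Sum>f\<in>F. real (card {v \<in> T i. v #>\<^bsub>Gb\<^esub> f \<notin> T i}))"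
      by (intro sum_mono iso[rule_format] TK fT)
    also have "\<dots> \<le> (\<Sum>i<m. \<Sum>f\<in>F. real (length (W (i, f)) * d))"
      by (intro sum_mono of_nat_mono bd) auto
    also have "\<dots> = real ((\<Sum>i<m. \<Sum>f\<in>F. length (W (i, f))) * d)" by (simp add: sum_distrib_right)
    also have "\<dots> \<le> real (\<Lambda> * d)" by (intro of_nat_mono mult_le_mono1) (simp add: \<Lambda>_def)
    finally have "\<epsilon> * real (card S) \<le> real \<Lambda> * real d" by simp
    then have "\<epsilon> / real \<Lambda> * real (card S) \<le> real d" using Lp by (simp add: field_simps)
    then show "\<epsilon> / real \<Lambda> * real (card S) \<le> (\<Sum>x\<in>letters A. real (card {v \<in> S. act v x \<notin> S}))" by (simp add: d_def)
  qed
  then show ?thesis by blast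
qed

text \<open>Linear and quadratic bounds are treated together, as p = 1 and p = 2. A word in
  \<open>Bad\<close> costs at most Bd (d/q)^n beyond the fast test and there are at most q^n such
  words of length n, so their total is Bd times the number d^n of all words.\<close>

theorem average_case:
  fixes \<rho> :: "nat \<Rightarrow> 'h" and \<pi>0 :: "nat \<Rightarrow> 'g" and n0 n1 :: nat
  assumes na: "nonamenable_cosets Gb K" and H: "H \<subseteq> G1" "\<phi> ` H \<subseteq> K" and p: "1 \<le> p"
    and fg1: "finite_generating Gb {..<n1} \<rho>"
    and M1: "decides M1 (letters {..<n1}) {w \<in> lists (letters {..<n1}). word_val Gb \<rho> w \<in> K}"
      "\<And>w. w \<in> lists (letters {..<n1}) \<Longrightarrow> run_time M1 w \<le> c1 * (length w ^ p + 1)"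
    and fg0: "finite_generating G {..<n0} \<pi>0"
    and M0: "decides M0 (letters {..<n0}) (membership_problem G H {..<n0} \<pi>0)" "subexponential f"
      "\<And>w. w \<in> lists (letters {..<n0}) \<Longrightarrow> real (run_time M0 w) \<le> f (length w)"
  shows "\<exists>M. solves_on_average M (letters A) (membership_problem G H A \<pi>) (\<lambda>n. real n ^ p + 1)
    {\<mu>. discrete_prob (letters A) \<mu> \<and> length_invariant (letters A) \<mu>}"
proof -
  interpret R: word_metric Gb "{..<n1}" \<rho> by (intro word_metric.intro word_metric_axioms.intro B.word_group_axioms fg1)
  interpret G0: word_metric G "{..<n0}" \<pi>0 by (intro word_metric.intro word_metric_axioms.intro word_group_axioms fg0)
  define z where "z i x = (SOME w. w \<in> R.Words \<and> R.val w = co i x)" for i x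
  define t where "t x = (SOME w. w \<in> G0.Words \<and> G0.val w = letter_val G \<pi> x)" for x
  have z: "z i x \<in> R.Words \<and> R.val (z i x) = co i x" if "i < m" "x \<in> letters A" for i x
    unfolding z_def by (rule someI_ex[OF B.generating_word[OF fg1 co_closed[OF that], unfolded Bex_def]])
  have t: "t x \<in> G0.Words \<and> G0.val (t x) = letter_val G \<pi> x" if "x \<in> letters A" for x
    unfolding t_def by (rule someI_ex[OF generating_word[OF fg0 lval_closed[OF that], unfolded Bex_def]])
  define out where "out i x = map (Pair False) (z i x) @ map (Pair True) (t x)" for i x
  let ?X = "letters A"
  let ?D = "\<lambda>c. if c then membership_problem G H {..<n0} \<pi>0 else {w \<in> R.Words. R.val w \<in> K}"
  interpret mf: machine_filter ?X m i0 nx out "{i0}" "\<lambda>c. if c then M0 else M1"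
    "\<lambda>c. if c then letters {..<n0} else letters {..<n1}" ?D
  proof
    show "finite ?X" using finite_alphabet by simp
    show "i0 < m" by (rule i0)
    show "nx q x < m" if "q < m" "x \<in> ?X" for q x using nx that by blast
    show "y \<in> (if c then letters {..<n0} else letters {..<n1})" if "q < m" "x \<in> ?X" "(c, y) \<in> set (out q x)" for q x c y
      using z[OF that(1,2)] t[OF that(2)] that(3) by (auto simp: out_def in_lists_conv_set)
    show "decides (if c then M0 else M1) (if c then letters {..<n0} else letters {..<n1}) (?D c)" for c
      using M1(1) M0(1) by simp
  qed simp
  have pF: "mf.proj False (out i x) = z i x" and pT: "mf.proj True (out i x) = t x" for i x
    by (simp_all add: mf.proj_def out_def filter_map o_def)
  have emF: "mf.proj False (mf.emit i w) \<in> R.Words \<and> R.val (mf.proj False (mf.emit i w)) = coc i w" if "i < m" "w \<in> Words" for i w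
    using that
  proof (induction w arbitrary: i rule: list.induct)
    case (Cons x w)
    have x: "x \<in> ?X" "w \<in> Words" using Cons.prems by auto
    then show ?case using Cons.IH[OF nx(1)[OF Cons.prems(1) x(1)] x(2)] z[OF Cons.prems(1) x(1)]
      by (simp add: mf.proj_append pF R.val_append)
  qed (simp add: mf.proj_def)
  have emT: "mf.proj True (mf.emit i w) \<in> G0.Words \<and> G0.val (mf.proj True (mf.emit i w)) = val w" if "w \<in> Words" for i w
    using that
  proof (induction w arbitrary: i rule: list.induct)
    case (Cons x w)
    have x: "x \<in> ?X" "w \<in> Words" using Cons.prems by auto
    then show ?case using Cons.IH[OF x(2), of "nx i x"] t[OF x(1)]
      by (simp add: mf.proj_append pT G0.val_append)
  qed (simp add: mf.proj_def)
  have inF: "mf.image_word False w \<in> ?D False \<longleftrightarrow> coc i0 w \<in> K" if "w \<in> Words" for w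
    unfolding mf.image_word_def using emF[OF i0(1) that] by simp
  have inT: "mf.image_word True w \<in> ?D True \<longleftrightarrow> val w \<in> H" if "w \<in> Words" for w
    unfolding mf.image_word_def membership_problem_def using emT[OF that] by simp
  have set_eq: "{w \<in> Words. foldl nx i0 w \<in> {i0} \<and> mf.image_word False w \<in> ?D False \<and> mf.image_word True w \<in> ?D True} = membership_problem G H A \<pi>"
    unfolding membership_problem_def[of G H A]
  proof (rule Collect_cong, rule conj_cong[OF refl])
    fix w assume w: "w \<in> Words"
    show "(foldl nx i0 w \<in> {i0} \<and> mf.image_word False w \<in> ?D False \<and> mf.image_word True w \<in> ?D True) = (val w \<in> H)"
      using inF[OF w] inT[OF w] word_in_H[OF w H] by blast
  qed
  obtain C where dec: "decides mf.M ?X (membership_problem G H A \<pi>)" and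
    time: "\<And>w. w \<in> Words \<Longrightarrow> run_time mf.M w \<le> C * (length w + 1) + mf.total_time w"
    using mf.filter_decides unfolding set_eq by blast
  obtain \<epsilon> where "nonamenable_action V ?X formal_inv act \<epsilon>" using transfer_isoperimetry[OF na] by blast
  then interpret na: nonamenable_action V ?X formal_inv act \<epsilon> .
  have KV: "K \<in> rcosets\<^bsub>Gb\<^esub> K" using subgroup.subgroup_in_rcosets[OF K] B.is_group by blast
  have "(i0, K) \<in> V" using i0 KV by (simp add: V_def)
  from na.few_closed_paths[OF this] obtain q where q: "0 < q" "q < real (card ?X)" and
    few: "\<And>n. real (card {w \<in> Words. length w = n \<and> foldl act (i0, K) w = (i0, K)}) \<le> q ^ n" by blast
  define d where "d = real (card ?X)"
  have dq: "0 < q / d" "q / d < 1" "0 < d" using q by (simp_all add: d_def)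
  \<comment> \<open>Letters of \<open>A\<close> are translated into words, so the inputs of both
    machines grow by a constant factor.\<close>
  define cm where "cm = mf.cmax"
  obtain Bd where Bd: "0 < Bd" "\<And>n l. l \<le> cm * n \<Longrightarrow> f l * (q / d) ^ n \<le> Bd"
    using subexponential_decay[OF M0(2) dq(1,2), of cm] by blast
  define Bad where "Bad n = {w \<in> Words. length w = n \<and> foldl act (i0, K) w = (i0, K)}" for n
  define W where "W n = {w \<in> Words. length w = n}" for n
  have fW: "finite (W n)" for n
    unfolding W_def by (rule finite_subset[OF _ finite_lists_length_eq[of ?X n]]) (use finite_alphabet in auto)
  have cW: "real (card (W n)) = d ^ n" for n
  proof -
    have "W n = {w. set w \<subseteq> ?X \<and> length w = n}" unfolding W_def by auto
    then show ?thesis using card_lists_length_eq[of ?X n] finite_alphabet by (simp add: d_def)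
  qed
  define C' where "C' = real (2 * C + c1 * (cm ^ p + 1))"
  have np: "real n \<le> real n ^ p" for n :: nat
  proof -
    have "n \<le> n ^ p" using p by (cases "n = 0") (auto intro: self_le_power)
    then have "real n \<le> real (n ^ p)" by (rule of_nat_mono)
    then show ?thesis by simp
  qed
  have tm: "real (run_time mf.M w) \<le> C' * (real n ^ p + 1) + (if w \<in> Bad n then Bd * (d / q) ^ n else 0)"
    if w: "w \<in> W n" for w n
  proof -
    have wW: "w \<in> Words" and lw: "length w = n" using w by (auto simp: W_def)
    let ?a = "mf.image_word False w" and ?b = "mf.image_word True w"
    have aW: "?a \<in> R.Words" "?b \<in> G0.Words" unfolding mf.image_word_def using emF[OF i0(1) wW] emT[OF wW] by auto
    have le: "length (mf.proj c l) \<le> length l" for c l unfolding mf.proj_def by simp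
    have la: "length ?a \<le> cm * n" "length ?b \<le> cm * n"
      unfolding mf.image_word_def cm_def using le order_trans mf.length_emit[OF i0(1) wW] lw by blast+
    have ra: "run_time M1 ?a \<le> c1 * ((cm * n) ^ p + 1)"
      by (rule order_trans[OF M1(2)[OF aW(1)]]) (intro mult_le_mono2 add_le_mono1 power_mono la, simp)
    \<comment> \<open>A word that passes the fast test traces a closed path at
      \<open>(i0, K)\<close>, and those are the paths that have been counted.\<close>
    have bad: "w \<in> Bad n" if "foldl nx i0 w = i0" "coc i0 w \<in> K"
    proof -
      have "K #>\<^bsub>Gb\<^esub> coc i0 w = K" using that(2) K coc_closed[OF i0(1) wW] by (intro B.coset_join2) auto
      then show ?thesis using that(1) foldl_act[OF i0(1) wW KV] wW lw by (simp add: Bad_def)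
    qed
    have rb: "real (run_time M0 ?b) \<le> Bd * (d / q) ^ n"
    proof -
      have "f (length ?b) * (q / d) ^ n * (d / q) ^ n \<le> Bd * (d / q) ^ n"
        using Bd(2)[OF la(2)] q dq by (intro mult_right_mono) auto
      moreover have "(q / d) ^ n * (d / q) ^ n = 1" using q dq by (simp add: power_mult_distrib[symmetric])
      ultimately show ?thesis using M0(3)[OF aW(2)] by (simp add: mult.assoc)
    qed
    have tt: "real (mf.total_time w) \<le> real (c1 * ((cm * n) ^ p + 1)) + (if w \<in> Bad n then Bd * (d / q) ^ n else 0)"
    proof -
      have nn: "0 \<le> Bd * (d / q) ^ n" using Bd(1) q dq by simp
      have "real (run_time M1 ?a) \<le> real (c1 * ((cm * n) ^ p + 1))" using ra by (rule of_nat_mono)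
      moreover have "?a \<in> ?D False \<longleftrightarrow> coc i0 w \<in> K" by (rule inF[OF wW])
      ultimately show ?thesis using rb nn bad unfolding mf.total_time_def
        by (cases "foldl nx i0 w = i0"; cases "coc i0 w \<in> K") auto
    qed
    have e1: "real (c1 * ((cm * n) ^ p + 1)) \<le> real c1 * ((real cm ^ p + 1) * (real n ^ p + 1))"
    proof -
      have "real cm ^ p * real n ^ p + 1 \<le> (real cm ^ p + 1) * (real n ^ p + 1)" by (simp add: algebra_simps)
      then have "real c1 * (real cm ^ p * real n ^ p + 1) \<le> real c1 * ((real cm ^ p + 1) * (real n ^ p + 1))"
        by (rule mult_left_mono) simp
      moreover have "real (c1 * ((cm * n) ^ p + 1)) = real c1 * (real cm ^ p * real n ^ p + 1)"
        by (simp only: of_nat_mult of_nat_add of_nat_power of_nat_1 power_mult_distrib)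
      ultimately show ?thesis by (simp only:)
    qed
    have e2: "real (C * (length w + 1)) \<le> real (2 * C) * (real n ^ p + 1)"
    proof -
      have "0 \<le> real n ^ p" by simp
      then have "real n + 1 \<le> 2 * (real n ^ p + 1)" unfolding mult_2 using np[of n] by linarith
      then have "real C * (real n + 1) \<le> real C * (2 * (real n ^ p + 1))" by (rule mult_left_mono) simp
      then show ?thesis by (simp add: lw algebra_simps)
    qed
    have e3: "C' * (real n ^ p + 1) = real (2 * C) * (real n ^ p + 1) + real c1 * ((real cm ^ p + 1) * (real n ^ p + 1))"
      by (simp add: C'_def algebra_simps)
    have "real (run_time mf.M w) \<le> real (C * (length w + 1)) + real (mf.total_time w)"
      using of_nat_mono[OF time[OF wW]] unfolding of_nat_add .
    also have "\<dots> \<le> real (2 * C) * (real n ^ p + 1) + (real c1 * ((real cm ^ p + 1) * (real n ^ p + 1)) + (if w \<in> Bad n then Bd * (d / q) ^ n else 0))"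
      by (intro add_mono e2 order_trans[OF tt add_right_mono[OF e1]])
    finally show ?thesis unfolding e3 add.assoc .
  qed
  have "solves_on_average mf.M ?X (membership_problem G H A \<pi>) (\<lambda>n. real n ^ p + 1)
    {\<mu>. discrete_prob ?X \<mu> \<and> length_invariant ?X \<mu>}"
  proof (rule solves_on_averageI[OF dec])
    show "finite ?X" using finite_alphabet by simp
    show "mono (\<lambda>n. real n ^ p + 1)" by (auto simp: mono_def intro: power_mono)
    show "0 < real n ^ p + 1" for n :: nat by (simp add: add_nonneg_pos)
    show "0 < C' + Bd" using Bd(1) by (simp add: C'_def add_nonneg_pos)
    fix n
    have "(\<Sum>w\<in>W n. real (run_time mf.M w)) \<le> (\<Sum>w\<in>W n. C' * (real n ^ p + 1) + (if w \<in> Bad n then Bd * (d / q) ^ n else 0))"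
      by (intro sum_mono tm)
    also have "\<dots> = d ^ n * (C' * (real n ^ p + 1)) + real (card (Bad n)) * (Bd * (d / q) ^ n)"
    proof -
      have "(\<Sum>w\<in>W n. if w \<in> Bad n then Bd * (d / q) ^ n else 0) = (\<Sum>w\<in>Bad n. Bd * (d / q) ^ n)"
        using fW by (intro sum.mono_neutral_cong_right) (auto simp: Bad_def W_def)
      then show ?thesis by (simp add: sum.distrib cW)
    qed
    also have "real (card (Bad n)) * (Bd * (d / q) ^ n) \<le> q ^ n * (Bd * (d / q) ^ n)"
      using few[of n] Bd(1) q dq unfolding Bad_def by (intro mult_right_mono) auto
    also have "q ^ n * (Bd * (d / q) ^ n) = Bd * d ^ n" using q by (simp add: power_divide)
    also have "Bd * d ^ n = Bd * d ^ n * 1" by (rule mult_1_right[symmetric])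
    also have "\<dots> \<le> Bd * d ^ n * (real n ^ p + 1)"
      by (rule mult_left_mono) (use Bd(1) dq(3) in simp_all)
    finally show "(\<Sum>w\<in>{w \<in> Words. length w = n}. real (run_time mf.M w)) \<le> (C' + Bd) * (real n ^ p + 1) * real (card ?X) ^ n"
      unfolding W_def[symmetric] d_def[symmetric] by (simp add: algebra_simps)
  qed
  then show ?thesis by blast
qed

end

theorem corollaryD:
  fixes G :: "'g monoid" and Gbar :: "'h monoid"
    and H G1 :: "'g set" and K :: "'h set" and \<phi> :: "'g \<Rightarrow> 'h"
  assumes "group G" and "finitely_presented G"
    and "subgroup H G" and "membership_subexponential G H"
    and "finite_index G G1" and "H \<subseteq> G1"
    and "group Gbar" and "\<phi> \<in> epi (G\<lparr>carrier := G1\<rparr>) Gbar"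
    and "subgroup K Gbar" and "\<phi> ` H \<subseteq> K"
  shows
    "(word_hyperbolic Gbar \<and> \<not> virtually_cyclic Gbar \<and>
      rational_subgroup K Gbar \<and> infinite (rcosets\<^bsub>Gbar\<^esub> K) \<longrightarrow>
        (\<forall>(A :: 'a set) \<pi>. finite_generating G A \<pi> \<longrightarrow>
           linear_time_on_average (letters A) (membership_problem G H A \<pi>)
             {\<mu>. discrete_prob (letters A) \<mu> \<and> length_invariant (letters A) \<mu>})) \<and>
     (automatic_group Gbar \<and> rational_subgroup K Gbar \<and> nonamenable_schreier Gbar K \<longrightarrow>
        (\<forall>(A :: 'a set) \<pi>. finite_generating G A \<pi> \<longrightarrow>
           quadratic_time_on_average (letters A) (membership_problem G H A \<pi>)
             {\<mu>. discrete_prob (letters A) \<mu> \<and> length_invariant (letters A) \<mu>}))"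
proof -
  have G: "word_group G" and Gb: "word_group Gbar" using assms by (simp_all add: word_group_def)
  obtain n0 :: nat and \<pi>0 M0 f where fg0: "finite_generating G {..<n0} \<pi>0"
    and M0: "decides M0 (letters {..<n0}) (membership_problem G H {..<n0} \<pi>0)" "subexponential f"
      "\<And>w. w \<in> lists (letters {..<n0}) \<Longrightarrow> real (run_time M0 w) \<le> f (length w)"
    using assms(4) unfolding membership_subexponential_def subexponential_time_solvable_def by blast
  obtain m :: nat and g i0 where i0: "i0 < m" "g i0 = \<one>\<^bsub>G\<^esub>" and g: "\<forall>i<m. g i \<in> carrier G"
    and uniq: "\<forall>x\<in>carrier G. \<exists>!i. i < m \<and> x \<otimes>\<^bsub>G\<^esub> inv\<^bsub>G\<^esub> (g i) \<in> G1"
    using word_group.transversal[OF G assms(5)] by (elim exE conjE) (rule that)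
  have G1: "subgroup G1 G" using assms(5) by (simp add: finite_index_def)
  have \<phi>: "\<phi> \<in> hom (G\<lparr>carrier := G1\<rparr>) Gbar" "\<phi> ` G1 = carrier Gbar" using assms(8) by (simp_all add: epi_def)
  have transfer: "coset_transfer G A \<pi> Gbar G1 \<phi> K m g i0" if fg: "finite_generating G A \<pi>" for A :: "'a set" and \<pi>
  proof (intro coset_transfer.intro coset_transfer_axioms.intro word_metric.intro word_metric_axioms.intro G Gb G1 \<phi> assms(9) i0 fg)
    show "g i \<in> carrier G" if "i < m" for i using g that by simp
    show "\<exists>!i. i < m \<and> x \<otimes>\<^bsub>G\<^esub> inv\<^bsub>G\<^esub> (g i) \<in> G1" if "x \<in> carrier G" for x by (rule bspec[OF uniq that])
  qed
  show ?thesis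
  proof (intro conjI impI allI)
    fix A :: "'a set" and \<pi>
    assume hyp: "word_hyperbolic Gbar \<and> \<not> virtually_cyclic Gbar \<and> rational_subgroup K Gbar \<and> infinite (rcosets\<^bsub>Gbar\<^esub> K)"
      and fg: "finite_generating G A \<pi>"
    then obtain n1 :: nat and \<rho> \<delta> where h: "hyperbolic_word_metric Gbar {..<n1} \<rho> \<delta>"
      using word_hyperbolic_metric by blast
    interpret Q: hyperbolic_word_metric Gbar "{..<n1}" \<rho> \<delta> by (rule h)
    \<comment> \<open>From here on rationality enters only as the one-direction property, stated for
      the hyperbolic generators.\<close>
    obtain C where C: "Q.seen_in_one_direction K C"
      using Q.rational_seen_in_one_direction[OF assms(9)] hyp by blast
    have na: "nonamenable_cosets Gbar K"
      using Q.infinite_index_nonamenable[OF assms(9) C] hyp by blast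
    obtain M1 c1 where M1: "decides M1 (letters {..<n1}) {w \<in> lists (letters {..<n1}). word_val Gbar \<rho> w \<in> K}"
      "\<And>w. w \<in> lists (letters {..<n1}) \<Longrightarrow> run_time M1 w \<le> c1 * (length w + 1)"
      using hyperbolic_membership_linear[OF h assms(9) C] by blast
    have r1: "run_time M1 w \<le> c1 * (length w ^ 1 + 1)" if "w \<in> lists (letters {..<n1})" for w
      unfolding power_one_right by (rule M1(2)[OF that])
    have "linear_fun (\<lambda>n. real n ^ 1 + 1)"
      unfolding linear_fun_def by (intro exI[of _ 1]) simp
    then show "linear_time_on_average (letters A) (membership_problem G H A \<pi>)
        {\<mu>. discrete_prob (letters A) \<mu> \<and> length_invariant (letters A) \<mu>}"
      using coset_transfer.average_case[OF transfer[OF fg] na assms(6) assms(10) order_refl Q.generating M1(1) r1 fg0 M0]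
      unfolding linear_time_on_average_def by blast
  next
    fix A :: "'a set" and \<pi>
    assume aut: "automatic_group Gbar \<and> rational_subgroup K Gbar \<and> nonamenable_schreier Gbar K"
      and fg: "finite_generating G A \<pi>"
    have na: "nonamenable_cosets Gbar K"
      using schreier_nonamenable_cosets[OF assms(7,9)] aut by blast
    obtain n1 :: nat and \<rho> M1 c1 where fg1: "finite_generating Gbar {..<n1} \<rho>"
      and M1: "decides M1 (letters {..<n1}) {w \<in> lists (letters {..<n1}). word_val Gbar \<rho> w \<in> K}"
      "\<And>w. w \<in> lists (letters {..<n1}) \<Longrightarrow> run_time M1 w \<le> c1 * (length w ^ 2 + 1)"
      using rational_membership_quadratic[OF assms(7)] aut by blast
    have two: "1 \<le> (2::nat)" by simp
    have "quadratic_fun (\<lambda>n. real n ^ 2 + 1)"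
      unfolding quadratic_fun_def by (intro exI[of _ 1] exI[of _ 0]) simp
    then show "quadratic_time_on_average (letters A) (membership_problem G H A \<pi>)
        {\<mu>. discrete_prob (letters A) \<mu> \<and> length_invariant (letters A) \<mu>}"
      using coset_transfer.average_case[OF transfer[OF fg] na assms(6) assms(10) two fg1 M1 fg0 M0]
      unfolding quadratic_time_on_average_def by blast
  qed
qed

end
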